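(* Let $V$ be a simple real Jordan algebra with Jordan determinant ${\bf det}$. For $s,t\in\mathbb C$ there exists a differential operator $D_{s,t}$ with polynomial coefficients on $V\times V$ such that, for all $\varepsilon,\eta\in\{+,-\}$, as operators on smooth functions of $(\xi,\zeta)\in V^\times\times V^\times$, $$ {\bf det}\left( \frac{\partial}{\partial \xi}-\frac{\partial}{\partial \zeta}\right)\circ {\bf det} (\xi)^{s,\varepsilon} \,{\bf det} (\zeta)^{t,\eta} ={\bf det} (\xi)^{s-1,-\varepsilon}\,{\bf det}( \zeta)^{t-1,-\eta}\circ D_{s,t}, $$ where functions are identified with the corresponding multiplication operators. Moreover, the coefficients of $D_{s,t}$ are polynomial in $(s,t)$.
   Context: $V$ is a simple real Jordan algebra with unit and $V^\times$ its set of invertible elements. If $\lambda^r-a_1(x)\lambda^{r-1}+\cdots+(-1)^ra_r(x)$ is the generic minimal polynomial ($r$ is the rank), then $\operatorname{tr}=a_1$ is the Jordan trace, ${\bf det}=a_r$ is the Jordan determinant, and $\tau(x,y)=\operatorname{tr}(xy)$ is the trace form, a nondegenerate symmetric bilinear form. For $x\in V^\times$, $s\in\mathbb C$: ${\bf det}(x)^{s,+}=|{\bf det}(x)|^s$, ${\bf det}(x)^{s,-}=\operatorname{sign}({\bf det}(x))|{\bf det}(x)|^s$. ${\bf det}\left(\frac{\partial}{\partial\xi}-\frac{\partial}{\partial\zeta}\right)$ is the constant coefficient differential operator on $V\times V$ (variables $(\xi,\zeta)$) characterized by ${\bf det}\left(\frac{\partial}{\partial\xi}-\frac{\partial}{\partial\zeta}\right)e^{\tau(\xi,x)+\tau(\zeta,y)}={\bf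 det}(x-y)\,e^{\tau(\xi,x)+\tau(\zeta,y)}$ for all $x,y\in V$. *)

theory Defs
  imports
    "HOL-Analysis.Analysis"
    "HOL-Library.Multiset"
    "HOL-Computational_Algebra.Polynomial"
begin

section \<open>Simple real Jordan algebras with unit\<close>

text \<open>
  The class \<open>euclidean_space\<close> stands for an arbitrary nonzero finite-dimensional real vector
  space. Its inner product is auxiliary and unrelated to the algebra structure; it serves only to
  provide the topology and a coordinate system.
\<close>

locale real_jordan_algebra =
  fixes mul :: "'a::euclidean_space \<Rightarrow> 'a \<Rightarrow> 'a"
    and e :: 'a
  assumes bilinear_mul: "bilinear mul"
    and mul_commute: "mul x y = mul y x"
    and jordan_identity: "mul x (mul (mul x x) y) = mul (mul x x) (mul x y)"
    and mul_unit: "mul e x = x"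

definition jordan_ideal :: "('a::euclidean_space \<Rightarrow> 'a \<Rightarrow> 'a) \<Rightarrow> 'a set \<Rightarrow> bool" where
  "jordan_ideal mul I \<longleftrightarrow> subspace I \<and> (\<forall>x. \<forall>y\<in>I. mul x y \<in> I)"

locale simple_real_jordan_algebra = real_jordan_algebra +
  assumes simple: "jordan_ideal mul I \<Longrightarrow> I = {0} \<or> I = UNIV"

primrec jordan_power :: "('a::euclidean_space \<Rightarrow> 'a \<Rightarrow> 'a) \<Rightarrow> 'a \<Rightarrow> 'a \<Rightarrow> nat \<Rightarrow> 'a" where
  "jordan_power mul e x 0 = e"
| "jordan_power mul e x (Suc n) = mul x (jordan_power mul e x n)"

definition jordan_eval ::
    "('a::euclidean_space \<Rightarrow> 'a \<Rightarrow> 'a) \<Rightarrow> 'a \<Rightarrow> real poly \<Rightarrow> 'a \<Rightarrow> 'a" where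
  "jordan_eval mul e p x = (\<Sum>i\<le>degree p. coeff p i *\<^sub>R jordan_power mul e x i)"

text \<open>Invertibility requires an inverse inside the associative subalgebra \<open>\<real>[x]\<close>: a mere
  solution of \<open>mul x y = e\<close> need not be unique in a Jordan algebra.\<close>

definition jordan_invertibles :: "('a::euclidean_space \<Rightarrow> 'a \<Rightarrow> 'a) \<Rightarrow> 'a \<Rightarrow> 'a set" where
  "jordan_invertibles mul e = {x. \<exists>p. mul x (jordan_eval mul e p x) = e}"

definition jordan_minpoly ::
    "('a::euclidean_space \<Rightarrow> 'a \<Rightarrow> 'a) \<Rightarrow> 'a \<Rightarrow> 'a \<Rightarrow> real poly" where
  "jordan_minpoly mul e x =
     (THE p. lead_coeff p = 1 \<and> jordan_eval mul e p x = 0 \<and>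
        (\<forall>q. lead_coeff q = 1 \<and> jordan_eval mul e q x = 0 \<longrightarrow> degree p \<le> degree q))"

definition jordan_rank :: "('a::euclidean_space \<Rightarrow> 'a \<Rightarrow> 'a) \<Rightarrow> 'a \<Rightarrow> nat" where
  "jordan_rank mul e = Max (range (\<lambda>x. degree (jordan_minpoly mul e x)))"

text \<open>The generic minimal polynomial is the only family of polynomials in \<open>\<lambda>\<close> whose
  coefficients are polynomial functions on \<open>V\<close> and which is the minimal polynomial of \<open>x\<close>
  whenever \<open>x\<close> is regular, i.e. has a minimal polynomial of maximal degree.\<close>

definition generic_minpoly ::
    "('a::euclidean_space \<Rightarrow> 'a \<Rightarrow> 'a) \<Rightarrow> 'a \<Rightarrow> 'a \<Rightarrow> real poly" where
  "generic_minpoly mul e =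
     (THE F. (\<forall>k. real_polynomial_function (\<lambda>x. coeff (F x) k)) \<and>
        (\<forall>x. degree (jordan_minpoly mul e x) = jordan_rank mul e \<longrightarrow>
             F x = jordan_minpoly mul e x))"

text \<open>The generic minimal polynomial is \<open>\<lambda>\<^sup>r - a\<^sub>1(x) \<lambda>\<^bsup>r-1\<^esup> + \<dots> + (-1)\<^sup>r a\<^sub>r(x)\<close>, with
  \<open>tr = a\<^sub>1\<close> and \<open>det = a\<^sub>r\<close>.\<close>

definition jordan_tr :: "('a::euclidean_space \<Rightarrow> 'a \<Rightarrow> 'a) \<Rightarrow> 'a \<Rightarrow> 'a \<Rightarrow> real" where
  "jordan_tr mul e x = - coeff (generic_minpoly mul e x) (jordan_rank mul e - 1)"

definition jordan_det :: "('a::euclidean_space \<Rightarrow> 'a \<Rightarrow> 'a) \<Rightarrow> 'a \<Rightarrow> 'a \<Rightarrow> real" where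
  "jordan_det mul e x = (-1) ^ jordan_rank mul e * coeff (generic_minpoly mul e x) 0"

definition trace_form :: "('a::euclidean_space \<Rightarrow> 'a \<Rightarrow> 'a) \<Rightarrow> 'a \<Rightarrow> 'a \<Rightarrow> 'a \<Rightarrow> real" where
  "trace_form mul e x y = jordan_tr mul e (mul x y)"

datatype parity_sign = Plus | Minus

primrec opposite :: "parity_sign \<Rightarrow> parity_sign" where
  "opposite Plus = Minus"
| "opposite Minus = Plus"

primrec signed_powr :: "real \<Rightarrow> complex \<Rightarrow> parity_sign \<Rightarrow> complex" where
  "signed_powr d s Plus = complex_of_real \<bar>d\<bar> powr s"
| "signed_powr d s Minus = complex_of_real (sgn d) * complex_of_real \<bar>d\<bar> powr s"


section \<open>Smooth functions and differential operators\<close>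

primrec iterated_deriv ::
    "'b::real_normed_vector list \<Rightarrow> ('b \<Rightarrow> complex) \<Rightarrow> 'b \<Rightarrow> complex" where
  "iterated_deriv [] f = f"
| "iterated_deriv (v # vs) f = (\<lambda>x. frechet_derivative (iterated_deriv vs f) (at x) v)"

text \<open>Meant for open \<open>S\<close>; values of \<open>f\<close> outside \<open>S\<close> are then irrelevant.\<close>

definition smooth_function_on :: "'b::real_normed_vector set \<Rightarrow> ('b \<Rightarrow> complex) \<Rightarrow> bool" where
  "smooth_function_on S f \<longleftrightarrow> (\<forall>vs. \<forall>x\<in>S. iterated_deriv vs f differentiable (at x))"

text \<open>A multi-index is a multiset of basis vectors. The order in which the partial derivatives are
  taken is chosen arbitrarily; it does not matter for smooth functions.\<close>

definition multi_deriv ::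
    "'b::real_normed_vector multiset \<Rightarrow> ('b \<Rightarrow> complex) \<Rightarrow> 'b \<Rightarrow> complex" where
  "multi_deriv \<alpha> = iterated_deriv (SOME vs. mset vs = \<alpha>)"

text \<open>A differential operator \<open>\<Sum>\<^sub>\<alpha> c\<^sub>\<alpha>(x) \<partial>\<^sup>\<alpha>\<close> is given by its coefficients \<open>c\<close>.\<close>

definition diffop ::
    "('b::real_normed_vector multiset \<Rightarrow> 'b \<Rightarrow> complex) \<Rightarrow> ('b \<Rightarrow> complex) \<Rightarrow> 'b \<Rightarrow> complex" where
  "diffop c f x = (\<Sum>\<alpha> | \<exists>y. c \<alpha> y \<noteq> 0. c \<alpha> x * multi_deriv \<alpha> f x)"

definition polynomial_diffop ::
    "('b::euclidean_space multiset \<Rightarrow> 'b \<Rightarrow> complex) \<Rightarrow> bool" where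
  "polynomial_diffop c \<longleftrightarrow>
     finite {\<alpha>. \<exists>y. c \<alpha> y \<noteq> 0} \<and>
     (\<forall>\<alpha>. (\<exists>y. c \<alpha> y \<noteq> 0) \<longrightarrow> set_mset \<alpha> \<subseteq> Basis) \<and>
     (\<forall>\<alpha>. polynomial_function (c \<alpha>))"

definition const_coeff_diffop ::
    "('b::euclidean_space multiset \<Rightarrow> 'b \<Rightarrow> complex) \<Rightarrow> bool" where
  "const_coeff_diffop c \<longleftrightarrow> polynomial_diffop c \<and> (\<forall>\<alpha> x y. c \<alpha> x = c \<alpha> y)"

text \<open>The operator \<open>det(\<partial>/\<partial>\<xi> - \<partial>/\<partial>\<zeta>)\<close>.\<close>

definition det_diffop ::
    "('a::euclidean_space \<Rightarrow> 'a \<Rightarrow> 'a) \<Rightarrow> 'a \<Rightarrow> ('a \<times> 'a) multiset \<Rightarrow> 'a \<times> 'a \<Rightarrow> complex" where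
  "det_diffop mul e =
     (THE c. const_coeff_diffop c \<and>
        (\<forall>x y. let E = (\<lambda>(\<xi>, \<zeta>).
                  complex_of_real (exp (trace_form mul e \<xi> x + trace_form mul e \<zeta> y)))
               in \<forall>\<xi> \<zeta>. diffop c E (\<xi>, \<zeta>) =
                    complex_of_real (jordan_det mul e (x - y)) * E (\<xi>, \<zeta>)))"

text \<open>\<open>g s t\<close> is a polynomial function on the space \<open>'b\<close> whose coefficients are complex
  (holomorphic) polynomials in the two complex parameters \<open>s\<close> and \<open>t\<close>.\<close>

definition polynomial_in_parameters ::
    "(complex \<Rightarrow> complex \<Rightarrow> 'b::real_normed_vector \<Rightarrow> complex) \<Rightarrow> bool" where
  "polynomial_in_parameters g \<longleftrightarrow>
     (\<exists>N p. (\<forall>i j. polynomial_function (p i j)) \<and>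
        (\<forall>s t x. g s t x = (\<Sum>i\<le>N. \<Sum>j\<le>(N::nat). s ^ i * t ^ j * p i j x)))"

end

theory Submission
  imports
    Defs
    "Jordan_Normal_Form.Char_Poly"
    "HOL-Computational_Algebra.Polynomial_Factorial"
    "HOL-Computational_Algebra.Field_as_Ring"
begin

no_notation scalar_prod (infix "\<bullet>" 70)
no_notation Matrix.vec_index (infixl "$" 100)
hide_const (open) Matrix.vec Matrix.mat Determinant.det Module.smult

text \<open>
  The Leibniz rule gives \<open>det(\<partial>\<^sub>\<xi> - \<partial>\<^sub>\<zeta>) (det \<xi>)\<^sup>s (det \<zeta>)\<^sup>t f\<close> as \<open>(det \<xi>)\<^bsup>s-K\<^esup> (det \<zeta>)\<^bsup>t-K\<^esup>\<close> times an
  operator whose coefficients are polynomial in \<open>s\<close>, \<open>t\<close> and the point, and it has to be shown that these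
  are divisible by \<open>(det \<xi> det \<zeta>)\<^bsup>K-1\<^esup>\<close>. By linear independence of the monomials in \<open>s\<close>, \<open>t\<close> and the
  frequency this may be tested on exponentials \<open>f\<close> and positive integers \<open>s = m\<close>, \<open>t = n\<close>, which reduces
  to polynomials; handling one variable at a time, one needs that \<open>E(\<xi>, \<eta>) = det(\<partial>\<^sub>\<xi> + \<eta>) (det \<xi>)\<^sup>m\<close> is
  divisible by \<open>(det \<xi>)\<^bsup>m-1\<^esup>\<close>.

  Newton's identities identify the gradient of \<open>det\<close> with respect to the trace form as the adjoint, a
  polynomial in \<open>x\<close> with \<open>x adj x = det x\<close>; in particular \<open>det\<close> is a relative invariant of the
  multiplications \<open>x \<mapsto> a x\<close>, and \<open>E\<close> is one of \<open>(\<xi>, \<eta>) \<mapsto> (a \<xi>, - a \<eta>)\<close> with multiplier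
  \<open>(m - 1) tr a\<close>. On a line \<open>\<xi> = \<lambda> e - x\<close> with \<open>a = adj \<xi>\<close> this is a Fuchsian system whose singularities
  are the roots of the generic minimal polynomial of \<open>x\<close>. Generically these are simple and the residue
  is \<open>m - 1\<close> plus the multiplication by an idempotent, whose eigenvalues are \<open>0\<close>, \<open>1/2\<close>, \<open>1\<close> by the
  Peirce decomposition, so that polynomial solutions vanish at each root to order at least \<open>m - 1\<close>.
\<close>

section \<open>Polynomial functions\<close>

text \<open>Simplicity of the algebra enters through the nondegeneracy of the trace form: it makes
  every linear form a \<tau>(k, .), so that polynomials become symbols of operators, and it supplies
  the directions in which multiple roots of the minimal polynomial separate.

  The frequency \<eta> does double duty. Exponentials reveal the full symbol of an operator, so
  divisibility of values yields divisibility of coefficients; and \<eta> carries the contragredient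
  action that makes E a relative invariant.

  The obstacle to the residue argument is that the roots of \<open>F x\<close> may be complex while
  the algebra is real. Nothing is localized at a root: idempotents, Peirce components and
  homogeneity are congruences modulo f = F x in \<real>[t], with all error terms kept as explicit
  multiples of f.

  The second concern is that quotients must stay polynomial in the remaining variables. Divisions
  are therefore made by monic polynomials with parameters, or along lines through one point, where
  Gauss's lemma is available.\<close>

lemmas rpf_linear = real_polynomial_function.intros(1)
lemmas rpf_const = real_polynomial_function.intros(2)
lemmas rpf_add = real_polynomial_function.intros(3)
lemmas rpf_mult = real_polynomial_function.intros(4)

lemma rpf_compose:
  assumes "polynomial_function f" "real_polynomial_function g"
  shows "real_polynomial_function (\<lambda>x. g (f x))"
  using real_polynomial_function_compose[OF assms] by (simp add: o_def)

lemma polynomial_function_compose':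
  assumes "polynomial_function f" "polynomial_function g"
  shows "polynomial_function (\<lambda>x. g (f x))"
  using polynomial_function_compose[OF assms] by (simp add: o_def)

lemma polynomial_function_Pair:
  fixes f :: "'c::real_normed_vector \<Rightarrow> 'a::euclidean_space" and g :: "'c \<Rightarrow> 'b::euclidean_space"
  assumes "polynomial_function f" "polynomial_function g"
  shows "polynomial_function (\<lambda>x. (f x, g x))"
  using assms unfolding polynomial_function_iff_Basis_inner
  by (auto simp: Basis_prod_def)

lemma polynomial_function_linear:
  fixes A :: "'a::euclidean_space \<Rightarrow> 'b::real_normed_vector"
  assumes "linear A" "polynomial_function f"
  shows "polynomial_function (\<lambda>x. A (f x))"
  by (rule polynomial_function_compose'[OF assms(2)])
    (rule polynomial_function_bounded_linear, rule linear_conv_bounded_linear[THEN iffD1, OF assms(1)])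

lemma polynomial_function_bilinear:
  fixes B :: "'a::euclidean_space \<Rightarrow> 'b::euclidean_space \<Rightarrow> 'c::real_normed_vector"
  assumes B: "bilinear B" and f: "polynomial_function f" and g: "polynomial_function g"
  shows "polynomial_function (\<lambda>x. B (f x) (g x))"
proof -
  interpret B: bounded_bilinear B
    using B bilinear_conv_bounded_bilinear by blast
  have "B u v = (\<Sum>i\<in>Basis. \<Sum>j\<in>Basis. (u \<bullet> i) *\<^sub>R (v \<bullet> j) *\<^sub>R B i j)" for u v
  proof -
    have "B u v = B (\<Sum>i\<in>Basis. (u \<bullet> i) *\<^sub>R i) (\<Sum>j\<in>Basis. (v \<bullet> j) *\<^sub>R j)"
      by (simp add: euclidean_representation)
    also have "\<dots> = (\<Sum>i\<in>Basis. (u \<bullet> i) *\<^sub>R B i (\<Sum>j\<in>Basis. (v \<bullet> j) *\<^sub>R j))"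
      by (simp only: B.sum_left B.scaleR_left)
    also have "\<dots> = (\<Sum>i\<in>Basis. \<Sum>j\<in>Basis. (u \<bullet> i) *\<^sub>R (v \<bullet> j) *\<^sub>R B i j)"
      by (simp only: B.sum_right B.scaleR_right scaleR_sum_right)
    finally show ?thesis .
  qed
  then have eq: "(\<lambda>x. B (f x) (g x)) =
      (\<lambda>x. \<Sum>i\<in>Basis. \<Sum>j\<in>Basis. (f x \<bullet> i) *\<^sub>R (g x \<bullet> j) *\<^sub>R B i j)"
    by (intro ext)
  have fi: "polynomial_function (\<lambda>x. f x \<bullet> i)" if "i \<in> Basis" for i
    using f that by (simp add: polynomial_function_iff_Basis_inner real_polynomial_function_eq[symmetric])
  have gi: "polynomial_function (\<lambda>x. g x \<bullet> i)" if "i \<in> Basis" for i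
    using g that by (simp add: polynomial_function_iff_Basis_inner real_polynomial_function_eq[symmetric])
  show ?thesis
    unfolding eq by (intro polynomial_function_sum polynomial_function_mult fi gi) auto
qed

lemma rpf_differentiable:
  "real_polynomial_function f \<Longrightarrow> f differentiable at x"
  by (rule differentiable_at_real_polynomial_function)

lemma rpf_has_derivative:
  "real_polynomial_function f \<Longrightarrow> (f has_derivative frechet_derivative f (at x)) (at x)"
  using rpf_differentiable frechet_derivative_works by blast

lemma frechet_derivative_add':
  fixes f g :: "'a::real_normed_vector \<Rightarrow> 'b::real_normed_vector"
  assumes "f differentiable at x" "g differentiable at x"
  shows "frechet_derivative (\<lambda>x. f x + g x) (at x) h = frechet_derivative f (at x) h + frechet_derivative g (at x) h"
  using frechet_derivative_at[OF has_derivative_add[OF assms[unfolded frechet_derivative_works]], symmetric]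
  by simp

lemma frechet_derivative_mult':
  fixes f g :: "'a::real_normed_vector \<Rightarrow> 'b::real_normed_algebra"
  assumes "f differentiable at x" "g differentiable at x"
  shows "frechet_derivative (\<lambda>x. f x * g x) (at x) h = f x * frechet_derivative g (at x) h + frechet_derivative f (at x) h * g x"
  using frechet_derivative_at[OF has_derivative_mult[OF assms[unfolded frechet_derivative_works]], symmetric]
  by simp

lemma frechet_derivative_cmult':
  fixes f :: "'a::real_normed_vector \<Rightarrow> 'b::real_normed_algebra"
  assumes "f differentiable at x"
  shows "frechet_derivative (\<lambda>x. c * f x) (at x) h = c * frechet_derivative f (at x) h"
  using frechet_derivative_at[OF has_derivative_mult_right[OF assms[unfolded frechet_derivative_works]], symmetric]
  by simp

lemma frechet_derivative_sum':
  fixes f :: "'i \<Rightarrow> 'a::real_normed_vector \<Rightarrow> 'b::real_normed_vector"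
  assumes "\<And>i. i \<in> I \<Longrightarrow> f i differentiable at x"
  shows "frechet_derivative (\<lambda>x. \<Sum>i\<in>I. f i x) (at x) h = (\<Sum>i\<in>I. frechet_derivative (f i) (at x) h)"
  using frechet_derivative_at[OF has_derivative_sum[of I f, OF assms[unfolded frechet_derivative_works]], symmetric]
  by simp

lemma frechet_derivative_bounded_linear:
  assumes "bounded_linear f"
  shows "frechet_derivative f (at x) = f"
  by (rule frechet_derivative_at[OF bounded_linear_imp_has_derivative[OF assms], symmetric])

lemma rpf_frechet_linear:
  assumes "real_polynomial_function f"
  shows "linear (frechet_derivative f (at x))"
  using rpf_differentiable[OF assms] by (rule linear_frechet_derivative)

text \<open>Joint polynomiality in point and direction admits directions that move polynomially with
  the point, such as the vector field \<open>str_field\<close>.\<close>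

lemma rpf_frechet_derivative_pair:
  assumes "real_polynomial_function f"
  shows "real_polynomial_function (\<lambda>(x, h). frechet_derivative f (at x) h)"
  using assms
proof (induction)
  case (linear f)
  have "bounded_linear (\<lambda>z::'a \<times> 'a. f (snd z))"
    using linear by (rule bounded_linear_compose) (rule bounded_linear_snd)
  then show ?case
    by (auto simp: frechet_derivative_bounded_linear[OF linear] case_prod_beta)
next
  case (const c)
  then show ?case by (auto simp: frechet_derivative_const case_prod_beta)
next
  case (add f g)
  then show ?case
    by (auto simp: frechet_derivative_add'[OF rpf_differentiable rpf_differentiable] case_prod_beta)
next
  case (mult f g)
  have "real_polynomial_function (\<lambda>z::'a \<times> 'a. f (fst z))" "real_polynomial_function (\<lambda>z::'a \<times> 'a. g (fst z))"
    using mult by (auto intro!: rpf_compose[of fst] polynomial_function_bounded_linear bounded_linear_fst)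
  then show ?case
    using mult by (auto simp: frechet_derivative_mult'[OF rpf_differentiable rpf_differentiable] case_prod_beta)
qed

lemma rpf_frechet_derivative:
  fixes f :: "'a::euclidean_space \<Rightarrow> real" and v w :: "'c::real_normed_vector \<Rightarrow> 'a"
  assumes "real_polynomial_function f" "polynomial_function v" "polynomial_function w"
  shows "real_polynomial_function (\<lambda>x. frechet_derivative f (at (v x)) (w x))"
  using rpf_compose[OF polynomial_function_Pair[OF assms(2,3)] rpf_frechet_derivative_pair[OF assms(1)]]
  by simp

lemma rpf_frechet_derivative_const:
  assumes "real_polynomial_function f"
  shows "real_polynomial_function (\<lambda>x. frechet_derivative f (at x) h)"
  using assms
proof (induction)
  case (linear f)
  then show ?case by (auto simp: frechet_derivative_bounded_linear)
next
  case (const c)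
  then show ?case by (auto simp: frechet_derivative_const)
next
  case (add f g)
  then show ?case by (auto simp: frechet_derivative_add'[OF rpf_differentiable rpf_differentiable])
next
  case (mult f g)
  then show ?case by (auto simp: frechet_derivative_mult'[OF rpf_differentiable rpf_differentiable])
qed

lemma rpf_frechet_derivative_commute:
  assumes "real_polynomial_function f"
  shows "frechet_derivative (\<lambda>y. frechet_derivative f (at y) h) (at x) k =
         frechet_derivative (\<lambda>y. frechet_derivative f (at y) k) (at x) h"
  using assms
proof (induction)
  case (linear f)
  then show ?case by (simp add: frechet_derivative_bounded_linear frechet_derivative_const)
next
  case (const c)
  then show ?case by (simp add: frechet_derivative_const)
next
  case (add f g)
  then show ?case
    by (simp add: frechet_derivative_add' rpf_differentiable rpf_frechet_derivative_const)
next
  case (mult f g)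
  then show ?case
    by (simp add: frechet_derivative_add' frechet_derivative_mult' rpf_differentiable
        rpf_frechet_derivative_const rpf_mult)
qed

text \<open>The constant field \<open>h\<close> and the linear field \<open>A\<close> have the
  constant field \<open>A h\<close> as commutator; the second derivatives agree by symmetry.\<close>

lemma rpf_frechet_derivative_field:
  fixes f :: "'a::euclidean_space \<Rightarrow> real"
  assumes "real_polynomial_function f" "linear A"
  shows "frechet_derivative (\<lambda>y. frechet_derivative f (at y) (A y)) (at x) h =
         frechet_derivative (\<lambda>y. frechet_derivative f (at y) h) (at x) (A x) + frechet_derivative f (at x) (A h)"
proof -
  have bl: "bounded_linear A"
    using assms(2) linear_conv_bounded_linear by blast
  from assms(1) show ?thesis
  proof (induction)
    case (linear f)
    have "bounded_linear (\<lambda>y. f (A y))"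
      using linear bl bounded_linear_compose by blast
    with linear show ?case
      by (simp add: frechet_derivative_bounded_linear frechet_derivative_const)
  next
    case (const c)
    then show ?case by (simp add: frechet_derivative_const)
  next
    case (add f g)
    have p: "polynomial_function A" by (rule polynomial_function_bounded_linear[OF bl])
    show ?case using add
      by (simp add: frechet_derivative_add' rpf_differentiable rpf_frechet_derivative_const
          rpf_frechet_derivative p)
  next
    case (mult f g)
    have p: "polynomial_function A" by (rule polynomial_function_bounded_linear[OF bl])
    show ?case using mult
      by (simp add: frechet_derivative_add' frechet_derivative_mult' rpf_differentiable
          rpf_frechet_derivative_const rpf_frechet_derivative p rpf_mult algebra_simps)
  qed
qed

subsection \<open>Polynomials whose coefficients are polynomial functions\<close>

text \<open>The uniform degree bound turns \<open>poly (p b) t\<close> into a sum over a fixed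
  range, hence into a polynomial function of \<open>(t, b)\<close>.\<close>

definition poly_family :: "('b::real_normed_vector \<Rightarrow> real poly) \<Rightarrow> bool" where
  "poly_family p \<longleftrightarrow> (\<forall>k. real_polynomial_function (\<lambda>b. coeff (p b) k)) \<and>
     (\<exists>n. \<forall>b. \<forall>k\<ge>n. coeff (p b) k = 0)"

lemma poly_familyI:
  assumes "\<And>k. real_polynomial_function (\<lambda>b. coeff (p b) k)" "\<And>b k. k \<ge> n \<Longrightarrow> coeff (p b) k = 0"
  shows "poly_family p"
  using assms unfolding poly_family_def by blast

lemma poly_family_const: "poly_family (\<lambda>b. q)"
  by (rule poly_familyI[of _ "Suc (degree q)"]) (auto simp: coeff_eq_0)

lemma poly_family_add:
  assumes "poly_family p" "poly_family q"
  shows "poly_family (\<lambda>b. p b + q b)"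
proof -
  obtain n m where "\<forall>b. \<forall>k\<ge>n. coeff (p b) k = 0" "\<forall>b. \<forall>k\<ge>m. coeff (q b) k = 0"
    using assms unfolding poly_family_def by blast
  then show ?thesis
    using assms unfolding poly_family_def by (auto intro!: exI[of _ "max n m"])
qed

lemma poly_family_mult:
  assumes "poly_family p" "poly_family q"
  shows "poly_family (\<lambda>b. p b * q b)"
proof -
  obtain n m where nm: "\<forall>b. \<forall>k\<ge>n. coeff (p b) k = 0" "\<forall>b. \<forall>k\<ge>m. coeff (q b) k = 0"
    using assms unfolding poly_family_def by blast
  show ?thesis
  proof (rule poly_familyI[of _ "n + m"])
    fix k show "real_polynomial_function (\<lambda>b. coeff (p b * q b) k)"
      using assms unfolding poly_family_def coeff_mult
      by (intro real_polynomial_function_sum rpf_mult) auto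
  next
    fix b k assume k: "k \<ge> n + m"
    show "coeff (p b * q b) k = 0"
      unfolding coeff_mult
    proof (rule sum.neutral, rule ballI)
      fix i assume "i \<in> {..k}"
      then have "i \<ge> n \<or> k - i \<ge> m" using k by auto
      then show "coeff (p b) i * coeff (q b) (k - i) = 0" using nm by auto
    qed
  qed
qed

lemma poly_family_monom:
  assumes "real_polynomial_function f"
  shows "poly_family (\<lambda>b. monom (f b) n)"
proof (rule poly_familyI[of _ "Suc n"])
  fix k show "real_polynomial_function (\<lambda>b. coeff (monom (f b) n) k)"
    using assms by (cases "n = k") auto
qed auto

lemma poly_family_minus:
  assumes "poly_family p"
  shows "poly_family (\<lambda>b. - p b)"
  using poly_family_mult[OF poly_family_const[of "-1"] assms] by simp

lemma poly_family_diff: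
  assumes "poly_family p" "poly_family q"
  shows "poly_family (\<lambda>b. p b - q b)"
  using poly_family_add[OF assms(1) poly_family_minus[OF assms(2)]] by simp

lemma poly_family_power:
  assumes "poly_family p"
  shows "poly_family (\<lambda>b. p b ^ n)"
  by (induction n) (use assms in \<open>auto intro: poly_family_mult poly_family_const\<close>)

lemma poly_family_compose:
  assumes "poly_family p" "polynomial_function f"
  shows "poly_family (\<lambda>b. p (f b))"
proof -
  obtain n where "\<And>b k. k \<ge> n \<Longrightarrow> coeff (p b) k = 0"
    using assms(1) unfolding poly_family_def by blast
  moreover have "real_polynomial_function (\<lambda>b. coeff (p (f b)) k)" for k
    using assms(1) unfolding poly_family_def by (intro rpf_compose[OF assms(2)]) blast
  ultimately show ?thesis by (intro poly_familyI)
qed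

lemma poly_family_coeff:
  "poly_family p \<Longrightarrow> real_polynomial_function (\<lambda>b. coeff (p b) k)"
  unfolding poly_family_def by blast

lemma poly_family_of_rpf:
  fixes f :: "real \<times> 'b::real_normed_vector \<Rightarrow> real"
  assumes "real_polynomial_function f"
  shows "\<exists>p. poly_family p \<and> (\<forall>t b. f (t, b) = poly (p b) t)"
  using assms
proof (induction)
  case (linear f)
  interpret f: bounded_linear f by fact
  have fb: "bounded_linear (\<lambda>b. f (0, b))"
    using bounded_linear_compose[OF linear, of "\<lambda>b. (0, b)"]
    by (simp add: bounded_linear_Pair bounded_linear_ident bounded_linear_zero)
  have f_eq: "f (t, b) = f (0, b) + t * f (1, 0)" for t b
  proof -
    have "f (t, b) = f ((0, b) + t *\<^sub>R (1, 0))" by simp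
    also have "\<dots> = f (0, b) + t * f (1, 0)"
      by (simp only: f.add f.scaleR real_scaleR_def)
    finally show ?thesis .
  qed
  have pf: "poly_family (\<lambda>b. monom (f (0, b)) 0 + monom (f (1, 0)) 1)"
    by (intro poly_family_add poly_family_monom rpf_const rpf_linear fb)
  have "f (t, b) = poly (monom (f (0, b)) 0 + monom (f (1, 0)) 1) t" for t b
    by (subst f_eq) (simp add: poly_monom)
  with pf show ?case by blast
next
  case (const c)
  then show ?case
    by (intro exI[of _ "\<lambda>b. [:c:]"]) (simp add: poly_family_const)
next
  case (add f g)
  then obtain p q where "poly_family p" "\<forall>t b. f (t, b) = poly (p b) t"
    "poly_family q" "\<forall>t b. g (t, b) = poly (q b) t" by blast
  then show ?case
    by (intro exI[of _ "\<lambda>b. p b + q b"]) (simp add: poly_family_add)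
next
  case (mult f g)
  then obtain p q where "poly_family p" "\<forall>t b. f (t, b) = poly (p b) t"
    "poly_family q" "\<forall>t b. g (t, b) = poly (q b) t" by blast
  then show ?case
    by (intro exI[of _ "\<lambda>b. p b * q b"]) (simp add: poly_family_mult)
qed

lemma rpf_of_poly_family:
  assumes p: "poly_family p" and f: "real_polynomial_function f" and g: "polynomial_function g"
  shows "real_polynomial_function (\<lambda>x. poly (p (g x)) (f x))"
proof -
  obtain n where n: "\<forall>b. \<forall>k\<ge>n. coeff (p b) k = 0"
    using p unfolding poly_family_def by blast
  have eq: "poly (p b) t = (\<Sum>k<n. coeff (p b) k * t ^ k)" for b t
  proof -
    have "poly (p b) t = (\<Sum>k\<le>degree (p b). coeff (p b) k * t ^ k)"
      by (rule poly_altdef)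
    also have "\<dots> = (\<Sum>k\<in>{..degree (p b)} \<inter> {..<n}. coeff (p b) k * t ^ k)"
      using n by (intro sum.mono_neutral_right) auto
    also have "\<dots> = (\<Sum>k<n. coeff (p b) k * t ^ k)"
      by (intro sum.mono_neutral_left) (auto simp: coeff_eq_0)
    finally show ?thesis .
  qed
  show ?thesis
    unfolding eq
    by (intro real_polynomial_function_sum rpf_mult real_polynomial_function_power f)
      (auto intro: rpf_compose[OF g] poly_family_coeff[OF p])
qed

section \<open>Restriction of polynomial functions to lines, and density arguments\<close>

lemma rpf_line_poly:
  fixes f :: "'a::euclidean_space \<Rightarrow> real"
  assumes "real_polynomial_function f"
  shows "\<exists>p. poly_family p \<and> (\<forall>x y t. f (x + t *\<^sub>R y) = poly (p (x, y)) t)"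
proof -
  have "polynomial_function (\<lambda>z::real \<times> 'a \<times> 'a. fst (snd z) + fst z *\<^sub>R snd (snd z))"
    by (intro polynomial_function_add polynomial_function_mult polynomial_function_bounded_linear
        bounded_linear_intros bounded_linear_ident)
  from rpf_compose[OF this assms]
  have "real_polynomial_function (\<lambda>z::real \<times> 'a \<times> 'a. f (fst (snd z) + fst z *\<^sub>R snd (snd z)))" .
  from poly_family_of_rpf[OF this] show ?thesis by auto
qed

lemma rpf_line_poly1:
  fixes f :: "'a::euclidean_space \<Rightarrow> real"
  assumes "real_polynomial_function f"
  shows "\<exists>p. \<forall>t. f (x + t *\<^sub>R y) = poly p t"
  using rpf_line_poly[OF assms] by blast

lemma real_poly_eqI:
  fixes p q :: "real poly"
  assumes "\<And>t. poly p t = poly q t"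
  shows "p = q"
  using assms poly_eq_poly_eq_iff[of p q] by auto

text \<open>On the line through \<open>a\<close> and \<open>b\<close> both factors become elements
  of the integral domain \<real>[t].\<close>

lemma rpf_mult_eq_0:
  fixes f g :: "'a::euclidean_space \<Rightarrow> real"
  assumes f: "real_polynomial_function f" and g: "real_polynomial_function g"
    and fg: "\<And>x. f x * g x = 0" and b: "g b \<noteq> 0"
  shows "f a = 0"
proof -
  obtain p q where p: "\<And>t. f (a + t *\<^sub>R (b - a)) = poly p t"
    and q: "\<And>t. g (a + t *\<^sub>R (b - a)) = poly q t"
    using rpf_line_poly1[OF f] rpf_line_poly1[OF g] by metis
  have "p * q = 0"
    by (rule real_poly_eqI) (simp add: p[symmetric] q[symmetric] fg)
  moreover have "q \<noteq> 0" using q[of 1] b by auto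
  ultimately have "p = 0" by auto
  then show ?thesis using p[of 0] by simp
qed

lemma rpf_eq_on_dense:
  fixes f g h :: "'a::euclidean_space \<Rightarrow> real"
  assumes f: "real_polynomial_function f" and h: "real_polynomial_function h"
    and g: "real_polynomial_function g" and b: "g b \<noteq> 0"
    and fg: "\<And>x. g x \<noteq> 0 \<Longrightarrow> f x = h x"
  shows "f a = h a"
proof -
  have "f a - h a = 0"
    by (rule rpf_mult_eq_0[of "\<lambda>x. f x - h x" g, OF real_polynomial_function_diff[OF f h] g _ b]) (use fg in auto)
  then show ?thesis by simp
qed

text \<open>Finitely many nonempty Zariski open sets meet: the product of the functions is nonzero
  by \<open>rpf_mult_eq_0\<close>.\<close>

lemma rpf_prod_nonzero:
  fixes f :: "'i \<Rightarrow> 'a::euclidean_space \<Rightarrow> real"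
  assumes "finite I" "\<And>i. i \<in> I \<Longrightarrow> real_polynomial_function (f i)" "\<And>i. i \<in> I \<Longrightarrow> \<exists>x. f i x \<noteq> 0"
  shows "\<exists>x. \<forall>i\<in>I. f i x \<noteq> 0"
proof -
  have "real_polynomial_function (\<lambda>x. \<Prod>i\<in>I. f i x) \<and> (\<exists>x. (\<Prod>i\<in>I. f i x) \<noteq> 0)"
    using assms
  proof (induction I)
    case (insert i I)
    then have 1: "real_polynomial_function (f i)" "real_polynomial_function (\<lambda>x. \<Prod>i\<in>I. f i x)" by simp_all
    obtain b where "(\<Prod>i\<in>I. f i b) \<noteq> 0" using insert by auto
    moreover obtain a where "f i a \<noteq> 0" using insert.prems(2)[of i] by auto
    ultimately have "\<exists>x. f i x * (\<Prod>i\<in>I. f i x) \<noteq> 0"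
      using rpf_mult_eq_0[OF 1] by blast
    then show ?case using insert 1 by (simp add: rpf_mult)
  qed (simp add: rpf_const)
  then show ?thesis using assms(1) by (auto simp: prod_zero_iff)
qed

text \<open>Division by a monic polynomial never divides by a coefficient, so quotient and remainder
  depend polynomially on the parameter. Each step of the induction on the degree bound
  \<open>n\<close> removes one top coefficient of \<open>p\<close>.\<close>

lemma poly_family_division_aux:
  fixes p f :: "'b::real_normed_vector \<Rightarrow> real poly"
  assumes f: "poly_family f" and lc: "\<And>b. coeff (f b) r = 1" and deg: "\<And>b. degree (f b) = r"
    and "poly_family p" "\<And>b k. k \<ge> n \<Longrightarrow> coeff (p b) k = 0"
  shows "\<exists>q s. poly_family q \<and> poly_family s \<and> (\<forall>b. p b = q b * f b + s b) \<and> (\<forall>b. \<forall>k\<ge>r. coeff (s b) k = 0)"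
  using assms(4,5)
proof (induction n arbitrary: p)
  case 0
  then have "p b = 0" for b by (intro poly_eqI) auto
  then show ?case
    by (intro exI[of _ "\<lambda>b. 0"]) (auto simp: poly_family_const)
next
  case (Suc n)
  show ?case
  proof (cases "n < r")
    case True
    then show ?thesis using Suc.prems
      by (intro exI[of _ "\<lambda>b. 0"] exI[of _ p]) (auto simp: poly_family_const)
  next
    case False
    define m where "m b = monom (coeff (p b) n) (n - r)" for b
    have m: "poly_family m"
      unfolding m_def using Suc.prems by (intro poly_family_monom poly_family_coeff)
    have p': "poly_family (\<lambda>b. p b - m b * f b)"
      by (intro poly_family_diff poly_family_mult m f Suc.prems)
    have "coeff (p b - m b * f b) k = 0" if "k \<ge> n" for b k
    proof (cases "k = n")
      case True
      then show ?thesis using False lc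
        by (simp add: m_def coeff_monom_mult)
    next
      case False
      then have "k - (n - r) > r" using that \<open>\<not> n < r\<close> by auto
      then have "coeff (f b) (k - (n - r)) = 0" using deg by (simp add: coeff_eq_0)
      then show ?thesis using False that Suc.prems(2)
        by (simp add: m_def coeff_monom_mult)
    qed
    from Suc.IH[OF p' this] obtain q s where qs: "poly_family q" "poly_family s"
      "\<forall>b. p b - m b * f b = q b * f b + s b" "\<forall>b. \<forall>k\<ge>r. coeff (s b) k = 0" by auto
    have "p b = (q b + m b) * f b + s b" for b
      using qs(3) by (simp add: algebra_simps)
    then show ?thesis using qs m
      by (intro exI[of _ "\<lambda>b. q b + m b"] exI[of _ s]) (auto intro: poly_family_add)
  qed
qed

lemma poly_family_division:
  fixes p f :: "'b::real_normed_vector \<Rightarrow> real poly"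
  assumes f: "poly_family f" and lc: "\<And>b. coeff (f b) r = 1" and deg: "\<And>b. degree (f b) = r"
    and p: "poly_family p"
  shows "\<exists>q s. poly_family q \<and> poly_family s \<and> (\<forall>b. p b = q b * f b + s b) \<and>
    (\<forall>b. f b dvd p b \<longrightarrow> s b = 0)"
proof -
  obtain n where n: "\<And>b k. k \<ge> n \<Longrightarrow> coeff (p b) k = 0"
    using p unfolding poly_family_def by blast
  obtain q s where qs: "poly_family q" "poly_family s" "\<forall>b. p b = q b * f b + s b"
    and s: "\<forall>b. \<forall>k\<ge>r. coeff (s b) k = 0"
    using poly_family_division_aux[where n = n, OF f lc deg p n] by blast
  have "s b = 0" if "f b dvd p b" for b
  proof (rule ccontr)
    assume "s b \<noteq> 0"
    have "p b = q b * f b + s b" using qs(3) by blast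
    then have "f b dvd s b"
      using that by (metis dvd_add_right_iff dvd_triv_right)
    then have "degree (f b) \<le> degree (s b)"
      using \<open>s b \<noteq> 0\<close> dvd_imp_degree_le by blast
    then have "coeff (s b) (degree (s b)) = 0" using s deg by auto
    with \<open>s b \<noteq> 0\<close> show False by simp
  qed
  with qs show ?thesis by blast
qed

section \<open>Identities in Jordan algebras\<close>

text \<open>Replacing \<open>b\<close> by \<open>- b\<close> separates the parts of
  \<open>T (a + b) (a + b) (a + b) = 0\<close> that are odd and even in \<open>b\<close>; the odd
  part, quadratic in \<open>a\<close>, is then polarized in \<open>a\<close>. As \<open>T\<close> is
  symmetric only in its last two arguments, three terms survive.\<close>

lemma trilinear_polarization:
  fixes T :: "'a::real_vector \<Rightarrow> 'a \<Rightarrow> 'a \<Rightarrow> 'b::real_vector"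
  assumes add: "\<And>a a' b c. T (a + a') b c = T a b c + T a' b c"
    "\<And>a b b' c. T a (b + b') c = T a b c + T a b' c"
    and sym: "\<And>a b c. T a b c = T a c b"
    and diag: "\<And>a. T a a a = 0"
  shows "T a b c + T b a c + T c a b = 0"
proof -
  have add3: "T a b (c + c') = T a b c + T a b c'" for a b c c'
    using add(2)[of a c c' b] sym by metis
  have "T 0 b c + T 0 b c = T 0 b c" for b c using add(1)[of 0 0 b c] by simp
  then have z1: "T 0 b c = 0" for b c by simp
  have "T a 0 c + T a 0 c = T a 0 c" for a c using add(2)[of a 0 0 c] by simp
  then have z2: "T a 0 c = 0" for a c by simp
  have m1: "T (- a) b c = - T a b c" for a b c
  proof -
    have "T (- a) b c + T a b c = 0" using add(1)[of "- a" a b c] z1 by simp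
    then show ?thesis by (simp add: eq_neg_iff_add_eq_0)
  qed
  have m2: "T a (- b) c = - T a b c" for a b c
  proof -
    have "T a (- b) c + T a b c = 0" using add(2)[of a "- b" b c] z2 by simp
    then show ?thesis by (simp add: eq_neg_iff_add_eq_0)
  qed
  have m3: "T a b (- c) = - T a b c" for a b c using m2 sym by metis
  have six: "T a a b + T a b a + T b a a + T a b b + T b a b + T b b a = 0" for a b
    using diag[of "a + b"] diag[of a] diag[of b] by (simp add: add add3 add_ac)
  have U: "T a a b + T a b a + T b a a = 0" for a b
  proof -
    let ?P = "T a a b + T a b a + T b a a" and ?Q = "T a b b + T b a b + T b b a"
    have "?P + ?Q = 0" using six[of a b] by (simp add: add_ac)
    moreover have "- ?P + ?Q = 0" using six[of a "- b"] by (simp add: m1 m2 m3 algebra_simps)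
    moreover have "?P + ?P = (?P + ?Q) - (- ?P + ?Q)" by (simp add: algebra_simps)
    ultimately have "?P + ?P = 0" by simp
    then have "(2::real) *\<^sub>R ?P = 0" by (simp only: scaleR_2)
    then show ?thesis by simp
  qed
  define W where "W x y = T x x y + T x y x + T y x x" for x y
  have "W x y = 0" for x y using U by (simp add: W_def)
  moreover have "(T a c b + T a b c) + (T c a b + T c b a) + (T b a c + T b c a) = W (a + c) b - W a b - W c b"
    unfolding W_def by (simp add: add add3 algebra_simps)
  ultimately have "(T a c b + T a b c) + (T c a b + T c b a) + (T b a c + T b c a) = 0" by simp
  then have "(2::real) *\<^sub>R (T a b c + T b a c + T c a b) = 0"
    unfolding scaleR_2 using sym[of a c b] sym[of c b a] sym[of b c a] by (simp add: add_ac)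
  then show ?thesis by simp
qed

context real_jordan_algebra
begin

lemmas mul_linear = bilinear_ladd[OF bilinear_mul] bilinear_radd[OF bilinear_mul]
  bilinear_lsub[OF bilinear_mul] bilinear_rsub[OF bilinear_mul]
  bilinear_lneg[OF bilinear_mul] bilinear_rneg[OF bilinear_mul]
  bilinear_lmul[OF bilinear_mul] bilinear_rmul[OF bilinear_mul]
  bilinear_lzero[OF bilinear_mul] bilinear_rzero[OF bilinear_mul]

lemma linear_mul: "linear (mul x)"
  using bilinear_mul unfolding bilinear_def by blast

lemma linear_mul_left: "linear (\<lambda>x. mul x y)"
  using bilinear_mul unfolding bilinear_def by blast

lemma mul_sum_right: "mul x (sum f S) = (\<Sum>i\<in>S. mul x (f i))"
  by (rule linear_sum[OF linear_mul])

lemma mul_sum_left: "mul (sum f S) y = (\<Sum>i\<in>S. mul (f i) y)"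
  by (rule linear_sum[OF linear_mul_left])

lemma mul_unit_right: "mul x e = x"
  using mul_commute mul_unit by metis

lemma jordan_linearized:
  "mul x (mul (mul w z) y) + mul w (mul (mul x z) y) + mul z (mul (mul x w) y) =
   mul (mul w z) (mul x y) + mul (mul x z) (mul w y) + mul (mul x w) (mul z y)"
proof -
  define T where "T a b c = mul a (mul (mul b c) y) - mul (mul b c) (mul a y)" for a b c
  have "T x w z + T w x z + T z x w = 0"
  proof (rule trilinear_polarization[of T])
    show "T a b c = T a c b" for a b c by (simp add: T_def mul_commute[of b c])
    show "T a a a = 0" for a by (simp add: T_def jordan_identity)
  qed (simp_all add: T_def mul_linear)
  then show ?thesis
    unfolding T_def by (simp add: algebra_simps)
qed

text \<open>The linearized identity, read as a formula for the multiplication operator of (x w) y in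
  terms of those of x, w, y and their pairwise products.\<close>

lemma mul_triple:
  "mul (mul (mul x w) y) z =
     mul (mul x w) (mul y z) + mul (mul x y) (mul w z) + mul (mul w y) (mul x z)
     - mul x (mul y (mul w z)) - mul w (mul y (mul x z))"
proof -
  have "mul z (mul (mul x w) y) = mul (mul w z) (mul x y) + mul (mul x z) (mul w y) + mul (mul x w) (mul z y)
     - mul x (mul (mul w z) y) - mul w (mul (mul x z) y)"
    using jordan_linearized[of x w z y] by (simp add: algebra_simps)
  then show ?thesis
    by (simp add: mul_commute algebra_simps)
qed

text \<open>For an idempotent c this is the cubic equation 2 L^3 - 3 L^2 + L = 0 for the
  multiplication by c, the source of the Peirce eigenvalues 0, 1/2, 1.\<close>

lemma mul_cube:
  "mul (mul (mul c c) c) z = 3 *\<^sub>R mul (mul c c) (mul c z) - 2 *\<^sub>R mul c (mul c (mul c z))"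
  unfolding mul_triple by (simp add: scaleR_conv_of_real algebra_simps numeral_3_eq_3 scaleR_left_distrib[of 1 2, simplified] scaleR_2)

definition inner_der :: "'a \<Rightarrow> 'a \<Rightarrow> 'a \<Rightarrow> 'a" where
  "inner_der a b x = mul a (mul b x) - mul b (mul a x)"

lemma linear_inner_der: "linear (inner_der a b)"
  unfolding inner_der_def
  by (intro linearI) (simp_all add: mul_linear algebra_simps)

text \<open>In the difference of the two instances of \<open>mul_triple\<close> the terms with
  pairwise products cancel. Commutators of multiplications are thus derivations, from which the
  associativity of the trace will follow.\<close>

lemma inner_der_mul:
  "inner_der a b (mul x z) = mul (inner_der a b x) z + mul x (inner_der a b z)"
proof -
  have 1: "inner_der a b x = mul (mul x b) a - mul (mul x a) b"
    unfolding inner_der_def by (simp add: mul_commute)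
  have "mul (inner_der a b x) z = mul (mul (mul x b) a) z - mul (mul (mul x a) b) z"
    unfolding 1 by (simp add: mul_linear)
  also have "\<dots> = inner_der a b (mul x z) - mul x (inner_der a b z)"
    unfolding mul_triple[of x b a z] mul_triple[of x a b z]
    by (simp add: inner_der_def mul_linear mul_commute algebra_simps)
  finally show ?thesis by simp
qed

subsection \<open>Power associativity\<close>

abbreviation pw :: "'a \<Rightarrow> nat \<Rightarrow> 'a" where
  "pw \<equiv> jordan_power mul e"

abbreviation ev :: "real poly \<Rightarrow> 'a \<Rightarrow> 'a" where
  "ev \<equiv> jordan_eval mul e"

lemma pw_commutant:
  assumes "\<And>z. T (mul x z) = mul x (T z)" "\<And>z. T (mul (mul x x) z) = mul (mul x x) (T z)"
    and T: "linear T"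
  shows "T (mul (pw x n) z) = mul (pw x n) (T z)"
proof (induction n arbitrary: z rule: less_induct)
  case (less n)
  consider "n = 0" | "n = 1" | m where "n = Suc (Suc m)"
    by (metis One_nat_def not0_implies_Suc)
  then show ?case
  proof cases
    case 1 then show ?thesis by (simp add: mul_unit)
  next
    case 2 then show ?thesis using assms(1) by (simp add: mul_unit_right)
  next
    case 3
    \<comment> \<open>The instance (x x^m) x = x^(m+2) of \<open>mul_triple\<close>.\<close>
    have eq: "mul (pw x n) z = mul (pw x (Suc m)) (mul x z) + mul (mul x x) (mul (pw x m) z)
        + mul (pw x (Suc m)) (mul x z) - mul x (mul x (mul (pw x m) z)) - mul (pw x m) (mul x (mul x z))" for z
      using mul_triple[of x "pw x m" x z] 3 by (simp add: mul_commute)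
    show ?thesis
      unfolding eq using less.IH[of m] less.IH[of "Suc m"] 3 assms
      by (simp only: linear_add[OF T] linear_diff[OF T])
  qed
qed

lemma pw_mul_commute: "mul (pw x m) (mul (pw x n) z) = mul (pw x n) (mul (pw x m) z)"
proof -
  have x: "mul x (mul (pw x n) z) = mul (pw x n) (mul x z)" for n z
    using jordan_identity by (intro pw_commutant linear_mul) auto
  have xx: "mul (mul x x) (mul (pw x n) z) = mul (pw x n) (mul (mul x x) z)" for n z
    using jordan_identity by (intro pw_commutant linear_mul) auto
  show ?thesis
    using x xx by (intro pw_commutant linear_mul) auto
qed

lemma pw_add: "mul (pw x m) (pw x n) = pw x (m + n)"
proof (induction m)
  case (Suc m)
  have "mul (mul x (pw x m)) (pw x n) = mul (pw x n) (mul x (pw x m))"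
    by (rule mul_commute)
  also have "\<dots> = mul x (mul (pw x n) (pw x m))"
    using pw_mul_commute[of x n "Suc 0" "pw x m"] by (simp add: mul_unit_right)
  finally show ?case using Suc by (simp add: mul_commute)
qed (simp add: mul_unit)

lemma ev_altdef:
  assumes "degree p \<le> n"
  shows "ev p x = (\<Sum>i\<le>n. coeff p i *\<^sub>R pw x i)"
  unfolding jordan_eval_def
  using assms by (intro sum.mono_neutral_left) (auto simp: coeff_eq_0)

lemma ev_add: "ev (p + q) x = ev p x + ev q x"
proof -
  let ?n = "max (degree p) (degree q)"
  have "degree (p + q) \<le> ?n" by (simp add: degree_add_le)
  then show ?thesis
    by (simp add: ev_altdef[of _ ?n] scaleR_left_distrib sum.distrib)
qed

lemma ev_smult: "ev (smult c p) x = c *\<^sub>R ev p x"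
  using ev_altdef[of "smult c p" "degree p" x] ev_altdef[of p "degree p" x]
  by (simp add: scaleR_sum_right degree_smult_le)

lemma ev_0 [simp]: "ev 0 x = 0"
  by (simp add: jordan_eval_def)

lemma ev_1 [simp]: "ev 1 x = e"
  by (simp add: jordan_eval_def)

lemma ev_minus: "ev (- p) x = - ev p x"
  using ev_smult[of "-1" p x] by simp

lemma ev_diff: "ev (p - q) x = ev p x - ev q x"
  using ev_add[of p "- q" x] by (simp add: ev_minus)

lemma ev_monom: "ev (monom c n) x = c *\<^sub>R pw x n"
proof -
  have "ev (monom c n) x = (\<Sum>i\<le>n. coeff (monom c n) i *\<^sub>R pw x i)"
    by (rule ev_altdef) (rule degree_monom_le)
  also have "\<dots> = (\<Sum>i\<le>n. if i = n then c *\<^sub>R pw x n else 0)"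
    by (intro sum.cong) auto
  finally show ?thesis by simp
qed

lemma ev_pCons: "ev (pCons a p) x = a *\<^sub>R e + mul x (ev p x)"
proof -
  have "ev (pCons a p) x = (\<Sum>i\<le>Suc (degree p). coeff (pCons a p) i *\<^sub>R pw x i)"
    by (rule ev_altdef) (rule degree_pCons_le)
  also have "\<dots> = a *\<^sub>R e + (\<Sum>i\<le>degree p. coeff p i *\<^sub>R pw x (Suc i))"
    by (simp only: sum.atMost_Suc_shift) simp
  finally show ?thesis
    by (simp add: jordan_eval_def mul_sum_right mul_linear)
qed

lemma ev_mul_commute: "mul (ev p x) (mul (ev q x) z) = mul (ev q x) (mul (ev p x) z)"
proof -
  have *: "mul (ev p x) (mul (ev q x) z) =
    (\<Sum>i\<le>degree p. \<Sum>j\<le>degree q. (coeff p i * coeff q j) *\<^sub>R mul (pw x i) (mul (pw x j) z))" for p q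
    unfolding jordan_eval_def
    by (simp add: mul_sum_left mul_linear) (simp add: mul_sum_right mul_linear scaleR_sum_right)
  show ?thesis
    unfolding * by (subst sum.swap) (simp add: pw_mul_commute[of x] mult.commute)
qed

lemma ev_x: "ev [:0, 1:] x = x"
  by (simp add: ev_pCons mul_unit_right mul_linear)

lemma ev_mult: "ev (p * q) x = mul (ev p x) (ev q x)"
proof (induction p)
  case (pCons a p)
  have "mul (mul x (ev p x)) (ev q x) = mul (ev q x) (mul x (ev p x))"
    by (rule mul_commute)
  also have "\<dots> = mul x (mul (ev q x) (ev p x))"
    using ev_mul_commute[of q x "[:0, 1:]" "ev p x"] by (simp add: ev_x)
  finally show ?case using pCons
    by (simp add: ev_pCons ev_add ev_smult mul_linear mul_unit mul_commute)
qed (simp add: mul_linear)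

lemma polynomial_function_mul:
  fixes f g :: "'c::real_normed_vector \<Rightarrow> 'a"
  assumes "polynomial_function f" "polynomial_function g"
  shows "polynomial_function (\<lambda>x. mul (f x) (g x))"
  by (rule polynomial_function_bilinear[OF bilinear_mul assms])

lemma polynomial_function_pw: "polynomial_function (\<lambda>x. pw x n)"
  by (induction n) (auto intro: polynomial_function_mul)

lemma e_nonzero: "e \<noteq> 0"
proof
  assume "e = 0"
  then have "x = 0" for x :: 'a using mul_unit[of x] by (simp add: mul_linear)
  then show False using nonempty_Basis nonzero_Basis by blast
qed

end

lemma rpf_inner:
  fixes f g :: "'c::real_normed_vector \<Rightarrow> 'a::euclidean_space"
  assumes "polynomial_function f" "polynomial_function g"
  shows "real_polynomial_function (\<lambda>x. f x \<bullet> g x)"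
  unfolding real_polynomial_function_eq
  by (rule polynomial_function_bilinear[OF _ assms])
    (simp add: bilinear_conv_bounded_bilinear bounded_bilinear_inner)

section \<open>The Cayley--Hamilton theorem with polynomial dependence on the operator\<close>

lemma poly_family_sum:
  assumes "finite I" "\<And>i. i \<in> I \<Longrightarrow> poly_family (p i)"
  shows "poly_family (\<lambda>b. \<Sum>i\<in>I. p i b)"
  using assms by (induction I) (auto intro: poly_family_add poly_family_const)

lemma poly_family_prod:
  assumes "finite I" "\<And>i. i \<in> I \<Longrightarrow> poly_family (p i)"
  shows "poly_family (\<lambda>b. \<Prod>i\<in>I. p i b)"
  using assms by (induction I) (auto intro: poly_family_mult poly_family_const)

lemma poly_family_det:
  assumes A: "\<And>b. A b \<in> carrier_mat n n"
    and fam: "\<And>i j. i < n \<Longrightarrow> j < n \<Longrightarrow> poly_family (\<lambda>b. A b $$ (i, j))"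
  shows "poly_family (\<lambda>b. Determinant.det (A b))"
  unfolding det_def'[OF A]
proof (intro poly_family_sum poly_family_mult poly_family_const poly_family_prod)
  fix p i assume "p \<in> {p. p permutes {0..<n}}" "i \<in> {0..<n}"
  then have "p i < n" "i < n" using permutes_in_image[of p "{0..<n}" i] by auto
  then show "poly_family (\<lambda>b. A b $$ (i, p i))" by (intro fam)
qed (auto simp: finite_permutations)

lemma rpf_det:
  fixes A :: "'b::real_normed_vector \<Rightarrow> real Matrix.mat"
  assumes A: "\<And>b. A b \<in> carrier_mat n n"
    and fam: "\<And>i j. i < n \<Longrightarrow> j < n \<Longrightarrow> real_polynomial_function (\<lambda>b. A b $$ (i, j))"
  shows "real_polynomial_function (\<lambda>b. Determinant.det (A b))"
  unfolding det_def'[OF A]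
proof (intro real_polynomial_function_sum rpf_mult rpf_const real_polynomial_function_prod)
  fix p i assume "p \<in> {p. p permutes {0..<n}}" "i \<in> {0..<n}"
  then have "p i < n" "i < n" using permutes_in_image[of p "{0..<n}" i] by auto
  then show "real_polynomial_function (\<lambda>b. A b $$ (i, p i))" by (intro fam)
qed (auto simp: finite_permutations)

definition poly_act :: "('a::real_vector \<Rightarrow> 'a) \<Rightarrow> real poly \<Rightarrow> 'a \<Rightarrow> 'a" where
  "poly_act L p v = fold_coeffs (\<lambda>a w. a *\<^sub>R v + L w) p 0"

context
  fixes L :: "'a::real_vector \<Rightarrow> 'a"
  assumes L: "linear L"
begin

lemma poly_act_0 [simp]: "poly_act L 0 v = 0"
  by (simp add: poly_act_def)

lemma poly_act_pCons: "poly_act L (pCons a p) v = a *\<^sub>R v + L (poly_act L p v)"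
  by (cases "p = 0 \<and> a = 0") (auto simp: poly_act_def linear_0[OF L])

lemma poly_act_add: "poly_act L (p + q) v = poly_act L p v + poly_act L q v"
proof (induction p arbitrary: q)
  case (pCons a p)
  obtain b r where "q = pCons b r" by (rule pCons_cases)
  then show ?case
    by (simp add: poly_act_pCons pCons linear_add[OF L] scaleR_left_distrib)
qed simp

lemma poly_act_smult: "poly_act L (Polynomial.smult c p) v = c *\<^sub>R poly_act L p v"
  by (induction p) (simp_all add: poly_act_pCons linear_scale[OF L] scaleR_right_distrib)

lemma poly_act_mult: "poly_act L (p * q) v = poly_act L p (poly_act L q v)"
  by (induction p) (simp_all add: poly_act_pCons poly_act_add poly_act_smult)

lemma linear_poly_act: "linear (poly_act L p)"
proof (rule linearI)
  show "poly_act L p (v + w) = poly_act L p v + poly_act L p w" for v w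
    by (induction p) (simp_all add: poly_act_pCons linear_add[OF L] scaleR_right_distrib)
  show "poly_act L p (c *\<^sub>R v) = c *\<^sub>R poly_act L p v" for c v
    by (induction p) (simp_all add: poly_act_pCons linear_scale[OF L] scaleR_right_distrib)
qed

lemma poly_act_sum_left: "poly_act L (sum f I) v = (\<Sum>i\<in>I. poly_act L (f i) v)"
  by (induction I rule: infinite_finite_induct) (simp_all add: poly_act_add)

end

definition operator_matrix :: "(nat \<Rightarrow> 'a::euclidean_space) \<Rightarrow> ('a \<Rightarrow> 'a) \<Rightarrow> real Matrix.mat" where
  "operator_matrix b L = Matrix.mat DIM('a) DIM('a) (\<lambda>(i, j). L (b j) \<bullet> b i)"

text \<open>When \<lambda> acts as \<open>L\<close>, the columns of the matrix \<lambda> - A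
  annihilate the basis vectors; multiplying by the adjugate leaves the determinant acting on each
  basis vector.\<close>

lemma poly_act_char_poly:
  fixes L :: "'a::euclidean_space \<Rightarrow> 'a" and b :: "nat \<Rightarrow> 'a"
  assumes L: "linear L" and b: "bij_betw b {0..<DIM('a)} Basis"
  shows "poly_act L (char_poly (operator_matrix b L)) v = 0"
proof -
  define n where "n = DIM('a)"
  define A where "A = operator_matrix b L"
  define M where "M = char_poly_matrix A"
  define P where "P = adj_mat M"
  have A: "A \<in> carrier_mat n n" by (simp add: A_def operator_matrix_def n_def)
  then have M: "M \<in> carrier_mat n n" by (simp add: M_def)
  have P: "P \<in> carrier_mat n n" and MP: "M * P = Determinant.det M \<cdot>\<^sub>m 1\<^sub>m n"
    using adj_mat[OF M] by (simp_all add: P_def)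
  have Mij: "M $$ (i, j) = (if i = j then [:0, 1:] else 0) + [:- (L (b j) \<bullet> b i):]"
    if "i < n" "j < n" for i j
    using that A by (auto simp: M_def char_poly_matrix_def A_def operator_matrix_def n_def)
  have expand: "L w = (\<Sum>i<n. (L w \<bullet> b i) *\<^sub>R b i)" for w
  proof -
    have "L w = (\<Sum>u\<in>Basis. (L w \<bullet> u) *\<^sub>R u)" by (simp add: euclidean_representation)
    also have "\<dots> = (\<Sum>i\<in>{0..<n}. (L w \<bullet> b i) *\<^sub>R b i)"
      using b by (intro sum.reindex_bij_betw[symmetric]) (simp add: n_def)
    finally show ?thesis by (simp add: lessThan_atLeast0)
  qed
  have col: "(\<Sum>i<n. poly_act L (M $$ (i, j)) (b i)) = 0" if j: "j < n" for j
  proof -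
    have "(\<Sum>i<n. poly_act L (M $$ (i, j)) (b i)) =
        (\<Sum>i<n. (if i = j then L (b j) else 0) - (L (b j) \<bullet> b i) *\<^sub>R b i)"
      using j by (intro sum.cong refl)
        (auto simp: Mij poly_act_add[OF L] poly_act_pCons[OF L] linear_0[OF L] poly_act_0[OF L])
    also have "\<dots> = L (b j) - (\<Sum>i<n. (L (b j) \<bullet> b i) *\<^sub>R b i)"
      using j by (simp add: sum_subtractf)
    finally show ?thesis using expand[of "b j"] by simp
  qed
  have "poly_act L (Determinant.det M) (b k) = 0" if k: "k < n" for k
  proof -
    have "0 = (\<Sum>j<n. poly_act L (P $$ (j, k)) (\<Sum>i<n. poly_act L (M $$ (i, j)) (b i)))"
      using col by (simp add: linear_0[OF linear_poly_act[OF L]])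
    also have "\<dots> = (\<Sum>j<n. \<Sum>i<n. poly_act L (M $$ (i, j) * P $$ (j, k)) (b i))"
      by (simp add: linear_sum[OF linear_poly_act[OF L]] poly_act_mult[OF L, symmetric] mult.commute)
    also have "\<dots> = (\<Sum>i<n. poly_act L (\<Sum>j<n. M $$ (i, j) * P $$ (j, k)) (b i))"
      by (subst sum.swap) (simp add: poly_act_sum_left[OF L])
    also have "\<dots> = (\<Sum>i<n. poly_act L ((M * P) $$ (i, k)) (b i))"
      using M P k by (intro sum.cong refl) (auto simp: scalar_prod_def lessThan_atLeast0)
    also have "\<dots> = (\<Sum>i<n. if i = k then poly_act L (Determinant.det M) (b k) else 0)"
      using k by (intro sum.cong refl) (auto simp: MP poly_act_0[OF L])
    also have "\<dots> = poly_act L (Determinant.det M) (b k)" using k by simp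
    finally show ?thesis by simp
  qed
  then have basis: "poly_act L (Determinant.det M) u = 0" if "u \<in> Basis" for u
    using that b unfolding bij_betw_def n_def by force
  have "poly_act L (Determinant.det M) v = poly_act L (Determinant.det M) (\<Sum>u\<in>Basis. (v \<bullet> u) *\<^sub>R u)"
    by (simp add: euclidean_representation)
  also have "\<dots> = 0"
    by (simp add: linear_sum[OF linear_poly_act[OF L]] linear_scale[OF linear_poly_act[OF L]] basis)
  finally have "poly_act L (Determinant.det M) v = 0" .
  then show ?thesis by (simp add: M_def A_def char_poly_def)
qed

context real_jordan_algebra
begin

lemma ev_poly_act: "ev p x = poly_act (mul x) p e"
  by (induction p) (simp_all add: ev_pCons poly_act_pCons[OF linear_mul] poly_act_0[OF linear_mul])

text \<open>The characteristic polynomial of the multiplication by \<open>x\<close>, applied to the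
  unit. Its degree is in general larger than the rank; it serves as the monic multiple of the
  minimal polynomial to which Gauss's lemma is applied.\<close>

lemma annihilating_family:
  "\<exists>h. poly_family h \<and> (\<forall>x. degree (h x) = DIM('a) \<and> coeff (h x) DIM('a) = 1 \<and> ev (h x) x = 0)"
proof -
  obtain b :: "nat \<Rightarrow> 'a" where b: "bij_betw b {0..<DIM('a)} Basis"
    using ex_bij_betw_nat_finite[OF finite_Basis] by blast
  define A where "A x = operator_matrix b (mul x)" for x
  have A: "A x \<in> carrier_mat DIM('a) DIM('a)" for x
    by (simp add: A_def operator_matrix_def)
  have entry: "real_polynomial_function (\<lambda>x. A x $$ (i, j))" if "i < DIM('a)" "j < DIM('a)" for i j
  proof -
    have "bounded_linear (\<lambda>x. mul x (b j) \<bullet> b i)"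
      using linear_mul_left linear_conv_bounded_linear bounded_linear_compose[OF bounded_linear_inner_left]
      by blast
    then show ?thesis using that by (auto simp: A_def operator_matrix_def intro: rpf_linear)
  qed
  have "poly_family (\<lambda>x. char_poly (A x))"
    unfolding char_poly_def
  proof (rule poly_family_det)
    show "char_poly_matrix (A x) \<in> carrier_mat DIM('a) DIM('a)" for x
      using A by simp
    fix i j assume ij: "i < DIM('a)" "j < DIM('a)"
    have "char_poly_matrix (A x) $$ (i, j) = (if i = j then [:0, 1:] else 0) - monom (A x $$ (i, j)) 0" for x
      using ij A[of x] by (auto simp: char_poly_matrix_def monom_0)
    then show "poly_family (\<lambda>x. char_poly_matrix (A x) $$ (i, j))"
      by (simp only:) (intro poly_family_diff poly_family_const poly_family_monom entry ij)
  qed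
  then show ?thesis
    using degree_monic_char_poly[OF A] poly_act_char_poly[OF linear_mul b]
    by (intro exI[of _ "\<lambda>x. char_poly (A x)"]) (auto simp: ev_poly_act A_def)
qed

section \<open>Minimal polynomials\<close>

lemma minpoly_exists:
  "\<exists>p. lead_coeff p = 1 \<and> ev p x = 0 \<and> (\<forall>q. lead_coeff q = 1 \<and> ev q x = 0 \<longrightarrow> degree p \<le> degree q)"
proof -
  have "\<exists>p. lead_coeff p = 1 \<and> ev p x = 0"
    using annihilating_family by metis
  then show ?thesis
    using ex_has_least_nat[of "\<lambda>p. lead_coeff p = 1 \<and> ev p x = 0" _ degree] by blast
qed

lemma monic_multiple:
  fixes p :: "real poly"
  assumes "p \<noteq> 0"
  shows "lead_coeff (Polynomial.smult (inverse (lead_coeff p)) p) = 1"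
  using assms by simp

lemma minpoly_unique:
  assumes "lead_coeff p = 1" "ev p x = 0" "\<And>q. lead_coeff q = 1 \<Longrightarrow> ev q x = 0 \<Longrightarrow> degree p \<le> degree q"
    and "lead_coeff p' = 1" "ev p' x = 0" "\<And>q. lead_coeff q = 1 \<Longrightarrow> ev q x = 0 \<Longrightarrow> degree p' \<le> degree q"
  shows "p = p'"
proof (rule ccontr)
  assume "p \<noteq> p'"
  define d where "d = p - p'"
  have d: "d \<noteq> 0" using \<open>p \<noteq> p'\<close> by (simp add: d_def)
  have deg: "degree p = degree p'" using assms by (meson le_antisym)
  have "degree d \<noteq> degree p"
  proof
    assume "degree d = degree p"
    then have "lead_coeff d = 0" using assms deg by (simp add: d_def)
    then show False using d by simp
  qed
  moreover have "degree d \<le> degree p" unfolding d_def using deg by (simp add: degree_diff_le)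
  moreover have "degree p \<le> degree (Polynomial.smult (inverse (lead_coeff d)) d)"
    using monic_multiple[OF d] assms by (intro assms(3)) (simp_all add: ev_smult d_def ev_diff)
  ultimately show False using d by simp
qed

abbreviation mp :: "'a \<Rightarrow> real poly" where "mp \<equiv> jordan_minpoly mul e"

lemma minpoly: "lead_coeff (mp x) = 1" "ev (mp x) x = 0"
  "lead_coeff q = 1 \<Longrightarrow> ev q x = 0 \<Longrightarrow> degree (mp x) \<le> degree q"
proof -
  have "\<exists>!p. lead_coeff p = 1 \<and> ev p x = 0 \<and> (\<forall>q. lead_coeff q = 1 \<and> ev q x = 0 \<longrightarrow> degree p \<le> degree q)"
    (is "\<exists>!p. ?P p")
  proof (rule ex_ex1I)
    show "\<exists>p. ?P p" by (rule minpoly_exists)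
    show "p = p'" if "?P p" "?P p'" for p p'
      using that by (intro minpoly_unique[of p x p']) auto
  qed
  from theI'[OF this] show "lead_coeff (mp x) = 1" "ev (mp x) x = 0"
    "lead_coeff q = 1 \<Longrightarrow> ev q x = 0 \<Longrightarrow> degree (mp x) \<le> degree q"
    unfolding jordan_minpoly_def by blast+
qed

lemma minpoly_le_degree:
  assumes "p \<noteq> 0" "ev p x = 0"
  shows "degree (mp x) \<le> degree p"
  using minpoly(3)[of "Polynomial.smult (inverse (lead_coeff p)) p"] monic_multiple[OF assms(1)] assms
  by (simp add: ev_smult)

lemma minpoly_dvd:
  assumes "ev p x = 0"
  shows "mp x dvd p"
proof -
  have "mp x \<noteq> 0" using minpoly(1)[of x] by auto
  have "ev (p mod mp x) x = ev (p - p div mp x * mp x) x" by (simp add: minus_div_mult_eq_mod)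
  also have "\<dots> = 0" using assms by (simp add: ev_diff ev_mult minpoly(2) mul_linear)
  finally have "ev (p mod mp x) x = 0" .
  then have "p mod mp x = 0"
    using minpoly_le_degree[of "p mod mp x" x] degree_mod_less[OF \<open>mp x \<noteq> 0\<close>, of p] by force
  then show ?thesis by (simp add: mod_eq_0_iff_dvd)
qed

abbreviation rk :: nat where "rk \<equiv> jordan_rank mul e"

lemma finite_degrees: "finite (range (\<lambda>x. degree (mp x)))"
proof (rule finite_subset)
  show "range (\<lambda>x. degree (mp x)) \<subseteq> {..DIM('a)}"
  proof (rule image_subsetI)
    fix x
    obtain h where "degree h = DIM('a)" "coeff h DIM('a) = 1" "ev h x = 0"
      using annihilating_family by blast
    then have "degree (mp x) \<le> degree h" by (intro minpoly(3)) auto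
    then show "degree (mp x) \<in> {..DIM('a)}" using \<open>degree h = DIM('a)\<close> by simp
  qed
qed simp

lemma degree_minpoly_le_rank: "degree (mp x) \<le> rk"
  unfolding jordan_rank_def using finite_degrees by (intro Max_ge) auto

lemma exists_regular: "\<exists>x. degree (mp x) = rk"
proof -
  have "rk \<in> range (\<lambda>x. degree (mp x))"
    unfolding jordan_rank_def using finite_degrees by (intro Max_in) auto
  then show ?thesis by auto
qed

lemma rank_pos: "rk > 0"
proof (rule ccontr)
  assume "\<not> rk > 0"
  then have "degree (mp e) = 0" using degree_minpoly_le_rank[of e] by simp
  then have "mp e = 1" using minpoly(1)[of e] by (metis monic_degree_0)
  then show False using minpoly(2)[of e] e_nonzero by simp
qed

definition gram :: "'a \<Rightarrow> real Matrix.mat" where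
  "gram x = Matrix.mat rk rk (\<lambda>(i, j). pw x i \<bullet> pw x j)"

text \<open>The Gram determinant of 1, x, ..., x^(r-1) for the auxiliary inner product: a polynomial
  function that is nonzero exactly at the regular elements. It is not the discriminant of the
  minimal polynomial.\<close>

definition disc :: "'a \<Rightarrow> real" where
  "disc x = Determinant.det (gram x)"

lemma gram_carrier: "gram x \<in> carrier_mat rk rk"
  by (simp add: gram_def)

lemma rpf_inner_pw: "real_polynomial_function (\<lambda>x. pw x i \<bullet> pw x j)"
  by (intro rpf_inner polynomial_function_pw)

lemma gram_mult:
  assumes "v \<in> carrier_vec rk" "i < rk"
  shows "Matrix.vec_index (gram x *\<^sub>v v) i = pw x i \<bullet> (\<Sum>j<rk. Matrix.vec_index v j *\<^sub>R pw x j)"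
  using assms by (auto simp: gram_def scalar_prod_def lessThan_atLeast0 inner_sum_right mult.commute)

lemma ev_coeffs:
  assumes "\<And>k. k \<ge> n \<Longrightarrow> coeff p k = 0"
  shows "ev p x = (\<Sum>j<n. coeff p j *\<^sub>R pw x j)"
proof -
  have "ev p x = (\<Sum>j\<le>degree p + n. coeff p j *\<^sub>R pw x j)" by (rule ev_altdef) simp
  also have "\<dots> = (\<Sum>j<n. coeff p j *\<^sub>R pw x j)"
    using assms by (intro sum.mono_neutral_right) auto
  finally show ?thesis .
qed

lemma disc_eq_0_iff: "disc x = 0 \<longleftrightarrow> (\<exists>p. p \<noteq> 0 \<and> (\<forall>k\<ge>rk. coeff p k = 0) \<and> ev p x = 0)"
proof
  assume "disc x = 0"
  then obtain v where v: "v \<in> carrier_vec rk" "v \<noteq> 0\<^sub>v rk" "gram x *\<^sub>v v = 0\<^sub>v rk"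
    using det_0_iff_vec_prod_zero[OF gram_carrier] unfolding disc_def by blast
  define p where "p = (\<Sum>j<rk. monom (Matrix.vec_index v j) j)"
  have coeff_p: "coeff p k = (if k < rk then Matrix.vec_index v k else 0)" for k
    by (simp add: p_def coeff_sum)
  have evp: "ev p x = (\<Sum>j<rk. Matrix.vec_index v j *\<^sub>R pw x j)" (is "_ = ?s")
    by (subst ev_coeffs[of rk]) (auto simp: coeff_p)
  \<comment> \<open>A kernel vector of the Gram matrix yields a combination of powers that is
    orthogonal to itself.\<close>
  have "?s \<bullet> ?s = (\<Sum>i<rk. Matrix.vec_index v i * (pw x i \<bullet> ?s))"
    by (subst inner_sum_left) simp
  also have "\<dots> = (\<Sum>i<rk. Matrix.vec_index v i * Matrix.vec_index (gram x *\<^sub>v v) i)"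
    using v(1) by (intro sum.cong refl) (simp add: gram_mult del: index_mult_mat_vec)
  also have "\<dots> = 0" unfolding v(3) by simp
  finally have "ev p x = 0" using evp by simp
  moreover have "p \<noteq> 0"
  proof
    assume "p = 0"
    then have "v = 0\<^sub>v rk" using v(1) coeff_p by (intro eq_vecI) (auto split: if_splits, metis)
    then show False using v(2) by simp
  qed
  ultimately show "\<exists>p. p \<noteq> 0 \<and> (\<forall>k\<ge>rk. coeff p k = 0) \<and> ev p x = 0"
    using coeff_p by (intro exI[of _ p]) auto
next
  assume "\<exists>p. p \<noteq> 0 \<and> (\<forall>k\<ge>rk. coeff p k = 0) \<and> ev p x = 0"
  then obtain p where p: "p \<noteq> 0" "\<And>k. k \<ge> rk \<Longrightarrow> coeff p k = 0" "ev p x = 0" by blast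
  define v where "v = Matrix.vec rk (coeff p)"
  have v: "v \<in> carrier_vec rk" by (simp add: v_def)
  have "v \<noteq> 0\<^sub>v rk"
  proof
    assume "v = 0\<^sub>v rk"
    then have "coeff p k = 0" for k
      using p(2)[of k] by (cases "k < rk") (auto simp: v_def dest: arg_cong[where f = "\<lambda>v. Matrix.vec_index v k"])
    then show False using p(1) by (simp add: poly_eq_iff)
  qed
  moreover have "gram x *\<^sub>v v = 0\<^sub>v rk"
  proof (rule eq_vecI)
    fix i assume "i < dim_vec (0\<^sub>v rk :: real Matrix.vec)"
    then have i: "i < rk" by simp
    have "(\<Sum>j<rk. Matrix.vec_index v j *\<^sub>R pw x j) = ev p x"
      using ev_coeffs[of rk p x, OF p(2)] by (simp add: v_def)
    then show "Matrix.vec_index (gram x *\<^sub>v v) i = Matrix.vec_index (0\<^sub>v rk) i"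
      using gram_mult[OF v i, of x] p(3) i by simp
  qed (simp add: gram_def)
  ultimately show "disc x = 0"
    unfolding disc_def using det_0_iff_vec_prod_zero[OF gram_carrier] v by blast
qed

lemma disc_nonzero_iff: "disc x \<noteq> 0 \<longleftrightarrow> degree (mp x) = rk"
proof -
  have "disc x = 0 \<longleftrightarrow> degree (mp x) < rk"
  proof
    assume "disc x = 0"
    then obtain p where p: "p \<noteq> 0" "\<forall>k\<ge>rk. coeff p k = 0" "ev p x = 0"
      unfolding disc_eq_0_iff by blast
    have "degree (mp x) \<le> degree p" using minpoly_le_degree p by blast
    also have "degree p < rk" using p(1,2) by (meson leading_coeff_0_iff not_less)
    finally show "degree (mp x) < rk" .
  next
    assume "degree (mp x) < rk"
    then show "disc x = 0" unfolding disc_eq_0_iff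
      using minpoly(1)[of x] minpoly(2)[of x] by (intro exI[of _ "mp x"]) (auto simp: coeff_eq_0)
  qed
  then show ?thesis using degree_minpoly_le_rank[of x] by auto
qed

lemma rpf_disc: "real_polynomial_function disc"
  unfolding disc_def
  by (rule rpf_det[OF gram_carrier]) (simp add: gram_def rpf_inner_pw)

lemma exists_disc_nonzero: "\<exists>x. disc x \<noteq> 0"
  using exists_regular disc_nonzero_iff by blast

text \<open>Inner products of the relation \<open>ev (mp x) x = 0\<close> with the powers of
  \<open>x\<close> form a linear system with the Gram matrix, which Cramer's rule solves with
  denominator \<open>disc x\<close>. Removing this denominator is the purpose of
  \<open>minpoly_coeff_line\<close>.\<close>

lemma coeff_minpoly_rational:
  assumes k: "k < rk"
  shows "\<exists>N. real_polynomial_function N \<and> (\<forall>x. disc x \<noteq> 0 \<longrightarrow> N x = coeff (mp x) k * disc x)"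
proof -
  define B where "B x = replace_col (gram x) (Matrix.vec rk (\<lambda>i. - (pw x i \<bullet> pw x rk))) k" for x
  have B: "B x \<in> carrier_mat rk rk" for x by (simp add: B_def replace_col_def gram_def)
  have "real_polynomial_function (\<lambda>x. Determinant.det (B x))"
  proof (rule rpf_det[OF B])
    fix i j assume "i < rk" "j < rk"
    then have "B x $$ (i, j) = (if j = k then - (pw x i \<bullet> pw x rk) else pw x i \<bullet> pw x j)" for x
      by (simp add: B_def replace_col_def gram_def)
    then show "real_polynomial_function (\<lambda>x. B x $$ (i, j))"
      by (cases "j = k") (auto simp: rpf_inner_pw intro: real_polynomial_function_minus)
  qed
  moreover have "Determinant.det (B x) = coeff (mp x) k * disc x" if "disc x \<noteq> 0" for x
  proof -
    have deg: "degree (mp x) = rk" using that disc_nonzero_iff by blast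
    define v where "v = Matrix.vec rk (coeff (mp x))"
    have v: "v \<in> carrier_vec rk" by (simp add: v_def)
    have "ev (mp x) x = (\<Sum>j<Suc rk. coeff (mp x) j *\<^sub>R pw x j)"
      using deg by (intro ev_coeffs) (simp add: coeff_eq_0)
    then have "(\<Sum>j<rk. coeff (mp x) j *\<^sub>R pw x j) = - pw x rk"
      using minpoly(1,2)[of x] deg by (simp add: eq_neg_iff_add_eq_0)
    then have "gram x *\<^sub>v v = Matrix.vec rk (\<lambda>i. - (pw x i \<bullet> pw x rk))"
      using gram_mult[OF v, of _ x] by (intro eq_vecI) (auto simp: v_def gram_def)
    then have "B x = replace_col (gram x) (gram x *\<^sub>v v) k" by (simp add: B_def)
    then show ?thesis
      using cramer_lemma_mat[OF gram_carrier v k, of x] k by (simp add: v_def disc_def)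
  qed
  ultimately show ?thesis by blast
qed

end

section \<open>Divisibility of polynomial functions\<close>

lemma poly_family_line:
  fixes f :: "'a::euclidean_space \<Rightarrow> real"
  assumes "real_polynomial_function f"
  obtains p where "poly_family p" "\<And>y t. f (x + t *\<^sub>R y) = poly (p y) t"
proof -
  obtain p where p: "poly_family p" "\<And>x y t. f (x + t *\<^sub>R y) = poly (p (x, y)) t"
    using rpf_line_poly[OF assms] by blast
  have "poly_family (\<lambda>y. p (x, y))"
    by (rule poly_family_compose[OF p(1)]) (intro polynomial_function_Pair polynomial_function_const polynomial_function_id)
  then show ?thesis using p(2) that by blast
qed

text \<open>Divisibility along all lines through one point suffices: the coefficients of the quotient are
  then given by power series division, hence depend polynomially on the direction.\<close>

lemma rpf_dvd_of_lines:
  fixes N M :: "'a::euclidean_space \<Rightarrow> real"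
  assumes N: "real_polynomial_function N" and M: "real_polynomial_function M" and x0: "M x0 \<noteq> 0"
    and lines: "\<And>y. \<exists>p. \<forall>t. N (x0 + t *\<^sub>R y) = poly p t * M (x0 + t *\<^sub>R y)"
  shows "\<exists>A. real_polynomial_function A \<and> (\<forall>x. N x = A x * M x)"
proof -
  obtain n where n: "poly_family n" "\<And>y t. N (x0 + t *\<^sub>R y) = poly (n y) t"
    using poly_family_line[OF N] by blast
  obtain m where m: "poly_family m" "\<And>y t. M (x0 + t *\<^sub>R y) = poly (m y) t"
    using poly_family_line[OF M] by blast
  obtain p where "\<forall>y t. N (x0 + t *\<^sub>R y) = poly (p y) t * M (x0 + t *\<^sub>R y)"
    using lines by metis
  then have nm: "n y = p y * m y" for y
    by (intro real_poly_eqI) (simp add: n(2)[symmetric] m(2)[symmetric])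
  have m0: "coeff (m y) 0 = M x0" for y
    using m(2)[of 0 y] by (simp add: poly_0_coeff_0)
  have "real_polynomial_function (\<lambda>y. coeff (p y) k)" for k
  proof (induction k rule: less_induct)
    case (less k)
    have "coeff (p y) k = (coeff (n y) k - (\<Sum>i<k. coeff (p y) i * coeff (m y) (k - i))) / M x0" for y
    proof -
      have "coeff (n y) k = (\<Sum>i<k. coeff (p y) i * coeff (m y) (k - i)) + coeff (p y) k * M x0"
        unfolding nm coeff_mult by (simp add: lessThan_Suc_atMost[symmetric] m0)
      then show ?thesis using x0 by (simp add: field_simps)
    qed
    then show ?case
      by (simp only:) (intro real_polynomial_function_divide real_polynomial_function_diff
          real_polynomial_function_sum rpf_mult less poly_family_coeff n m; simp)
  qed
  moreover obtain d where d: "\<And>y k. k \<ge> d \<Longrightarrow> coeff (n y) k = 0"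
    using n(1) unfolding poly_family_def by blast
  have "coeff (p y) k = 0" if k: "k \<ge> Suc d" for y k
  proof (rule ccontr)
    assume nz: "coeff (p y) k \<noteq> 0"
    then have "p y \<noteq> 0" by auto
    moreover have "m y \<noteq> 0" using m0[of y] x0 by auto
    ultimately have "degree (n y) = degree (p y) + degree (m y)" "n y \<noteq> 0"
      unfolding nm by (simp_all add: degree_mult_eq)
    moreover have "k \<le> degree (p y)" using nz by (rule le_degree)
    ultimately have "degree (n y) \<ge> d" using k by linarith
    then have "lead_coeff (n y) = 0" using d by simp
    with \<open>n y \<noteq> 0\<close> show False by simp
  qed
  ultimately have p: "poly_family p" by (intro poly_familyI)
  have "polynomial_function (\<lambda>x. x - x0)"
    by (intro polynomial_function_diff polynomial_function_id polynomial_function_const)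
  then have "real_polynomial_function (\<lambda>x. poly (p (x - x0)) 1)"
    by (rule rpf_of_poly_family[OF p rpf_const])
  moreover have "N x = poly (p (x - x0)) 1 * M x" for x
    using n(2)[of 1 "x - x0"] m(2)[of 1 "x - x0"] by (simp add: nm)
  ultimately show ?thesis by blast
qed

text \<open>Gauss's lemma: contents multiply, so \<open>a\<close> divides the content of the
  cofactor and cancels.\<close>

lemma primitive_dvd_smult:
  fixes g h :: "real poly poly"
  assumes "g dvd Polynomial.smult a h" "a \<noteq> 0" "content g = 1"
  shows "g dvd h"
proof -
  obtain q where q: "Polynomial.smult a h = g * q" using assms(1) by (elim dvdE)
  have "content q = normalize a * content h"
    using arg_cong[OF q, of content] assms(3) by (simp add: content_mult)
  then have "a dvd content q" by simp
  then have "[:a:] dvd q" by (simp add: const_poly_dvd_iff_dvd_content)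
  then obtain q' where "q = [:a:] * q'" by (elim dvdE)
  then have "Polynomial.smult a h = Polynomial.smult a (g * q')" using q by simp
  then have "Polynomial.smult a (h - g * q') = 0" by (simp add: smult_diff_right)
  then have "h = g * q'" using assms(2) by simp
  then show ?thesis by simp
qed

abbreviation eval_coeffs :: "real \<Rightarrow> real poly poly \<Rightarrow> real poly" where
  "eval_coeffs t \<equiv> map_poly (\<lambda>c. poly c t)"

lemma eval_coeffs_mult: "eval_coeffs t (p * q) = eval_coeffs t p * eval_coeffs t q"
  by (intro poly_eqI) (simp add: coeff_map_poly coeff_mult poly_sum)

lemma eval_coeffs_add: "eval_coeffs t (p + q) = eval_coeffs t p + eval_coeffs t q"
  by (intro poly_eqI) (simp add: coeff_map_poly)

lemma eval_coeffs_smult: "eval_coeffs t (Polynomial.smult a q) = Polynomial.smult (poly a t) (eval_coeffs t q)"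
  by (intro poly_eqI) (simp add: coeff_map_poly)

lemma bivariate_of_family:
  assumes "\<And>t k. coeff (h t) k = poly (c k) t" "\<And>k. k \<ge> n \<Longrightarrow> c k = 0"
  shows "\<exists>H. (\<forall>t. eval_coeffs t H = h t) \<and> (\<forall>k. coeff H k = c k)"
proof -
  define H where "H = (\<Sum>k<n. monom (c k) k)"
  have H: "coeff H j = c j" for j
    using assms(2)[of j] by (auto simp: H_def coeff_sum)
  have "eval_coeffs t H = h t" for t
    by (rule poly_eqI) (simp add: coeff_map_poly H assms(1))
  with H show ?thesis by blast
qed

lemma infinitely_many_zeros:
  fixes c g :: "real poly"
  assumes "g \<noteq> 0" "\<And>t. poly g t \<noteq> 0 \<Longrightarrow> poly c t = 0"
  shows "c = 0"
proof -
  have "c * g = 0" using assms(2) by (intro real_poly_eqI) auto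
  then show ?thesis using assms(1) by auto
qed

context real_jordan_algebra
begin

section \<open>The generic minimal polynomial\<close>

text \<open>Along the line, \<open>disc\<close> times the minimal polynomial is a polynomial
  \<open>G\<close> over \<real>[t] with leading coefficient \<open>g\<close>. The primitive part of
  \<open>G\<close> divides the monic annihilator \<open>H\<close>, so its leading coefficient is a
  unit; hence \<open>g\<close> divides the content of \<open>G\<close> and with it every
  coefficient.\<close>

lemma minpoly_coeff_line:
  assumes k: "k < rk" and x0: "disc x0 \<noteq> 0" and N: "real_polynomial_function N"
    and N_eq: "\<And>x. disc x \<noteq> 0 \<Longrightarrow> N x = coeff (mp x) k * disc x"
  shows "\<exists>p. \<forall>t. N (x0 + t *\<^sub>R y) = poly p t * disc (x0 + t *\<^sub>R y)"
proof -
  define X where "X t = x0 + t *\<^sub>R y" for t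
  obtain g where g: "\<And>t. disc (X t) = poly g t"
    unfolding X_def using rpf_line_poly1[OF rpf_disc] by metis
  have g0: "g \<noteq> 0" using g[of 0] x0 by (auto simp: X_def)
  have "\<exists>c. \<forall>t. poly g t \<noteq> 0 \<longrightarrow> poly c t = coeff (mp (X t)) j * poly g t" if j: "j < rk" for j
  proof -
    obtain M where M: "real_polynomial_function M" "\<forall>x. disc x \<noteq> 0 \<longrightarrow> M x = coeff (mp x) j * disc x"
      using coeff_minpoly_rational[OF j] by blast
    obtain c where c: "\<And>t. M (X t) = poly c t"
      unfolding X_def using rpf_line_poly1[OF M(1)] by metis
    have "poly c t = coeff (mp (X t)) j * poly g t" if "poly g t \<noteq> 0" for t
    proof -
      have "disc (X t) \<noteq> 0" using that g by simp
      then have "M (X t) = coeff (mp (X t)) j * disc (X t)" using M(2) by blast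
      then show ?thesis by (simp only: g c)
    qed
    then show ?thesis by blast
  qed
  then obtain c where c: "\<And>j t. j < rk \<Longrightarrow> poly g t \<noteq> 0 \<Longrightarrow> poly (c j) t = coeff (mp (X t)) j * poly g t"
    by metis
  define G where "G = monom g rk + (\<Sum>j<rk. monom (c j) j)"
  have coeff_G: "coeff G j = (if j = rk then g else if j < rk then c j else 0)" for j
    by (auto simp: G_def coeff_sum)
  have G0: "G \<noteq> 0" using coeff_G[of rk] g0 by auto
  have deg_G: "degree G = rk"
    using coeff_G g0 by (intro antisym degree_le le_degree) auto
  have G_eval: "eval_coeffs t G = Polynomial.smult (poly g t) (mp (X t))" if "poly g t \<noteq> 0" for t
  proof (rule poly_eqI)
    fix j
    have reg: "degree (mp (X t)) = rk" using that g disc_nonzero_iff by metis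
    then show "coeff (eval_coeffs t G) j = coeff (Polynomial.smult (poly g t) (mp (X t))) j"
      using minpoly(1)[of "X t"] c[of j t] that
      by (auto simp: coeff_map_poly coeff_G coeff_eq_0)
  qed
  obtain h where h: "poly_family h" "\<And>x. degree (h x) = DIM('a)" "\<And>x. coeff (h x) DIM('a) = 1"
    "\<And>x. ev (h x) x = 0"
    using annihilating_family by blast
  have "\<exists>c. \<forall>t. coeff (h (X t)) j = poly c t" for j
    unfolding X_def using rpf_line_poly1[OF poly_family_coeff[OF h(1)]] by metis
  then obtain b where b: "\<And>j t. coeff (h (X t)) j = poly (b j) t" by metis
  have "b j = 0" if "j \<ge> Suc DIM('a)" for j
    using that h(2) by (intro real_poly_eqI) (simp add: b[symmetric] coeff_eq_0)
  then obtain H where H: "\<And>t. eval_coeffs t H = h (X t)" "\<And>j. coeff H j = b j"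
    using bivariate_of_family[of "\<lambda>t. h (X t)" b "Suc DIM('a)"] b by blast
  have b1: "b DIM('a) = 1" by (intro real_poly_eqI) (simp add: b[symmetric] h(3))
  have H0: "H \<noteq> 0" using H(2)[of "DIM('a)"] b1 by auto
  have deg_H: "degree H = DIM('a)"
    using H(2) b1 \<open>\<And>j. j \<ge> Suc DIM('a) \<Longrightarrow> b j = 0\<close>
    by (intro antisym degree_le le_degree) auto
  \<comment> \<open>Pseudo-division, since \<real>[t] is not a field. The remainder annihilates
    \<open>X t\<close> and has degree below the rank, so it vanishes at every regular point of the
    line.\<close>
  obtain a q where aq: "a \<noteq> 0" "Polynomial.smult a H = G * q + pseudo_mod H G"
    and deg_s: "pseudo_mod H G = 0 \<or> degree (pseudo_mod H G) < degree G"
    using pseudo_mod[OF G0, of H] by blast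
  define s where "s = pseudo_mod H G"
  have s_coeff: "coeff s j = 0" if "j \<ge> rk" for j
    using deg_s that deg_G by (auto simp: s_def coeff_eq_0)
  have "coeff s j = 0" for j
  proof (rule infinitely_many_zeros[OF g0])
    fix t assume t: "poly g t \<noteq> 0"
    have "Polynomial.smult (poly a t) (h (X t)) =
        Polynomial.smult (poly g t) (mp (X t)) * eval_coeffs t q + eval_coeffs t s"
      using arg_cong[OF aq(2), of "eval_coeffs t"]
      by (simp add: eval_coeffs_mult eval_coeffs_add eval_coeffs_smult H G_eval[OF t] s_def)
    then have "ev (eval_coeffs t s) (X t) =
        ev (Polynomial.smult (poly a t) (h (X t)) - Polynomial.smult (poly g t) (mp (X t)) * eval_coeffs t q) (X t)"
      by simp
    also have "\<dots> = 0"
      by (simp only: ev_diff ev_smult ev_mult h minpoly(2) mul_linear scaleR_zero_right diff_self)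
    finally have "ev (eval_coeffs t s) (X t) = 0" .
    moreover have "disc (X t) \<noteq> 0" using t g by simp
    moreover have "\<forall>k\<ge>rk. coeff (eval_coeffs t s) k = 0" using s_coeff by (simp add: coeff_map_poly)
    ultimately have "eval_coeffs t s = 0" using disc_eq_0_iff[of "X t"] by blast
    then show "poly (coeff s j) t = 0" by (metis coeff_map_poly coeff_0 poly_0)
  qed
  then have "s = 0" by (simp add: poly_eq_iff)
  then have "G dvd Polynomial.smult a H" using aq(2) by (simp add: s_def)
  obtain G' where G': "G = Polynomial.smult (content G) G'" "content G' = 1"
    by (rule content_decompose)
  have "G' dvd G" by (subst G'(1)) (rule dvd_smult, rule dvd_refl)
  then have "G' dvd H"
    using \<open>G dvd Polynomial.smult a H\<close> primitive_dvd_smult[OF _ aq(1) G'(2)] dvd_trans by blast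
  then obtain Q where "H = G' * Q" by (elim dvdE)
  then have "lead_coeff G' dvd lead_coeff H" by (simp add: lead_coeff_mult)
  then have unit: "lead_coeff G' dvd 1" by (simp add: deg_H H(2) b1)
  have "degree G' = rk"
    using deg_G arg_cong[OF G'(1), of degree] G0 by simp
  then have "g = content G * coeff G' rk"
    using coeff_G[of rk] arg_cong[OF G'(1), of "\<lambda>p. coeff p rk"] by simp
  moreover have "coeff G' rk dvd 1" using unit \<open>degree G' = rk\<close> by simp
  ultimately have "g dvd content G" by (simp add: mult_unit_dvd_iff)
  moreover have "content G dvd c k" using coeff_G[of k] k content_dvd_coeff[of G k] by simp
  ultimately have "g dvd c k" by (rule dvd_trans)
  then obtain p where p: "c k = g * p" by (elim dvdE)
  obtain nk where nk: "\<And>t. N (X t) = poly nk t"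
    unfolding X_def using rpf_line_poly1[OF N] by metis
  have "nk - c k = 0"
  proof (rule infinitely_many_zeros[OF g0])
    fix t assume "poly g t \<noteq> 0"
    then show "poly (nk - c k) t = 0" using c[OF k, of t] N_eq[of "X t"] by (simp add: nk g)
  qed
  then have "N (X t) = poly p t * disc (X t)" for t
    by (simp add: nk g p)
  then show ?thesis unfolding X_def by blast
qed

lemma coeff_minpoly_polynomial:
  assumes k: "k < rk"
  shows "\<exists>C. real_polynomial_function C \<and> (\<forall>x. disc x \<noteq> 0 \<longrightarrow> C x = coeff (mp x) k)"
proof -
  obtain N where N: "real_polynomial_function N" "\<And>x. disc x \<noteq> 0 \<Longrightarrow> N x = coeff (mp x) k * disc x"
    using coeff_minpoly_rational[OF k] by blast
  obtain x0 where x0: "disc x0 \<noteq> 0" using exists_disc_nonzero by blast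
  obtain C where "real_polynomial_function C" "\<forall>x. N x = C x * disc x"
    using rpf_dvd_of_lines[OF N(1) rpf_disc x0 minpoly_coeff_line[OF k x0 N]] by blast
  then show ?thesis using N(2) by (intro exI[of _ C]) auto
qed

lemma eq_if_eq_on_regular:
  assumes "real_polynomial_function f" "real_polynomial_function h" "\<And>x. disc x \<noteq> 0 \<Longrightarrow> f x = h x"
  shows "f x = h x"
  using exists_disc_nonzero rpf_eq_on_dense[OF assms(1,2) rpf_disc _ assms(3)] by blast

abbreviation F :: "'a \<Rightarrow> real poly" where "F \<equiv> generic_minpoly mul e"

lemma generic_minpoly:
  "real_polynomial_function (\<lambda>x. coeff (F x) k)" "disc x \<noteq> 0 \<Longrightarrow> F x = mp x"
proof -
  have "\<exists>C. \<forall>k<rk. real_polynomial_function (C k) \<and> (\<forall>x. disc x \<noteq> 0 \<longrightarrow> C k x = coeff (mp x) k)"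
    using coeff_minpoly_polynomial by metis
  then obtain C where C: "\<And>k. k < rk \<Longrightarrow> real_polynomial_function (C k)"
    "\<And>k x. k < rk \<Longrightarrow> disc x \<noteq> 0 \<Longrightarrow> C k x = coeff (mp x) k" by blast
  define F' where "F' x = monom 1 rk + (\<Sum>k<rk. monom (C k x) k)" for x
  have coeff_F': "coeff (F' x) k = (if k = rk then 1 else if k < rk then C k x else 0)" for x k
    by (auto simp: F'_def coeff_sum)
  let ?P = "\<lambda>F. (\<forall>k. real_polynomial_function (\<lambda>x. coeff (F x) k)) \<and>
        (\<forall>x. degree (mp x) = rk \<longrightarrow> F x = mp x)"
  have "?P F'"
  proof (intro conjI allI impI)
    show "real_polynomial_function (\<lambda>x. coeff (F' x) k)" for k
      using C(1)[of k] by (cases "k = rk"; cases "k < rk") (simp_all add: coeff_F' rpf_const)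
    show "F' x = mp x" if "degree (mp x) = rk" for x
    proof (rule poly_eqI)
      fix k
      have "disc x \<noteq> 0" using that disc_nonzero_iff by blast
      then show "coeff (F' x) k = coeff (mp x) k"
        using C(2)[of k x] minpoly(1)[of x] that by (auto simp: coeff_F' coeff_eq_0)
    qed
  qed
  moreover have "G = G'" if G: "?P G" and G': "?P G'" for G G'
  proof (rule ext, rule poly_eqI)
    fix x k
    show "coeff (G x) k = coeff (G' x) k"
      by (rule eq_if_eq_on_regular) (use G G' disc_nonzero_iff in auto)
  qed
  ultimately have "\<exists>!F. ?P F" by (intro ex1I[of ?P F']) blast+
  from theI'[OF this] have "?P F" unfolding generic_minpoly_def .
  then show "real_polynomial_function (\<lambda>x. coeff (F x) k)" "disc x \<noteq> 0 \<Longrightarrow> F x = mp x"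
    using disc_nonzero_iff by blast+
qed

lemma coeff_F_rank: "coeff (F x) rk = 1"
proof (rule eq_if_eq_on_regular[OF generic_minpoly(1) rpf_const])
  show "coeff (F x) rk = 1" if "disc x \<noteq> 0" for x
    using that minpoly(1)[of x] disc_nonzero_iff[of x] by (simp add: generic_minpoly(2))
qed

lemma coeff_F_above_rank: "k > rk \<Longrightarrow> coeff (F x) k = 0"
proof (rule eq_if_eq_on_regular[OF generic_minpoly(1) rpf_const])
  show "coeff (F x) k = 0" if "disc x \<noteq> 0" "k > rk" for x
    using that disc_nonzero_iff[of x] by (simp add: generic_minpoly(2) coeff_eq_0)
qed

lemma degree_F: "degree (F x) = rk"
  using coeff_F_rank[of x] coeff_F_above_rank[of _ x] by (intro antisym degree_le le_degree) auto

lemma F_nonzero: "F x \<noteq> 0"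
  using coeff_F_rank[of x] by auto

lemma poly_family_F: "poly_family F"
  using generic_minpoly(1) coeff_F_above_rank by (intro poly_familyI[of F "Suc rk"]) auto

lemma ev_F_sum: "ev (F x) y = (\<Sum>k\<le>rk. coeff (F x) k *\<^sub>R pw y k)"
  using ev_altdef[of "F x" rk y] degree_F[of x] by simp

lemma ev_F: "ev (F x) x = 0"
proof (rule euclidean_eqI)
  fix b :: 'a assume "b \<in> Basis"
  have "polynomial_function (\<lambda>x. ev (F x) x)"
    unfolding ev_F_sum
    by (intro polynomial_function_sum polynomial_function_mult polynomial_function_pw)
      (simp_all add: real_polynomial_function_eq[symmetric] generic_minpoly(1))
  then have "real_polynomial_function (\<lambda>x. ev (F x) x \<bullet> b)"
    by (intro rpf_inner polynomial_function_const)
  then show "ev (F x) x \<bullet> b = 0 \<bullet> b"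
    by (rule eq_if_eq_on_regular) (simp_all add: generic_minpoly(2) minpoly(2) rpf_const)
qed

lemma regular_annihilator:
  assumes "disc x \<noteq> 0" "ev p x = 0" "\<And>k. k \<ge> rk \<Longrightarrow> coeff p k = 0"
  shows "p = 0"
  using assms disc_eq_0_iff by blast

lemma ev_affine: "ev (pcompose p [:b, a:]) x = ev p (a *\<^sub>R x + b *\<^sub>R e)"
proof (induction p)
  case (pCons c p)
  have "mul (ev [:b, a:] x) z = mul (a *\<^sub>R x + b *\<^sub>R e) z" for z
    by (simp add: ev_pCons mul_linear mul_unit mul_unit_right)
  moreover have "ev (pcompose (pCons c p) [:b, a:]) x = ev [:c:] x + mul (ev [:b, a:] x) (ev (pcompose p [:b, a:]) x)"
    by (simp only: pcompose_pCons ev_add ev_mult)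
  ultimately show ?case using pCons
    by (simp only: ev_pCons[of c]) (simp add: mul_linear)
qed simp

text \<open>Both sides annihilate the regular element \<open>x\<close> and agree in the coefficient
  at the rank, so their difference is an annihilator of smaller degree.\<close>

lemma F_affine_regular:
  assumes x: "disc x \<noteq> 0" and a: "a \<noteq> 0"
  shows "pcompose (F (a *\<^sub>R x + b *\<^sub>R e)) [:b, a:] = Polynomial.smult (a ^ rk) (F x)"
proof -
  let ?y = "a *\<^sub>R x + b *\<^sub>R e"
  let ?p = "pcompose (F ?y) [:b, a:]"
  have deg: "degree ?p = rk" using a by (simp add: degree_pcompose degree_F)
  have "lead_coeff ?p = lead_coeff (F ?y) * lead_coeff [:b, a:] ^ degree (F ?y)"
    using a by (intro lead_coeff_comp) simp
  then have lc: "coeff ?p rk = a ^ rk" using a by (simp add: deg degree_F coeff_F_rank)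
  have "?p - Polynomial.smult (a ^ rk) (F x) = 0"
  proof (rule regular_annihilator[OF x])
    show "ev (?p - Polynomial.smult (a ^ rk) (F x)) x = 0"
      by (simp add: ev_diff ev_affine ev_F ev_smult)
    show "coeff (?p - Polynomial.smult (a ^ rk) (F x)) k = 0" if "k \<ge> rk" for k
      using that lc deg coeff_F_rank[of x] degree_F[of x]
      by (cases "k = rk") (simp_all add: coeff_eq_0)
  qed
  then show ?thesis by simp
qed

lemma F_affine:
  assumes a: "a \<noteq> 0"
  shows "poly (F (a *\<^sub>R x + b *\<^sub>R e)) (a * t + b) = a ^ rk * poly (F x) t"
proof (rule eq_if_eq_on_regular)
  show "real_polynomial_function (\<lambda>x. poly (F (a *\<^sub>R x + b *\<^sub>R e)) (a * t + b))"
    by (intro rpf_of_poly_family[OF poly_family_F] rpf_const polynomial_function_add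
        polynomial_function_cmul polynomial_function_const polynomial_function_id)
  show "real_polynomial_function (\<lambda>x. a ^ rk * poly (F x) t)"
    by (intro rpf_mult rpf_of_poly_family[OF poly_family_F] rpf_const polynomial_function_id)
  show "poly (F (a *\<^sub>R x + b *\<^sub>R e)) (a * t + b) = a ^ rk * poly (F x) t" if "disc x \<noteq> 0" for x
    using arg_cong[OF F_affine_regular[OF that a, of b], of "\<lambda>p. poly p t"]
    by (simp add: poly_pcompose algebra_simps)
qed

lemma det_eq: "jordan_det mul e x = (- 1) ^ rk * poly (F x) 0"
  by (simp add: jordan_det_def poly_0_coeff_0)

abbreviation det :: "'a \<Rightarrow> real" where "det \<equiv> jordan_det mul e"

text \<open>The affine substitution with a = -1. It translates divisibility by \<open>F x\<close> as
  a polynomial in \<open>t\<close> into divisibility by \<open>det\<close> along lines in direction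
  \<open>e\<close>.\<close>

lemma det_shift: "det (t *\<^sub>R e - x) = poly (F x) t"
proof -
  have "poly (F ((- 1) *\<^sub>R x + t *\<^sub>R e)) ((- 1) * t + t) = (- 1) ^ rk * poly (F x) t"
    by (rule F_affine) simp
  then have "det (t *\<^sub>R e - x) = ((- 1) ^ rk * (- 1) ^ rk) * poly (F x) t"
    by (simp add: det_eq)
  then show ?thesis by (simp add: power_add[symmetric] mult_2[symmetric])
qed

lemma rpf_det_jordan: "real_polynomial_function det"
  unfolding det_eq
  by (intro rpf_mult rpf_const rpf_of_poly_family[OF poly_family_F] polynomial_function_id)

end

section \<open>The trace form\<close>

lemma frechet_derivative_eqI:
  "(f has_derivative f') (at x) \<Longrightarrow> frechet_derivative f (at x) v = f' v"
  using frechet_derivative_at by metis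

text \<open>A function that is homogeneous of degree 1 and differentiable at 0 coincides with its
  derivative there.\<close>

lemma rpf_homogeneous_linear:
  fixes f :: "'a::euclidean_space \<Rightarrow> real"
  assumes f: "real_polynomial_function f" and hom: "\<And>a x. a \<noteq> 0 \<Longrightarrow> f (a *\<^sub>R x) = a * f x"
  shows "linear f"
proof -
  have f0: "f 0 = 0" using hom[of 2 0] by simp
  have f': "(f has_derivative frechet_derivative f (at 0)) (at 0)"
    by (rule rpf_has_derivative[OF f])
  have "frechet_derivative f (at 0) x = f x" for x
  proof -
    have "((\<lambda>t::real. t *\<^sub>R x) has_derivative (\<lambda>t. t *\<^sub>R x)) (at 0)"
      by (auto intro!: derivative_eq_intros)
    then have "((\<lambda>t. f (t *\<^sub>R x)) has_derivative (\<lambda>t. frechet_derivative f (at 0) (t *\<^sub>R x))) (at 0)"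
      by (rule has_derivative_compose) (use f' in simp)
    moreover have "f (t *\<^sub>R x) = t * f x" for t using hom f0 by (cases "t = 0") auto
    ultimately have "((\<lambda>t. t * f x) has_derivative (\<lambda>t. frechet_derivative f (at 0) (t *\<^sub>R x))) (at 0)"
      by simp
    moreover have "((\<lambda>t. t * f x) has_derivative (\<lambda>t. t * f x)) (at 0)"
      by (auto intro!: derivative_eq_intros)
    ultimately have "(\<lambda>t. frechet_derivative f (at 0) (t *\<^sub>R x)) = (\<lambda>t. t * f x)"
      by (rule has_derivative_unique)
    from fun_cong[OF this, of 1] show ?thesis by simp
  qed
  then have "frechet_derivative f (at 0) = f" by blast
  then show ?thesis using rpf_frechet_linear[OF f, of 0] by simp
qed

context real_jordan_algebra
begin

abbreviation tr :: "'a \<Rightarrow> real" where "tr \<equiv> jordan_tr mul e"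
abbreviation \<tau> :: "'a \<Rightarrow> 'a \<Rightarrow> real" where "\<tau> \<equiv> trace_form mul e"

lemma rpf_tr: "real_polynomial_function tr"
  unfolding jordan_tr_def by (intro real_polynomial_function_minus generic_minpoly(1))

lemma coeff_F_scale:
  assumes "a \<noteq> 0"
  shows "a ^ k * coeff (F (a *\<^sub>R x)) k = a ^ rk * coeff (F x) k"
proof -
  have "pcompose (F (a *\<^sub>R x)) [:0, a:] = Polynomial.smult (a ^ rk) (F x)"
    using F_affine[OF assms, of x 0] by (intro real_poly_eqI) (simp add: poly_pcompose mult.commute)
  from arg_cong[OF this, of "\<lambda>p. coeff p k"] show ?thesis
    by (simp add: coeff_pcompose_linear)
qed

lemma linear_tr: "linear tr"
proof (rule rpf_homogeneous_linear[OF rpf_tr])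
  fix a :: real and x assume a: "a \<noteq> 0"
  have "a ^ (rk - 1) * coeff (F (a *\<^sub>R x)) (rk - 1) = a ^ (rk - 1) * (a * coeff (F x) (rk - 1))"
    using coeff_F_scale[OF a, of "rk - 1" x] rank_pos by (simp add: power_eq_if)
  then show "tr (a *\<^sub>R x) = a * tr x" using a by (simp add: jordan_tr_def)
qed

text \<open>The derivative of x^n at x in direction v. Without associativity it does not collapse to
  n x^(n-1) v; under the trace it does, see \<open>tr_dpw\<close>.\<close>

primrec dpw :: "'a \<Rightarrow> 'a \<Rightarrow> nat \<Rightarrow> 'a" where
  "dpw x v 0 = 0"
| "dpw x v (Suc n) = mul v (pw x n) + mul x (dpw x v n)"

lemma bounded_bilinear_mul: "bounded_bilinear mul"
  using bilinear_mul bilinear_conv_bounded_bilinear by blast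

lemma pw_has_derivative: "((\<lambda>x. pw x n) has_derivative (\<lambda>v. dpw x v n)) (at x)"
proof (induction n)
  case (Suc n)
  have "((\<lambda>x. mul x (pw x n)) has_derivative (\<lambda>v. mul x (dpw x v n) + mul v (pw x n))) (at x)"
    by (rule bounded_bilinear.FDERIV[OF bounded_bilinear_mul has_derivative_ident Suc])
  then show ?case by (simp add: add.commute)
qed simp

definition dF :: "'a \<Rightarrow> 'a \<Rightarrow> nat \<Rightarrow> real" where
  "dF x v k = frechet_derivative (\<lambda>x. coeff (F x) k) (at x) v"

lemma dF_rank: "dF x v rk = 0"
  by (simp add: dF_def coeff_F_rank frechet_derivative_const)

lemma dF_trace: "dF x v (rk - 1) = - tr v"
proof -
  have eq: "(\<lambda>x. coeff (F x) (rk - 1)) = (\<lambda>x. - tr x)" by (simp add: jordan_tr_def)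
  have "bounded_linear (\<lambda>x. - tr x)"
    using linear_tr linear_conv_bounded_linear bounded_linear_minus by blast
  then show ?thesis unfolding dF_def eq by (simp add: frechet_derivative_bounded_linear)
qed

text \<open>The derivative of \<open>ev (F x) x = 0\<close> in direction \<open>v\<close>. The first
  sum stops below the rank because the leading coefficient is constant.\<close>

lemma cayley_hamilton_derivative:
  "(\<Sum>k<rk. dF x v k *\<^sub>R pw x k) + (\<Sum>k\<le>rk. coeff (F x) k *\<^sub>R dpw x v k) = 0"
proof -
  have "((\<lambda>x. \<Sum>k\<le>rk. coeff (F x) k *\<^sub>R pw x k) has_derivative
      (\<lambda>v. \<Sum>k\<le>rk. coeff (F x) k *\<^sub>R dpw x v k + dF x v k *\<^sub>R pw x k)) (at x)"
    unfolding dF_def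
    by (intro has_derivative_sum has_derivative_scaleR pw_has_derivative rpf_has_derivative generic_minpoly(1))
  then have "((\<lambda>x. 0) has_derivative
      (\<lambda>v. \<Sum>k\<le>rk. coeff (F x) k *\<^sub>R dpw x v k + dF x v k *\<^sub>R pw x k)) (at x)"
    using ev_F by (simp add: ev_F_sum)
  from fun_cong[OF has_derivative_unique[OF this has_derivative_const], of v]
  have "(\<Sum>k\<le>rk. dF x v k *\<^sub>R pw x k) + (\<Sum>k\<le>rk. coeff (F x) k *\<^sub>R dpw x v k) = 0"
    by (simp add: sum.distrib add.commute)
  then show ?thesis by (simp add: lessThan_Suc_atMost[symmetric] dF_rank)
qed

text \<open>For v = D x the derivative of x^k is D (x^k), so the second sum in
  \<open>cayley_hamilton_derivative\<close> is \<open>D\<close> applied to 0. At a regular element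
  the first sum is then a relation among powers below the rank, hence trivial, and its top
  coefficient is - tr (D x).\<close>

lemma tr_derivation:
  assumes D: "linear D" and der: "\<And>x z. D (mul x z) = mul (D x) z + mul x (D z)"
  shows "tr (D x) = 0"
proof (rule eq_if_eq_on_regular[where f = "\<lambda>x. tr (D x)" and h = "\<lambda>x. 0"])
  have bl: "bounded_linear (\<lambda>x. tr (D x))"
    using linear_compose[OF D linear_tr] by (simp add: o_def linear_conv_bounded_linear)
  then show "real_polynomial_function (\<lambda>x. tr (D x))" by (rule rpf_linear)
  show "real_polynomial_function (\<lambda>x. 0)" by (rule rpf_const)
  fix x assume x: "disc x \<noteq> 0"
  have De: "D e = 0" using der[of e e] by (simp add: mul_unit mul_unit_right)
  have dpw: "dpw x (D x) n = D (pw x n)" for n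
    by (induction n) (simp_all add: De der)
  have "(\<Sum>k\<le>rk. coeff (F x) k *\<^sub>R dpw x (D x) k) = D (ev (F x) x)"
    unfolding dpw ev_F_sum by (simp add: linear_sum[OF D] linear_scale[OF D])
  then have "(\<Sum>k<rk. dF x (D x) k *\<^sub>R pw x k) = 0"
    using cayley_hamilton_derivative[of x "D x"] by (simp add: ev_F linear_0[OF D])
  moreover define p where "p = (\<Sum>k<rk. monom (dF x (D x) k) k)"
  have coeff_p: "coeff p k = (if k < rk then dF x (D x) k else 0)" for k
    by (simp add: p_def coeff_sum)
  ultimately have "ev p x = 0" by (subst ev_coeffs[of rk]) (simp_all add: coeff_p)
  then have "p = 0" using coeff_p by (intro regular_annihilator[OF x]) auto
  then have "dF x (D x) (rk - 1) = 0" using coeff_p[of "rk - 1"] rank_pos by simp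
  then show "tr (D x) = 0" using dF_trace[of x "D x"] by simp
qed

text \<open>The difference of the two sides is the trace of a value of an inner derivation.\<close>

lemma tr_assoc: "tr (mul (mul x y) z) = tr (mul x (mul y z))"
proof -
  have "tr (inner_der z x y) = 0"
    by (rule tr_derivation[OF linear_inner_der inner_der_mul])
  then have "tr (mul z (mul x y)) = tr (mul x (mul z y))"
    by (simp add: inner_der_def linear_diff[OF linear_tr])
  then show ?thesis by (simp add: mul_commute)
qed

lemma \<tau>_commute: "\<tau> x y = \<tau> y x"
  by (simp add: trace_form_def mul_commute)

lemma bilinear_\<tau>: "bilinear \<tau>"
proof -
  have "linear (\<lambda>y. tr (mul x y))" for x
    using linear_compose[OF linear_mul linear_tr] by (simp add: o_def)
  moreover have "linear (\<lambda>x. tr (mul x y))" for y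
    using linear_compose[OF linear_mul_left linear_tr] by (simp add: o_def)
  ultimately show ?thesis by (simp add: bilinear_def trace_form_def)
qed

lemma linear_\<tau>: "linear (\<tau> x)" "linear (\<lambda>x. \<tau> x y)"
  using bilinear_\<tau> by (simp_all add: bilinear_def)

lemmas \<tau>_linear = bilinear_ladd[OF bilinear_\<tau>] bilinear_radd[OF bilinear_\<tau>]
  bilinear_lsub[OF bilinear_\<tau>] bilinear_rsub[OF bilinear_\<tau>]
  bilinear_lneg[OF bilinear_\<tau>] bilinear_rneg[OF bilinear_\<tau>]
  bilinear_lmul[OF bilinear_\<tau>] bilinear_rmul[OF bilinear_\<tau>]
  bilinear_lzero[OF bilinear_\<tau>] bilinear_rzero[OF bilinear_\<tau>]

lemma \<tau>_mul: "\<tau> (mul x y) z = \<tau> x (mul y z)"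
  by (simp add: trace_form_def tr_assoc)

subsection \<open>Newton's identities and the gradient of the determinant\<close>

lemma dpw_pw: "dpw x (pw x j) n = real n *\<^sub>R pw x (n + j - 1)"
proof (induction n)
  case (Suc n)
  have "mul (pw x j) (pw x n) = pw x (n + j)" by (simp add: pw_add add.commute)
  moreover have "real n *\<^sub>R mul x (pw x (n + j - 1)) = real n *\<^sub>R pw x (n + j)"
    by (cases n) simp_all
  ultimately show ?case
    by (simp add: Suc mul_linear scaleR_left_distrib del: One_nat_def)
qed simp

text \<open>This expands F'/F into power sums. Cayley-Hamilton, differentiated in direction x^j,
  says that \<open>R j\<close> is the remainder of \<lambda>^j F' modulo \<open>F x\<close>, and the
  coefficient of \<open>R j\<close> at r - 1 is tr (x^j). So \<open>S j\<close> is the quotient, and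
  comparing coefficients at r - 1 gives the identity.\<close>

lemma newton_regular:
  assumes x: "disc x \<noteq> 0" and j: "j < rk"
  shows "(\<Sum>i\<le>j. tr (pw x i) * coeff (F x) (rk - j + i)) = real (rk - j) * coeff (F x) (rk - j)"
proof -
  define R where "R j = - (\<Sum>k<rk. monom (dF x (pw x j) k) k)" for j
  have coeff_R: "coeff (R j) k = (if k < rk then - dF x (pw x j) k else 0)" for j k
    by (simp add: R_def coeff_sum)
  have lead_R: "coeff (R j) (rk - 1) = tr (pw x j)" for j
    using rank_pos dF_trace[of x "pw x j"] by (simp add: coeff_R)
  have mp_dvd: "F x dvd p" if "ev p x = 0" for p
    using minpoly_dvd[OF that] generic_minpoly(2)[OF x] by simp
  have ev_R: "ev (R j) x = ev (monom 1 j * pderiv (F x)) x" for j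
  proof -
    have "ev (R j) x = - (\<Sum>k<rk. dF x (pw x j) k *\<^sub>R pw x k)"
      by (subst ev_coeffs[of rk]) (simp_all add: coeff_R sum_negf)
    also have "\<dots> = (\<Sum>k\<le>rk. coeff (F x) k *\<^sub>R dpw x (pw x j) k)"
      using cayley_hamilton_derivative[of x "pw x j"] by (simp add: neg_eq_iff_add_eq_0)
    also have "\<dots> = (\<Sum>k<rk. coeff (F x) (Suc k) *\<^sub>R real (Suc k) *\<^sub>R pw x (k + j))"
      unfolding dpw_pw lessThan_Suc_atMost[symmetric] by (subst sum.lessThan_Suc_shift) simp
    also have "\<dots> = mul (pw x j) (ev (pderiv (F x)) x)"
      by (subst ev_coeffs[of rk "pderiv (F x)"])
        (simp_all add: coeff_pderiv coeff_F_above_rank mul_sum_right mul_linear pw_add add.commute mult.commute)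
    finally show ?thesis by (simp add: ev_mult ev_monom)
  qed
  have small: "p = 0" if dvd: "F x dvd p" and "\<And>k. k \<ge> rk \<Longrightarrow> coeff p k = 0" for p
  proof (rule regular_annihilator[OF x _ that(2)])
    obtain q where "p = F x * q" using dvd by (elim dvdE)
    then show "ev p x = 0" by (simp add: ev_mult ev_F mul_linear)
  qed
  have R0: "R 0 = pderiv (F x)"
  proof -
    have "R 0 - pderiv (F x) = 0"
      using ev_R[of 0] by (intro small mp_dvd)
        (simp_all add: ev_diff coeff_R coeff_pderiv coeff_F_above_rank monom_0)
    then show ?thesis by simp
  qed
  \<comment> \<open>Multiplying the remainder by \<lambda> creates one coefficient at r, namely tr
    (x^j), which is cancelled against the monic \<open>F x\<close>.\<close>
  have RSuc: "monom 1 1 * R j = R (Suc j) + Polynomial.smult (tr (pw x j)) (F x)" for j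
  proof -
    have mm: "monom 1 (Suc j) = monom 1 1 * monom (1::real) j" by (simp add: mult_monom)
    let ?p = "monom 1 1 * R j - R (Suc j) - Polynomial.smult (tr (pw x j)) (F x)"
    have "?p = 0"
    proof (intro small mp_dvd)
      show "ev ?p x = 0"
        unfolding ev_diff ev_smult ev_F ev_R ev_mult[of "monom 1 1"] mm mult.assoc by simp
      show "coeff ?p k = 0" if k: "k \<ge> rk" for k
      proof (cases "k = rk")
        case True
        then show ?thesis using rank_pos lead_R[of j] coeff_R[of "Suc j" rk]
          by (simp add: coeff_monom_mult coeff_F_rank)
      next
        case False
        then show ?thesis using k
          by (simp add: coeff_monom_mult coeff_R coeff_F_above_rank)
      qed
    qed
    then show ?thesis by (simp add: algebra_simps)
  qed
  define S where "S j = (\<Sum>i<j. monom (tr (pw x i)) (j - 1 - i))" for j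
  have SSuc: "S (Suc j) = monom 1 1 * S j + monom (tr (pw x j)) 0" for j
    by (auto simp: S_def sum_distrib_left mult_monom Suc_diff_Suc intro!: sum.cong)
  have main: "monom 1 j * pderiv (F x) = R j + F x * S j" for j
  proof (induction j)
    case 0
    then show ?case by (simp add: R0 S_def monom_0)
  next
    case (Suc j)
    have "monom 1 (Suc j) * pderiv (F x) = monom 1 1 * (monom 1 j * pderiv (F x))"
      by (simp add: mult.assoc[symmetric] mult_monom)
    also have "\<dots> = monom 1 1 * R j + F x * (monom 1 1 * S j)"
      unfolding Suc.IH by (simp add: algebra_simps)
    also have "\<dots> = R (Suc j) + F x * S (Suc j)"
      unfolding RSuc SSuc by (simp add: algebra_simps monom_0)
    finally show ?case .
  qed
  have "coeff (F x * S j) (rk - 1) = (\<Sum>i<j. tr (pw x i) * coeff (F x) (rk - j + i))"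
    unfolding S_def sum_distrib_left coeff_sum
  proof (intro sum.cong refl)
    fix i assume i: "i \<in> {..<j}"
    have "rk - 1 - (j - 1 - i) = rk - j + i" using i j by auto
    moreover have "j - 1 - i \<le> rk - 1" using i j by auto
    ultimately show "coeff (F x * monom (tr (pw x i)) (j - 1 - i)) (rk - 1) = tr (pw x i) * coeff (F x) (rk - j + i)"
      by (simp add: mult.commute[of "F x"] coeff_monom_mult)
  qed
  moreover have "coeff (monom 1 j * pderiv (F x)) (rk - 1) = real (rk - j) * coeff (F x) (rk - j)"
  proof -
    have *: "Suc (rk - 1 - j) = rk - j" using j by auto
    show ?thesis using j unfolding coeff_monom_mult coeff_pderiv * by auto
  qed
  ultimately have "real (rk - j) * coeff (F x) (rk - j) =
      tr (pw x j) + (\<Sum>i<j. tr (pw x i) * coeff (F x) (rk - j + i))"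
    using arg_cong[OF main[of j], of "\<lambda>p. coeff p (rk - 1)"] lead_R[of j] by simp
  then show ?thesis
    using j by (simp add: lessThan_Suc_atMost[symmetric] coeff_F_rank)
qed

text \<open>For k up to the rank this is, up to the sign (-1)^k, the k-th elementary symmetric
  function of the eigenvalues.\<close>

definition ec :: "nat \<Rightarrow> 'a \<Rightarrow> real" where
  "ec k x = coeff (F x) (rk - k)"

lemma rpf_ec: "real_polynomial_function (ec k)"
  unfolding ec_def by (rule generic_minpoly(1))

lemma rpf_tr_pw: "real_polynomial_function (\<lambda>x. tr (pw x i))"
  by (rule rpf_compose[OF polynomial_function_pw rpf_tr])

lemma newton:
  assumes "j \<le> rk"
  shows "(\<Sum>i\<le>j. tr (pw x i) * ec (j - i) x) = real (rk - j) * ec j x"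
proof (cases "j = rk")
  case True
  \<comment> \<open>At j = r the identity is the trace of Cayley-Hamilton.\<close>
  have "(\<Sum>i\<le>j. tr (pw x i) * ec (j - i) x) = tr (ev (F x) x)"
    unfolding ev_F_sum True ec_def
    by (simp add: linear_sum[OF linear_tr] linear_scale[OF linear_tr] mult.commute)
  then show ?thesis using True by (simp add: ev_F linear_0[OF linear_tr])
next
  case False
  show ?thesis
  proof (rule eq_if_eq_on_regular)
    show "real_polynomial_function (\<lambda>x. \<Sum>i\<le>j. tr (pw x i) * ec (j - i) x)"
      by (intro real_polynomial_function_sum rpf_mult rpf_tr_pw rpf_ec) simp
    show "real_polynomial_function (\<lambda>x. real (rk - j) * ec j x)"
      by (intro rpf_mult rpf_const rpf_ec)
    fix x assume x: "disc x \<noteq> 0"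
    have "j < rk" using assms False by simp
    moreover have "(\<Sum>i\<le>j. tr (pw x i) * ec (j - i) x) = (\<Sum>i\<le>j. tr (pw x i) * coeff (F x) (rk - j + i))"
      using assms by (intro sum.cong refl) (simp add: ec_def)
    ultimately show "(\<Sum>i\<le>j. tr (pw x i) * ec (j - i) x) = real (rk - j) * ec j x"
      using newton_regular[OF x] by (simp add: ec_def)
  qed
qed

lemma ec_0: "ec 0 x = 1"
  by (simp add: ec_def coeff_F_rank)

lemma tr_e: "tr e = real rk"
  using newton[of 0 e] by (simp add: ec_0)

lemma newton':
  assumes "j \<le> rk"
  shows "(\<Sum>i=1..j. tr (pw x i) * ec (j - i) x) = - real j * ec j x"
proof -
  have "(\<Sum>i\<le>j. tr (pw x i) * ec (j - i) x) = tr (pw x 0) * ec j x + (\<Sum>i=1..j. tr (pw x i) * ec (j - i) x)"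
    by (simp add: sum.atMost_shift sum.atLeast1_atMost_eq)
  then show ?thesis using newton[OF assms, of x] assms by (simp add: tr_e of_nat_diff algebra_simps)
qed

text \<open>Associativity of the trace lets the powers around \<open>v\<close> be collected. The
  factor x^j is there for the induction, which moves one x at a time out of
  \<open>dpw\<close>.\<close>

lemma tr_dpw: "tr (mul (pw x j) (dpw x v n)) = real n * \<tau> (pw x (n + j - 1)) v"
proof (induction n arbitrary: j)
  case (Suc n)
  have "tr (mul (pw x j) (mul v (pw x n))) = tr (mul (mul (pw x j) (pw x n)) v)"
    by (simp only: tr_assoc mul_commute[of v])
  moreover have "tr (mul (pw x j) (mul x (dpw x v n))) = tr (mul (pw x (Suc j)) (dpw x v n))"
    by (simp only: tr_assoc[symmetric] jordan_power.simps mul_commute[of x "pw x j"])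
  ultimately show ?case
    using Suc[of "Suc j"]
    by (simp add: mul_linear linear_add[OF linear_tr] pw_add trace_form_def add.commute algebra_simps)
qed (simp add: mul_linear linear_0[OF linear_tr])

lemma tr_pw_has_derivative:
  "((\<lambda>x. tr (pw x n)) has_derivative (\<lambda>v. real n * \<tau> (pw x (n - 1)) v)) (at x)"
proof -
  have "((\<lambda>x. tr (pw x n)) has_derivative (\<lambda>v. tr (dpw x v n))) (at x)"
    by (rule bounded_linear.has_derivative[OF _ pw_has_derivative])
      (use linear_tr linear_conv_bounded_linear in blast)
  moreover have "tr (dpw x v n) = real n * \<tau> (pw x (n - 1)) v" for v
    using tr_dpw[of x 0 v n] by (simp add: mul_unit)
  ultimately show ?thesis by simp
qed

text \<open>For k up to the rank, minus the gradient of \<open>ec k\<close> with respect to the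
  trace form: a truncation of \<open>F x\<close> as in Horner's scheme, evaluated at
  \<open>x\<close>.\<close>

definition grad_ec :: "nat \<Rightarrow> 'a \<Rightarrow> 'a" where
  "grad_ec k x = (\<Sum>m<k. ec (k - 1 - m) x *\<^sub>R pw x m)"

text \<open>Differentiating \<open>newton'\<close> expresses the gradient of \<open>ec k\<close>
  through those of smaller index. The coefficient of x^m receives m + 1 from the power sums and k -
  1 - m from the earlier gradients, k in total.\<close>

lemma ec_has_derivative:
  assumes "k \<le> rk"
  shows "(ec k has_derivative (\<lambda>v. - \<tau> (grad_ec k x) v)) (at x)"
  using assms
proof (induction k rule: less_induct)
  case (less k)
  show ?case
  proof (cases "k = 0")
    case True
    then have "ec k = (\<lambda>x. 1)" "\<And>v. - \<tau> (grad_ec k x) v = 0"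
      by (auto simp: ec_0 grad_ec_def \<tau>_linear)
    then show ?thesis by simp
  next
    case False
    have ec_eq: "ec k = (\<lambda>x. (- 1 / real k) * (\<Sum>i=1..k. tr (pw x i) * ec (k - i) x))"
      using newton'[OF less.prems] False by (auto simp: field_simps)
    have "((\<lambda>x. (- 1 / real k) * (\<Sum>i=1..k. tr (pw x i) * ec (k - i) x)) has_derivative
        (\<lambda>v. (- 1 / real k) * (\<Sum>i=1..k. tr (pw x i) * (- \<tau> (grad_ec (k - i) x) v) +
           (real i * \<tau> (pw x (i - 1)) v) * ec (k - i) x))) (at x)"
      using False less.prems
      by (intro has_derivative_mult_right has_derivative_sum has_derivative_mult tr_pw_has_derivative less.IH) auto
    moreover have "(\<Sum>i=1..k. tr (pw x i) * (- \<tau> (grad_ec (k - i) x) v) + (real i * \<tau> (pw x (i - 1)) v) * ec (k - i) x)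
        = real k * \<tau> (grad_ec k x) v" for v
    proof -
      have "(\<Sum>i=1..k. tr (pw x i) *\<^sub>R grad_ec (k - i) x) =
          (\<Sum>i=1..k. \<Sum>m<k - i. (tr (pw x i) * ec (k - 1 - m - i) x) *\<^sub>R pw x m)"
        unfolding grad_ec_def scaleR_sum_right by (intro sum.cong refl) (auto simp: add.commute)
      \<comment> \<open>Exchanging the sums turns the inner one into Newton's identity of order k -
        1 - m.\<close>
      also have "\<dots> = (\<Sum>m<k. \<Sum>i=1..k - 1 - m. (tr (pw x i) * ec (k - 1 - m - i) x) *\<^sub>R pw x m)"
        unfolding sum.Sigma[OF finite_atLeastAtMost ballI[OF finite_lessThan]]
          sum.Sigma[OF finite_lessThan ballI[OF finite_atLeastAtMost]]
        by (rule sum.reindex_bij_witness[of _ "\<lambda>(m, i). (i, m)" "\<lambda>(i, m). (m, i)"]) auto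
      also have "\<dots> = (\<Sum>m<k. (- real (k - 1 - m) * ec (k - 1 - m) x) *\<^sub>R pw x m)"
        unfolding scaleR_sum_left[symmetric] using less.prems
        by (intro sum.cong refl arg_cong[where f = "\<lambda>c. c *\<^sub>R _"] newton') auto
      finally have 1: "(\<Sum>i=1..k. tr (pw x i) *\<^sub>R grad_ec (k - i) x) =
          (\<Sum>m<k. (- real (k - 1 - m) * ec (k - 1 - m) x) *\<^sub>R pw x m)" .
      have 2: "(\<Sum>i=1..k. (real i * ec (k - i) x) *\<^sub>R pw x (i - 1)) =
          (\<Sum>m<k. (real (Suc m) * ec (k - 1 - m) x) *\<^sub>R pw x m)"
        unfolding One_nat_def sum.atLeast1_atMost_eq by simp
      have "(\<Sum>i=1..k. (real i * ec (k - i) x) *\<^sub>R pw x (i - 1)) - (\<Sum>i=1..k. tr (pw x i) *\<^sub>R grad_ec (k - i) x)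
          = real k *\<^sub>R grad_ec k x"
        unfolding 1 2 unfolding grad_ec_def scaleR_sum_right sum_subtractf[symmetric]
      proof (rule sum.cong[OF refl])
        fix m assume m: "m \<in> {..<k}"
        have "real (Suc m) * ec (k - 1 - m) x - - real (k - 1 - m) * ec (k - 1 - m) x = real k * ec (k - 1 - m) x"
          using m by (simp add: of_nat_diff algebra_simps)
        then show "(real (Suc m) * ec (k - 1 - m) x) *\<^sub>R pw x m - (- real (k - 1 - m) * ec (k - 1 - m) x) *\<^sub>R pw x m
            = real k *\<^sub>R ec (k - 1 - m) x *\<^sub>R pw x m"
          by (simp only: scaleR_left_diff_distrib[symmetric] scaleR_scaleR)
      qed
      then have "real k * \<tau> (grad_ec k x) v =
          \<tau> ((\<Sum>i=1..k. (real i * ec (k - i) x) *\<^sub>R pw x (i - 1)) - (\<Sum>i=1..k. tr (pw x i) *\<^sub>R grad_ec (k - i) x)) v"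
        by (simp add: \<tau>_linear)
      then show ?thesis
        by (simp add: \<tau>_linear linear_sum[OF linear_\<tau>(2)] sum_subtractf algebra_simps)
    qed
    ultimately show ?thesis unfolding ec_eq[symmetric] using False by simp
  qed
qed

text \<open>Up to the sign (-1)^(r+1) the quotient (F(\<lambda>) - F(0)) / \<lambda>, so that F(x) =
  0 becomes x adj x = det x e.\<close>

definition adjp :: "'a \<Rightarrow> real poly" where
  "adjp x = (\<Sum>m<rk. monom ((- 1) ^ Suc rk * coeff (F x) (Suc m)) m)"

definition adj :: "'a \<Rightarrow> 'a" where
  "adj x = ev (adjp x) x"

lemma adj_eq: "adj x = (\<Sum>m<rk. ((- 1) ^ Suc rk * coeff (F x) (Suc m)) *\<^sub>R pw x m)"
  unfolding adj_def by (subst ev_coeffs[of rk]) (simp_all add: adjp_def coeff_sum)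

lemma polynomial_function_adj: "polynomial_function adj"
  unfolding adj_eq
  by (intro polynomial_function_sum polynomial_function_mult polynomial_function_pw)
    (simp_all only: real_polynomial_function_eq[symmetric] finite_lessThan rpf_mult rpf_const generic_minpoly(1))

lemma det_has_derivative: "(det has_derivative \<tau> (adj x)) (at x)"
proof -
  have "det = (\<lambda>x. (- 1) ^ rk * ec rk x)"
    by (auto simp: det_eq ec_def poly_0_coeff_0)
  moreover have "((\<lambda>x. (- 1) ^ rk * ec rk x) has_derivative (\<lambda>v. (- 1) ^ rk * - \<tau> (grad_ec rk x) v)) (at x)"
    by (intro has_derivative_mult_right ec_has_derivative) simp
  moreover have "adj x = (- ((- 1) ^ rk)) *\<^sub>R grad_ec rk x"
    unfolding adj_eq grad_ec_def ec_def scaleR_sum_right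
    by (intro sum.cong refl) (auto simp: Suc_diff_Suc)
  then have "\<tau> (adj x) = (\<lambda>v. (- 1) ^ rk * - \<tau> (grad_ec rk x) v)"
    by (intro ext) (simp add: \<tau>_linear)
  ultimately show ?thesis by simp
qed

lemma det_derivative: "frechet_derivative det (at x) v = \<tau> (adj x) v"
  by (rule frechet_derivative_eqI[OF det_has_derivative])

lemma mul_adj: "mul x (adj x) = det x *\<^sub>R e"
proof -
  have "mul x (adj x) = (- 1) ^ Suc rk *\<^sub>R (\<Sum>m<rk. coeff (F x) (Suc m) *\<^sub>R pw x (Suc m))"
    unfolding adj_eq by (simp add: mul_sum_right mul_linear scaleR_sum_right)
  also have "(\<Sum>m<rk. coeff (F x) (Suc m) *\<^sub>R pw x (Suc m)) = ev (F x) x - coeff (F x) 0 *\<^sub>R e"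
    unfolding ev_F_sum lessThan_Suc_atMost[symmetric] by (subst sum.lessThan_Suc_shift) simp
  finally show ?thesis by (simp add: ev_F det_eq poly_0_coeff_0)
qed

text \<open>\<open>adj y\<close> is the gradient of \<open>det\<close> and
  \<open>mul y (adj y)\<close> is a multiple of the unit, so associativity of the trace form
  isolates \<open>a\<close>.\<close>

lemma det_semi_invariant: "frechet_derivative det (at y) (mul a y) = tr a * det y"
proof -
  have "\<tau> (adj y) (mul a y) = \<tau> (mul y (adj y)) a"
    using \<tau>_mul[of "adj y" y a] by (simp add: mul_commute)
  also have "\<dots> = tr a * det y"
    by (simp add: mul_adj trace_form_def mul_linear mul_unit linear_scale[OF linear_tr])
  finally show ?thesis by (simp add: det_derivative)
qed

section \<open>Invertible elements\<close>

lemma ev_assoc: "mul (mul (ev p x) (ev q x)) (ev r x) = mul (ev p x) (mul (ev q x) (ev r x))"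
  by (simp add: ev_mult[symmetric] mult.assoc)

lemma det_line_derivative:
  "((\<lambda>t. det (z + t *\<^sub>R v)) has_real_derivative \<tau> (adj (z + t *\<^sub>R v)) v) (at t)"
proof -
  have "((\<lambda>t. z + t *\<^sub>R v) has_derivative (\<lambda>h. h *\<^sub>R v)) (at t)"
    by (auto intro!: derivative_eq_intros)
  from has_derivative_compose[OF this det_has_derivative]
  have "((\<lambda>t. det (z + t *\<^sub>R v)) has_derivative (\<lambda>h. h * \<tau> (adj (z + t *\<^sub>R v)) v)) (at t)"
    by (simp add: \<tau>_linear)
  then show ?thesis
    by (simp add: has_field_derivative_def mult.commute[of _ "\<tau> _ _"] mult_commute_abs)
qed

lemma det_nonzero_imp_invertible:
  assumes "det x \<noteq> 0"
  shows "x \<in> jordan_invertibles mul e"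
proof -
  have "mul x (ev (Polynomial.smult (inverse (det x)) (adjp x)) x) = e"
    using mul_adj[of x] assms by (simp add: ev_smult adj_def mul_linear)
  then show ?thesis unfolding jordan_invertibles_def by blast
qed

text \<open>If \<open>z w = e\<close> with \<open>w \<in> \<real>[z]\<close> then \<open>adj (z + t e) = det (z + t e) w - t adj (z + t e) w\<close>, so
  \<open>adj (z + t e)\<close>, and hence the derivative of \<open>det (z + t e)\<close>, vanishes at \<open>t = 0\<close> to at least the
  order of \<open>det (z + t e)\<close> itself.\<close>

lemma invertible_imp_det_nonzero:
  assumes "z \<in> jordan_invertibles mul e"
  shows "det z \<noteq> 0"
proof
  assume det0: "det z = 0"
  obtain p where p: "mul z (ev p z) = e" using assms unfolding jordan_invertibles_def by blast
  define w where "w = ev p z"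
  define chi where "chi = F (- z)"
  define A where "A t = adj (z + t *\<^sub>R e)" for t
  have chi: "poly chi t = det (z + t *\<^sub>R e)" for t
    using det_shift[of t "- z"] by (simp add: chi_def add.commute)
  have chi': "poly (pderiv chi) t = tr (A t)" for t
  proof -
    have "((\<lambda>t. poly chi t) has_real_derivative \<tau> (A t) e) (at t)"
      unfolding chi A_def by (rule det_line_derivative)
    then have "poly (pderiv chi) t = \<tau> (A t) e"
      using poly_DERIV DERIV_unique by blast
    then show ?thesis by (simp add: trace_form_def mul_unit_right)
  qed
  have A_eq: "A t = poly chi t *\<^sub>R w - t *\<^sub>R mul (A t) w" for t
  proof -
    have zt: "z + t *\<^sub>R e = ev [:t, 1:] z"
      by (simp add: ev_pCons mul_unit_right mul_linear add.commute)
    \<comment> \<open>\<open>A t\<close> and \<open>w\<close> both lie in the associative algebra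
      generated by \<open>z\<close>.\<close>
    have At: "A t = ev (pcompose (adjp (z + t *\<^sub>R e)) [:t, 1:]) z"
      unfolding A_def adj_def using ev_affine[of _ t 1 z] by simp
    have "mul (A t) (mul (z + t *\<^sub>R e) w) = mul (mul (A t) (z + t *\<^sub>R e)) w"
      unfolding zt At w_def by (rule ev_assoc[symmetric])
    moreover have "mul (A t) (z + t *\<^sub>R e) = poly chi t *\<^sub>R e"
      using mul_adj[of "z + t *\<^sub>R e"] by (simp add: A_def chi mul_commute)
    moreover have "mul (z + t *\<^sub>R e) w = e + t *\<^sub>R w"
      using p by (simp add: w_def mul_linear mul_unit)
    ultimately have "mul (A t) (e + t *\<^sub>R w) = mul (poly chi t *\<^sub>R e) w" by (simp only:)
    then have "A t + t *\<^sub>R mul (A t) w = poly chi t *\<^sub>R w"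
      by (simp add: mul_linear mul_unit mul_unit_right)
    then show ?thesis by (simp add: algebra_simps)
  qed
  have A_poly: "\<exists>q. \<forall>t. l (A t) = poly q t" if "linear l" for l :: "'a \<Rightarrow> real"
  proof -
    have "real_polynomial_function (\<lambda>x. l (adj x))"
      unfolding real_polynomial_function_eq by (rule polynomial_function_linear[OF that polynomial_function_adj])
    from rpf_line_poly1[OF this, of z e] show ?thesis by (simp add: A_def)
  qed
  \<comment> \<open>Each use of \<open>A_eq\<close> gains one factor t as long as the determinant
    provides it. The statement ranges over all linear forms because the recursion passes from
    \<open>l\<close> to v \<mapsto> l (v w).\<close>
  have div: "\<exists>q. \<forall>t. l (A t) = t ^ j * poly q t" if "[:0, 1:] ^ j dvd chi" "linear l" for j and l :: "'a \<Rightarrow> real"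
    using that
  proof (induction j arbitrary: l)
    case 0
    then show ?case using A_poly[of l] by simp
  next
    case (Suc j)
    obtain c where c: "chi = [:0, 1:] ^ Suc j * c" using Suc.prems(1) by (elim dvdE)
    have "linear (\<lambda>v. l (mul v w))"
      using linear_compose[OF linear_mul_left Suc.prems(2)] by (simp add: o_def)
    moreover have "[:0, 1:] ^ j dvd chi" by (rule power_le_dvd[OF Suc.prems(1)]) simp
    ultimately obtain q where q: "\<And>t. l (mul (A t) w) = t ^ j * poly q t" using Suc.IH by blast
    have "l (A t) = t ^ Suc j * poly (Polynomial.smult (l w) c - q) t" for t
    proof -
      have "l (A t) = l (poly chi t *\<^sub>R w - t *\<^sub>R mul (A t) w)" using A_eq[of t] by simp
      also have "\<dots> = poly chi t * l w - t * (t ^ j * poly q t)"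
        by (simp add: linear_diff[OF Suc.prems(2)] linear_scale[OF Suc.prems(2)] q)
      finally show ?thesis by (simp add: c algebra_simps)
    qed
    then show ?case by blast
  qed
  define k where "k = order 0 chi"
  have chi0: "chi \<noteq> 0" "poly chi 0 = 0" using F_nonzero det0 chi[of 0] by (simp_all add: chi_def)
  have "[:0, 1:] ^ k dvd chi" using order_1[of 0 chi] by (simp add: k_def)
  then obtain q where q: "\<And>t. tr (A t) = t ^ k * poly q t" using div linear_tr by blast
  have "pderiv chi = [:0, 1:] ^ k * q"
    by (intro real_poly_eqI) (simp add: chi' q)
  then have "[:- 0, 1:] ^ k dvd pderiv chi" by simp
  moreover have "pderiv chi \<noteq> 0"
    using rank_pos degree_F[of "- z"] by (auto simp: chi_def pderiv_eq_0_iff)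
  ultimately have "k \<le> order 0 (pderiv chi)" unfolding order_divides by blast
  then show False using order_pderiv[OF chi0] by (simp add: k_def)
qed

lemma invertibles_eq: "jordan_invertibles mul e = {x. det x \<noteq> 0}"
  using det_nonzero_imp_invertible invertible_imp_det_nonzero by blast

lemma e_invertible: "det e \<noteq> 0"
  by (rule invertible_imp_det_nonzero)
    (auto simp: jordan_invertibles_def mul_unit intro!: exI[of _ 1])

end

section \<open>Nondegeneracy of the trace form\<close>

context simple_real_jordan_algebra
begin

text \<open>The radical is an ideal because the form is associative, and it misses \<open>e\<close>
  since \<tau>(e, e) = r > 0; simplicity leaves only 0.\<close>

lemma \<tau>_nondegenerate:
  assumes "\<And>y. \<tau> x y = 0"
  shows "x = 0"
proof -
  define I where "I = {x. \<forall>y. \<tau> x y = 0}"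
  have "jordan_ideal mul I"
    unfolding jordan_ideal_def
  proof (intro conjI allI ballI)
    show "subspace I" by (auto simp: I_def subspace_def \<tau>_linear)
    show "mul x y \<in> I" if "y \<in> I" for x y
      using that \<tau>_mul[of y x] by (simp add: I_def mul_commute)
  qed
  moreover have "e \<notin> I"
    using tr_e rank_pos by (auto simp: I_def trace_form_def mul_unit intro!: exI[of _ e])
  ultimately have "I = {0}" using simple by blast
  then show ?thesis using assms unfolding I_def by blast
qed

lemma \<tau>_representation:
  fixes l :: "'a \<Rightarrow> real"
  assumes "linear l"
  shows "\<exists>k. \<forall>v. l v = \<tau> k v"
proof -
  define T where "T x = (\<Sum>b\<in>Basis. \<tau> x b *\<^sub>R b)" for x
  have T: "linear T"
    unfolding T_def by (intro linear_compose_sum ballI linearI) (simp_all add: \<tau>_linear scaleR_left_distrib)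
  have Tb: "T x \<bullet> b = \<tau> x b" if "b \<in> Basis" for x b
    using that by (simp add: T_def inner_sum_left inner_Basis if_distrib cong: if_cong)
  have expand: "h v = (\<Sum>b\<in>Basis. (v \<bullet> b) * h b)" if "linear h" for h :: "'a \<Rightarrow> real" and v
  proof -
    have "h v = h (\<Sum>b\<in>Basis. (v \<bullet> b) *\<^sub>R b)" by (simp add: euclidean_representation)
    then show ?thesis by (simp add: linear_sum[OF that] linear_scale[OF that])
  qed
  have "inj T"
    unfolding linear_injective_0[OF T]
  proof (intro allI impI)
    fix x assume "T x = 0"
    then have "\<tau> x b = 0" if "b \<in> Basis" for b using Tb[OF that, of x] by simp
    then have "\<tau> x y = 0" for y using expand[OF linear_\<tau>(1), of x y] by simp
    then show "x = 0" by (rule \<tau>_nondegenerate)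
  qed
  then have "surj T" by (intro linear_injective_imp_surjective[OF T]) simp_all
  then obtain k where k: "T k = (\<Sum>b\<in>Basis. l b *\<^sub>R b)" by (metis surjD)
  have "l b = \<tau> k b" if "b \<in> Basis" for b
    using Tb[OF that, of k] that by (simp add: k inner_sum_left inner_Basis if_distrib cong: if_cong)
  then have "l v = \<tau> k v" for v
    using expand[OF assms, of v] expand[OF linear_\<tau>(1), of k v] by simp
  then show ?thesis by blast
qed

section \<open>Generic elements have squarefree minimal polynomial\<close>

definition dFp :: "'a \<Rightarrow> 'a \<Rightarrow> real poly" where
  "dFp x v = (\<Sum>k<rk. monom (dF x v k) k)"

lemma coeff_dFp: "coeff (dFp x v) k = (if k < rk then dF x v k else 0)"
  by (simp add: dFp_def coeff_sum)

lemma dF_ec: "j \<le> rk \<Longrightarrow> dF x v (rk - j) = - \<tau> (grad_ec j x) v"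
  using frechet_derivative_eqI[OF ec_has_derivative, of j x v] by (simp add: dF_def ec_def[abs_def])

lemma grad_ec_Suc: "grad_ec (Suc j) x = ec j x *\<^sub>R e + mul x (grad_ec j x)"
  unfolding grad_ec_def
  by (subst sum.lessThan_Suc_shift) (simp add: mul_sum_right mul_linear)

lemma grad_ec_rank: "mul x (grad_ec rk x) = - ec rk x *\<^sub>R e"
proof -
  have "grad_ec (Suc rk) x = ev (F x) x"
    unfolding grad_ec_def ev_F_sum lessThan_Suc_atMost
    by (intro sum.cong refl) (auto simp: ec_def)
  then show ?thesis using grad_ec_Suc[of rk x] ev_F[of x] by (simp add: eq_neg_iff_add_eq_0 add.commute)
qed

text \<open>Modulo \<open>F x\<close>, multiplying \<open>dFp x v\<close> by \<lambda> amounts to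
  multiplying the direction \<open>v\<close> by \<open>x\<close>. In coefficients this is the
  recursion \<open>grad_ec_Suc\<close>, closed at the constant term by Cayley-Hamilton.\<close>

lemma dFp_recursion: "monom 1 1 * dFp x v = dFp x (mul x v) - Polynomial.smult (tr v) (F x)"
proof (rule poly_eqI)
  fix k
  have \<tau>e: "\<tau> (c *\<^sub>R e) v = c * tr v" for c by (simp add: trace_form_def mul_unit mul_linear linear_scale[OF linear_tr])
  consider "k > rk" | "k = 0" | j where "k = rk - j" "j < rk"
    by (metis diff_diff_cancel diff_less not_less not_gr0 rank_pos)
  then show "coeff (monom 1 1 * dFp x v) k = coeff (dFp x (mul x v) - Polynomial.smult (tr v) (F x)) k"
  proof cases
    case 1
    then show ?thesis by (simp add: coeff_monom_mult coeff_dFp coeff_F_above_rank)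
  next
    case 2
    have "\<tau> (grad_ec rk x) (mul x v) = \<tau> (mul x (grad_ec rk x)) v"
      using \<tau>_mul[of "grad_ec rk x" x v] by (simp add: mul_commute[of "grad_ec rk x" x])
    also have "\<dots> = - (ec rk x * tr v)" unfolding grad_ec_rank \<tau>e by simp
    finally have "dF x (mul x v) 0 = tr v * coeff (F x) 0" using dF_ec[of rk x "mul x v"] by (simp add: ec_def)
    then show ?thesis using 2 rank_pos by (simp add: coeff_monom_mult coeff_dFp)
  next
    case 3
    have "\<tau> (grad_ec (Suc j) x) v = ec j x * tr v + \<tau> (mul x (grad_ec j x)) v"
      by (simp add: grad_ec_Suc \<tau>_linear(1) \<tau>e)
    also have "\<tau> (mul x (grad_ec j x)) v = \<tau> (grad_ec j x) (mul x v)"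
      using \<tau>_mul[of "grad_ec j x" x v] by (simp add: mul_commute[of "grad_ec j x" x])
    finally have "dF x v (rk - Suc j) = dF x (mul x v) (rk - j) - tr v * coeff (F x) (rk - j)"
      using dF_ec[of "Suc j" x v] dF_ec[of j x "mul x v"] 3 by (simp add: ec_def)
    moreover have "coeff (dFp x (mul x v)) k = dF x (mul x v) k"
      using 3 by (cases "j = 0") (auto simp: coeff_dFp dF_rank)
    moreover have "1 \<le> k" "k - 1 = rk - Suc j" "rk - Suc j < rk" using 3 by auto
    ultimately show ?thesis using 3(1) by (simp add: coeff_monom_mult coeff_dFp)
  qed
qed

lemma dFp_add: "dFp x (v + w) = dFp x v + dFp x w"
proof (rule poly_eqI)
  have lin: "linear (\<lambda>v. dF x v k)" for k
    unfolding dF_def by (rule rpf_frechet_linear[OF generic_minpoly(1)])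
  then show "coeff (dFp x (v + w)) k = coeff (dFp x v + dFp x w) k" for k
    by (simp add: coeff_dFp linear_add[OF lin])
qed

lemma dFp_scale: "dFp x (c *\<^sub>R v) = Polynomial.smult c (dFp x v)"
proof (rule poly_eqI)
  have lin: "linear (\<lambda>v. dF x v k)" for k
    unfolding dF_def by (rule rpf_frechet_linear[OF generic_minpoly(1)])
  then show "coeff (dFp x (c *\<^sub>R v)) k = coeff (Polynomial.smult c (dFp x v)) k" for k
    by (simp add: coeff_dFp linear_scale[OF lin])
qed

lemma dFp_module: "F x dvd h * dFp x v - dFp x (poly_act (mul x) h v)"
proof (induction h)
  case 0
  have "dFp x 0 = 0" using dFp_scale[of x 0 0] by simp
  then show ?case by (simp add: poly_act_0[OF linear_mul])
next
  case (pCons a h)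
  let ?w = "poly_act (mul x) h v"
  have "pCons a h * dFp x v - dFp x (poly_act (mul x) (pCons a h) v) =
      monom 1 1 * (h * dFp x v - dFp x ?w) + (monom 1 1 * dFp x ?w - dFp x (mul x ?w))"
    by (simp add: poly_act_pCons[OF linear_mul] dFp_add dFp_scale monom_Suc monom_0 algebra_simps)
  also have "monom 1 1 * dFp x ?w - dFp x (mul x ?w) = F x * [:- tr ?w:]"
    unfolding dFp_recursion by simp
  finally have eq: "pCons a h * dFp x v - dFp x (poly_act (mul x) (pCons a h) v) =
      monom 1 1 * (h * dFp x v - dFp x ?w) + F x * [:- tr ?w:]" .
  show ?case unfolding eq by (intro dvd_add dvd_mult pCons.IH dvd_triv_left)
qed

lemma tr_poly_act: "tr (mul u (poly_act (mul x) h v)) = tr (mul (poly_act (mul x) h u) v)"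
proof (induction h arbitrary: u)
  case (pCons a h)
  have "tr (mul u (mul x (poly_act (mul x) h v))) = tr (mul (mul x u) (poly_act (mul x) h v))"
    by (simp only: tr_assoc[symmetric] mul_commute[of u x])
  also have "\<dots> = tr (mul (poly_act (mul x) h (mul x u)) v)" by (rule pCons.IH)
  also have "poly_act (mul x) h (mul x u) = mul x (poly_act (mul x) h u)"
    by (induction h) (simp_all add: poly_act_pCons[OF linear_mul] poly_act_0[OF linear_mul] mul_linear)
  finally show ?case
    by (simp add: poly_act_pCons[OF linear_mul] mul_linear linear_add[OF linear_tr] linear_scale[OF linear_tr])
qed (simp add: poly_act_0[OF linear_mul] mul_linear)

text \<open>If \<open>p\<close> divided all derivatives then, with \<open>F x = p Q\<close>, the element \<open>Q(x)\<close> would be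
  \<open>\<tau>\<close>-orthogonal to everything, although \<open>deg Q < r\<close>.\<close>

lemma square_factor_direction:
  assumes x: "disc x \<noteq> 0" and sq: "p ^ 2 dvd F x" and p: "degree p > 0"
  shows "\<exists>v. \<not> p dvd dFp x v"
proof (rule ccontr)
  assume "\<not> ?thesis"
  then have all: "p dvd dFp x v" for v by blast
  obtain H where H: "F x = p ^ 2 * H" using sq by (elim dvdE)
  define Q where "Q = p * H"
  have FQ: "F x = Q * p" by (simp add: H Q_def power2_eq_square algebra_simps)
  have "Q \<noteq> 0" using FQ F_nonzero[of x] by auto
  have "p \<noteq> 0" using p by auto
  have "degree Q < rk" using degree_F[of x] FQ p \<open>Q \<noteq> 0\<close> \<open>p \<noteq> 0\<close> by (simp add: degree_mult_eq)
  have "\<tau> (ev Q x) v = 0" for v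
  proof -
    define w where "w = poly_act (mul x) Q v"
    have "F x dvd Q * dFp x v" unfolding FQ using all by (intro mult_dvd_mono) auto
    then have "F x dvd dFp x w"
      using dFp_module[of x Q v] unfolding w_def by (metis dvd_diff_left_iff dvd_minus_iff minus_diff_eq dvd_diff_right_iff)
    then obtain q where q: "dFp x w = F x * q" by (elim dvdE)
    have "dFp x w = 0"
    proof (rule regular_annihilator[OF x])
      show "ev (dFp x w) x = 0" by (simp add: q ev_mult ev_F mul_linear)
    qed (simp add: coeff_dFp)
    then have "tr w = 0" using coeff_dFp[of x w "rk - 1"] rank_pos dF_trace[of x w] by simp
    then have "tr (mul e (poly_act (mul x) Q v)) = 0" by (simp add: w_def mul_unit)
    then show ?thesis unfolding tr_poly_act by (simp add: ev_poly_act trace_form_def)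
  qed
  then have "ev Q x = 0" by (rule \<tau>_nondegenerate)
  then have "Q = 0" using \<open>degree Q < rk\<close> by (intro regular_annihilator[OF x]) (simp_all add: coeff_eq_0)
  then show False using \<open>Q \<noteq> 0\<close> by simp
qed

text \<open>For each prime whose square divides \<open>F x\<close> it suffices to avoid the kernel
  of one nonzero linear form, a coefficient of the remainder modulo the prime; there are finitely
  many such primes.\<close>

lemma good_direction:
  assumes x: "disc x \<noteq> 0"
  shows "\<exists>v. \<forall>p. prime p \<longrightarrow> p ^ 2 dvd F x \<longrightarrow> \<not> p dvd dFp x v"
proof -
  define S where "S = {p \<in> prime_factors (F x). p ^ 2 dvd F x}"
  have fin: "finite S" by (simp add: S_def)
  have "\<exists>f. real_polynomial_function f \<and> (\<exists>v. f v \<noteq> 0) \<and> (\<forall>v. p dvd dFp x v \<longrightarrow> f v = 0)"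
    if "p \<in> S" for p
  proof -
    have p: "prime p" "p ^ 2 dvd F x" using that by (auto simp: S_def)
    then have "degree p > 0" by (metis is_unit_iff_degree not_gr0 not_prime_0 not_prime_unit)
    then obtain v where "\<not> p dvd dFp x v" using square_factor_direction[OF x p(2)] by blast
    then have "dFp x v mod p \<noteq> 0" by (simp add: mod_eq_0_iff_dvd)
    then obtain k where k: "coeff (dFp x v mod p) k \<noteq> 0" by (metis leading_coeff_0_iff)
    have "linear (\<lambda>v. coeff (dFp x v mod p) k)"
      by (intro linearI) (simp_all add: dFp_add dFp_scale poly_mod_add_left mod_smult_left)
    then have "real_polynomial_function (\<lambda>v. coeff (dFp x v mod p) k)"
      using linear_conv_bounded_linear rpf_linear by blast
    then show ?thesis using k by (intro exI[of _ "\<lambda>v. coeff (dFp x v mod p) k"]) auto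
  qed
  then obtain f where f: "\<And>p. p \<in> S \<Longrightarrow> real_polynomial_function (f p)" "\<And>p. p \<in> S \<Longrightarrow> \<exists>v. f p v \<noteq> 0"
    "\<And>p v. p \<in> S \<Longrightarrow> p dvd dFp x v \<Longrightarrow> f p v = 0" by metis
  obtain v where v: "\<forall>p\<in>S. f p v \<noteq> 0" using rpf_prod_nonzero[OF fin, of f] f(1,2) by blast
  have "p \<in> S" if "prime p" "p ^ 2 dvd F x" for p
    using that F_nonzero[of x] dvd_trans[of p "p ^ 2" "F x"]
    by (auto simp: S_def prime_factors_dvd power2_eq_square)
  then show ?thesis using v f(3) by blast
qed

end

text \<open>A monic polynomial over \<open>\<real>[t]\<close> without square factors is coprime to its derivative over
  \<open>\<real>(t)\<close>. The denominators of a Bezout identity are cleared.\<close>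

lemma bezout_pderiv:
  fixes H :: "real poly poly"
  assumes lc: "lead_coeff H = 1" and deg: "degree H > 0"
    and sqf: "\<And>P. prime P \<Longrightarrow> \<not> P ^ 2 dvd H"
  shows "\<exists>A B d. d \<noteq> 0 \<and> A * H + B * pderiv H = [:d:]"
proof -
  define I where "I = {D. \<exists>A B. D = A * H + B * pderiv H}"
  have H0: "H \<noteq> 0" using deg by auto
  have HI: "H \<in> I" unfolding I_def by (intro CollectI exI[of _ 1] exI[of _ 0]) simp
  have H'I: "pderiv H \<in> I" unfolding I_def by (intro CollectI exI[of _ 0] exI[of _ 1]) simp
  have closed: "Polynomial.smult a X - D * Y \<in> I" if "X \<in> I" "D \<in> I" for a X D Y
  proof -
    obtain A B A' B' where "X = A * H + B * pderiv H" "D = A' * H + B' * pderiv H"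
      using \<open>X \<in> I\<close> \<open>D \<in> I\<close> unfolding I_def by blast
    then have "Polynomial.smult a X - D * Y = ([:a:] * A - A' * Y) * H + ([:a:] * B - B' * Y) * pderiv H"
      by (simp add: algebra_simps smult_add_right)
    then show ?thesis unfolding I_def by blast
  qed
  obtain D where D: "D \<in> I" "D \<noteq> 0" and Dmin: "\<And>X. X \<in> I \<Longrightarrow> X \<noteq> 0 \<Longrightarrow> degree D \<le> degree X"
    using ex_has_least_nat[of "\<lambda>X. X \<in> I \<and> X \<noteq> 0" H degree] HI H0 by blast
  obtain D' where D': "D = Polynomial.smult (content D) D'" "content D' = 1"
    by (rule content_decompose)
  have "content D \<noteq> 0" using D(2) by simp
  \<comment> \<open>\<open>D\<close> has least degree in the ideal, so pseudo-remainders by it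
    vanish, and its primitive part \<open>D'\<close> is a common divisor of \<open>H\<close> and its
    derivative.\<close>
  have D_dvd: "D' dvd X" if X: "X \<in> I" for X
  proof -
    obtain a q where aq: "a \<noteq> 0" "Polynomial.smult a X = D * q + pseudo_mod X D"
      and deg: "pseudo_mod X D = 0 \<or> degree (pseudo_mod X D) < degree D"
      using pseudo_mod[OF D(2), of X] by blast
    have "pseudo_mod X D = Polynomial.smult a X - D * q" using aq(2) by simp
    then have "pseudo_mod X D \<in> I" using closed[OF X D(1)] by simp
    then have "pseudo_mod X D = 0" using Dmin deg by (meson leD)
    then have "Polynomial.smult a X = D * q" using aq(2) by simp
    moreover have "D' dvd D" by (subst D'(1)) (intro dvd_smult dvd_refl)
    ultimately have "D' dvd Polynomial.smult a X" by simp
    then show ?thesis by (rule primitive_dvd_smult[OF _ aq(1) D'(2)])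
  qed
  have "is_unit D'"
  proof (rule ccontr)
    assume "\<not> is_unit D'"
    moreover have "D' \<noteq> 0" using D' D(2) by auto
    ultimately obtain P where P: "prime P" "P dvd D'" using prime_divisorE by blast
    have "P dvd H" "P dvd pderiv H" using D_dvd[OF HI] D_dvd[OF H'I] P(2) dvd_trans by blast+
    then obtain Q where Q: "H = P * Q" by (elim dvdE)
    have "P \<noteq> 0" "Q \<noteq> 0" using Q H0 by auto
    have "lead_coeff P * lead_coeff Q = 1" using lc unfolding Q by (simp only: lead_coeff_mult)
    \<comment> \<open>\<open>H\<close> is monic, so its factors have units as leading coefficients;
      a prime factor can then not be constant in the outer variable.\<close>
    then have unit: "is_unit (lead_coeff P)" by (metis dvdI)
    have degP: "degree P > 0"
    proof (rule ccontr)
      assume "\<not> degree P > 0"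
      then obtain c where "P = [:c:]" by (metis degree_eq_zeroE not_gr0)
      then have "is_unit P" using unit by (simp add: is_unit_const_poly_iff)
      then show False using P(1) not_prime_unit by blast
    qed
    have "pderiv H = pderiv P * Q + P * pderiv Q" unfolding Q by (simp add: pderiv_mult algebra_simps)
    then have "P dvd pderiv P * Q" using \<open>P dvd pderiv H\<close> by (simp add: dvd_add_left_iff)
    moreover have "\<not> P dvd pderiv P"
    proof
      assume "P dvd pderiv P"
      moreover have "pderiv P \<noteq> 0" using degP by (simp add: pderiv_eq_0_iff)
      ultimately have "degree P \<le> degree (pderiv P)" by (rule dvd_imp_degree_le)
      then show False using degP by (simp add: degree_pderiv)
    qed
    ultimately have "P dvd Q" using prime_dvd_mult_iff[OF P(1)] by blast
    then have "P ^ 2 dvd H" unfolding Q power2_eq_square by (intro mult_dvd_mono) auto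
    then show False using sqf P(1) by blast
  qed
  then obtain c where "D' = [:c:]" unfolding is_unit_poly_iff by blast
  then have Dc: "D = [:content D * c:]" using D'(1) by simp
  then have "content D * c \<noteq> 0" using D(2) by auto
  moreover obtain A B where "D = A * H + B * pderiv H" using D(1) unfolding I_def by blast
  then have "A * H + B * pderiv H = [:content D * c:]" using Dc by simp
  ultimately show ?thesis by blast
qed

lemma eval_coeffs_pderiv: "eval_coeffs t (pderiv P) = pderiv (eval_coeffs t P)"
  by (intro poly_eqI) (simp add: coeff_map_poly coeff_pderiv)

lemma map_pderiv_mult:
  "map_poly pderiv (P * Q) = map_poly pderiv P * Q + P * map_poly pderiv (Q :: real poly poly)"
proof (rule poly_eqI)
  fix k
  have "pderiv (\<Sum>i\<le>k. coeff P i * coeff Q (k - i)) =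
      (\<Sum>i\<le>k. pderiv (coeff P i) * coeff Q (k - i)) + (\<Sum>i\<le>k. coeff P i * pderiv (coeff Q (k - i)))"
    by (simp add: pderiv_sum pderiv_mult sum.distrib algebra_simps)
  then show "coeff (map_poly pderiv (P * Q)) k = coeff (map_poly pderiv P * Q + P * map_poly pderiv Q) k"
    by (simp add: coeff_map_poly coeff_mult)
qed

section \<open>Squarefreeness along generic lines\<close>

context simple_real_jordan_algebra
begin

text \<open>View F(x + t v) as a polynomial \<open>H\<close> over \<real>[t]. A square factor of
  \<open>H\<close> would give, at t = 0, a prime whose square divides \<open>F x\<close> and which
  divides the t-derivative \<open>dFp x v\<close>, against the choice of \<open>v\<close>. The
  Bezout identity for \<open>H\<close> then specializes to coprimality wherever \<open>d\<close> is
  nonzero.\<close>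

lemma generic_squarefree_line:
  assumes x: "disc x \<noteq> 0"
  shows "\<exists>v d. d \<noteq> 0 \<and> (\<forall>t. poly d t \<noteq> 0 \<longrightarrow> coprime (F (x + t *\<^sub>R v)) (pderiv (F (x + t *\<^sub>R v))))"
proof -
  obtain v where v: "\<And>p. prime p \<Longrightarrow> p ^ 2 dvd F x \<Longrightarrow> \<not> p dvd dFp x v"
    using good_direction[OF x] by blast
  define X where "X t = x + t *\<^sub>R v" for t
  have "\<exists>c. \<forall>t. coeff (F (X t)) j = poly c t" for j
    unfolding X_def using rpf_line_poly1[OF generic_minpoly(1)] by metis
  then obtain b where b: "\<And>j t. coeff (F (X t)) j = poly (b j) t" by metis
  have "b j = 0" if "j \<ge> Suc rk" for j
    using that by (intro real_poly_eqI) (simp add: b[symmetric] coeff_F_above_rank)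
  then obtain H where H: "\<And>t. eval_coeffs t H = F (X t)" "\<And>j. coeff H j = b j"
    using bivariate_of_family[of "\<lambda>t. F (X t)" b "Suc rk"] b by blast
  have b1: "b rk = 1" by (intro real_poly_eqI) (simp add: b[symmetric] coeff_F_rank)
  have degH: "degree H = rk"
    using H(2) b1 \<open>\<And>j. j \<ge> Suc rk \<Longrightarrow> b j = 0\<close> by (intro antisym degree_le le_degree) auto
  have lcH: "lead_coeff H = 1" using H(2) b1 degH by simp
  have deriv: "eval_coeffs 0 (map_poly pderiv H) = dFp x v"
  proof (rule poly_eqI)
    fix k
    have "((\<lambda>t. x + t *\<^sub>R v) has_derivative (\<lambda>h. h *\<^sub>R v)) (at 0)"
      by (auto intro!: derivative_eq_intros)
    from has_derivative_compose[OF this, of "\<lambda>x. coeff (F x) k" "\<lambda>v. dF x v k"]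
    have "((\<lambda>t. coeff (F (X t)) k) has_derivative (\<lambda>h. dF x (h *\<^sub>R v) k)) (at 0)"
      using rpf_has_derivative[OF generic_minpoly(1), of k x] by (simp add: X_def dF_def)
    moreover have "dF x (h *\<^sub>R v) k = h * dF x v k" for h
      unfolding dF_def using linear_scale[OF rpf_frechet_linear[OF generic_minpoly(1)]] by simp
    ultimately have "((\<lambda>t. poly (b k) t) has_real_derivative dF x v k) (at 0)"
      unfolding b by (simp add: has_field_derivative_def mult_commute_abs)
    then have "poly (pderiv (b k)) 0 = dF x v k" using poly_DERIV DERIV_unique by blast
    moreover have "dF x v k = 0" if "k \<ge> rk"
    proof (cases "k = rk")
      case False
      then show ?thesis using that by (simp add: dF_def coeff_F_above_rank frechet_derivative_const)
    qed (simp add: dF_rank)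
    ultimately show "coeff (eval_coeffs 0 (map_poly pderiv H)) k = coeff (dFp x v) k"
      by (simp add: coeff_map_poly H coeff_dFp)
  qed
  have "\<not> P ^ 2 dvd H" if P: "prime P" for P
  proof
    assume "P ^ 2 dvd H"
    then obtain R where R: "H = P ^ 2 * R" by (elim dvdE)
    then have PR: "H = P * (P * R)" by (simp add: power2_eq_square algebra_simps)
    have "lead_coeff P * lead_coeff (P * R) = 1" using lcH unfolding PR by (simp only: lead_coeff_mult)
    then have unit: "is_unit (lead_coeff P)" by (metis dvdI)
    define P0 where "P0 = eval_coeffs 0 P"
    have "degree P > 0"
    proof (rule ccontr)
      assume "\<not> degree P > 0"
      then obtain c where "P = [:c:]" by (metis degree_eq_zeroE not_gr0)
      then have "is_unit P" using unit by (simp add: is_unit_const_poly_iff)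
      then show False using P not_prime_unit by blast
    qed
    \<comment> \<open>The leading coefficient is a nonzero constant, so the degree of
      \<open>P\<close> does not drop at t = 0.\<close>
    moreover have "poly (lead_coeff P) 0 \<noteq> 0"
    proof -
      obtain c where "lead_coeff P = [:c:]" "c dvd 1" using unit unfolding is_unit_poly_iff by blast
      then show ?thesis by auto
    qed
    then have "coeff P0 (degree P) \<noteq> 0" by (simp add: P0_def coeff_map_poly)
    ultimately have degP0: "degree P0 > 0" using le_degree[of P0 "degree P"] by linarith
    then have "P0 \<noteq> 0" "\<not> is_unit P0" by (auto simp: is_unit_iff_degree)
    then obtain p where p: "prime p" "p dvd P0" using prime_divisorE by blast
    have "F x = P0 ^ 2 * eval_coeffs 0 R"
      using H(1)[of 0] by (simp add: R P0_def X_def eval_coeffs_mult power2_eq_square)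
    moreover have "p ^ 2 dvd P0 ^ 2" using p(2) by (simp add: dvd_power_same)
    ultimately have "p ^ 2 dvd F x" by simp
    moreover have "dFp x v = P0 * (eval_coeffs 0 (map_poly pderiv P) * eval_coeffs 0 R +
        eval_coeffs 0 (map_poly pderiv (P * R)))"
      unfolding deriv[symmetric] PR
      by (simp only: map_pderiv_mult[of P "P * R"] eval_coeffs_add eval_coeffs_mult P0_def[symmetric] ring_distribs mult_ac)
    then have "p dvd dFp x v" using p(2) by simp
    ultimately show False using v p(1) by blast
  qed
  then obtain A B d where d: "d \<noteq> 0" "A * H + B * pderiv H = [:d:]"
    using bezout_pderiv[OF lcH] degH rank_pos by auto
  have "coprime (F (X t)) (pderiv (F (X t)))" if "poly d t \<noteq> 0" for t
  proof (rule coprimeI)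
    fix c assume c: "c dvd F (X t)" "c dvd pderiv (F (X t))"
    have "c dvd eval_coeffs t A * F (X t) + eval_coeffs t B * pderiv (F (X t))"
      using c by (intro dvd_add dvd_mult)
    moreover have "eval_coeffs t A * F (X t) + eval_coeffs t B * pderiv (F (X t)) = eval_coeffs t [:d:]"
      using arg_cong[OF d(2), of "eval_coeffs t"]
      by (simp only: eval_coeffs_add eval_coeffs_mult eval_coeffs_pderiv H)
    moreover have "eval_coeffs t [:d:] = [:poly d t:]"
      by (intro poly_eqI) (simp add: coeff_map_poly coeff_pCons split: nat.split)
    ultimately have "c dvd [:poly d t:]" by simp
    moreover have "is_unit [:poly d t:]" using that by (simp add: is_unit_const_poly_iff dvd_field_iff)
    ultimately show "is_unit c" by (rule dvd_trans)
  qed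
  then show ?thesis using d(1) unfolding X_def by blast
qed

text \<open>On the line of \<open>generic_squarefree_line\<close> all but finitely many points are
  squarefree, which carries the vanishing to each regular element and from there to all.\<close>

lemma eq_0_if_eq_0_on_squarefree:
  assumes f: "real_polynomial_function f"
    and zero: "\<And>x. coprime (F x) (pderiv (F x)) \<Longrightarrow> f x = 0"
  shows "f x = 0"
proof (rule eq_if_eq_on_regular[OF f rpf_const])
  fix x assume "disc x \<noteq> 0"
  then obtain v d where d: "d \<noteq> 0"
    "\<And>t. poly d t \<noteq> 0 \<Longrightarrow> coprime (F (x + t *\<^sub>R v)) (pderiv (F (x + t *\<^sub>R v)))"
    using generic_squarefree_line by blast
  obtain p where p: "\<And>t. f (x + t *\<^sub>R v) = poly p t" using rpf_line_poly1[OF f] by metis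
  have "p = 0"
  proof (rule infinitely_many_zeros[OF d(1)])
    show "poly p t = 0" if "poly d t \<noteq> 0" for t
      using zero[OF d(2)[OF that]] p[of t] by simp
  qed
  then show "f x = 0" using p[of 0] by simp
qed

end

section \<open>A Fuchsian system whose polynomial solutions are divisible\<close>

lemma rpf_fst: "real_polynomial_function f \<Longrightarrow> real_polynomial_function (\<lambda>q. f (fst q))"
  by (rule rpf_compose[OF polynomial_function_bounded_linear[OF bounded_linear_fst]])

lemma rpf_snd: "real_polynomial_function f \<Longrightarrow> real_polynomial_function (\<lambda>q. f (snd q))"
  by (rule rpf_compose[OF polynomial_function_bounded_linear[OF bounded_linear_snd]])

lemma polynomial_function_fst: "polynomial_function (\<lambda>q. fst q)"
  by (rule polynomial_function_bounded_linear[OF bounded_linear_fst])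

lemma polynomial_function_snd: "polynomial_function (\<lambda>q. snd q)"
  by (rule polynomial_function_bounded_linear[OF bounded_linear_snd])

lemma polynomial_function_scale:
  assumes "real_polynomial_function f" "polynomial_function g"
  shows "polynomial_function (\<lambda>x. f x *\<^sub>R g x)"
  using assms by (intro polynomial_function_mult) (simp_all add: real_polynomial_function_eq)

lemma rpf_poly: "real_polynomial_function f \<Longrightarrow> real_polynomial_function (\<lambda>x. poly p (f x))"
  by (rule rpf_of_poly_family[OF poly_family_const _ polynomial_function_id])

lemma rpf_real_id: "real_polynomial_function (\<lambda>x::real. x)"
  by (rule rpf_linear[OF bounded_linear_ident])

lemmas polynomial_intros = rpf_const rpf_real_id rpf_fst rpf_snd rpf_add rpf_mult real_polynomial_function_diff
  real_polynomial_function_minus real_polynomial_function_power rpf_poly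

lemma frechet_affine_comp:
  fixes f :: "'a::euclidean_space \<Rightarrow> real"
  assumes f: "real_polynomial_function f" and g: "(g has_derivative g') (at x)"
  shows "frechet_derivative (\<lambda>x. f (g x)) (at x) v = frechet_derivative f (at (g x)) (g' v)"
  by (rule frechet_derivative_eqI) (rule has_derivative_compose[OF g rpf_has_derivative[OF f]])

context real_jordan_algebra
begin

text \<open>Put c = w u with w inverse to f' modulo f. Modulo f, c is idempotent and the equation
  says that the derivative of \<open>P\<close> in \<eta> along c \<eta> is - k P. With
  \<open>\<Phi> \<theta> t\<close> in the role of \<theta>^(2 L) \<eta>, L the multiplication by c,
  the function \<psi> satisfies modulo f Euler's relation of degree - 2 k in \<theta>; but a
  polynomial in \<theta> has no terms of negative degree.\<close>

lemma fuchsian_divisible_pointwise: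
  fixes P :: "real \<times> 'a \<Rightarrow> real" and u u2 :: "real \<Rightarrow> 'a"
  assumes P: "real_polynomial_function P"
    and u: "polynomial_function u" and u2: "polynomial_function u2"
    and uu: "\<And>t. mul (u t) (u t) = poly (pderiv f) t *\<^sub>R u t - poly f t *\<^sub>R u2 t"
    and cop: "coprime f (pderiv f)"
    and ode: "\<And>t \<eta>. poly f t * frechet_derivative P (at (t, \<eta>)) (1, 0)
        - frechet_derivative P (at (t, \<eta>)) (0, mul (u t) \<eta>) = k * poly (pderiv f) t * P (t, \<eta>)"
    and k: "k > 0"
  shows "\<exists>q. \<forall>t. P (t, \<eta>) = poly f t * poly q t"
proof -
  obtain w h where "w * pderiv f + h * f = 1"
    using cop by (metis bezout_coefficients_fst_snd coprime_commute coprime_iff_gcd_eq_1)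
  then have "poly (w * pderiv f + h * f) t = 1" for t by simp
  then have wf: "poly w t * poly (pderiv f) t = 1 - poly h t * poly f t" for t
    by (simp add: algebra_simps)
  define c where "c t = poly w t *\<^sub>R u t" for t
  \<comment> \<open>\<open>\<kappa>\<close> measures the failure of c^2 = c: it collects the error
    of the inverse \<open>w\<close> and the term with \<open>u2\<close>.\<close>
  define \<kappa> where "\<kappa> t = - (poly h t *\<^sub>R c t) - (poly w t * poly w t) *\<^sub>R u2 t" for t
  have c: "polynomial_function c" and \<kappa>: "polynomial_function \<kappa>"
    unfolding c_def \<kappa>_def
    by (intro polynomial_function_scale polynomial_function_diff polynomial_function_minus polynomial_intros u u2)+
  have cc: "mul (c t) (c t) = c t + poly f t *\<^sub>R \<kappa> t" for t
  proof -
    have "mul (c t) (c t) = (poly w t * poly w t) *\<^sub>R (poly (pderiv f) t *\<^sub>R u t - poly f t *\<^sub>R u2 t)"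
      unfolding c_def by (simp add: mul_linear uu)
    also have "\<dots> = (poly w t * (poly w t * poly (pderiv f) t)) *\<^sub>R u t - (poly f t * (poly w t * poly w t)) *\<^sub>R u2 t"
      by (simp add: scaleR_diff_right mult_ac)
    also have "\<dots> = c t + poly f t *\<^sub>R \<kappa> t"
      unfolding wf c_def \<kappa>_def by (simp add: algebra_simps)
    finally show ?thesis .
  qed
  define \<kappa>' where "\<kappa>' t = \<kappa> t + mul (\<kappa> t) (c t)" for t
  have ccc: "mul (mul (c t) (c t)) (c t) = c t + poly f t *\<^sub>R \<kappa>' t" for t
    unfolding \<kappa>'_def by (subst cc) (simp add: mul_linear cc algebra_simps)
  define K where "K t = 3 *\<^sub>R mul (\<kappa> t) (mul (c t) \<eta>) - mul (\<kappa>' t) \<eta>" for t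
  define z1 where "z1 t = mul (c t) \<eta>" for t
  define z2 where "z2 t = mul (c t) (z1 t)" for t
  have K: "polynomial_function K"
    unfolding K_def \<kappa>'_def
    by (intro polynomial_function_cmul polynomial_function_diff polynomial_function_add
        polynomial_function_mul c \<kappa> polynomial_function_const)
  have z1: "polynomial_function z1" and z2: "polynomial_function z2"
    unfolding z1_def z2_def by (intro polynomial_function_mul c polynomial_function_const)+
  \<comment> \<open>By \<open>mul_cube\<close> the multiplication L by c satisfies 2 L^3 = 3 L^2 - L
    modulo f; \<open>K\<close> is the error term on \<eta>.\<close>
  have cube: "2 *\<^sub>R mul (c t) (z2 t) = 3 *\<^sub>R z2 t - z1 t + poly f t *\<^sub>R K t" for t
  proof -
    have "z1 t + poly f t *\<^sub>R mul (\<kappa>' t) \<eta> = mul (mul (mul (c t) (c t)) (c t)) \<eta>"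
      unfolding ccc by (simp add: mul_linear z1_def)
    also have "\<dots> = 3 *\<^sub>R mul (mul (c t) (c t)) (z1 t) - 2 *\<^sub>R mul (c t) (z2 t)"
      unfolding mul_cube z1_def z2_def ..
    also have "mul (mul (c t) (c t)) (z1 t) = z2 t + poly f t *\<^sub>R mul (\<kappa> t) (z1 t)"
      unfolding cc by (simp add: mul_linear z2_def)
    finally show ?thesis by (simp add: K_def z1_def algebra_simps)
  qed
  text \<open>Modulo \<open>f\<close> the element \<open>c\<close> is an idempotent, and \<open>\<pi>\<^sub>1\<close>, \<open>\<pi>\<^sub>h\<close>, \<open>\<pi>\<^sub>0\<close> are the Peirce components
    of \<open>\<eta>\<close> for the eigenvalues \<open>1\<close>, \<open>1/2\<close>, \<open>0\<close>.\<close>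
  define \<pi>1 where "\<pi>1 t = 2 *\<^sub>R z2 t - z1 t" for t
  define \<pi>h where "\<pi>h t = 4 *\<^sub>R z1 t - 4 *\<^sub>R z2 t" for t
  define \<pi>0 where "\<pi>0 t = \<eta> - 3 *\<^sub>R z1 t + 2 *\<^sub>R z2 t" for t
  have \<pi>: "polynomial_function \<pi>1" "polynomial_function \<pi>h" "polynomial_function \<pi>0"
    unfolding \<pi>1_def \<pi>h_def \<pi>0_def
    by (intro polynomial_function_cmul polynomial_function_diff polynomial_function_add z1 z2 polynomial_function_const)+
  \<comment> \<open>The Peirce components are scaled by \<theta> to twice the eigenvalue, so that
    only integral powers occur. At \<theta> = 1 they add up to \<eta>.\<close>
  define \<Phi> where "\<Phi> \<theta> t = (\<theta> * \<theta>) *\<^sub>R \<pi>1 t + \<theta> *\<^sub>R \<pi>h t + \<pi>0 t" for \<theta> t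
  have c\<Phi>: "2 *\<^sub>R mul (c t) (\<Phi> \<theta> t) = (2 * \<theta> * \<theta>) *\<^sub>R \<pi>1 t + \<theta> *\<^sub>R \<pi>h t
      + (2 * (\<theta> - 1) * (\<theta> - 1) * poly f t) *\<^sub>R K t" for \<theta> t
  proof -
    define z3 where "z3 = mul (c t) (z2 t)"
    have z3: "2 *\<^sub>R z3 = 3 *\<^sub>R z2 t - z1 t + poly f t *\<^sub>R K t" using cube by (simp add: z3_def)
    have "mul (c t) (\<pi>1 t) = \<pi>1 t + poly f t *\<^sub>R K t"
    proof -
      have "mul (c t) (\<pi>1 t) = 2 *\<^sub>R z3 - z2 t" by (simp add: \<pi>1_def z3_def mul_linear z2_def)
      then show ?thesis unfolding z3 \<pi>1_def by (simp add: algebra_simps scaleR_left_distrib[of 1 2, simplified] scaleR_2)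
    qed
    moreover have "2 *\<^sub>R mul (c t) (\<pi>h t) = \<pi>h t - (4 * poly f t) *\<^sub>R K t"
    proof -
      have "2 *\<^sub>R mul (c t) (\<pi>h t) = 8 *\<^sub>R z2 t - 4 *\<^sub>R (2 *\<^sub>R z3)"
        by (simp add: \<pi>h_def z3_def mul_linear z2_def scaleR_diff_right)
      also have "\<dots> = \<pi>h t - (4 * poly f t) *\<^sub>R K t"
        unfolding z3 \<pi>h_def by (simp add: scaleR_diff_right scaleR_add_right) (simp add: algebra_simps flip: scaleR_left_distrib)
      finally show ?thesis .
    qed
    moreover have "mul (c t) (\<pi>0 t) = poly f t *\<^sub>R K t"
    proof -
      have "mul (c t) (\<pi>0 t) = z1 t - 3 *\<^sub>R z2 t + 2 *\<^sub>R z3"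
        by (simp add: \<pi>0_def z3_def mul_linear z2_def z1_def)
      then show ?thesis unfolding z3 by simp
    qed
    moreover have "2 *\<^sub>R mul (c t) (\<Phi> \<theta> t) = (2 * \<theta> * \<theta>) *\<^sub>R mul (c t) (\<pi>1 t)
        + \<theta> *\<^sub>R (2 *\<^sub>R mul (c t) (\<pi>h t)) + 2 *\<^sub>R mul (c t) (\<pi>0 t)"
      by (simp add: \<Phi>_def mul_linear scaleR_add_right mult_ac)
    moreover have "(2 * (\<theta> - 1) * (\<theta> - 1) * poly f t) *\<^sub>R K t = (2 * \<theta> * \<theta> * poly f t) *\<^sub>R K t
        - (\<theta> * 4 * poly f t) *\<^sub>R K t + (2 * poly f t) *\<^sub>R K t"
      unfolding scaleR_left_distrib[symmetric] scaleR_left_diff_distrib[symmetric]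
      by (rule arg_cong[where f = "\<lambda>s. s *\<^sub>R K t"]) (simp add: algebra_simps)
    ultimately show ?thesis
      by (simp add: scaleR_add_right scaleR_diff_right mult_ac)
  qed
  let ?dP = "\<lambda>q. frechet_derivative P (at q)"
  have lin: "linear (?dP q)" for q by (rule rpf_frechet_linear[OF P])
  define \<psi> where "\<psi> q = P (snd q, \<Phi> (fst q) (snd q))" for q :: "real \<times> real"
  define H where "H q = 2 * poly w (snd q) * ?dP (snd q, \<Phi> (fst q) (snd q)) (1, 0)
      + 2 * k * poly h (snd q) * P (snd q, \<Phi> (fst q) (snd q))
      - 2 * (fst q - 1) * (fst q - 1) * ?dP (snd q, \<Phi> (fst q) (snd q)) (0, K (snd q))" for q :: "real \<times> real"
  have pf\<Phi>: "polynomial_function (\<lambda>q. (snd q, \<Phi> (fst q) (snd q)))"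
    unfolding \<Phi>_def
    by (intro polynomial_function_Pair polynomial_function_snd polynomial_function_add polynomial_function_scale
        polynomial_intros polynomial_function_compose'[OF polynomial_function_snd] \<pi>)
  have r\<psi>: "real_polynomial_function \<psi>"
    unfolding \<psi>_def by (rule rpf_compose[OF pf\<Phi> P])
  have rH: "real_polynomial_function H"
    unfolding H_def
    by (intro rpf_mult rpf_add real_polynomial_function_diff polynomial_intros rpf_compose[OF pf\<Phi> P]
        rpf_frechet_derivative[OF P pf\<Phi>] polynomial_function_const polynomial_function_Pair
        polynomial_function_compose'[OF polynomial_function_snd K])
  obtain p\<psi> where p\<psi>: "\<And>\<theta> t. \<psi> (\<theta>, t) = poly (p\<psi> t) \<theta>"
    using poly_family_of_rpf[OF r\<psi>] by blast
  obtain pH where pH: "poly_family pH" "\<And>\<theta> t. H (\<theta>, t) = poly (pH t) \<theta>"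
    using poly_family_of_rpf[OF rH] by blast
  \<comment> \<open>The equation for \<open>P\<close>, multiplied by 2 w, is Euler's relation for
    \<psi> up to a multiple of f.\<close>
  have euler: "\<theta> * poly (pderiv (p\<psi> t)) \<theta> = - 2 * k * poly (p\<psi> t) \<theta> + poly f t * poly (pH t) \<theta>" for \<theta> t
  proof -
    let ?q = "(t, \<Phi> \<theta> t)"
    have "((\<lambda>\<theta>. (t, \<Phi> \<theta> t)) has_derivative (\<lambda>s. (0, s *\<^sub>R ((2 * \<theta>) *\<^sub>R \<pi>1 t + \<pi>h t)))) (at \<theta>)"
      unfolding \<Phi>_def by (auto intro!: derivative_eq_intros simp: algebra_simps)
    from has_derivative_compose[OF this rpf_has_derivative[OF P]]
    have "((\<lambda>\<theta>. \<psi> (\<theta>, t)) has_derivative (\<lambda>s. ?dP ?q (0, s *\<^sub>R ((2 * \<theta>) *\<^sub>R \<pi>1 t + \<pi>h t)))) (at \<theta>)"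
      by (simp add: \<psi>_def)
    moreover have "?dP ?q (0, s *\<^sub>R ((2 * \<theta>) *\<^sub>R \<pi>1 t + \<pi>h t)) = s * ?dP ?q (0, (2 * \<theta>) *\<^sub>R \<pi>1 t + \<pi>h t)" for s
      using linear_scale[OF lin[of ?q], of s "(0, (2 * \<theta>) *\<^sub>R \<pi>1 t + \<pi>h t)"] by simp
    ultimately have "((\<lambda>\<theta>. poly (p\<psi> t) \<theta>) has_real_derivative ?dP ?q (0, (2 * \<theta>) *\<^sub>R \<pi>1 t + \<pi>h t)) (at \<theta>)"
      by (simp add: has_field_derivative_def p\<psi> mult_commute_abs)
    then have "poly (pderiv (p\<psi> t)) \<theta> = ?dP ?q (0, (2 * \<theta>) *\<^sub>R \<pi>1 t + \<pi>h t)"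
      using poly_DERIV DERIV_unique by blast
    then have "\<theta> * poly (pderiv (p\<psi> t)) \<theta> = ?dP ?q (\<theta> *\<^sub>R (0, (2 * \<theta>) *\<^sub>R \<pi>1 t + \<pi>h t))"
      by (simp add: linear_scale[OF lin] del: scaleR_Pair)
    also have "\<theta> *\<^sub>R (0::real, (2 * \<theta>) *\<^sub>R \<pi>1 t + \<pi>h t) =
        (2 * poly w t) *\<^sub>R (0, mul (u t) (\<Phi> \<theta> t)) - (2 * (\<theta> - 1) * (\<theta> - 1) * poly f t) *\<^sub>R (0, K t)"
    proof -
      have "\<theta> *\<^sub>R ((2 * \<theta>) *\<^sub>R \<pi>1 t + \<pi>h t) = 2 *\<^sub>R mul (c t) (\<Phi> \<theta> t) - (2 * (\<theta> - 1) * (\<theta> - 1) * poly f t) *\<^sub>R K t"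
        unfolding c\<Phi> by (simp add: scaleR_add_right mult_ac)
      then show ?thesis by (simp add: c_def mul_linear)
    qed
    also have "?dP ?q \<dots> = 2 * poly w t * ?dP ?q (0, mul (u t) (\<Phi> \<theta> t))
        - 2 * (\<theta> - 1) * (\<theta> - 1) * poly f t * ?dP ?q (0, K t)"
      by (simp only: linear_diff[OF lin] linear_scale[OF lin] real_scaleR_def)
    also have "?dP ?q (0, mul (u t) (\<Phi> \<theta> t)) = poly f t * ?dP ?q (1, 0) - k * poly (pderiv f) t * P ?q"
      using ode[of t "\<Phi> \<theta> t"] by simp
    finally have "\<theta> * poly (pderiv (p\<psi> t)) \<theta> = poly f t * (2 * poly w t * ?dP ?q (1, 0))
        - 2 * k * (poly w t * poly (pderiv f) t) * P ?q - poly f t * (2 * (\<theta> - 1) * (\<theta> - 1) * ?dP ?q (0, K t))"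
      by (simp add: algebra_simps)
    then show ?thesis
      unfolding wf p\<psi>[symmetric] pH(2)[symmetric] \<psi>_def H_def by (simp add: algebra_simps)
  qed
  \<comment> \<open>Since i + 2 k > 0, the coefficient of \<theta>^i in \<psi> is f times a
    polynomial in t. Summing the coefficients evaluates \<psi> at \<theta> = 1, where it equals
    \<open>P\<close>.\<close>
  have coeffs: "(real i + 2 * k) * coeff (p\<psi> t) i = poly f t * coeff (pH t) i" for i t
  proof -
    have "monom 1 1 * pderiv (p\<psi> t) + Polynomial.smult (2 * k) (p\<psi> t) = Polynomial.smult (poly f t) (pH t)"
      using euler[of _ t] by (intro real_poly_eqI) (simp add: poly_monom)
    from arg_cong[OF this, of "\<lambda>p. coeff p i"] show ?thesis
      by (cases i) (simp_all add: coeff_monom_mult coeff_pderiv distrib_right)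
  qed
  obtain n where n: "\<And>t i. i \<ge> n \<Longrightarrow> coeff (pH t) i = 0"
    using pH(1) unfolding poly_family_def by blast
  define R where "R t = (\<Sum>i<n. coeff (pH t) i / (real i + 2 * k))" for t
  have "real_polynomial_function R"
    unfolding R_def
    by (intro real_polynomial_function_sum real_polynomial_function_divide poly_family_coeff pH) simp
  then have "real_polynomial_function (\<lambda>z::real \<times> real. R (fst z))" by (rule rpf_fst)
  from poly_family_of_rpf[OF this] obtain q where q: "\<And>t. R t = poly q t" by fastforce
  have "P (t, \<eta>) = poly f t * poly q t" for t
  proof -
    have ci: "coeff (p\<psi> t) i = poly f t * (coeff (pH t) i / (real i + 2 * k))" for i
      using coeffs[of i t] k by (simp add: field_simps)
    have "4 *\<^sub>R z1 t = z1 t + 3 *\<^sub>R z1 t" "4 *\<^sub>R z2 t = 2 *\<^sub>R z2 t + 2 *\<^sub>R z2 t"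
      using scaleR_left_distrib[of 1 3 "z1 t"] scaleR_left_distrib[of 2 2 "z2 t"] by simp_all
    then have "\<Phi> 1 t = \<eta>" by (simp add: \<Phi>_def \<pi>1_def \<pi>h_def \<pi>0_def)
    then have "P (t, \<eta>) = poly (p\<psi> t) 1" using p\<psi>[of 1 t] by (simp add: \<psi>_def)
    also have "\<dots> = (\<Sum>i\<le>degree (p\<psi> t) + n. coeff (p\<psi> t) i)"
      unfolding poly_altdef by (simp, intro sum.mono_neutral_left) (auto simp: coeff_eq_0)
    also have "\<dots> = (\<Sum>i<n. coeff (p\<psi> t) i)"
      using ci n by (intro sum.mono_neutral_right) auto
    also have "\<dots> = poly f t * R t" unfolding R_def ci by (simp add: sum_distrib_left)
    finally show ?thesis by (simp add: q)
  qed
  then show ?thesis by blast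
qed

text \<open>Each application of the pointwise lemma splits off one factor f. For P = f P1 the
  derivative of that factor contributes f' P1 and lowers \<open>k\<close> in the equation by one.
  Division by the monic f keeps the quotient polynomial in \<eta>.\<close>

lemma fuchsian_divisible:
  fixes P :: "real \<times> 'a \<Rightarrow> real" and u u2 :: "real \<Rightarrow> 'a"
  assumes P: "real_polynomial_function P"
    and u: "polynomial_function u" "polynomial_function u2"
    and uu: "\<And>t. mul (u t) (u t) = poly (pderiv f) t *\<^sub>R u t - poly f t *\<^sub>R u2 t"
    and cop: "coprime f (pderiv f)" and lc: "lead_coeff f = 1"
    and ode: "\<And>t \<eta>. poly f t * frechet_derivative P (at (t, \<eta>)) (1, 0)
        - frechet_derivative P (at (t, \<eta>)) (0, mul (u t) \<eta>) = real k * poly (pderiv f) t * P (t, \<eta>)"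
  shows "\<exists>Q. real_polynomial_function Q \<and> (\<forall>t \<eta>. P (t, \<eta>) = poly f t ^ k * Q (t, \<eta>))"
  using P ode
proof (induction k arbitrary: P)
  case 0
  then show ?case by (intro exI[of _ P]) simp
next
  case (Suc k)
  note P = Suc.prems(1)
  obtain p where p: "poly_family p" "\<And>t \<eta>. P (t, \<eta>) = poly (p \<eta>) t"
    using poly_family_of_rpf[OF P] by blast
  obtain p1 s where ps: "poly_family p1" "\<And>\<eta>. p \<eta> = p1 \<eta> * f + s \<eta>" "\<And>\<eta>. f dvd p \<eta> \<Longrightarrow> s \<eta> = 0"
    using poly_family_division[OF poly_family_const[of f], of "degree f" p] lc p(1) by metis
  have "f dvd p \<eta>" for \<eta>
  proof -
    obtain q where "\<And>t. P (t, \<eta>) = poly f t * poly q t"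
      using fuchsian_divisible_pointwise[OF P u uu cop Suc.prems(2), of \<eta>] by auto
    then have "p \<eta> = f * q" by (intro real_poly_eqI) (simp add: p(2)[symmetric])
    then show ?thesis by simp
  qed
  then have p1: "p \<eta> = f * p1 \<eta>" for \<eta> using ps(2,3)[of \<eta>] by (simp add: mult.commute)
  define P1 where "P1 q = poly (p1 (snd q)) (fst q)" for q
  have rP1: "real_polynomial_function P1"
    unfolding P1_def by (intro rpf_of_poly_family[OF ps(1)] polynomial_intros polynomial_function_snd)
  have PP1: "P = (\<lambda>q. poly f (fst q) * P1 q)"
    by (rule ext) (metis P1_def p(2) p1 poly_mult prod.collapse)
  have rf: "real_polynomial_function (\<lambda>q::real \<times> 'a. poly f (fst q))" by (intro polynomial_intros)
  have dP: "frechet_derivative P (at q) h =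
      poly f (fst q) * frechet_derivative P1 (at q) h + poly (pderiv f) (fst q) * fst h * P1 q" for q h
  proof -
    have "((\<lambda>q::real \<times> 'a. poly f (fst q)) has_derivative (\<lambda>h. poly (pderiv f) (fst q) * fst h)) (at q)"
      by (rule has_derivative_compose[OF has_derivative_fst[OF has_derivative_ident]])
        (use poly_DERIV[of f "fst q"] in \<open>simp add: has_field_derivative_def\<close>)
    from has_derivative_mult[OF this rpf_has_derivative[OF rP1]]
    show ?thesis unfolding PP1 by (rule frechet_derivative_eqI)
  qed
  have ode1: "poly f t * frechet_derivative P1 (at (t, \<eta>)) (1, 0)
        - frechet_derivative P1 (at (t, \<eta>)) (0, mul (u t) \<eta>) = real k * poly (pderiv f) t * P1 (t, \<eta>)" for t \<eta>
  proof -
    define L where "L q = poly f (fst q) * frechet_derivative P1 (at q) (1, 0)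
        - frechet_derivative P1 (at q) (0, mul (u (fst q)) (snd q)) - real k * poly (pderiv f) (fst q) * P1 q"
      for q :: "real \<times> 'a"
    have "real_polynomial_function L"
      unfolding L_def
      by (intro polynomial_intros rpf_frechet_derivative[OF rP1] polynomial_function_Pair polynomial_function_const
          polynomial_function_id polynomial_function_mul polynomial_function_snd
          polynomial_function_compose'[OF polynomial_function_fst u(1)] rP1)
    \<comment> \<open>The equation for \<open>P\<close> is f times the one for \<open>P1\<close>;
      the factor cancels since polynomial functions have no zero divisors.\<close>
    moreover have "L q * poly f (fst q) = 0" for q
      using Suc.prems(2)[of "fst q" "snd q"] unfolding dP
      by (simp add: L_def PP1 algebra_simps)
    moreover obtain t0 where "poly f t0 \<noteq> 0"
      using lc by (metis leading_coeff_0_iff poly_all_0_iff_0 zero_neq_one)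
    ultimately have "L (t, \<eta>) = 0"
      using rpf_mult_eq_0[OF _ rf, of L "(t0, 0)" "(t, \<eta>)"] by simp
    then show ?thesis by (simp add: L_def)
  qed
  obtain Q where "real_polynomial_function Q" "\<And>t \<eta>. P1 (t, \<eta>) = poly f t ^ k * Q (t, \<eta>)"
    using Suc.IH[OF rP1 ode1] by blast
  then show ?case by (intro exI[of _ Q]) (simp add: PP1)
qed

end

context simple_real_jordan_algebra
begin

section \<open>Twisted constant coefficient operators\<close>

text \<open>A list \<open>cs\<close> of pairs \<open>(c, [v\<^sub>1, \<dots>, v\<^sub>k])\<close> represents the polynomial
  \<open>x \<mapsto> \<Sum> c \<tau>(v\<^sub>1, x) \<cdots> \<tau>(v\<^sub>k, x)\<close>. Replacing the factors \<open>\<tau>(v, x)\<close> by \<open>\<partial>\<^bsub>d v\<^esub> + \<tau>(v, \<eta>)\<close> yields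
  an operator on functions of \<open>(p, \<eta>)\<close>; the second summand comes from conjugation with exponentials.\<close>

type_synonym 'v symbol = "(real \<times> 'v list) list"

definition sym :: "'a symbol \<Rightarrow> 'a \<Rightarrow> real" where
  "sym cs x = (\<Sum>(c, vs)\<leftarrow>cs. c * (\<Prod>v\<leftarrow>vs. \<tau> v x))"

definition dop :: "('a \<Rightarrow> 'b::euclidean_space) \<Rightarrow> 'a \<Rightarrow> ('b \<times> 'a \<Rightarrow> real) \<Rightarrow> 'b \<times> 'a \<Rightarrow> real" where
  "dop d v \<Phi> q = frechet_derivative \<Phi> (at q) (d v, 0) + \<tau> v (snd q) * \<Phi> q"

primrec dops :: "('a \<Rightarrow> 'b::euclidean_space) \<Rightarrow> 'a list \<Rightarrow> ('b \<times> 'a \<Rightarrow> real) \<Rightarrow> 'b \<times> 'a \<Rightarrow> real" where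
  "dops d [] \<Phi> = \<Phi>"
| "dops d (v # vs) \<Phi> = dop d v (dops d vs \<Phi>)"

definition Dop :: "('a \<Rightarrow> 'b::euclidean_space) \<Rightarrow> 'a symbol \<Rightarrow> ('b \<times> 'a \<Rightarrow> real) \<Rightarrow> 'b \<times> 'a \<Rightarrow> real" where
  "Dop d cs \<Phi> q = (\<Sum>(c, vs)\<leftarrow>cs. c * dops d vs \<Phi> q)"

lemma sym_simps: "sym [] x = 0" "sym ((c, vs) # cs) x = c * (\<Prod>v\<leftarrow>vs. \<tau> v x) + sym cs x"
  "sym (cs @ cs') x = sym cs x + sym cs' x"
  by (simp_all add: sym_def)

lemma Dop_simps: "Dop d [] \<Phi> q = 0" "Dop d ((c, vs) # cs) \<Phi> q = c * dops d vs \<Phi> q + Dop d cs \<Phi> q"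
  "Dop d (cs @ cs') \<Phi> q = Dop d cs \<Phi> q + Dop d cs' \<Phi> q"
  by (simp_all add: Dop_def)

lemma rpf_\<tau>: "real_polynomial_function (\<lambda>q. \<tau> v (snd q))"
  by (intro rpf_snd rpf_linear) (use linear_\<tau>(1) linear_conv_bounded_linear in blast)

lemma rpf_prod_list_\<tau>: "real_polynomial_function (\<lambda>x. \<Prod>v\<leftarrow>vs. \<tau> v x)"
proof (induction vs)
  case (Cons v vs)
  have "bounded_linear (\<tau> v)" using linear_\<tau>(1) linear_conv_bounded_linear by blast
  then show ?case using Cons by (simp add: rpf_mult rpf_linear)
qed (simp add: rpf_const)

lemma rpf_sym: "real_polynomial_function (sym cs)"
proof (induction cs)
  case (Cons b cs)
  obtain c vs where b: "b = (c, vs)" by fastforce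
  have "sym (b # cs) = (\<lambda>x. c * (\<Prod>v\<leftarrow>vs. \<tau> v x) + sym cs x)" by (auto simp: b sym_simps)
  then show ?case using Cons by (simp add: rpf_add rpf_mult rpf_const rpf_prod_list_\<tau>)
qed (simp add: sym_simps[abs_def] rpf_const)

lemma rpf_dop: "real_polynomial_function \<Phi> \<Longrightarrow> real_polynomial_function (dop d v \<Phi>)"
  unfolding dop_def by (intro rpf_add rpf_mult rpf_\<tau> rpf_frechet_derivative_const)

lemma rpf_dops: "real_polynomial_function \<Phi> \<Longrightarrow> real_polynomial_function (dops d vs \<Phi>)"
  by (induction vs) (auto intro: rpf_dop)

lemma rpf_Dop:
  assumes "real_polynomial_function \<Phi>"
  shows "real_polynomial_function (Dop d cs \<Phi>)"
proof (induction cs)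
  case (Cons a cs)
  obtain c vs where "a = (c, vs)" by fastforce
  then have "Dop d (a # cs) \<Phi> = (\<lambda>q. c * dops d vs \<Phi> q + Dop d cs \<Phi> q)"
    by (auto simp: Dop_simps)
  then show ?case using Cons by (simp only:) (intro rpf_add rpf_mult rpf_const rpf_dops[OF assms])
qed (simp add: Dop_simps[abs_def] rpf_const)

lemma dop_add:
  assumes "real_polynomial_function \<Phi>" "real_polynomial_function \<Psi>"
  shows "dop d v (\<lambda>q. \<Phi> q + \<Psi> q) q = dop d v \<Phi> q + dop d v \<Psi> q"
  by (simp add: dop_def frechet_derivative_add' rpf_differentiable assms algebra_simps)

lemma dop_mult:
  assumes "real_polynomial_function \<Phi>" "real_polynomial_function \<Psi>"
  shows "dop d v (\<lambda>q. \<Phi> q * \<Psi> q) q = \<Phi> q * dop d v \<Psi> q + frechet_derivative \<Phi> (at q) (d v, 0) * \<Psi> q"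
  by (simp add: dop_def frechet_derivative_mult' rpf_differentiable assms algebra_simps)

lemma dop_0: "dop d v (\<lambda>q. 0) q = 0"
  by (simp add: dop_def frechet_derivative_const)

text \<open>Nondegeneracy of the trace form writes each linear form as some \<tau>(k, .), and
  symbols are multiplied by concatenating direction lists. The representing list is not unique,
  whence the need for \<open>Dop_eq_0\<close>.\<close>

lemma sym_exists:
  assumes "real_polynomial_function \<phi>"
  shows "\<exists>cs. \<forall>x. sym cs x = \<phi> x"
  using assms
proof (induction)
  case (linear f)
  then obtain k where "\<forall>v. f v = \<tau> k v"
    using \<tau>_representation linear_conv_bounded_linear by blast
  then show ?case by (intro exI[of _ "[(1, [k])]"]) (simp add: sym_simps)
next
  case (const c)
  show ?case by (intro exI[of _ "[(c, [])]"]) (simp add: sym_simps)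
next
  case (add f g)
  then obtain cs cs' where "\<forall>x. sym cs x = f x" "\<forall>x. sym cs' x = g x" by blast
  then show ?case by (intro exI[of _ "cs @ cs'"]) (simp add: sym_simps)
next
  case (mult f g)
  then obtain cs cs' where cs: "\<forall>x. sym cs x = f x" "\<forall>x. sym cs' x = g x" by blast
  have 1: "sym (map (\<lambda>(c', vs'). (c * c', vs @ vs')) cs') x = c * (\<Prod>v\<leftarrow>vs. \<tau> v x) * sym cs' x" for c vs x
    by (induction cs') (auto simp: sym_simps algebra_simps)
  have "sym (concat (map (\<lambda>(c, vs). map (\<lambda>(c', vs'). (c * c', vs @ vs')) cs') cs)) x = sym cs x * sym cs' x" for x
    by (induction cs) (auto simp: sym_simps 1 algebra_simps)
  then show ?case using cs by metis
qed

subsection \<open>Multiplication by linear forms\<close>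

text \<open>Formally \<open>[Dop, l] = [\<partial>\<^sub>\<kappa>, Dop]\<close> where \<open>\<partial>\<^sub>\<kappa>\<close> differentiates with respect to \<open>\<eta>\<close>.\<close>

lemma dops_linear:
  fixes d :: "'a \<Rightarrow> 'b::euclidean_space" and l :: "'b \<Rightarrow> real"
  assumes l: "linear l" and \<kappa>: "\<And>v. l (d v) = \<tau> v \<kappa>" and \<Phi>: "real_polynomial_function \<Phi>"
    and indep: "\<And>q. frechet_derivative \<Phi> (at q) (0, \<kappa>) = 0"
  shows "dops d vs (\<lambda>q. l (fst q) * \<Phi> q) q
    = l (fst q) * dops d vs \<Phi> q + frechet_derivative (dops d vs \<Phi>) (at q) (0, \<kappa>)"
proof (induction vs arbitrary: q)
  case (Cons v vs)
  define X where "X = dops d vs \<Phi>"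
  have X: "real_polynomial_function X" unfolding X_def by (rule rpf_dops[OF \<Phi>])
  have bl: "bounded_linear (\<lambda>q::'b \<times> 'a. l (fst q))"
    using l linear_conv_bounded_linear bounded_linear_compose[OF _ bounded_linear_fst] by blast
  have bl\<tau>: "bounded_linear (\<lambda>q::'b \<times> 'a. \<tau> v (snd q))"
    using linear_\<tau>(1) linear_conv_bounded_linear bounded_linear_compose[OF _ bounded_linear_snd] by blast
  have rl: "real_polynomial_function (\<lambda>q::'b \<times> 'a. l (fst q))" using bl by (rule rpf_linear)
  let ?dX = "\<lambda>q. frechet_derivative X (at q) (0, \<kappa>)"
  have rdX: "real_polynomial_function ?dX" by (rule rpf_frechet_derivative_const[OF X])
  have IH: "dops d vs (\<lambda>q. l (fst q) * \<Phi> q) = (\<lambda>q. l (fst q) * X q + ?dX q)"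
    by (rule ext) (simp add: Cons.IH X_def)
  have "dops d (v # vs) (\<lambda>q. l (fst q) * \<Phi> q) q = dop d v (\<lambda>q. l (fst q) * X q) q + dop d v ?dX q"
    by (simp add: IH dop_add rpf_mult rl X rdX)
  also have "dop d v (\<lambda>q. l (fst q) * X q) q = l (fst q) * dop d v X q + \<tau> v \<kappa> * X q"
    by (simp add: dop_mult rl X frechet_derivative_bounded_linear[OF bl] \<kappa>)
  \<comment> \<open>Differentiating the summand \<tau>(v, \<eta>) of \<open>dop\<close> in \<eta>
    produces \<tau>(v, \<kappa>) X, the very term by which \<open>dop\<close> fails to commute with
    the linear form.\<close>
  also have "dop d v ?dX q = frechet_derivative (dop d v X) (at q) (0, \<kappa>) - \<tau> v \<kappa> * X q"
  proof -
    have "frechet_derivative (dop d v X) (at q) (0, \<kappa>) =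
        frechet_derivative (\<lambda>q. frechet_derivative X (at q) (d v, 0)) (at q) (0, \<kappa>)
        + (\<tau> v (snd q) * ?dX q + \<tau> v \<kappa> * X q)"
      unfolding dop_def
      by (simp add: frechet_derivative_add' frechet_derivative_mult' rpf_differentiable rpf_mult rpf_\<tau> X
          rpf_frechet_derivative_const frechet_derivative_bounded_linear[OF bl\<tau>])
    then show ?thesis
      using rpf_frechet_derivative_commute[OF X, of "(d v, 0)" q "(0, \<kappa>)"]
      by (simp add: dop_def algebra_simps)
  qed
  finally show ?case by (simp add: X_def)
qed (use indep in simp)

lemma frechet_derivative_Dop:
  assumes "real_polynomial_function \<Phi>"
  shows "frechet_derivative (Dop d cs \<Phi>) (at q) h = (\<Sum>(c, vs)\<leftarrow>cs. c * frechet_derivative (dops d vs \<Phi>) (at q) h)"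
proof (induction cs)
  case (Cons a cs)
  obtain c vs where a: "a = (c, vs)" by fastforce
  have "Dop d (a # cs) \<Phi> = (\<lambda>q. c * dops d vs \<Phi> q + Dop d cs \<Phi> q)" by (auto simp: a Dop_simps)
  then show ?case using Cons a
    by (simp add: frechet_derivative_add' frechet_derivative_cmult' rpf_differentiable rpf_mult rpf_const
        rpf_dops rpf_Dop assms)
qed (simp add: Dop_simps[abs_def] frechet_derivative_const)

lemma Dop_linear:
  fixes d :: "'a \<Rightarrow> 'b::euclidean_space" and l :: "'b \<Rightarrow> real"
  assumes "linear l" "\<And>v. l (d v) = \<tau> v \<kappa>" "real_polynomial_function \<Phi>"
    "\<And>q. frechet_derivative \<Phi> (at q) (0, \<kappa>) = 0"
  shows "Dop d cs (\<lambda>q. l (fst q) * \<Phi> q) q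
    = l (fst q) * Dop d cs \<Phi> q + frechet_derivative (Dop d cs \<Phi>) (at q) (0, \<kappa>)"
  unfolding frechet_derivative_Dop[OF assms(3)]
  by (induction cs) (auto simp: Dop_simps dops_linear[OF assms] distrib_left mult.left_commute)

lemma dops_add:
  assumes "real_polynomial_function \<Phi>" "real_polynomial_function \<Psi>"
  shows "dops d vs (\<lambda>q. \<Phi> q + \<Psi> q) q = dops d vs \<Phi> q + dops d vs \<Psi> q"
proof (induction vs arbitrary: q)
  case (Cons v vs)
  then have "dops d vs (\<lambda>q. \<Phi> q + \<Psi> q) = (\<lambda>q. dops d vs \<Phi> q + dops d vs \<Psi> q)" by blast
  then show ?case by (simp add: dop_add rpf_dops assms)
qed simp

lemma dops_cmult:
  assumes "real_polynomial_function \<Phi>"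
  shows "dops d vs (\<lambda>q. c * \<Phi> q) q = c * dops d vs \<Phi> q"
proof (induction vs arbitrary: q)
  case (Cons v vs)
  then have "dops d vs (\<lambda>q. c * \<Phi> q) = (\<lambda>q. c * dops d vs \<Phi> q)" by blast
  then show ?case by (simp add: dop_mult rpf_dops rpf_const assms frechet_derivative_const)
qed simp

lemma Dop_add:
  assumes "real_polynomial_function \<Phi>" "real_polynomial_function \<Psi>"
  shows "Dop d cs (\<lambda>q. \<Phi> q + \<Psi> q) q = Dop d cs \<Phi> q + Dop d cs \<Psi> q"
  by (induction cs) (auto simp: Dop_simps dops_add[OF assms] algebra_simps)

lemma Dop_cmult:
  assumes "real_polynomial_function \<Phi>"
  shows "Dop d cs (\<lambda>q. c * \<Phi> q) q = c * Dop d cs \<Phi> q"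
  by (induction cs) (auto simp: Dop_simps dops_cmult[OF assms] algebra_simps)

text \<open>Divisibility of \<open>Dop w\<close> by a function of \<open>p\<close> alone is inherited by all multiples of \<open>w\<close>. For
  \<open>M = 0\<close> this says that the operator depends only on the polynomial represented by \<open>cs\<close>.\<close>

lemma Dop_dvd_mult:
  fixes d :: "'a \<Rightarrow> 'b::euclidean_space"
  assumes d: "linear d" and M: "real_polynomial_function M" and \<phi>: "real_polynomial_function \<phi>"
    and "real_polynomial_function w"
    and "\<exists>Q. real_polynomial_function Q \<and> (\<forall>q. Dop d cs (\<lambda>q. w (fst q)) q = M (fst q) * Q q)"
  shows "\<exists>Q. real_polynomial_function Q \<and> (\<forall>q. Dop d cs (\<lambda>q. \<phi> (fst q) * w (fst q)) q = M (fst q) * Q q)"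
  using \<phi> assms(4-)
proof (induction arbitrary: w)
  case (linear l)
  then have l: "linear l" using linear_conv_bounded_linear by blast
  obtain \<kappa> where "\<forall>v. l (d v) = \<tau> \<kappa> v"
    using \<tau>_representation[OF linear_compose[OF d l]] by auto
  then have \<kappa>: "\<And>v. l (d v) = \<tau> v \<kappa>" by (simp add: \<tau>_commute)
  obtain Q where Q: "real_polynomial_function Q" "\<And>q. Dop d cs (\<lambda>q. w (fst q)) q = M (fst q) * Q q"
    using linear.prems(2) by blast
  have w: "real_polynomial_function (\<lambda>q::'b \<times> 'a. w (fst q))" by (rule rpf_fst[OF linear.prems(1)])
  have indep: "frechet_derivative (\<lambda>q::'b \<times> 'a. g (fst q)) (at q) (0, k) = 0"
    if "real_polynomial_function g" for g :: "'b \<Rightarrow> real" and q :: "'b \<times> 'a" and k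
  proof -
    have "(fst has_derivative fst) (at q)" by (rule has_derivative_fst[OF has_derivative_ident])
    from frechet_affine_comp[OF that this, of "(0, k)"] show ?thesis
      using linear_0[OF rpf_frechet_linear[OF that]] by simp
  qed
  have "Dop d cs (\<lambda>q. l (fst q) * w (fst q)) q = M (fst q) * (l (fst q) * Q q + frechet_derivative Q (at q) (0, \<kappa>))" for q
  proof -
    have "Dop d cs (\<lambda>q. w (fst q)) = (\<lambda>q. M (fst q) * Q q)" using Q(2) by blast
    then have "frechet_derivative (Dop d cs (\<lambda>q. w (fst q))) (at q) (0, \<kappa>) = M (fst q) * frechet_derivative Q (at q) (0, \<kappa>)"
      by (simp add: frechet_derivative_mult' rpf_differentiable rpf_fst M Q(1) indep[OF M])
    then show ?thesis
      using Dop_linear[OF l \<kappa> w indep[OF linear.prems(1)], of cs q] by (simp add: Q(2) algebra_simps)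
  qed
  moreover have "real_polynomial_function (\<lambda>q. l (fst q) * Q q + frechet_derivative Q (at q) (0, \<kappa>))"
    by (intro rpf_add rpf_mult rpf_fst rpf_linear linear Q rpf_frechet_derivative_const)
  ultimately show ?case by blast
next
  case (const c)
  then obtain Q where "real_polynomial_function Q" "\<And>q. Dop d cs (\<lambda>q. w (fst q)) q = M (fst q) * Q q" by blast
  then show ?case
    by (intro exI[of _ "\<lambda>q. c * Q q"]) (simp add: Dop_cmult rpf_fst const rpf_mult rpf_const)
next
  case (add f g)
  obtain Q R where "real_polynomial_function Q" "\<And>q. Dop d cs (\<lambda>q. f (fst q) * w (fst q)) q = M (fst q) * Q q"
    "real_polynomial_function R" "\<And>q. Dop d cs (\<lambda>q. g (fst q) * w (fst q)) q = M (fst q) * R q"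
    using add.IH[OF add.prems] by blast
  then show ?case
    by (intro exI[of _ "\<lambda>q. Q q + R q"])
      (simp add: distrib_right Dop_add rpf_fst rpf_mult rpf_add add distrib_left)
next
  case (mult f g)
  have "real_polynomial_function (\<lambda>p. g p * w p)" by (intro rpf_mult mult)
  from mult.IH(1)[OF this mult.IH(2)[OF mult.prems]] show ?case by (simp add: mult.assoc)
qed

lemma dops_one: "dops d vs (\<lambda>q. 1) q = (\<Prod>v\<leftarrow>vs. \<tau> v (snd q))"
proof (induction vs arbitrary: q)
  case (Cons v vs)
  let ?g = "\<lambda>x. \<Prod>v\<leftarrow>vs. \<tau> v x"
  have g: "real_polynomial_function ?g" by (rule rpf_prod_list_\<tau>)
  have "(snd has_derivative snd) (at q)" by (rule has_derivative_snd[OF has_derivative_ident])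
  from frechet_affine_comp[OF g this, of "(d v, 0)"]
  have "frechet_derivative (\<lambda>q. ?g (snd q)) (at q) (d v, 0) = 0"
    using linear_0[OF rpf_frechet_linear[OF g]] by simp
  moreover have "dops d vs (\<lambda>q. 1) = (\<lambda>q. ?g (snd q))" using Cons.IH by blast
  ultimately show ?case by (simp add: dop_def)
qed simp

lemma Dop_one: "Dop d cs (\<lambda>q. 1) q = sym cs (snd q)"
  by (induction cs) (auto simp: Dop_simps sym_simps dops_one)

text \<open>A zero symbol kills the constant 1 by \<open>Dop_one\<close>, and
  \<open>Dop_dvd_mult\<close> with M = 0 passes this on to every function of \<open>p\<close>.
  Operators may therefore be compared through their symbols.\<close>

lemma Dop_eq_0:
  assumes d: "linear d" and cs: "\<And>x. sym cs x = 0" and w: "real_polynomial_function w"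
  shows "Dop d cs (\<lambda>q. w (fst q)) q = 0"
proof -
  have "\<exists>Q. real_polynomial_function Q \<and> (\<forall>q. Dop d cs (\<lambda>q. w (fst q) * 1) q = (0::real) * Q q)"
  proof (rule Dop_dvd_mult[OF d rpf_const w rpf_const])
    show "\<exists>Q. real_polynomial_function Q \<and> (\<forall>q. Dop d cs (\<lambda>q. 1) q = 0 * Q q)"
      by (intro exI[of _ "\<lambda>_. 0"]) (simp add: Dop_one cs rpf_const)
  qed
  then obtain Q where "\<forall>q. Dop d cs (\<lambda>q. w (fst q) * 1) q = (0::real) * Q q" by blast
  then have "Dop d cs (\<lambda>q. w (fst q) * 1) q = 0 * Q q" by blast
  then show ?thesis by simp
qed

subsection \<open>Equivariance under the structure algebra\<close>

text \<open>One list for each position whose entry \<open>v\<close> is replaced by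
  \<open>mul a v\<close>: the Leibniz rule for the derivative of a product of linear forms along x
  \<mapsto> a x.\<close>

primrec repl :: "'a \<Rightarrow> 'a list \<Rightarrow> 'a list list" where
  "repl a [] = []"
| "repl a (v # vs) = (mul a v # vs) # map ((#) v) (repl a vs)"

definition repls :: "'a \<Rightarrow> 'a symbol \<Rightarrow> 'a symbol" where
  "repls a cs = concat (map (\<lambda>(c, vs). map (Pair c) (repl a vs)) cs)"

lemma prod_list_\<tau>_derivative:
  "((\<lambda>x. \<Prod>v\<leftarrow>vs. \<tau> v x) has_derivative frechet_derivative (\<lambda>x. \<Prod>v\<leftarrow>vs. \<tau> v x) (at x)) (at x)"
  "frechet_derivative (\<lambda>x. \<Prod>v\<leftarrow>vs. \<tau> v x) (at x) (mul a x) = (\<Sum>ws\<leftarrow>repl a vs. \<Prod>v\<leftarrow>ws. \<tau> v x)"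
proof -
  note g = rpf_prod_list_\<tau>
  show "((\<lambda>x. \<Prod>v\<leftarrow>vs. \<tau> v x) has_derivative frechet_derivative (\<lambda>x. \<Prod>v\<leftarrow>vs. \<tau> v x) (at x)) (at x)"
    by (rule rpf_has_derivative[OF g])
  show "frechet_derivative (\<lambda>x. \<Prod>v\<leftarrow>vs. \<tau> v x) (at x) (mul a x) = (\<Sum>ws\<leftarrow>repl a vs. \<Prod>v\<leftarrow>ws. \<tau> v x)"
  proof (induction vs)
    case (Cons v vs)
    have bl: "bounded_linear (\<tau> v)" using linear_\<tau>(1) linear_conv_bounded_linear by blast
    have "frechet_derivative (\<lambda>x. \<tau> v x * (\<Prod>v\<leftarrow>vs. \<tau> v x)) (at x) (mul a x) =
        \<tau> v x * (\<Sum>ws\<leftarrow>repl a vs. \<Prod>v\<leftarrow>ws. \<tau> v x) + \<tau> v (mul a x) * (\<Prod>v\<leftarrow>vs. \<tau> v x)"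
      by (simp add: frechet_derivative_mult' rpf_differentiable g rpf_linear[OF bl]
          frechet_derivative_bounded_linear[OF bl] Cons.IH)
    moreover have "\<tau> v (mul a x) = \<tau> (mul a v) x"
      using \<tau>_mul[of v a x] by (simp add: mul_commute[of v a])
    ultimately show ?case
      by (simp add: o_def sum_list_const_mult)
  qed (simp add: frechet_derivative_const)
qed

lemma sym_repls: "sym (repls a cs) x = frechet_derivative (sym cs) (at x) (mul a x)"
proof (induction cs)
  case (Cons b cs)
  obtain c vs where b: "b = (c, vs)" by fastforce
  note rsym = rpf_sym
  have diff: "(\<lambda>x. \<Prod>v\<leftarrow>vs. \<tau> v x) differentiable at x"
    using prod_list_\<tau>_derivative(1) differentiable_def by blast
  have "sym (b # cs) = (\<lambda>x. c * (\<Prod>v\<leftarrow>vs. \<tau> v x) + sym cs x)" by (auto simp: b sym_simps)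
  then have "frechet_derivative (sym (b # cs)) (at x) (mul a x) =
      c * (\<Sum>ws\<leftarrow>repl a vs. \<Prod>v\<leftarrow>ws. \<tau> v x) + sym (repls a cs) x"
    using diff rsym
    by (simp add: frechet_derivative_add' frechet_derivative_cmult' rpf_differentiable
        prod_list_\<tau>_derivative(2) Cons.IH)
  moreover have "sym (map (Pair c) wss) x = c * (\<Sum>ws\<leftarrow>wss. \<Prod>v\<leftarrow>ws. \<tau> v x)" for wss
    by (induction wss) (simp_all add: sym_simps algebra_simps)
  moreover have "repls a (b # cs) = map (Pair c) (repl a vs) @ repls a cs" by (simp add: b repls_def)
  ultimately show ?case by (simp only: sym_simps(3))
qed (simp add: repls_def sym_simps sym_simps[abs_def] frechet_derivative_const)

lemma rpf_sum_list_dops: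
  "real_polynomial_function \<Phi> \<Longrightarrow> real_polynomial_function (\<lambda>q. \<Sum>ws\<leftarrow>L. dops d ws \<Phi> q)"
  by (induction L) (simp_all add: rpf_const rpf_add rpf_dops)

lemma dop_sum_list:
  assumes "real_polynomial_function \<Phi>"
  shows "dop d v (\<lambda>q. \<Sum>ws\<leftarrow>L. dops d ws \<Phi> q) q = (\<Sum>ws\<leftarrow>L. dop d v (dops d ws \<Phi>) q)"
proof (induction L)
  case (Cons ws L)
  then show ?case by (simp add: dop_add rpf_dops rpf_sum_list_dops assms)
qed (simp add: dop_0)

text \<open>The infinitesimal action of \<open>a\<close>, contragredient in the second variable. It
  preserves \<tau>(\<xi>, \<eta>) and hence the exponentials from which the twist stems.\<close>

definition str_field :: "'a \<Rightarrow> 'a \<times> 'a \<Rightarrow> 'a \<times> 'a" where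
  "str_field a q = (mul a (fst q), - mul a (snd q))"

lemma linear_str_field: "linear (str_field a)"
  by (intro linearI) (simp_all add: str_field_def mul_linear)

text \<open>Commuting the field past the two summands of \<open>dop\<close> replaces
  \<open>v\<close> by \<open>mul a v\<close> in each; for the summand \<tau>(v, \<eta>) this is due
  to the minus sign in \<open>str_field\<close>. That \<open>d\<close> is a scalar makes it commute
  with the multiplication by \<open>a\<close>.\<close>

lemma dops_str_field:
  fixes \<Phi> :: "'a \<times> 'a \<Rightarrow> real"
  assumes \<Phi>: "real_polynomial_function \<Phi>" and d: "\<And>v. d v = \<alpha> *\<^sub>R v"
  shows "dops d vs (\<lambda>q. frechet_derivative \<Phi> (at q) (str_field a q)) q
    = frechet_derivative (dops d vs \<Phi>) (at q) (str_field a q) + (\<Sum>ws\<leftarrow>repl a vs. dops d ws \<Phi> q)"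
proof (induction vs arbitrary: q)
  case (Cons v vs)
  define X where "X = dops d vs \<Phi>"
  have X: "real_polynomial_function X" unfolding X_def by (rule rpf_dops[OF \<Phi>])
  have pA: "polynomial_function (str_field a)"
    using linear_str_field linear_conv_bounded_linear polynomial_function_bounded_linear by blast
  have bl\<tau>: "bounded_linear (\<lambda>q::'a \<times> 'a. \<tau> v (snd q))"
    using linear_\<tau>(1) linear_conv_bounded_linear bounded_linear_compose[OF _ bounded_linear_snd] by blast
  let ?Y = "\<lambda>q. frechet_derivative X (at q) (str_field a q)"
  let ?S = "\<lambda>q. \<Sum>ws\<leftarrow>repl a vs. dops d ws \<Phi> q"
  let ?h = "(d v, 0::'a)"
  have rY: "real_polynomial_function ?Y"
    by (rule rpf_frechet_derivative[OF X polynomial_function_id pA])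
  have rS: "real_polynomial_function ?S"
    by (rule rpf_sum_list_dops[OF \<Phi>])
  have IH: "dops d vs (\<lambda>q. frechet_derivative \<Phi> (at q) (str_field a q)) = (\<lambda>q. ?Y q + ?S q)"
    by (rule ext) (simp add: Cons.IH X_def)
  have "dops d (v # vs) (\<lambda>q. frechet_derivative \<Phi> (at q) (str_field a q)) q = dop d v ?Y q + dop d v ?S q"
    by (simp add: IH dop_add rY rS)
  also have "dop d v ?Y q = frechet_derivative (\<lambda>y. frechet_derivative X (at y) ?h) (at q) (str_field a q)
      + frechet_derivative X (at q) (str_field a ?h) + \<tau> v (snd q) * ?Y q"
    unfolding dop_def by (simp add: rpf_frechet_derivative_field[OF X linear_str_field])
  also have "\<dots> = frechet_derivative (dop d v X) (at q) (str_field a q) + dop d (mul a v) X q"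
  proof -
    have "frechet_derivative (dop d v X) (at q) (str_field a q) =
        frechet_derivative (\<lambda>y. frechet_derivative X (at y) ?h) (at q) (str_field a q)
        + (\<tau> v (snd q) * ?Y q + \<tau> v (snd (str_field a q)) * X q)"
      unfolding dop_def
      by (simp add: frechet_derivative_add' frechet_derivative_mult' rpf_differentiable rpf_mult rpf_\<tau> X
          rpf_frechet_derivative_const frechet_derivative_bounded_linear[OF bl\<tau>])
    moreover have "\<tau> v (snd (str_field a q)) = - \<tau> (mul a v) (snd q)"
      using \<tau>_mul[of v a "snd q"] by (simp add: str_field_def \<tau>_linear mul_commute[of v a])
    moreover have "str_field a ?h = (d (mul a v), 0)"
      by (simp add: str_field_def d mul_linear)
    ultimately show ?thesis by (simp add: dop_def)
  qed
  finally show ?case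
    by (simp add: dop_sum_list[OF \<Phi>] X_def o_def)
qed simp

lemma Dop_str_field:
  fixes \<Phi> :: "'a \<times> 'a \<Rightarrow> real"
  assumes \<Phi>: "real_polynomial_function \<Phi>" and d: "\<And>v. d v = \<alpha> *\<^sub>R v"
  shows "Dop d cs (\<lambda>q. frechet_derivative \<Phi> (at q) (str_field a q)) q
    = frechet_derivative (Dop d cs \<Phi>) (at q) (str_field a q) + Dop d (repls a cs) \<Phi> q"
proof (induction cs)
  case (Cons b cs)
  obtain c vs where b: "b = (c, vs)" by fastforce
  have "Dop d (map (Pair c) wss) \<Phi> q = c * (\<Sum>ws\<leftarrow>wss. dops d ws \<Phi> q)" for wss
    by (induction wss) (simp_all add: Dop_simps distrib_left)
  moreover have "repls a (b # cs) = map (Pair c) (repl a vs) @ repls a cs" by (simp add: b repls_def)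
  ultimately show ?case
    using Cons unfolding b frechet_derivative_Dop[OF \<Phi>]
    by (simp add: Dop_simps dops_str_field[OF \<Phi> d] distrib_left)
qed (simp add: Dop_simps repls_def frechet_derivative_Dop[OF \<Phi>])

section \<open>Divisibility by powers of the determinant\<close>

text \<open>Along the lines t e - x the power of \<open>det\<close> becomes the monic polynomial
  F(x)^k in t. Division by it leaves a remainder with coefficients polynomial in (x, c), which
  vanish once they do so for generic \<open>c\<close> and squarefree \<open>F x\<close>.\<close>

lemma det_power_dvd:
  fixes N :: "'a \<times> 'c::euclidean_space \<Rightarrow> real"
  assumes N: "real_polynomial_function N" and g: "real_polynomial_function g" "g c0 \<noteq> 0"
    and lines: "\<And>x c. coprime (F x) (pderiv (F x)) \<Longrightarrow> g c \<noteq> 0 \<Longrightarrow>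
      \<exists>q. \<forall>t. N (t *\<^sub>R e - x, c) = poly (F x) t ^ k * poly q t"
  shows "\<exists>Q. real_polynomial_function Q \<and> (\<forall>x c. N (x, c) = det x ^ k * Q (x, c))"
proof -
  have pf: "polynomial_function (\<lambda>z::real \<times> 'a \<times> 'c. (fst z *\<^sub>R e - fst (snd z), snd (snd z)))"
    by (intro polynomial_function_Pair polynomial_function_diff polynomial_function_scale polynomial_intros
        polynomial_function_const polynomial_function_compose'[OF polynomial_function_snd polynomial_function_fst]
        polynomial_function_compose'[OF polynomial_function_snd polynomial_function_snd])
  obtain p where p: "poly_family p" "\<And>t x c. N (t *\<^sub>R e - x, c) = poly (p (x, c)) t"
    using poly_family_of_rpf[OF rpf_compose[OF pf N]] by auto
  have f: "poly_family (\<lambda>b::'a \<times> 'c. F (fst b) ^ k)"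
    by (intro poly_family_power poly_family_compose[OF poly_family_F polynomial_function_fst])
  have degf: "degree (F x ^ k) = k * rk" for x
    by (simp add: degree_power_eq F_nonzero degree_F)
  have lcf: "coeff (F x ^ k) (k * rk) = 1" for x
    using lead_coeff_power[of "F x" k] by (simp add: degf degree_F coeff_F_rank)
  obtain q s where qs: "poly_family q" "poly_family s" "\<And>b. p b = q b * F (fst b) ^ k + s b"
    "\<And>b. F (fst b) ^ k dvd p b \<Longrightarrow> s b = 0"
    using poly_family_division[OF f lcf degf p(1)] by blast
  have "coeff (s (x, c)) i = 0" for x c i
  proof (rule rpf_eq_on_dense[OF _ rpf_const g])
    show "real_polynomial_function (\<lambda>c. coeff (s (x, c)) i)"
      by (rule rpf_compose[OF polynomial_function_Pair[OF polynomial_function_const polynomial_function_id]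
          poly_family_coeff[OF qs(2)]])
    fix c assume c: "g c \<noteq> 0"
    show "coeff (s (x, c)) i = 0"
    proof (rule eq_0_if_eq_0_on_squarefree[of "\<lambda>x. coeff (s (x, c)) i"])
      show "real_polynomial_function (\<lambda>x. coeff (s (x, c)) i)"
        by (rule rpf_compose[OF polynomial_function_Pair[OF polynomial_function_id polynomial_function_const]
            poly_family_coeff[OF qs(2)]])
      fix x assume "coprime (F x) (pderiv (F x))"
      then obtain r where "\<And>t. N (t *\<^sub>R e - x, c) = poly (F x) t ^ k * poly r t" using lines c by blast
      then have "p (x, c) = F x ^ k * r" by (intro real_poly_eqI) (simp add: p(2)[symmetric])
      then show "coeff (s (x, c)) i = 0" using qs(4)[of "(x, c)"] by simp
    qed
  qed
  then have s0: "s b = 0" for b by (intro poly_eqI) (metis coeff_0 prod.collapse)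
  \<comment> \<open>The point x is t e - (- x) at t = 0.\<close>
  define Q where "Q b = poly (q (- fst b, snd b)) 0" for b
  have "real_polynomial_function Q"
    unfolding Q_def
    by (intro rpf_of_poly_family[OF qs(1)] rpf_const polynomial_function_Pair polynomial_function_minus
        polynomial_function_fst polynomial_function_snd)
  moreover have "N (x, c) = det x ^ k * Q (x, c)" for x c
    using p(2)[of 0 "- x" c] qs(3)[of "(- x, c)"] det_shift[of 0 "- x"] by (simp add: s0 Q_def)
  ultimately show ?thesis by blast
qed

text \<open>\<open>adj (t e - x)\<close> is F(t) times the resolvent of \<open>x\<close>. The
  resolvent equation, cleared of denominators, is differentiated in s at s = t; \<open>u2\<close> is
  the derivative of \<open>u\<close>.\<close>

lemma adj_resolvent:
  "\<exists>u2. polynomial_function u2 \<and> (\<forall>t. mul (adj (t *\<^sub>R e - x)) (adj (t *\<^sub>R e - x)) =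
    poly (pderiv (F x)) t *\<^sub>R adj (t *\<^sub>R e - x) - poly (F x) t *\<^sub>R u2 t)"
proof -
  define u where "u t = adj (t *\<^sub>R e - x)" for t
  have u: "polynomial_function u"
    unfolding u_def
    by (intro polynomial_function_compose'[OF _ polynomial_function_adj] polynomial_function_diff
        polynomial_function_scale polynomial_intros polynomial_function_const)
  obtain u2 where u2: "polynomial_function u2" "\<And>t. (u has_vector_derivative u2 t) (at t)"
    using has_vector_derivative_polynomial_function[OF u] by blast
  have ev_u: "\<exists>p. u t = ev p x" for t
    unfolding u_def adj_def using ev_affine[of _ t "-1" x] by (metis scaleR_minus1_left uminus_add_conv_diff)
  have uf: "mul (u t) (t *\<^sub>R e - x) = poly (F x) t *\<^sub>R e" for t
    using mul_adj[of "t *\<^sub>R e - x"] by (simp add: u_def det_shift mul_commute)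
  have ev_t: "t *\<^sub>R e - x = ev [:t, -1:] x" for t
    by (simp add: ev_pCons mul_unit_right mul_linear)
  have res: "poly (F x) s *\<^sub>R u t - poly (F x) t *\<^sub>R u s + (t - s) *\<^sub>R mul (u t) (u s) = 0" for s t
  proof -
    obtain p p' where p: "u t = ev p x" "u s = ev p' x" using ev_u by metis
    have "mul (u s) (mul (u t) (t *\<^sub>R e - x)) = mul (mul (u s) (u t)) (t *\<^sub>R e - x)"
      unfolding p ev_t by (simp only: ev_mult[symmetric] mult.assoc)
    moreover have "mul (u t) (mul (u s) (s *\<^sub>R e - x)) = mul (mul (u s) (u t)) (s *\<^sub>R e - x)"
      unfolding p ev_t by (simp only: ev_mult[symmetric] mult_ac)
    ultimately have "poly (F x) t *\<^sub>R u s - poly (F x) s *\<^sub>R u t =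
        mul (mul (u s) (u t)) (t *\<^sub>R e - x) - mul (mul (u s) (u t)) (s *\<^sub>R e - x)"
      unfolding uf by (simp add: mul_linear mul_unit_right)
    also have "\<dots> = (t - s) *\<^sub>R mul (u t) (u s)"
      by (simp add: mul_linear mul_unit_right mul_commute[of "u s" "u t"] algebra_simps)
    finally show ?thesis by (simp add: algebra_simps)
  qed
  have "mul (u t) (u t) = poly (pderiv (F x)) t *\<^sub>R u t - poly (F x) t *\<^sub>R u2 t" for t
  proof -
    have bl: "bounded_linear (mul (u t))" using linear_mul linear_conv_bounded_linear by blast
    have "((\<lambda>s. poly (F x) s) has_vector_derivative poly (pderiv (F x)) t) (at t)"
      by (simp add: has_real_derivative_iff_has_vector_derivative[symmetric] poly_DERIV)
    from bounded_linear.has_vector_derivative[OF bounded_linear_scaleR_left this]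
    have 1: "((\<lambda>s. poly (F x) s *\<^sub>R u t) has_vector_derivative poly (pderiv (F x)) t *\<^sub>R u t) (at t)" .
    have 2: "((\<lambda>s. poly (F x) t *\<^sub>R u s) has_vector_derivative poly (F x) t *\<^sub>R u2 t) (at t)"
      by (rule bounded_linear.has_vector_derivative[OF bounded_linear_scaleR_right u2(2)])
    have "((\<lambda>s. t - s) has_field_derivative - 1) (at t)" by (auto intro!: derivative_eq_intros)
    from has_vector_derivative_scaleR[OF this bounded_linear.has_vector_derivative[OF bl u2(2)]]
    have 3: "((\<lambda>s. (t - s) *\<^sub>R mul (u t) (u s)) has_vector_derivative
        ((t - t) *\<^sub>R mul (u t) (u2 t) + (- 1) *\<^sub>R mul (u t) (u t))) (at t)" .
    note has_vector_derivative_add[OF has_vector_derivative_diff[OF 1 2] 3]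
    then have "poly (pderiv (F x)) t *\<^sub>R u t - poly (F x) t *\<^sub>R u2 t + ((t - t) *\<^sub>R mul (u t) (u2 t) + (- 1) *\<^sub>R mul (u t) (u t)) = 0"
      unfolding res using vector_derivative_unique_at[OF _ has_vector_derivative_const] by blast
    then show ?thesis by simp
  qed
  with u2(1) show ?thesis unfolding u_def by blast
qed

text \<open>Under the structure field the function det^(m+1) has the multiplier (m + 1) tr a and the
  symbol \<open>det\<close> the multiplier tr a; the difference m tr a remains for \<open>E\<close>
  and determines the exponent of the divisor.\<close>

theorem Dop_det_power:
  assumes cs: "\<And>x. sym cs x = det x" and d: "\<And>v. d v = \<alpha> *\<^sub>R v"
  shows "\<exists>Q. real_polynomial_function Q \<and>
    (\<forall>q. Dop d cs (\<lambda>q. det (fst q) ^ Suc m) q = det (fst q) ^ m * Q q)"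
proof -
  define \<Phi> where "\<Phi> q = det (fst q) ^ Suc m" for q :: "'a \<times> 'a"
  have \<Phi>: "real_polynomial_function \<Phi>"
    unfolding \<Phi>_def by (intro real_polynomial_function_power rpf_fst rpf_det_jordan)
  define E where "E = Dop d cs \<Phi>"
  have E: "real_polynomial_function E" unfolding E_def by (rule rpf_Dop[OF \<Phi>])
  have lind: "linear d" unfolding d by (rule linear_scaleR)
  have cs': "sym cs = det" using cs by blast
  have equiv: "frechet_derivative E (at q) (str_field a q) = real m * tr a * E q" for a q
  proof -
    have Y\<Phi>: "frechet_derivative \<Phi> (at q) (str_field a q) = real (Suc m) * tr a * \<Phi> q" for q
    proof -
      have "((\<lambda>q::'a \<times> 'a. det (fst q)) has_derivative (\<lambda>h. frechet_derivative det (at (fst q)) (fst h))) (at q)"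
        by (rule has_derivative_compose[OF has_derivative_fst[OF has_derivative_ident] rpf_has_derivative[OF rpf_det_jordan]])
      from frechet_derivative_eqI[OF has_derivative_power[OF this, of "Suc m"]]
      show ?thesis unfolding \<Phi>_def
        by (simp add: str_field_def det_semi_invariant mult_ac)
    qed
    have "real (Suc m) * tr a * E q = Dop d cs (\<lambda>q. frechet_derivative \<Phi> (at q) (str_field a q)) q"
      unfolding Y\<Phi> E_def by (rule Dop_cmult[OF \<Phi>, symmetric])
    also have "\<dots> = frechet_derivative E (at q) (str_field a q) + Dop d (repls a cs) \<Phi> q"
      unfolding E_def by (rule Dop_str_field[OF \<Phi> d])
    also have "Dop d (repls a cs) \<Phi> q = tr a * E q"
    proof -
      have scale: "sym (map (\<lambda>(c, vs). (k * c, vs)) cs) x = k * sym cs x"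
        "Dop d (map (\<lambda>(c, vs). (k * c, vs)) cs) \<Phi> q = k * Dop d cs \<Phi> q" for k x
        by (induction cs) (auto simp: sym_simps Dop_simps algebra_simps)
      \<comment> \<open>By semi-invariance of \<open>det\<close> the replaced list represents tr a
        times the same polynomial; \<open>Dop_eq_0\<close> transfers this from symbols to
        operators.\<close>
      have "sym (repls a cs @ map (\<lambda>(c, vs). (- tr a * c, vs)) cs) x = 0" for x
        unfolding sym_simps scale sym_repls cs' by (simp add: det_semi_invariant)
      from Dop_eq_0[OF lind this real_polynomial_function_power[OF rpf_det_jordan], of "Suc m" q]
      show ?thesis
        unfolding Dop_simps \<Phi>_def[symmetric] scale E_def by simp
    qed
    finally show ?thesis by (simp add: algebra_simps)
  qed
  have "\<exists>Q. real_polynomial_function Q \<and> (\<forall>x c. E (x, c) = det x ^ m * Q (x, c))"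
  proof (rule det_power_dvd[OF E rpf_const[of 1]])
    fix x c assume cop: "coprime (F x) (pderiv (F x))"
    define u where "u t = adj (t *\<^sub>R e - x)" for t
    txt \<open>Along the line \<open>t e - x\<close> the choice \<open>a = adj (t e - x)\<close> turns the equivariance of \<open>E\<close> into an
      ordinary differential equation in \<open>t\<close>.\<close>
    define P where "P z = E (fst z *\<^sub>R e - x, snd z)" for z :: "real \<times> 'a"
    obtain u2 where u2: "polynomial_function u2"
      "\<And>t. mul (u t) (u t) = poly (pderiv (F x)) t *\<^sub>R u t - poly (F x) t *\<^sub>R u2 t"
      unfolding u_def using adj_resolvent[of x] by blast
    have u: "polynomial_function u"
      unfolding u_def
      by (intro polynomial_function_compose'[OF _ polynomial_function_adj] polynomial_function_diff
          polynomial_function_scale polynomial_intros polynomial_function_const)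
    have P: "real_polynomial_function P"
      unfolding P_def
      by (intro rpf_compose[OF _ E] polynomial_function_Pair polynomial_function_diff polynomial_function_scale
          polynomial_intros polynomial_function_const polynomial_function_snd)
    have dP: "frechet_derivative P (at (t, \<eta>)) h = frechet_derivative E (at (t *\<^sub>R e - x, \<eta>)) (fst h *\<^sub>R e, snd h)" for t \<eta> h
    proof -
      have "((\<lambda>z::real \<times> 'a. (fst z *\<^sub>R e - x, snd z)) has_derivative (\<lambda>h. (fst h *\<^sub>R e, snd h))) (at (t, \<eta>))"
        by (auto intro!: derivative_eq_intros)
      from frechet_affine_comp[OF E this, of h] show ?thesis by (simp add: P_def[abs_def])
    qed
    have tru: "tr (u t) = poly (pderiv (F x)) t" for t
    proof -
      have "((\<lambda>t. det (- x + t *\<^sub>R e)) has_real_derivative \<tau> (adj (- x + t *\<^sub>R e)) e) (at t)"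
        by (rule det_line_derivative)
      then have "((\<lambda>t. poly (F x) t) has_real_derivative tr (u t)) (at t)"
        by (simp add: det_shift[symmetric] u_def trace_form_def mul_unit_right)
      then show ?thesis using poly_DERIV DERIV_unique by blast
    qed
    have "poly (F x) t * frechet_derivative P (at (t, \<eta>)) (1, 0)
        - frechet_derivative P (at (t, \<eta>)) (0, mul (u t) \<eta>) = real m * poly (pderiv (F x)) t * P (t, \<eta>)" for t \<eta>
    proof -
      let ?q = "(t *\<^sub>R e - x, \<eta>)"
      have lin: "linear (frechet_derivative E (at ?q))" by (rule rpf_frechet_linear[OF E])
      have "mul (u t) (t *\<^sub>R e - x) = poly (F x) t *\<^sub>R e"
        using mul_adj[of "t *\<^sub>R e - x"] by (simp add: u_def det_shift mul_commute)
      then have "str_field (u t) ?q = poly (F x) t *\<^sub>R (e, 0) - (0, mul (u t) \<eta>)"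
        by (simp add: str_field_def)
      then have "poly (F x) t * frechet_derivative E (at ?q) (e, 0) - frechet_derivative E (at ?q) (0, mul (u t) \<eta>)
          = real m * tr (u t) * E ?q"
        using equiv[of ?q "u t"] by (simp only: linear_diff[OF lin] linear_scale[OF lin] real_scaleR_def)
      then show ?thesis by (simp add: dP tru P_def)
    qed
    from fuchsian_divisible[OF P u u2 cop _ this]
    obtain Q where Q: "real_polynomial_function Q" "\<And>t \<eta>. P (t, \<eta>) = poly (F x) t ^ m * Q (t, \<eta>)"
      using coeff_F_rank[of x] degree_F[of x] by auto
    obtain fam where "\<And>t b. Q (t, b) = poly (fam b) t" using poly_family_of_rpf[OF Q(1)] by blast
    then show "\<exists>q. \<forall>t. E (t *\<^sub>R e - x, c) = poly (F x) t ^ m * poly q t"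
      using Q(2)[of _ c] by (intro exI[of _ "fam c"]) (simp add: P_def)
  qed simp
  then show ?thesis unfolding E_def \<Phi>_def by auto
qed

section \<open>From one variable to pairs of variables\<close>

lemma dops_pullback:
  fixes d :: "'a \<Rightarrow> 'b::euclidean_space" and d' :: "'a \<Rightarrow> 'c::euclidean_space" and \<pi> :: "'b \<Rightarrow> 'c"
  assumes \<pi>: "linear \<pi>" "\<And>v. \<pi> (d v) = d' v" and \<Psi>: "real_polynomial_function \<Psi>"
  shows "dops d vs (\<lambda>q. \<Psi> (\<pi> (fst q), snd q)) q = dops d' vs \<Psi> (\<pi> (fst q), snd q)"
proof (induction vs arbitrary: q)
  case (Cons v vs)
  have "bounded_linear (\<lambda>q::'b \<times> 'a. \<pi> (fst q))"
    using \<pi>(1) linear_conv_bounded_linear bounded_linear_compose[OF _ bounded_linear_fst] by blast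
  then have "((\<lambda>q::'b \<times> 'a. (\<pi> (fst q), snd q)) has_derivative (\<lambda>h. (\<pi> (fst h), snd h))) (at q)"
    by (intro has_derivative_Pair bounded_linear_imp_has_derivative bounded_linear_snd)
  from frechet_affine_comp[OF rpf_dops[OF \<Psi>] this, of d' vs "(d v, 0)"]
  moreover have "dops d vs (\<lambda>q. \<Psi> (\<pi> (fst q), snd q)) = (\<lambda>q. dops d' vs \<Psi> (\<pi> (fst q), snd q))"
    using Cons by blast
  ultimately show ?case by (simp add: dop_def[abs_def] \<pi>(2))
qed simp

lemma Dop_pullback:
  fixes d :: "'a \<Rightarrow> 'b::euclidean_space" and d' :: "'a \<Rightarrow> 'c::euclidean_space" and \<pi> :: "'b \<Rightarrow> 'c"
  assumes "linear \<pi>" "\<And>v. \<pi> (d v) = d' v" and \<Psi>: "real_polynomial_function \<Psi>"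
  shows "Dop d cs (\<lambda>q. \<Psi> (\<pi> (fst q), snd q)) q = Dop d' cs \<Psi> (\<pi> (fst q), snd q)"
  unfolding Dop_def by (simp add: dops_pullback[OF assms])

lemma rpf_det_power: "real_polynomial_function (\<lambda>x. det x ^ m)"
  by (intro real_polynomial_function_power rpf_det_jordan)

text \<open>A function of the first variable sees only the first component of \<open>d\<close>,
  which reduces the power of \<open>det\<close> to \<open>Dop_det_power\<close>;
  \<open>Dop_dvd_mult\<close> then admits the factor \<open>w\<close> of the second
  variable.\<close>

lemma Dop_det_times:
  fixes w :: "'a \<Rightarrow> real"
  assumes cs: "\<And>x. sym cs x = det x" and d: "\<And>v. d v = (\<alpha> *\<^sub>R v, \<beta> *\<^sub>R v)" and w: "real_polynomial_function w"
  shows "\<exists>Q. real_polynomial_function Q \<and>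
    (\<forall>q. Dop d cs (\<lambda>q. w (snd (fst q)) * det (fst (fst q)) ^ Suc m) q = det (fst (fst q)) ^ m * Q q)"
proof (rule Dop_dvd_mult[where M = "\<lambda>p. det (fst p) ^ m" and \<phi> = "\<lambda>p. w (snd p)" and w = "\<lambda>p. det (fst p) ^ Suc m"])
  show "linear d" by (intro linearI) (simp_all add: d scaleR_add_right)
  show "\<exists>Q. real_polynomial_function Q \<and>
      (\<forall>q. Dop d cs (\<lambda>q. det (fst (fst q)) ^ Suc m) q = det (fst (fst q)) ^ m * Q q)"
  proof -
    obtain Q where Q: "real_polynomial_function Q"
      "\<And>q. Dop (\<lambda>v. \<alpha> *\<^sub>R v) cs (\<lambda>q. det (fst q) ^ Suc m) q = det (fst q) ^ m * Q q"
      using Dop_det_power[OF cs, of "\<lambda>v. \<alpha> *\<^sub>R v" \<alpha> m] by blast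
    have "Dop d cs (\<lambda>q. det (fst (fst q)) ^ Suc m) q = det (fst (fst q)) ^ m * Q (fst (fst q), snd q)" for q
      using Dop_pullback[of fst d "\<lambda>v. \<alpha> *\<^sub>R v" "\<lambda>q. det (fst q) ^ Suc m" cs q]
      by (simp only: d fst_conv linear_fst rpf_fst[OF rpf_det_power] Q(2))
    moreover have "real_polynomial_function (\<lambda>q::('a \<times> 'a) \<times> 'a. Q (fst (fst q), snd q))"
      by (intro rpf_compose[OF _ Q(1)] polynomial_function_Pair polynomial_function_snd
          polynomial_function_compose'[OF polynomial_function_fst polynomial_function_fst])
    ultimately show ?thesis by (intro exI[of _ "\<lambda>q. Q (fst (fst q), snd q)"]) simp
  qed
qed (intro rpf_fst rpf_snd rpf_det_power w)+

text \<open>There is divisibility by det \<xi>^m and, after exchanging the variables, by det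
  \<zeta>^n. To combine them without unique factorization, det \<xi>^m is inverted at points where
  it is nonzero: there the first quotient is divisible by det \<zeta>^n along lines in \<zeta>, and
  \<open>det_power_dvd\<close> permits this restriction on its parameter.\<close>

theorem Dop_det_det:
  assumes cs: "\<And>x. sym cs x = det x"
  shows "\<exists>Q. real_polynomial_function Q \<and>
    (\<forall>\<xi> \<zeta> \<eta>. Dop (\<lambda>v. (v, - v)) cs (\<lambda>q. det (fst (fst q)) ^ Suc m * det (snd (fst q)) ^ Suc n) ((\<xi>, \<zeta>), \<eta>) =
      det \<xi> ^ m * det \<zeta> ^ n * Q ((\<xi>, \<zeta>), \<eta>))"
proof -
  let ?d = "\<lambda>v::'a. (v, - v)" and ?d' = "\<lambda>v::'a. (- v, v)"
  let ?\<Phi> = "\<lambda>q::('a \<times> 'a) \<times> 'a. det (fst (fst q)) ^ Suc m * det (snd (fst q)) ^ Suc n"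
  let ?\<Psi> = "\<lambda>q::('a \<times> 'a) \<times> 'a. det (snd (fst q)) ^ Suc m * det (fst (fst q)) ^ Suc n"
  have \<Psi>: "real_polynomial_function ?\<Psi>"
    by (intro rpf_mult rpf_compose[OF _ rpf_det_power]
        polynomial_function_compose'[OF polynomial_function_fst polynomial_function_fst]
        polynomial_function_compose'[OF polynomial_function_fst polynomial_function_snd])
  obtain Q1 where Q1: "real_polynomial_function Q1" "\<And>q. Dop ?d cs ?\<Phi> q = det (fst (fst q)) ^ m * Q1 q"
  proof -
    have "?d v = (1 *\<^sub>R v, (- 1) *\<^sub>R v)" for v by simp
    from Dop_det_times[OF cs this rpf_det_power, of "Suc n" m] show ?thesis
      using that by (auto simp only: mult.commute[of "det (snd _) ^ _"])
  qed
  obtain Q2 where Q2: "real_polynomial_function Q2" "\<And>q. Dop ?d' cs ?\<Psi> q = det (fst (fst q)) ^ n * Q2 q"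
  proof -
    have "?d' v = ((- 1) *\<^sub>R v, 1 *\<^sub>R v)" for v by simp
    from Dop_det_times[OF cs this rpf_det_power, of "Suc m" n] show ?thesis using that by blast
  qed
  have swap: "Dop ?d cs ?\<Phi> ((\<xi>, \<zeta>), \<eta>) = Dop ?d' cs ?\<Psi> ((\<zeta>, \<xi>), \<eta>)" for \<xi> \<zeta> \<eta>
  proof -
    have "linear (\<lambda>p::'a \<times> 'a. (snd p, fst p))" by (intro linearI) auto
    from Dop_pullback[OF this _ \<Psi>, of ?d ?d' cs "((\<xi>, \<zeta>), \<eta>)"] show ?thesis by simp
  qed
  then have Q12: "det \<xi> ^ m * Q1 ((\<xi>, \<zeta>), \<eta>) = det \<zeta> ^ n * Q2 ((\<zeta>, \<xi>), \<eta>)" for \<xi> \<zeta> \<eta>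
    using Q1(2)[of "((\<xi>, \<zeta>), \<eta>)"] Q2(2)[of "((\<zeta>, \<xi>), \<eta>)"] by simp
  define N where "N z = Q1 ((fst (snd z), fst z), snd (snd z))" for z :: "'a \<times> 'a \<times> 'a"
  have "\<exists>Q. real_polynomial_function Q \<and> (\<forall>\<zeta> c. N (\<zeta>, c) = det \<zeta> ^ n * Q (\<zeta>, c))"
  proof (rule det_power_dvd)
    show "real_polynomial_function N"
      unfolding N_def
      by (intro rpf_compose[OF _ Q1(1)] polynomial_function_Pair polynomial_function_fst
          polynomial_function_compose'[OF polynomial_function_snd polynomial_function_fst]
          polynomial_function_compose'[OF polynomial_function_snd polynomial_function_snd])
    show "real_polynomial_function (\<lambda>c::'a \<times> 'a. det (fst c) ^ m)" by (rule rpf_fst[OF rpf_det_power])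
    show "det (fst (e, 0::'a)) ^ m \<noteq> 0" using e_invertible by simp
    fix x and c :: "'a \<times> 'a" assume c: "det (fst c) ^ m \<noteq> 0"
    have "real_polynomial_function (\<lambda>\<zeta>. Q2 ((\<zeta>, fst c), snd c) / det (fst c) ^ m)"
      by (intro real_polynomial_function_divide rpf_compose[OF _ Q2(1)] polynomial_function_Pair
          polynomial_function_id polynomial_function_const)
    from rpf_line_poly1[OF this, of "- x" e]
    obtain q where q: "\<And>t. Q2 ((t *\<^sub>R e - x, fst c), snd c) / det (fst c) ^ m = poly q t" by auto
    have "N (t *\<^sub>R e - x, c) = poly (F x) t ^ n * poly q t" for t
      using Q12[of "fst c" "t *\<^sub>R e - x" "snd c"] c by (simp add: N_def q[symmetric] det_shift field_simps)
    then show "\<exists>q. \<forall>t. N (t *\<^sub>R e - x, c) = poly (F x) t ^ n * poly q t" by blast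
  qed
  then obtain Q where Q: "real_polynomial_function Q" "\<And>\<zeta> c. N (\<zeta>, c) = det \<zeta> ^ n * Q (\<zeta>, c)" by blast
  have "real_polynomial_function (\<lambda>q::('a \<times> 'a) \<times> 'a. Q (snd (fst q), fst (fst q), snd q))"
    by (intro rpf_compose[OF _ Q(1)] polynomial_function_Pair polynomial_function_snd
        polynomial_function_compose'[OF polynomial_function_fst polynomial_function_fst]
        polynomial_function_compose'[OF polynomial_function_fst polynomial_function_snd])
  moreover have "Dop ?d cs ?\<Phi> ((\<xi>, \<zeta>), \<eta>) = det \<xi> ^ m * det \<zeta> ^ n * Q (\<zeta>, \<xi>, \<eta>)" for \<xi> \<zeta> \<eta>
    using Q1(2)[of "((\<xi>, \<zeta>), \<eta>)"] Q(2)[of \<zeta> "(\<xi>, \<eta>)"] by (simp add: N_def)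
  ultimately show ?thesis
    by (intro exI[of _ "\<lambda>q. Q (snd (fst q), fst (fst q), snd q)"]) simp
qed

end

section \<open>Iterated derivatives of smooth functions\<close>

lemma has_derivative_line:
  assumes "g differentiable (at (y + t *\<^sub>R v))"
  shows "((\<lambda>s. g (y + s *\<^sub>R v)) has_vector_derivative frechet_derivative g (at (y + t *\<^sub>R v)) v) (at t)"
proof -
  have "((\<lambda>s. y + s *\<^sub>R v) has_derivative (\<lambda>h. h *\<^sub>R v)) (at t)"
    by (auto intro!: derivative_eq_intros)
  from has_derivative_compose[OF this assms[unfolded frechet_derivative_works]]
  show ?thesis
    by (simp add: has_vector_derivative_def linear_scale[OF linear_frechet_derivative[OF assms]])
qed

text \<open>The mean value theorem twice: in direction \<open>v\<close> for the increment of
  \<open>g\<close> along h w, then in direction \<open>w\<close> for the derivative along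
  \<open>v\<close>.\<close>

lemma second_difference_mvt:
  fixes g :: "'b::real_normed_vector \<Rightarrow> real"
  assumes h: "h > 0" and S: "\<And>s t. 0 \<le> s \<Longrightarrow> s \<le> h \<Longrightarrow> 0 \<le> t \<Longrightarrow> t \<le> h \<Longrightarrow> x + s *\<^sub>R v + t *\<^sub>R w \<in> S"
    and g: "\<And>y. y \<in> S \<Longrightarrow> g differentiable (at y)"
    and gv: "\<And>y. y \<in> S \<Longrightarrow> (\<lambda>z. frechet_derivative g (at z) v) differentiable (at y)"
  shows "\<exists>s t. 0 < s \<and> s < h \<and> 0 < t \<and> t < h \<and>
    g (x + h *\<^sub>R v + h *\<^sub>R w) - g (x + h *\<^sub>R v) - g (x + h *\<^sub>R w) + g x =
    h * h * frechet_derivative (\<lambda>z. frechet_derivative g (at z) v) (at (x + s *\<^sub>R v + t *\<^sub>R w)) w"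
proof -
  let ?gv = "\<lambda>z. frechet_derivative g (at z) v"
  define \<phi> where "\<phi> s = g ((x + h *\<^sub>R w) + s *\<^sub>R v) - g (x + s *\<^sub>R v)" for s
  have "DERIV \<phi> s :> ?gv ((x + h *\<^sub>R w) + s *\<^sub>R v) - ?gv (x + s *\<^sub>R v)" if "0 \<le> s" "s \<le> h" for s
  proof -
    have 1: "(x + h *\<^sub>R w) + s *\<^sub>R v \<in> S" using S[of s h] that h by (simp add: algebra_simps)
    have 2: "x + s *\<^sub>R v \<in> S" using S[of s 0] that h by simp
    show ?thesis
      unfolding \<phi>_def
      by (intro DERIV_diff; unfold has_real_derivative_iff_has_vector_derivative)
        (intro has_derivative_line g 1 2)+
  qed
  from MVT2[OF h this] obtain s where s: "0 < s" "s < h"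
    and \<phi>s: "\<phi> h - \<phi> 0 = (h - 0) * (?gv ((x + h *\<^sub>R w) + s *\<^sub>R v) - ?gv (x + s *\<^sub>R v))" by blast
  have "DERIV (\<lambda>t. ?gv ((x + s *\<^sub>R v) + t *\<^sub>R w)) t :> frechet_derivative ?gv (at ((x + s *\<^sub>R v) + t *\<^sub>R w)) w"
    if "0 \<le> t" "t \<le> h" for t
    unfolding has_real_derivative_iff_has_vector_derivative
    by (intro has_derivative_line gv S) (use s that in auto)
  from MVT2[OF h this] obtain t where t: "0 < t" "t < h"
    and "?gv (x + s *\<^sub>R v + h *\<^sub>R w) - ?gv (x + s *\<^sub>R v + 0 *\<^sub>R w) =
      (h - 0) * frechet_derivative ?gv (at (x + s *\<^sub>R v + t *\<^sub>R w)) w" by blast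
  then have "\<phi> h - \<phi> 0 = h * h * frechet_derivative ?gv (at (x + s *\<^sub>R v + t *\<^sub>R w)) w"
    unfolding \<phi>s by (simp add: algebra_simps)
  then show ?thesis using s t
    by (intro exI[of _ s] exI[of _ t]) (simp add: \<phi>_def algebra_simps)
qed

text \<open>The second difference is symmetric in \<open>v\<close> and \<open>w\<close>, so the two
  mixed derivatives take equal values at points arbitrarily near \<open>x\<close>; continuity does
  the rest.\<close>

lemma schwarz_real:
  fixes g :: "'b::real_normed_vector \<Rightarrow> real"
  assumes S: "open S" "x \<in> S"
    and g: "\<And>y. y \<in> S \<Longrightarrow> g differentiable (at y)"
    and gv: "\<And>y. y \<in> S \<Longrightarrow> (\<lambda>z. frechet_derivative g (at z) v) differentiable (at y)"
    and gw: "\<And>y. y \<in> S \<Longrightarrow> (\<lambda>z. frechet_derivative g (at z) w) differentiable (at y)"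
    and c1: "isCont (\<lambda>y. frechet_derivative (\<lambda>z. frechet_derivative g (at z) v) (at y) w) x"
    and c2: "isCont (\<lambda>y. frechet_derivative (\<lambda>z. frechet_derivative g (at z) w) (at y) v) x"
  shows "frechet_derivative (\<lambda>z. frechet_derivative g (at z) v) (at x) w =
    frechet_derivative (\<lambda>z. frechet_derivative g (at z) w) (at x) v" (is "?A x = ?B x")
proof (rule ccontr)
  assume neq: "?A x \<noteq> ?B x"
  define \<epsilon> where "\<epsilon> = \<bar>?A x - ?B x\<bar> / 2"
  have \<epsilon>: "\<epsilon> > 0" using neq by (simp add: \<epsilon>_def)
  obtain d1 where d1: "d1 > 0" "\<And>y. dist y x < d1 \<Longrightarrow> \<bar>?A y - ?A x\<bar> < \<epsilon>"
    using c1 \<epsilon> unfolding continuous_at_eps_delta dist_real_def by blast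
  obtain d2 where d2: "d2 > 0" "\<And>y. dist y x < d2 \<Longrightarrow> \<bar>?B y - ?B x\<bar> < \<epsilon>"
    using c2 \<epsilon> unfolding continuous_at_eps_delta dist_real_def by blast
  obtain d3 where d3: "d3 > 0" "\<And>y. dist y x < d3 \<Longrightarrow> y \<in> S"
    using S unfolding open_dist by blast
  define d where "d = min d1 (min d2 d3)"
  define h where "h = d / (norm v + norm w + 1) / 2"
  have d: "d > 0" using d1 d2 d3 by (simp add: d_def)
  have nv: "norm v + norm w + 1 > 0" by (simp add: add_nonneg_pos)
  have h: "h > 0" using d nv by (simp add: h_def)
  have near: "dist (x + s *\<^sub>R v + t *\<^sub>R w) x < d" if "0 \<le> s" "s \<le> h" "0 \<le> t" "t \<le> h" for s t
  proof -
    have "dist (x + s *\<^sub>R v + t *\<^sub>R w) x = norm (s *\<^sub>R v + t *\<^sub>R w)" by (simp add: dist_norm add.assoc)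
    also have "\<dots> \<le> s * norm v + t * norm w" using norm_triangle_ineq[of "s *\<^sub>R v" "t *\<^sub>R w"] that by simp
    also have "\<dots> \<le> h * norm v + h * norm w" using that by (intro add_mono mult_right_mono) auto
    also have "\<dots> \<le> h * (norm v + norm w + 1)" using h by (simp add: algebra_simps)
    also have "\<dots> = d / 2" using nv by (simp add: h_def field_simps)
    also have "\<dots> < d" using d by simp
    finally show ?thesis .
  qed
  have inS: "x + s *\<^sub>R v + t *\<^sub>R w \<in> S" if "0 \<le> s" "s \<le> h" "0 \<le> t" "t \<le> h" for s t
    using near[OF that] d3(2) by (simp add: d_def)
  have inS': "x + s *\<^sub>R w + t *\<^sub>R v \<in> S" if "0 \<le> s" "s \<le> h" "0 \<le> t" "t \<le> h" for s t
    using inS[OF that(3,4,1,2)] by (simp add: algebra_simps)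
  obtain s t where st: "0 < s" "s < h" "0 < t" "t < h"
    and 1: "g (x + h *\<^sub>R v + h *\<^sub>R w) - g (x + h *\<^sub>R v) - g (x + h *\<^sub>R w) + g x = h * h * ?A (x + s *\<^sub>R v + t *\<^sub>R w)"
    using second_difference_mvt[OF h inS g gv] by blast
  obtain s' t' where st': "0 < s'" "s' < h" "0 < t'" "t' < h"
    and 2: "g (x + h *\<^sub>R w + h *\<^sub>R v) - g (x + h *\<^sub>R w) - g (x + h *\<^sub>R v) + g x = h * h * ?B (x + s' *\<^sub>R w + t' *\<^sub>R v)"
    using second_difference_mvt[OF h inS' g gw] by blast
  have swap: "x + h *\<^sub>R w + h *\<^sub>R v = x + h *\<^sub>R v + h *\<^sub>R w" by (simp add: algebra_simps)
  have "h * h * ?A (x + s *\<^sub>R v + t *\<^sub>R w) = h * h * ?B (x + s' *\<^sub>R w + t' *\<^sub>R v)"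
    using 1 2[unfolded swap] by linarith
  then have eq: "?A (x + s *\<^sub>R v + t *\<^sub>R w) = ?B (x + s' *\<^sub>R w + t' *\<^sub>R v)" using h by simp
  have "dist (x + s *\<^sub>R v + t *\<^sub>R w) x < d" using near[of s t] st by simp
  then have "\<bar>?A (x + s *\<^sub>R v + t *\<^sub>R w) - ?A x\<bar> < \<epsilon>" using d1(2) by (simp add: d_def)
  moreover have "dist (x + s' *\<^sub>R w + t' *\<^sub>R v) x < d" using near[of t' s'] st' by (simp add: algebra_simps)
  then have "\<bar>?B (x + s' *\<^sub>R w + t' *\<^sub>R v) - ?B x\<bar> < \<epsilon>" using d2(2) by (simp add: d_def)
  ultimately have "\<bar>?A x - ?B x\<bar> < 2 * \<epsilon>" using eq by linarith
  then show False by (simp add: \<epsilon>_def)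
qed

lemma frechet_derivative_bounded_linear_comp:
  assumes "bounded_linear L" "g differentiable (at x)"
  shows "frechet_derivative (\<lambda>x. L (g x)) (at x) v = L (frechet_derivative g (at x) v)"
    "(\<lambda>x. L (g x)) differentiable (at x)"
proof -
  have "((\<lambda>x. L (g x)) has_derivative (\<lambda>v. L (frechet_derivative g (at x) v))) (at x)"
    using bounded_linear.has_derivative[OF assms(1)] assms(2) frechet_derivative_works by blast
  then show "frechet_derivative (\<lambda>x. L (g x)) (at x) v = L (frechet_derivative g (at x) v)"
    "(\<lambda>x. L (g x)) differentiable (at x)"
    by (auto intro: frechet_derivative_eqI simp: differentiable_def)
qed

lemma frechet_derivative_cong_open:
  assumes "open S" "x \<in> S" "\<And>y. y \<in> S \<Longrightarrow> f y = g y"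
  shows "frechet_derivative f (at x) = frechet_derivative g (at x)"
proof -
  have "(f has_derivative D) (at x) \<longleftrightarrow> (g has_derivative D) (at x)" for D
    using has_derivative_transform_within_open[of f D x UNIV S g]
      has_derivative_transform_within_open[of g D x UNIV S f] assms by auto
  then show ?thesis unfolding frechet_derivative_def by simp
qed

lemma differentiable_cong_open:
  assumes "open S" "x \<in> S" "\<And>y. y \<in> S \<Longrightarrow> f y = g y" "f differentiable (at x)"
  shows "g differentiable (at x)"
  using assms has_derivative_transform_within_open[of f _ x UNIV S g] unfolding differentiable_def by blast

text \<open>Mean values are available for real functions only, hence the passage through real and
  imaginary parts.\<close>

lemma schwarz_complex:
  fixes g :: "'b::real_normed_vector \<Rightarrow> complex"
  assumes S: "open S" "x \<in> S"
    and g: "\<And>y. y \<in> S \<Longrightarrow> g differentiable (at y)"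
    and gv: "\<And>y. y \<in> S \<Longrightarrow> (\<lambda>z. frechet_derivative g (at z) v) differentiable (at y)"
    and gw: "\<And>y. y \<in> S \<Longrightarrow> (\<lambda>z. frechet_derivative g (at z) w) differentiable (at y)"
    and c1: "isCont (\<lambda>y. frechet_derivative (\<lambda>z. frechet_derivative g (at z) v) (at y) w) x"
    and c2: "isCont (\<lambda>y. frechet_derivative (\<lambda>z. frechet_derivative g (at z) w) (at y) v) x"
  shows "frechet_derivative (\<lambda>z. frechet_derivative g (at z) v) (at x) w =
    frechet_derivative (\<lambda>z. frechet_derivative g (at z) w) (at x) v"
proof -
  have L: "L (frechet_derivative (\<lambda>z. frechet_derivative g (at z) v) (at x) w) =
    L (frechet_derivative (\<lambda>z. frechet_derivative g (at z) w) (at x) v)"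
    if L: "bounded_linear L" for L :: "complex \<Rightarrow> real"
  proof -
    have d1: "frechet_derivative (\<lambda>x. L (g x)) (at y) u = L (frechet_derivative g (at y) u)" if "y \<in> S" for y u
      by (rule frechet_derivative_bounded_linear_comp(1)[OF L g[OF that]])
    have d2: "frechet_derivative (\<lambda>z. frechet_derivative (\<lambda>x. L (g x)) (at z) u) (at y) u' =
        L (frechet_derivative (\<lambda>z. frechet_derivative g (at z) u) (at y) u')"
      "(\<lambda>z. frechet_derivative (\<lambda>x. L (g x)) (at z) u) differentiable (at y)"
      if "y \<in> S" "(\<lambda>z. frechet_derivative g (at z) u) differentiable (at y)" for y u u'
    proof -
      have "frechet_derivative (\<lambda>z. frechet_derivative (\<lambda>x. L (g x)) (at z) u) (at y) =
          frechet_derivative (\<lambda>z. L (frechet_derivative g (at z) u)) (at y)"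
        by (rule frechet_derivative_cong_open[OF S(1) that(1) d1])
      then show "frechet_derivative (\<lambda>z. frechet_derivative (\<lambda>x. L (g x)) (at z) u) (at y) u' =
        L (frechet_derivative (\<lambda>z. frechet_derivative g (at z) u) (at y) u')"
        using frechet_derivative_bounded_linear_comp(1)[OF L that(2)] by simp
      show "(\<lambda>z. frechet_derivative (\<lambda>x. L (g x)) (at z) u) differentiable (at y)"
        by (rule differentiable_cong_open[OF S(1) that(1) _ frechet_derivative_bounded_linear_comp(2)[OF L that(2)]])
          (simp add: d1)
    qed
    have ev: "eventually (\<lambda>y. y \<in> S) (nhds x)" using S eventually_nhds by blast
    have cont: "isCont (\<lambda>y. frechet_derivative (\<lambda>z. frechet_derivative (\<lambda>x. L (g x)) (at z) u) (at y) u') x"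
      if "\<And>y. y \<in> S \<Longrightarrow> (\<lambda>z. frechet_derivative g (at z) u) differentiable (at y)"
        "isCont (\<lambda>y. frechet_derivative (\<lambda>z. frechet_derivative g (at z) u) (at y) u') x" for u u'
    proof -
      have "isCont (\<lambda>y. L (frechet_derivative (\<lambda>z. frechet_derivative g (at z) u) (at y) u')) x"
        by (rule bounded_linear.isCont[OF L that(2)])
      then show ?thesis
        by (rule isCont_cong[THEN iffD1, rotated]) (rule eventually_mono[OF ev], simp add: d2(1) that(1))
    qed
    have "frechet_derivative (\<lambda>z. frechet_derivative (\<lambda>x. L (g x)) (at z) v) (at x) w =
        frechet_derivative (\<lambda>z. frechet_derivative (\<lambda>x. L (g x)) (at z) w) (at x) v"
      by (rule schwarz_real[OF S]) (auto intro!: frechet_derivative_bounded_linear_comp(2)[OF L] g d2(2) gv gw cont c1 c2)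
    then show ?thesis by (simp add: d2(1) S gv gw)
  qed
  show ?thesis
    using L[OF bounded_linear_Re] L[OF bounded_linear_Im] by (rule complex_eqI)
qed

context
  fixes S :: "'b::euclidean_space set"
  assumes S: "open S"
begin

lemma iterated_deriv_cong:
  assumes "\<And>y. y \<in> S \<Longrightarrow> f y = g y" "x \<in> S"
  shows "iterated_deriv vs f x = iterated_deriv vs g x"
  using assms(2)
proof (induction vs arbitrary: x)
  case (Cons v vs)
  then show ?case by (simp add: frechet_derivative_cong_open[OF S Cons.prems Cons.IH])
qed (use assms(1) in simp)

context
  fixes f
  assumes f: "smooth_function_on S f"
begin

lemma iterated_deriv_differentiable: "x \<in> S \<Longrightarrow> iterated_deriv vs f differentiable (at x)"
  using f unfolding smooth_function_on_def by blast

lemma iterated_deriv_swap: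
  assumes "x \<in> S"
  shows "iterated_deriv (v # w # vs) f x = iterated_deriv (w # v # vs) f x"
proof -
  have cont: "isCont (iterated_deriv us f) x" for us
    using iterated_deriv_differentiable[OF assms] by (rule differentiable_imp_continuous_within)
  show ?thesis
    unfolding iterated_deriv.simps
    using schwarz_complex[OF S assms, of "iterated_deriv vs f" w v]
      iterated_deriv_differentiable[of _ vs] iterated_deriv_differentiable[of _ "v # vs"]
      iterated_deriv_differentiable[of _ "w # vs"] cont[of "v # w # vs"] cont[of "w # v # vs"] by simp
qed

lemma iterated_deriv_move:
  assumes "x \<in> S"
  shows "iterated_deriv (us @ v # vs) f x = iterated_deriv (v # us @ vs) f x"
  using assms
proof (induction us arbitrary: x)
  case (Cons u us)
  have "iterated_deriv ((u # us) @ v # vs) f x = iterated_deriv (u # v # us @ vs) f x"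
    using frechet_derivative_cong_open[OF S Cons.prems Cons.IH] by simp
  then show ?case using iterated_deriv_swap[OF Cons.prems, of u v "us @ vs"] by simp
qed simp

text \<open>\<open>multi_deriv\<close> picks an unspecified order of the partial derivatives; on
  smooth functions any order may be used instead.\<close>

lemma iterated_deriv_mset:
  assumes "mset vs = mset ws" "x \<in> S"
  shows "iterated_deriv vs f x = iterated_deriv ws f x"
  using assms
proof (induction vs arbitrary: ws x)
  case (Cons v vs)
  have "v \<in> set ws" using mset_eq_setD[OF Cons.prems(1)] by auto
  then obtain us us' where ws: "ws = us @ v # us'" by (meson split_list)
  have "mset vs = mset (us @ us')" using Cons.prems(1) by (simp add: ws)
  then have "iterated_deriv vs f y = iterated_deriv (us @ us') f y" if "y \<in> S" for y
    using Cons.IH that by blast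
  then have "iterated_deriv (v # vs) f x = iterated_deriv (v # us @ us') f x"
    using frechet_derivative_cong_open[OF S Cons.prems(2), of "iterated_deriv vs f" "iterated_deriv (us @ us') f"] by simp
  then show ?case unfolding ws using iterated_deriv_move[OF Cons.prems(2)] by simp
qed simp

lemma multi_deriv_eq:
  assumes "mset vs = \<alpha>" "x \<in> S"
  shows "multi_deriv \<alpha> f x = iterated_deriv vs f x"
proof -
  have "mset (SOME vs. mset vs = \<alpha>) = \<alpha>" by (rule someI[of _ vs]) (rule assms(1))
  then show ?thesis unfolding multi_deriv_def using assms by (intro iterated_deriv_mset) simp_all
qed

lemma multi_deriv_differentiable:
  assumes "x \<in> S"
  shows "multi_deriv \<alpha> f differentiable (at x)"
  unfolding multi_deriv_def by (rule iterated_deriv_differentiable[OF assms])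

lemma frechet_derivative_multi_deriv:
  assumes "x \<in> S"
  shows "frechet_derivative (multi_deriv \<alpha> f) (at x) v = (\<Sum>b\<in>Basis. of_real (v \<bullet> b) * multi_deriv (add_mset b \<alpha>) f x)"
proof -
  obtain vs where vs: "mset vs = \<alpha>" using ex_mset by blast
  have lin: "linear (frechet_derivative (multi_deriv \<alpha> f) (at x))"
    by (rule linear_frechet_derivative[OF multi_deriv_differentiable[OF assms]])
  have key: "frechet_derivative (multi_deriv \<alpha> f) (at x) b = multi_deriv (add_mset b \<alpha>) f x" for b
  proof -
    have "frechet_derivative (multi_deriv \<alpha> f) (at x) = frechet_derivative (iterated_deriv vs f) (at x)"
      by (rule frechet_derivative_cong_open[OF S assms]) (rule multi_deriv_eq[OF vs])
    then show ?thesis using multi_deriv_eq[of "b # vs" "add_mset b \<alpha>" x] vs assms by simp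
  qed
  have "frechet_derivative (multi_deriv \<alpha> f) (at x) v =
      frechet_derivative (multi_deriv \<alpha> f) (at x) (\<Sum>b\<in>Basis. (v \<bullet> b) *\<^sub>R b)"
    by (simp only: euclidean_representation)
  also have "\<dots> = (\<Sum>b\<in>Basis. (v \<bullet> b) *\<^sub>R frechet_derivative (multi_deriv \<alpha> f) (at x) b)"
    by (simp only: linear_sum[OF lin] linear_scale[OF lin])
  finally show ?thesis by (simp add: key scaleR_conv_of_real)
qed

end

end

subsection \<open>The Leibniz rule for powers\<close>

definition multi_indices :: "nat \<Rightarrow> 'b::euclidean_space multiset set" where
  "multi_indices n = {\<alpha>. set_mset \<alpha> \<subseteq> Basis \<and> size \<alpha> \<le> n}"

lemma finite_multi_indices: "finite (multi_indices n :: 'b::euclidean_space multiset set)"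
proof (rule finite_surj)
  show "finite {vs::'b list. set vs \<subseteq> Basis \<and> length vs \<le> n}"
    by (rule finite_lists_length_le[OF finite_Basis])
  show "multi_indices n \<subseteq> mset ` {vs::'b list. set vs \<subseteq> Basis \<and> length vs \<le> n}"
  proof
    fix \<alpha> :: "'b multiset" assume "\<alpha> \<in> multi_indices n"
    moreover obtain vs where "mset vs = \<alpha>" using ex_mset by blast
    ultimately show "\<alpha> \<in> mset ` {vs. set vs \<subseteq> Basis \<and> length vs \<le> n}"
      by (intro image_eqI[of _ _ vs]) (auto simp: multi_indices_def)
  qed
qed

text \<open>If \<open>\<partial>\<^sub>v h\<^sub>k = a k v \<cdot> h\<^sub>k\<^sub>+\<^sub>1\<close> and \<open>h\<^sub>k = m \<cdot> h\<^sub>k\<^sub>+\<^sub>1\<close> then \<open>lcoeff\<close> collects the coefficients of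
  \<open>f \<mapsto> \<partial>\<^bsub>vs\<^esub> (h\<^sub>0 f) / h\<^bsub>length vs\<^esub>\<close>.\<close>

primrec lcoeff :: "(nat \<Rightarrow> 'b \<Rightarrow> 'b \<Rightarrow> complex) \<Rightarrow> ('b \<Rightarrow> complex) \<Rightarrow> 'b::euclidean_space list \<Rightarrow>
    'b multiset \<Rightarrow> 'b \<Rightarrow> complex" where
  "lcoeff a m [] = (\<lambda>\<alpha> x. if \<alpha> = {#} then 1 else 0)"
| "lcoeff a m (v # vs) = (\<lambda>\<alpha> x. a (length vs) v x * lcoeff a m vs \<alpha> x +
     m x * (frechet_derivative (lcoeff a m vs \<alpha>) (at x) v +
       (\<Sum>b\<in>Basis. if b \<in># \<alpha> then of_real (v \<bullet> b) * lcoeff a m vs (\<alpha> - {#b#}) x else 0)))"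

lemma lcoeff_support: "\<alpha> \<notin> multi_indices (length vs) \<Longrightarrow> lcoeff a m vs \<alpha> x = 0"
proof (induction vs arbitrary: \<alpha> x)
  case Nil
  then show ?case by (auto simp: multi_indices_def)
next
  case (Cons v vs)
  have n: "\<alpha> \<notin> multi_indices (length vs)" using Cons.prems by (auto simp: multi_indices_def)
  then have "lcoeff a m vs \<alpha> = (\<lambda>x. 0)" using Cons.IH by blast
  moreover have "lcoeff a m vs (\<alpha> - {#b#}) x = 0" if "b \<in> Basis" "b \<in># \<alpha>" for b
  proof (rule Cons.IH)
    show "\<alpha> - {#b#} \<notin> multi_indices (length vs)"
    proof
      assume "\<alpha> - {#b#} \<in> multi_indices (length vs)"
      then have "set_mset (\<alpha> - {#b#}) \<subseteq> Basis" "size (\<alpha> - {#b#}) \<le> length vs"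
        by (auto simp: multi_indices_def)
      moreover have "\<alpha> = add_mset b (\<alpha> - {#b#})" using that(2) by simp
      then have "set_mset \<alpha> = insert b (set_mset (\<alpha> - {#b#}))" "size \<alpha> = Suc (size (\<alpha> - {#b#}))"
        by (metis set_mset_add_mset_insert, metis size_add_mset)
      ultimately have "\<alpha> \<in> multi_indices (Suc (length vs))" using that(1) by (simp add: multi_indices_def)
      then show False using Cons.prems by simp
    qed
  qed
  ultimately show ?case by (auto simp: frechet_derivative_const intro!: sum.neutral)
qed

lemma sum_multi_index_shift:
  fixes C M :: "'b::euclidean_space multiset \<Rightarrow> complex"
  assumes b: "b \<in> Basis" and C: "\<And>\<alpha>. \<alpha> \<notin> multi_indices n \<Longrightarrow> C \<alpha> = 0"
  shows "(\<Sum>\<alpha>\<in>multi_indices n. C \<alpha> * M (add_mset b \<alpha>)) =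
    (\<Sum>\<alpha>\<in>multi_indices (Suc n). if b \<in># \<alpha> then C (\<alpha> - {#b#}) * M \<alpha> else 0)"
proof -
  have "(\<Sum>\<alpha>\<in>multi_indices n. C \<alpha> * M (add_mset b \<alpha>)) =
      (\<Sum>\<alpha>\<in>add_mset b ` multi_indices n. C (\<alpha> - {#b#}) * M \<alpha>)"
    by (subst sum.reindex) (auto simp: inj_on_def)
  also have "\<dots> = (\<Sum>\<alpha>\<in>add_mset b ` multi_indices n. if b \<in># \<alpha> then C (\<alpha> - {#b#}) * M \<alpha> else 0)"
    by (intro sum.cong) auto
  also have "\<dots> = (\<Sum>\<alpha>\<in>multi_indices (Suc n). if b \<in># \<alpha> then C (\<alpha> - {#b#}) * M \<alpha> else 0)"
  proof (rule sum.mono_neutral_left)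
    show "add_mset b ` multi_indices n \<subseteq> multi_indices (Suc n)" using b by (auto simp: multi_indices_def)
    show "\<forall>\<alpha>\<in>multi_indices (Suc n) - add_mset b ` multi_indices n. (if b \<in># \<alpha> then C (\<alpha> - {#b#}) * M \<alpha> else 0) = 0"
    proof
      fix \<alpha> assume \<alpha>: "\<alpha> \<in> multi_indices (Suc n) - add_mset b ` multi_indices n"
      show "(if b \<in># \<alpha> then C (\<alpha> - {#b#}) * M \<alpha> else 0) = 0"
      proof (cases "b \<in># \<alpha>")
        case True
        then have "\<alpha> - {#b#} \<notin> multi_indices n" using \<alpha> by (metis Diff_iff image_eqI insert_DiffM)
        then show ?thesis using C by simp
      qed simp
    qed
  qed (rule finite_multi_indices)
  finally show ?thesis .
qed

text \<open>Each derivative moves one step down the ladder \<open>h\<close>: a derivative of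
  \<open>h k\<close> does so by \<open>h'\<close>, and in the other terms \<open>hm\<close> supplies
  the factor \<open>m\<close>. The ladder in view consists of the powers of det \<xi> and det
  \<zeta> with exponents s - k and t - k.\<close>

lemma iterated_deriv_power_mult:
  fixes f :: "'b::euclidean_space \<Rightarrow> complex"
  assumes S: "open S" and f: "smooth_function_on S f"
    and h: "\<And>k x. x \<in> S \<Longrightarrow> h k differentiable (at x)"
    and h': "\<And>k x v. x \<in> S \<Longrightarrow> frechet_derivative (h k) (at x) v = a k v x * h (Suc k) x"
    and hm: "\<And>k x. x \<in> S \<Longrightarrow> h k x = m x * h (Suc k) x"
    and lc: "\<And>vs \<alpha> x. x \<in> S \<Longrightarrow> lcoeff a m vs \<alpha> differentiable (at x)"
    and x: "x \<in> S"
  shows "iterated_deriv vs (\<lambda>x. h 0 x * f x) x =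
    h (length vs) x * (\<Sum>\<alpha>\<in>multi_indices (length vs). lcoeff a m vs \<alpha> x * multi_deriv \<alpha> f x)"
  using x
proof (induction vs arbitrary: x)
  case Nil
  have "(multi_indices 0 :: 'b multiset set) = {{#}}" by (auto simp: multi_indices_def)
  then show ?case using multi_deriv_eq[OF S f, of "[]" "{#}"] Nil by simp
next
  case (Cons v vs)
  let ?n = "length vs"
  let ?L = "lcoeff a m vs"
  let ?M = "\<lambda>\<alpha>. multi_deriv \<alpha> f x"
  have md: "multi_deriv \<alpha> f differentiable (at x)" for \<alpha>
    by (rule multi_deriv_differentiable[OF S f Cons.prems])
  have LM: "(\<lambda>x. ?L \<alpha> x * multi_deriv \<alpha> f x) differentiable (at x)" for \<alpha>
    by (intro differentiable_mult lc md Cons.prems)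
  have sumd: "(\<lambda>x. \<Sum>\<alpha>\<in>multi_indices ?n. ?L \<alpha> x * multi_deriv \<alpha> f x) differentiable (at x)"
    by (rule differentiable_sum[OF finite_multi_indices]) (use LM in blast)
  have "iterated_deriv (v # vs) (\<lambda>x. h 0 x * f x) x =
      frechet_derivative (\<lambda>x. h ?n x * (\<Sum>\<alpha>\<in>multi_indices ?n. ?L \<alpha> x * multi_deriv \<alpha> f x)) (at x) v"
    using frechet_derivative_cong_open[OF S Cons.prems Cons.IH] by simp
  also have "\<dots> = h ?n x * (\<Sum>\<alpha>\<in>multi_indices ?n. frechet_derivative (\<lambda>x. ?L \<alpha> x * multi_deriv \<alpha> f x) (at x) v)
      + a ?n v x * h (Suc ?n) x * (\<Sum>\<alpha>\<in>multi_indices ?n. ?L \<alpha> x * ?M \<alpha>)"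
    using frechet_derivative_mult'[OF h[OF Cons.prems, of ?n] sumd]
      frechet_derivative_sum'[of "multi_indices ?n" "\<lambda>\<alpha> x. ?L \<alpha> x * multi_deriv \<alpha> f x" x v] LM
    by (simp add: h'[OF Cons.prems])
  also have "(\<Sum>\<alpha>\<in>multi_indices ?n. frechet_derivative (\<lambda>x. ?L \<alpha> x * multi_deriv \<alpha> f x) (at x) v) =
      (\<Sum>\<alpha>\<in>multi_indices ?n. frechet_derivative (?L \<alpha>) (at x) v * ?M \<alpha>) +
      (\<Sum>b\<in>Basis. of_real (v \<bullet> b) * (\<Sum>\<alpha>\<in>multi_indices ?n. ?L \<alpha> x * ?M (add_mset b \<alpha>)))"
  proof -
    have "frechet_derivative (\<lambda>x. ?L \<alpha> x * multi_deriv \<alpha> f x) (at x) v =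
        frechet_derivative (?L \<alpha>) (at x) v * ?M \<alpha> +
        (\<Sum>b\<in>Basis. of_real (v \<bullet> b) * (?L \<alpha> x * ?M (add_mset b \<alpha>)))" for \<alpha>
      using frechet_derivative_mult'[OF lc[OF Cons.prems] md, of vs \<alpha> \<alpha> v]
        frechet_derivative_multi_deriv[OF S f Cons.prems, of \<alpha> v]
      by (simp add: sum_distrib_left mult_ac)
    then show ?thesis
      by (simp add: sum.distrib sum_distrib_left) (rule sum.swap)
  qed
  also have "(\<Sum>\<alpha>\<in>multi_indices ?n. frechet_derivative (?L \<alpha>) (at x) v * ?M \<alpha>) =
      (\<Sum>\<alpha>\<in>multi_indices (Suc ?n). frechet_derivative (?L \<alpha>) (at x) v * ?M \<alpha>)"
  proof (rule sum.mono_neutral_left[OF finite_multi_indices])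
    show "\<forall>\<alpha>\<in>multi_indices (Suc ?n) - multi_indices ?n. frechet_derivative (?L \<alpha>) (at x) v * ?M \<alpha> = 0"
    proof
      fix \<alpha> :: "'b multiset" assume "\<alpha> \<in> multi_indices (Suc ?n) - multi_indices ?n"
      then have "?L \<alpha> = (\<lambda>x. 0)" using lcoeff_support[of \<alpha> vs] by blast
      then show "frechet_derivative (?L \<alpha>) (at x) v * ?M \<alpha> = 0" by (simp add: frechet_derivative_const)
    qed
  qed (auto simp: multi_indices_def)
  also have "(\<Sum>b\<in>Basis. of_real (v \<bullet> b) * (\<Sum>\<alpha>\<in>multi_indices ?n. ?L \<alpha> x * ?M (add_mset b \<alpha>))) =
      (\<Sum>\<alpha>\<in>multi_indices (Suc ?n). (\<Sum>b\<in>Basis. if b \<in># \<alpha> then of_real (v \<bullet> b) * ?L (\<alpha> - {#b#}) x else 0) * ?M \<alpha>)"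
  proof -
    have "(\<Sum>b\<in>Basis. of_real (v \<bullet> b) * (\<Sum>\<alpha>\<in>multi_indices ?n. ?L \<alpha> x * ?M (add_mset b \<alpha>))) =
        (\<Sum>b\<in>Basis. \<Sum>\<alpha>\<in>multi_indices (Suc ?n). of_real (v \<bullet> b) * (if b \<in># \<alpha> then ?L (\<alpha> - {#b#}) x * ?M \<alpha> else 0))"
    proof (rule sum.cong[OF refl])
      fix b :: 'b assume "b \<in> Basis"
      then show "of_real (v \<bullet> b) * (\<Sum>\<alpha>\<in>multi_indices ?n. ?L \<alpha> x * ?M (add_mset b \<alpha>)) =
          (\<Sum>\<alpha>\<in>multi_indices (Suc ?n). of_real (v \<bullet> b) * (if b \<in># \<alpha> then ?L (\<alpha> - {#b#}) x * ?M \<alpha> else 0))"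
        using sum_multi_index_shift[of b ?n "\<lambda>\<alpha>. ?L \<alpha> x" ?M] lcoeff_support[of _ vs]
        by (simp add: sum_distrib_left)
    qed
    also have "\<dots> = (\<Sum>\<alpha>\<in>multi_indices (Suc ?n). \<Sum>b\<in>Basis. of_real (v \<bullet> b) * (if b \<in># \<alpha> then ?L (\<alpha> - {#b#}) x * ?M \<alpha> else 0))"
      by (rule sum.swap)
    also have "\<dots> = (\<Sum>\<alpha>\<in>multi_indices (Suc ?n). (\<Sum>b\<in>Basis. if b \<in># \<alpha> then of_real (v \<bullet> b) * ?L (\<alpha> - {#b#}) x else 0) * ?M \<alpha>)"
      by (intro sum.cong refl) (auto simp: sum_distrib_right intro!: sum.cong)
    finally show ?thesis .
  qed
  also have "(\<Sum>\<alpha>\<in>multi_indices ?n. ?L \<alpha> x * ?M \<alpha>) = (\<Sum>\<alpha>\<in>multi_indices (Suc ?n). ?L \<alpha> x * ?M \<alpha>)"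
    by (rule sum.mono_neutral_left[OF finite_multi_indices]) (auto simp: multi_indices_def intro!: lcoeff_support)
  also have "h ?n x = m x * h (Suc ?n) x" by (rule hm[OF Cons.prems])
  finally show ?case
    by (simp add: sum.distrib sum_distrib_left distrib_left distrib_right mult_ac)
qed

section \<open>Comparison of coefficients\<close>

abbreviation mon :: "('i \<Rightarrow> real) \<Rightarrow> 'i multiset \<Rightarrow> real" where
  "mon y \<alpha> \<equiv> \<Prod>b\<in>#\<alpha>. y b"

lemma complex_poly_eq_0_if_real_zeros:
  fixes p :: "complex poly"
  assumes "\<And>t::real. poly p (of_real t) = 0"
  shows "p = 0"
proof (rule ccontr)
  assume "p \<noteq> 0"
  then have "finite {z. poly p z = 0}" by (rule poly_roots_finite)
  moreover have "range (of_real :: real \<Rightarrow> complex) \<subseteq> {z. poly p z = 0}" using assms by auto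
  moreover have "infinite (range (of_real :: real \<Rightarrow> complex))"
    using finite_imageD[of of_real "UNIV :: real set"] by (auto simp: inj_on_def infinite_UNIV_char_0)
  ultimately show False using finite_subset by blast
qed

text \<open>Induction over the variables: as a polynomial in the value at \<open>b\<close>, the sum
  has coefficients that are sums of monomials in the remaining variables.\<close>

lemma mon_independent:
  fixes k :: "'i multiset \<Rightarrow> complex"
  assumes "finite B" "finite A" "\<And>\<alpha>. \<alpha> \<in> A \<Longrightarrow> set_mset \<alpha> \<subseteq> B"
    and "\<And>y. (\<Sum>\<alpha>\<in>A. k \<alpha> * of_real (mon y \<alpha>)) = 0" and "\<alpha> \<in> A"
  shows "k \<alpha> = 0"
  using assms
proof (induction B arbitrary: A k \<alpha>)
  case empty
  have "A = {{#}}" using empty.prems(2,4) by auto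
  then show ?case using empty.prems(3)[of "\<lambda>_. 1"] empty.prems(4) by simp
next
  case (insert b B)
  define fl where "fl \<beta> = filter_mset (\<lambda>c. c \<noteq> b) \<beta>" for \<beta> :: "'i multiset"
  define n where "n = count \<alpha> b"
  define An where "An = {\<beta> \<in> A. count \<beta> b = n}"
  have split: "\<beta> = fl \<beta> + replicate_mset (count \<beta> b) b" for \<beta>
    by (rule multiset_eqI) (auto simp: fl_def)
  have mon_upd: "mon (y(b := t)) \<beta> = mon y (fl \<beta>) * t ^ count \<beta> b" for y t \<beta>
  proof -
    have "mon (y(b := t)) \<beta> = mon (y(b := t)) (fl \<beta>) * t ^ count \<beta> b"
      by (subst split[of \<beta>]) (simp add: fl_def)
    also have "mon (y(b := t)) (fl \<beta>) = mon y (fl \<beta>)"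
      by (rule arg_cong[of _ _ prod_mset], rule image_mset_cong) (auto simp: fl_def)
    finally show ?thesis .
  qed
  have inj: "inj_on fl An"
  proof (rule inj_onI)
    fix \<beta> \<gamma> assume "\<beta> \<in> An" "\<gamma> \<in> An" "fl \<beta> = fl \<gamma>"
    then show "\<beta> = \<gamma>" using split[of \<beta>] split[of \<gamma>] by (simp add: An_def)
  qed
  have fin: "finite An" using insert.prems(1) by (simp add: An_def)
  have zero: "(\<Sum>\<beta>\<in>An. k \<beta> * of_real (mon y (fl \<beta>))) = 0" for y
  proof -
    define p where "p = (\<Sum>\<beta>\<in>A. monom (k \<beta> * of_real (mon y (fl \<beta>))) (count \<beta> b))"
    have "poly p (of_real t) = 0" for t :: real
      using insert.prems(3)[of "y(b := t)", unfolded mon_upd] by (simp add: p_def poly_sum poly_monom mult.assoc)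
    then have "p = 0" by (rule complex_poly_eq_0_if_real_zeros)
    then have "coeff p n = 0" by simp
    then have "(\<Sum>\<beta>\<in>A. if count \<beta> b = n then k \<beta> * of_real (mon y (fl \<beta>)) else 0) = 0"
      by (simp add: p_def coeff_sum)
    then show ?thesis unfolding An_def using insert.prems(1) by (subst (asm) sum.inter_filter[symmetric]) simp_all
  qed
  define k' where "k' \<gamma> = k (\<gamma> + replicate_mset n b)" for \<gamma>
  have kk': "k' (fl \<beta>) = k \<beta>" if "\<beta> \<in> An" for \<beta>
    using that split[of \<beta>] by (simp add: k'_def An_def)
  have "k' (fl \<alpha>) = 0"
  proof (rule insert.IH[of "fl ` An"])
    show "finite (fl ` An)" using fin by simp
    show "set_mset \<gamma> \<subseteq> B" if "\<gamma> \<in> fl ` An" for \<gamma>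
      using that insert.prems(2) by (fastforce simp: An_def fl_def)
    show "(\<Sum>\<gamma>\<in>fl ` An. k' \<gamma> * of_real (mon y \<gamma>)) = 0" for y
      using zero[of y] by (simp add: sum.reindex[OF inj] kk')
    show "fl \<alpha> \<in> fl ` An" using insert.prems(4) by (auto simp: An_def n_def)
  qed
  then show ?case using kk'[of \<alpha>] insert.prems(4) by (simp add: An_def n_def)
qed

text \<open>Solves for the \<open>c a\<close> without choosing interpolation points. Modulo
  multiples of \<open>c a0\<close> the induction hypothesis applies, so each other
  \<open>c b\<close> is an element \<open>u b\<close> of the subspace plus k b times
  \<open>c a0\<close>; independence then provides an x at which the total coefficient of
  \<open>c a0\<close> is nonzero.\<close>

lemma subspace_extraction:
  fixes c :: "'i \<Rightarrow> 'b \<Rightarrow> real" and U :: "('b \<Rightarrow> real) \<Rightarrow> bool"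
  assumes "finite A" and "U (\<lambda>_. 0)" and "\<And>f g. U f \<Longrightarrow> U g \<Longrightarrow> U (\<lambda>p. f p + g p)"
    and "\<And>a f. U f \<Longrightarrow> U (\<lambda>p. a * f p)"
    and "\<And>k. (\<And>x. x \<in> X \<Longrightarrow> (\<Sum>a\<in>A. k a * \<phi> a x) = 0) \<Longrightarrow> \<forall>a\<in>A. k a = 0"
    and "\<And>x. x \<in> X \<Longrightarrow> U (\<lambda>p. \<Sum>a\<in>A. \<phi> a x * c a p)"
    and "a \<in> A"
  shows "U (c a)"
  using assms
proof (induction A arbitrary: U a)
  case empty
  then show ?case by simp
next
  case (insert a0 A U)
  note U0 = insert.prems(1) and Uadd = insert.prems(2) and Umult = insert.prems(3)
    and indep = insert.prems(4) and hyp = insert.prems(5)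
  define U' where "U' f \<longleftrightarrow> (\<exists>u k. U u \<and> f = (\<lambda>p. u p + k * c a0 p))" for f
  have U'I: "U' f" if "U u" "f = (\<lambda>p. u p + k * c a0 p)" for f u k
    unfolding U'_def by (intro exI conjI) (rule that)+
  have "U' (c b)" if b: "b \<in> A" for b
  proof (rule insert.IH[of U'])
    show "U' (\<lambda>_. 0)" by (rule U'I[OF U0, of _ 0]) simp
    show "U' (\<lambda>p. f p + g p)" if fg: "U' f" "U' g" for f g
    proof -
      obtain u k u' k' where "U u" "f = (\<lambda>p. u p + k * c a0 p)" "U u'" "g = (\<lambda>p. u' p + k' * c a0 p)"
        using fg unfolding U'_def by blast
      then have "U (\<lambda>p. u p + u' p) \<and> (\<lambda>p. f p + g p) = (\<lambda>p. (u p + u' p) + (k + k') * c a0 p)"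
        using Uadd[of u u'] by (auto simp: algebra_simps)
      then show ?thesis using U'I by blast
    qed
    show "U' (\<lambda>p. r * f p)" if f: "U' f" for r f
    proof -
      obtain u k where "U u" "f = (\<lambda>p. u p + k * c a0 p)" using f unfolding U'_def by blast
      then have "U (\<lambda>p. r * u p) \<and> (\<lambda>p. r * f p) = (\<lambda>p. r * u p + (r * k) * c a0 p)"
        using Umult[of u r] by (auto simp: algebra_simps)
      then show ?thesis using U'I by blast
    qed
    show "\<forall>a\<in>A. k a = 0" if k: "\<And>x. x \<in> X \<Longrightarrow> (\<Sum>a\<in>A. k a * \<phi> a x) = 0" for k
    proof -
      have "(\<Sum>a\<in>insert a0 A. (k(a0 := 0)) a * \<phi> a x) = 0" if "x \<in> X" for x
      proof -
        have "(\<Sum>a\<in>A. (k(a0 := 0)) a * \<phi> a x) = (\<Sum>a\<in>A. k a * \<phi> a x)"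
          using insert.hyps by (intro sum.cong) auto
        then show ?thesis using k[OF that] insert.hyps by simp
      qed
      then have *: "\<forall>a\<in>insert a0 A. (k(a0 := 0)) a = 0" by (rule indep)
      show ?thesis
      proof
        fix a assume a: "a \<in> A"
        then have "(k(a0 := 0)) a = 0" using * by blast
        moreover have "a \<noteq> a0" using a insert.hyps by blast
        ultimately show "k a = 0" by simp
      qed
    qed
    show "U' (\<lambda>p. \<Sum>a\<in>A. \<phi> a x * c a p)" if "x \<in> X" for x
    proof -
      have "(\<lambda>p. \<Sum>a\<in>A. \<phi> a x * c a p) = (\<lambda>p. (\<Sum>a\<in>insert a0 A. \<phi> a x * c a p) + (- \<phi> a0 x) * c a0 p)"
      proof (rule ext)
        fix p show "(\<Sum>a\<in>A. \<phi> a x * c a p) = (\<Sum>a\<in>insert a0 A. \<phi> a x * c a p) + (- \<phi> a0 x) * c a0 p"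
          unfolding sum.insert[OF insert.hyps] by linarith
      qed
      with hyp[OF that] show ?thesis by (rule U'I)
    qed
  qed (rule b)
  then have U'c: "\<And>b. b \<in> A \<Longrightarrow> U' (c b)" .
  have "\<forall>b\<in>A. \<exists>z. U (fst z) \<and> c b = (\<lambda>p. fst z p + snd z * c a0 p)"
  proof
    fix b assume "b \<in> A"
    from U'c[OF this] obtain u k where "U u" and cb: "c b = (\<lambda>p. u p + k * c a0 p)"
      unfolding U'_def by (elim exE conjE)
    then show "\<exists>z. U (fst z) \<and> c b = (\<lambda>p. fst z p + snd z * c a0 p)"
      by (intro exI[of _ "(u, k)"] conjI) (simp_all only: fst_conv snd_conv)
  qed
  from bchoice[OF this] obtain z where z: "\<forall>b\<in>A. U (fst (z b)) \<and> c b = (\<lambda>p. fst (z b) p + snd (z b) * c a0 p)" ..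
  define u where "u b = fst (z b)" for b
  define k where "k b = snd (z b)" for b
  have uk: "U (u b)" "c b = (\<lambda>p. u b p + k b * c a0 p)" if "b \<in> A" for b
    using z that unfolding u_def k_def by blast+
  have "\<exists>x\<in>X. \<phi> a0 x + (\<Sum>a\<in>A. k a * \<phi> a x) \<noteq> 0"
  proof (rule ccontr)
    assume "\<not> ?thesis"
    then have *: "\<phi> a0 x + (\<Sum>a\<in>A. k a * \<phi> a x) = 0" if "x \<in> X" for x using that by blast
    have "(\<Sum>a\<in>insert a0 A. (k(a0 := 1)) a * \<phi> a x) = 0" if "x \<in> X" for x
    proof -
      have "(\<Sum>a\<in>A. (k(a0 := 1)) a * \<phi> a x) = (\<Sum>a\<in>A. k a * \<phi> a x)"
        using insert.hyps by (intro sum.cong) auto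
      then show ?thesis using *[OF that] insert.hyps by simp
    qed
    then have "\<forall>a\<in>insert a0 A. (k(a0 := 1)) a = 0" by (rule indep)
    then show False by simp
  qed
  then obtain x where x: "x \<in> X" "\<phi> a0 x + (\<Sum>a\<in>A. k a * \<phi> a x) \<noteq> 0" by blast
  let ?r = "\<phi> a0 x + (\<Sum>a\<in>A. k a * \<phi> a x)"
  have Usum: "U (\<lambda>p. \<Sum>a\<in>A'. \<phi> a x * u a p)" if "finite A'" "A' \<subseteq> A" for A'
    using that
  proof (induction A')
    case (insert b A')
    have "b \<in> A" using insert.prems by simp
    from Umult[OF uk(1)[OF this], of "\<phi> b x"] have "U (\<lambda>p. \<phi> b x * u b p)" .
    moreover have "U (\<lambda>p. \<Sum>a\<in>A'. \<phi> a x * u a p)" using insert by blast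
    ultimately have "U (\<lambda>p. \<phi> b x * u b p + (\<Sum>a\<in>A'. \<phi> a x * u a p))" by (rule Uadd)
    then show ?case using insert.hyps by simp
  qed (simp add: U0)
  have "U (\<lambda>p. (1 / ?r) * ((\<Sum>a\<in>insert a0 A. \<phi> a x * c a p) + (- 1) * (\<Sum>a\<in>A. \<phi> a x * u a p)))"
    using Umult[OF Uadd[OF hyp[OF x(1)] Umult[OF Usum[OF insert.hyps(1) subset_refl], of "- 1"]], of "1 / ?r"] .
  moreover have "(1 / ?r) * ((\<Sum>a\<in>insert a0 A. \<phi> a x * c a p) + (- 1) * (\<Sum>a\<in>A. \<phi> a x * u a p)) = c a0 p" for p
  proof -
    have "(\<Sum>a\<in>A. \<phi> a x * c a p) = (\<Sum>a\<in>A. \<phi> a x * u a p) + (\<Sum>a\<in>A. k a * \<phi> a x) * c a0 p"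
      unfolding sum_distrib_right sum.distrib[symmetric]
      by (intro sum.cong refl) (simp add: uk(2) algebra_simps)
    then have "(\<Sum>a\<in>insert a0 A. \<phi> a x * c a p) + (- 1) * (\<Sum>a\<in>A. \<phi> a x * u a p) = ?r * c a0 p"
      using insert.hyps by (simp add: algebra_simps)
    then have "(1 / ?r) * ((\<Sum>a\<in>insert a0 A. \<phi> a x * c a p) + (- 1) * (\<Sum>a\<in>A. \<phi> a x * u a p)) = (1 / ?r) * (?r * c a0 p)"
      by (rule arg_cong)
    also have "\<dots> = c a0 p" using x(2) by (simp only: mult.assoc[symmetric] divide_self_if times_divide_eq_left mult_1 if_False)
    finally show ?thesis .
  qed
  ultimately have Ua0: "U (c a0)" by (simp only:)
  have "U (c b)" if "b \<in> A" for b
  proof -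
    have "U (\<lambda>p. u b p + k b * c a0 p)"
      using Uadd[OF uk(1)[OF that] Umult[OF Ua0, of "k b"]] .
    then show ?thesis by (subst uk(2)[OF that])
  qed
  then show ?case using Ua0 insert.prems(6) by blast
qed

section \<open>Polynomial dependence on two parameters\<close>

text \<open>The coefficients \<open>p\<close> are real although \<open>s\<close> and
  \<open>t\<close> are complex, so real linear algebra at natural parameters can reach them. Their
  vanishing beyond \<open>N\<close> allows \<open>N\<close> to grow with the same
  \<open>p\<close>.\<close>

definition param_rep :: "nat \<Rightarrow> (nat \<Rightarrow> nat \<Rightarrow> 'b \<Rightarrow> real) \<Rightarrow> (complex \<Rightarrow> complex \<Rightarrow> 'b::real_normed_vector \<Rightarrow> complex) \<Rightarrow> bool" where
  "param_rep N p g \<longleftrightarrow> (\<forall>i j. real_polynomial_function (p i j)) \<and>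
     (\<forall>i j x. N < i \<or> N < j \<longrightarrow> p i j x = 0) \<and>
     (\<forall>s t x. g s t x = (\<Sum>i\<le>N. \<Sum>j\<le>N. s ^ i * t ^ j * of_real (p i j x)))"

definition param_poly :: "(complex \<Rightarrow> complex \<Rightarrow> 'b::real_normed_vector \<Rightarrow> complex) \<Rightarrow> bool" where
  "param_poly g \<longleftrightarrow> (\<exists>N p. param_rep N p g)"

lemma param_rep_mono:
  assumes "param_rep N p g" "N \<le> M"
  shows "param_rep M p g"
proof -
  have "(\<Sum>i\<le>M. \<Sum>j\<le>M. s ^ i * t ^ j * of_real (p i j x)) = g s t x" for s t x
  proof -
    have "(\<Sum>i\<le>M. \<Sum>j\<le>M. s ^ i * t ^ j * complex_of_real (p i j x)) = (\<Sum>i\<le>M. \<Sum>j\<le>N. s ^ i * t ^ j * of_real (p i j x))"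
      using assms by (intro sum.cong refl sum.mono_neutral_right) (auto simp: param_rep_def)
    also have "\<dots> = (\<Sum>i\<le>N. \<Sum>j\<le>N. s ^ i * t ^ j * of_real (p i j x))"
      using assms by (intro sum.mono_neutral_right) (auto simp: param_rep_def)
    finally show ?thesis using assms(1) by (simp add: param_rep_def)
  qed
  then show ?thesis using assms unfolding param_rep_def by auto
qed

lemma param_poly_of_rpf:
  assumes "real_polynomial_function r"
  shows "param_poly (\<lambda>s t x. of_real (r x))"
proof -
  have "param_rep 0 (\<lambda>i j x. if i = 0 \<and> j = 0 then r x else 0) (\<lambda>s t x. of_real (r x))"
  proof -
    have "real_polynomial_function (\<lambda>x. if i = 0 \<and> j = 0 then r x else 0)" for i j :: nat
    proof (cases "i = 0 \<and> j = 0")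
      case False
      then have "(\<lambda>x. if i = 0 \<and> j = 0 then r x else 0) = (\<lambda>x. 0)" by auto
      then show ?thesis by (simp only: rpf_const)
    qed (use assms in simp)
    then show ?thesis unfolding param_rep_def by auto
  qed
  then show ?thesis unfolding param_poly_def by blast
qed

lemma param_poly_add:
  assumes "param_poly f" "param_poly g"
  shows "param_poly (\<lambda>s t x. f s t x + g s t x)"
proof -
  obtain N p M q where "param_rep N p f" "param_rep M q g" using assms unfolding param_poly_def by blast
  then have "param_rep (max N M) p f" "param_rep (max N M) q g" by (auto intro: param_rep_mono)
  then have "param_rep (max N M) (\<lambda>i j x. p i j x + q i j x) (\<lambda>s t x. f s t x + g s t x)"
    unfolding param_rep_def by (auto simp: sum.distrib distrib_left rpf_add)
  then show ?thesis unfolding param_poly_def by blast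
qed

lemma param_poly_rpf_mult:
  assumes "real_polynomial_function r" "param_poly g"
  shows "param_poly (\<lambda>s t x. of_real (r x) * g s t x)"
proof -
  obtain N p where "param_rep N p g" using assms unfolding param_poly_def by blast
  then have "param_rep N (\<lambda>i j x. r x * p i j x) (\<lambda>s t x. of_real (r x) * g s t x)"
    unfolding param_rep_def using assms(1) by (auto simp: sum_distrib_left mult_ac rpf_mult)
  then show ?thesis unfolding param_poly_def by blast
qed

lemma param_poly_cmult: "param_poly g \<Longrightarrow> param_poly (\<lambda>s t x. of_real c * g s t x)"
  by (rule param_poly_rpf_mult[OF rpf_const])

lemma param_poly_mult_s:
  assumes "param_poly g"
  shows "param_poly (\<lambda>s t x. s * g s t x)"
proof -
  obtain N p where p: "param_rep N p g" using assms unfolding param_poly_def by blast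
  define q where "q i j x = (case i of 0 \<Rightarrow> 0 | Suc i' \<Rightarrow> p i' j x)" for i j x
  have pM: "param_rep (Suc N) p g" by (rule param_rep_mono[OF p]) simp
  have "s * g s t x = (\<Sum>i\<le>Suc N. \<Sum>j\<le>Suc N. s ^ i * t ^ j * of_real (q i j x))" for s t x
  proof -
    have "(\<Sum>i\<le>Suc N. \<Sum>j\<le>Suc N. s ^ i * t ^ j * of_real (q i j x)) =
        (\<Sum>i\<le>N. \<Sum>j\<le>Suc N. s ^ Suc i * t ^ j * of_real (p i j x))"
      by (subst sum.atMost_Suc_shift) (simp add: q_def)
    also have "\<dots> = s * (\<Sum>i\<le>N. \<Sum>j\<le>Suc N. s ^ i * t ^ j * of_real (p i j x))"
      unfolding sum_distrib_left by (intro sum.cong refl) simp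
    also have "(\<Sum>i\<le>N. \<Sum>j\<le>Suc N. s ^ i * t ^ j * of_real (p i j x)) = (\<Sum>i\<le>N. \<Sum>j\<le>N. s ^ i * t ^ j * complex_of_real (p i j x))"
      using p by (intro sum.cong refl sum.mono_neutral_right) (auto simp: param_rep_def)
    finally show ?thesis using p by (simp add: param_rep_def)
  qed
  moreover have "real_polynomial_function (q i j)" for i j
    using p by (cases i) (simp_all add: q_def[abs_def] param_rep_def rpf_const)
  moreover have "q i j x = 0" if "Suc N < i \<or> Suc N < j" for i j x
    using p that by (cases i) (auto simp: q_def param_rep_def)
  ultimately have "param_rep (Suc N) q (\<lambda>s t x. s * g s t x)" unfolding param_rep_def by blast
  then show ?thesis unfolding param_poly_def by blast
qed

lemma param_poly_swap:
  assumes "param_poly g"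
  shows "param_poly (\<lambda>s t x. g t s x)"
proof -
  obtain N p where p: "param_rep N p g" using assms unfolding param_poly_def by blast
  have "g t s x = (\<Sum>i\<le>N. \<Sum>j\<le>N. s ^ i * t ^ j * of_real (p j i x))" for s t x
    using p unfolding param_rep_def by (subst sum.swap) (simp add: mult_ac)
  then have "param_rep N (\<lambda>i j. p j i) (\<lambda>s t x. g t s x)"
    using p unfolding param_rep_def by blast
  then show ?thesis unfolding param_poly_def by blast
qed

lemma param_poly_mult_t: "param_poly g \<Longrightarrow> param_poly (\<lambda>s t x. t * g s t x)"
  using param_poly_swap[OF param_poly_mult_s[OF param_poly_swap]] .

lemma param_poly_sum:
  assumes "finite I" "\<And>i. i \<in> I \<Longrightarrow> param_poly (g i)"
  shows "param_poly (\<lambda>s t x. \<Sum>i\<in>I. g i s t x)"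
  using assms
  by (induction I) (auto intro: param_poly_add param_poly_of_rpf[OF rpf_const, of 0, simplified])

lemma param_poly_derivative:
  assumes "param_poly g"
  shows "g s t differentiable (at x)" "param_poly (\<lambda>s t x. frechet_derivative (g s t) (at x) v)"
proof -
  obtain N p where p: "param_rep N p g" using assms unfolding param_poly_def by blast
  have rp: "real_polynomial_function (p i j)" for i j using p unfolding param_rep_def by blast
  have g: "g s t = (\<lambda>x. \<Sum>i\<le>N. \<Sum>j\<le>N. s ^ i * t ^ j * of_real (p i j x))" for s t
    using p unfolding param_rep_def by blast
  have term_d: "((\<lambda>x. s ^ i * t ^ j * complex_of_real (p i j x)) has_derivative
      (\<lambda>v. s ^ i * t ^ j * complex_of_real (frechet_derivative (p i j) (at x) v))) (at x)" for s t i j x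
    by (intro has_derivative_mult_right bounded_linear.has_derivative[OF bounded_linear_of_real]
        rpf_has_derivative rp)
  have gd: "(g s t has_derivative (\<lambda>v. \<Sum>i\<le>N. \<Sum>j\<le>N. s ^ i * t ^ j * of_real (frechet_derivative (p i j) (at x) v))) (at x)" for s t x
    unfolding g by (intro has_derivative_sum term_d)
  then show "g s t differentiable (at x)" by (auto simp: differentiable_def)
  have "p i j = (\<lambda>x. 0)" if "N < i \<or> N < j" for i j using p that unfolding param_rep_def by blast
  then have "param_rep N (\<lambda>i j x. frechet_derivative (p i j) (at x) v) (\<lambda>s t x. frechet_derivative (g s t) (at x) v)"
    unfolding param_rep_def using rp frechet_derivative_eqI[OF gd]
    by (auto simp: rpf_frechet_derivative_const frechet_derivative_const)
  then show "param_poly (\<lambda>s t x. frechet_derivative (g s t) (at x) v)" unfolding param_poly_def by blast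
qed

lemma param_rep_uniform:
  assumes "finite A" "\<And>\<alpha>. \<alpha> \<in> A \<Longrightarrow> param_poly (g \<alpha>)"
  shows "\<exists>N p. \<forall>\<alpha>\<in>A. param_rep N (p \<alpha>) (g \<alpha>)"
proof -
  obtain N p where Np: "\<And>\<alpha>. \<alpha> \<in> A \<Longrightarrow> param_rep (N \<alpha>) (p \<alpha>) (g \<alpha>)"
    using assms(2) unfolding param_poly_def by metis
  have "param_rep (Max (N ` A)) (p \<alpha>) (g \<alpha>)" if "\<alpha> \<in> A" for \<alpha>
    using that assms(1) by (intro param_rep_mono[OF Np]) auto
  then show ?thesis by blast
qed

section \<open>Signed powers\<close>

text \<open>Since |d| = d sgn d, extracting a factor \<open>d\<close> in place of |d| flips the
  parity.\<close>

lemma signed_powr_step: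
  assumes "d \<noteq> 0"
  shows "signed_powr d s \<epsilon> = of_real d * signed_powr d (s - 1) (opposite \<epsilon>)"
proof -
  have "complex_of_real \<bar>d\<bar> powr s = complex_of_real \<bar>d\<bar> powr 1 * complex_of_real \<bar>d\<bar> powr (s - 1)"
    by (subst powr_add[symmetric]) simp
  then have abs_eq: "complex_of_real \<bar>d\<bar> powr s = complex_of_real \<bar>d\<bar> * complex_of_real \<bar>d\<bar> powr (s - 1)"
    using assms by simp
  show ?thesis
  proof (cases \<epsilon>)
    case Plus
    have "\<bar>d\<bar> = d * sgn d" by (simp add: sgn_if)
    then have "complex_of_real \<bar>d\<bar> = of_real d * of_real (sgn d)" by (simp only: of_real_mult)
    then show ?thesis using Plus abs_eq by simp
  next
    case Minus
    have "complex_of_real (sgn d) * complex_of_real \<bar>d\<bar> = of_real d"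
      by (simp only: of_real_mult[symmetric] sgn_mult_abs)
    then show ?thesis using Minus abs_eq by (simp add: mult.assoc[symmetric])
  qed
qed

lemma signed_powr_has_vector_derivative:
  assumes "d \<noteq> 0"
  shows "((\<lambda>d. signed_powr d s \<epsilon>) has_vector_derivative s * signed_powr d (s - 1) (opposite \<epsilon>)) (at d)"
proof -
  have pos: "((\<lambda>d. complex_of_real d powr s) has_vector_derivative s * complex_of_real d powr (s - 1)) (at d)"
    if "d > 0" for d
    by (rule has_vector_derivative_real_field) (use that in \<open>auto intro!: has_field_derivative_powr simp: complex_nonpos_Reals_iff\<close>)
  have neg: "((\<lambda>d. complex_of_real (- d) powr s) has_vector_derivative - (s * complex_of_real (- d) powr (s - 1))) (at d)"
    if "d < 0"
  proof -
    have "((\<lambda>d::real. - d) has_vector_derivative - 1) (at d)" by (auto intro!: derivative_eq_intros)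
    from vector_diff_chain_at[OF this pos[of "- d"]] that show ?thesis by (simp add: o_def)
  qed
  show ?thesis
  proof (cases "d > 0")
    case True
    have "((\<lambda>d. signed_powr d s \<epsilon>) has_vector_derivative s * complex_of_real d powr (s - 1)) (at d)"
      by (rule has_vector_derivative_transform_within_open[OF pos[OF True], of "{0<..}"])
        (use True in \<open>cases \<epsilon>; auto\<close>)+
    then show ?thesis using True by (cases \<epsilon>) auto
  next
    case False
    then have d: "d < 0" using assms by simp
    show ?thesis
    proof (cases \<epsilon>)
      case Plus
      have "((\<lambda>d. signed_powr d s \<epsilon>) has_vector_derivative - (s * complex_of_real (- d) powr (s - 1))) (at d)"
        by (rule has_vector_derivative_transform_within_open[OF neg[OF d], of "{..<0}"]) (use d Plus in auto)
      then show ?thesis using d Plus by simp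
    next
      case Minus
      have "((\<lambda>d. - (complex_of_real (- d) powr s)) has_vector_derivative - (- (s * complex_of_real (- d) powr (s - 1)))) (at d)"
        by (rule has_vector_derivative_minus[OF neg[OF d]])
      then have "((\<lambda>d. signed_powr d s \<epsilon>) has_vector_derivative - (- (s * complex_of_real (- d) powr (s - 1)))) (at d)"
        by (rule has_vector_derivative_transform_within_open[of _ _ _ "{..<0}"]) (use d Minus in auto)
      then show ?thesis using d Minus by simp
    qed
  qed
qed

text \<open>The parity sign is chosen to match \<open>n\<close>; in this way natural parameters lead
  back to polynomials.\<close>

lemma signed_powr_nat:
  assumes "d \<noteq> 0"
  shows "signed_powr d (of_nat n) (if even n then Plus else Minus) = of_real (d ^ n)"
proof -
  have powr_n: "complex_of_real \<bar>d\<bar> powr of_nat n = of_real (\<bar>d\<bar> ^ n)"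
    using assms by (simp add: powr_nat)
  show ?thesis
  proof (cases "even n")
    case True
    then show ?thesis using powr_n by (simp add: power_even_abs)
  next
    case False
    have "sgn d * \<bar>d\<bar> ^ n = d ^ n"
      using False by (cases "d > 0") (auto simp: sgn_if power_minus_odd assms)
    then show ?thesis using False powr_n by (simp add: of_real_mult[symmetric] of_real_power[symmetric] del: of_real_mult of_real_power)
  qed
qed

section \<open>Operators given by lists of directions, in multi-index form\<close>

lemma sum_list_sum_swap:
  fixes f :: "'x \<Rightarrow> 'i \<Rightarrow> 'c::comm_monoid_add"
  shows "(\<Sum>x\<leftarrow>xs. \<Sum>a\<in>A. f x a) = (\<Sum>a\<in>A. \<Sum>x\<leftarrow>xs. f x a)"
  by (induction xs) (simp_all add: sum.distrib)

text \<open>Lists of different lengths end at different steps of the ladder; the power of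
  \<open>m\<close> brings them all to step \<open>K\<close>.\<close>

lemma iterated_deriv_power_mult_list:
  fixes f :: "'b::euclidean_space \<Rightarrow> complex" and cs :: "(real \<times> 'v list) list" and d :: "'v \<Rightarrow> 'b"
  assumes S: "open S" and f: "smooth_function_on S f"
    and h: "\<And>k x. x \<in> S \<Longrightarrow> h k differentiable (at x)"
    and h': "\<And>k x v. x \<in> S \<Longrightarrow> frechet_derivative (h k) (at x) v = a k v x * h (Suc k) x"
    and hm: "\<And>k x. x \<in> S \<Longrightarrow> h k x = m x * h (Suc k) x"
    and lc: "\<And>vs \<alpha> x. x \<in> S \<Longrightarrow> lcoeff a m vs \<alpha> differentiable (at x)"
    and x: "x \<in> S" and K: "\<And>c vs. (c, vs) \<in> set cs \<Longrightarrow> length vs \<le> K"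
  shows "(\<Sum>(c, vs)\<leftarrow>cs. of_real c * iterated_deriv (map d vs) (\<lambda>x. h 0 x * f x) x) =
    h K x * (\<Sum>\<alpha>\<in>multi_indices K.
      (\<Sum>(c, vs)\<leftarrow>cs. of_real c * m x ^ (K - length vs) * lcoeff a m (map d vs) \<alpha> x) * multi_deriv \<alpha> f x)"
proof -
  have hmn: "h k x = m x ^ n * h (k + n) x" for k n
  proof (induction n)
    case (Suc n)
    then show ?case using hm[OF x, of "k + n"] by simp
  qed simp
  have term_eq: "of_real c * iterated_deriv (map d vs) (\<lambda>x. h 0 x * f x) x =
      (\<Sum>\<alpha>\<in>multi_indices K. h K x * (of_real c * m x ^ (K - length vs) * lcoeff a m (map d vs) \<alpha> x * multi_deriv \<alpha> f x))"
    if "(c, vs) \<in> set cs" for c vs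
  proof -
    have "iterated_deriv (map d vs) (\<lambda>x. h 0 x * f x) x = h (length vs) x *
        (\<Sum>\<alpha>\<in>multi_indices (length vs). lcoeff a m (map d vs) \<alpha> x * multi_deriv \<alpha> f x)"
      using iterated_deriv_power_mult[OF S f h h' hm lc x, of "map d vs"] by simp
    also have "(\<Sum>\<alpha>\<in>multi_indices (length vs). lcoeff a m (map d vs) \<alpha> x * multi_deriv \<alpha> f x) =
        (\<Sum>\<alpha>\<in>multi_indices K. lcoeff a m (map d vs) \<alpha> x * multi_deriv \<alpha> f x)"
      using K[OF that] lcoeff_support[of _ "map d vs" a m x]
      by (intro sum.mono_neutral_left finite_multi_indices) (auto simp: multi_indices_def)
    also have "h (length vs) x = m x ^ (K - length vs) * h K x"
      using hmn[of "length vs" "K - length vs"] K[OF that] by simp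
    finally show ?thesis by (simp add: sum_distrib_left mult_ac)
  qed
  have "(\<Sum>(c, vs)\<leftarrow>cs. of_real c * iterated_deriv (map d vs) (\<lambda>x. h 0 x * f x) x) =
      (\<Sum>(c, vs)\<leftarrow>cs. \<Sum>\<alpha>\<in>multi_indices K. h K x * (of_real c * m x ^ (K - length vs) * lcoeff a m (map d vs) \<alpha> x * multi_deriv \<alpha> f x))"
    by (rule arg_cong[of _ _ sum_list], rule map_cong) (auto simp: term_eq)
  also have "\<dots> = (\<Sum>\<alpha>\<in>multi_indices K. \<Sum>(c, vs)\<leftarrow>cs. h K x * (of_real c * m x ^ (K - length vs) * lcoeff a m (map d vs) \<alpha> x * multi_deriv \<alpha> f x))"
    using sum_list_sum_swap[of "\<lambda>z \<alpha>. h K x * (of_real (fst z) * m x ^ (K - length (snd z)) * lcoeff a m (map d (snd z)) \<alpha> x * multi_deriv \<alpha> f x)" "multi_indices K" cs]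
    unfolding case_prod_unfold .
  also have "\<dots> = h K x * (\<Sum>\<alpha>\<in>multi_indices K.
      (\<Sum>(c, vs)\<leftarrow>cs. of_real c * m x ^ (K - length vs) * lcoeff a m (map d vs) \<alpha> x) * multi_deriv \<alpha> f x)"
    unfolding sum_distrib_left
    unfolding case_prod_unfold
    by (intro sum.cong refl) (simp add: sum_list_const_mult sum_list_mult_const)
  finally show ?thesis .
qed

lemma diffop_eq_sum:
  assumes "finite A" "\<And>\<alpha> y. \<alpha> \<notin> A \<Longrightarrow> c \<alpha> y = 0"
  shows "diffop c f x = (\<Sum>\<alpha>\<in>A. c \<alpha> x * multi_deriv \<alpha> f x)"
  unfolding diffop_def
  by (rule sum.mono_neutral_left) (use assms in auto)

lemma lcoeff_const: "\<exists>k. lcoeff (\<lambda>_ _ _. 0) (\<lambda>_. 1) vs \<alpha> = (\<lambda>x. k)"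
proof (induction vs arbitrary: \<alpha>)
  case (Cons v vs)
  then obtain k where k: "\<And>\<alpha>. lcoeff (\<lambda>_ _ _. 0) (\<lambda>_. 1) vs \<alpha> = (\<lambda>x. k \<alpha>)" by metis
  show ?case by (intro exI) (simp add: k frechet_derivative_const cong: if_cong)
qed auto

lemma mon_independent_real:
  fixes k :: "'i multiset \<Rightarrow> real"
  assumes "finite B" "finite A" "\<And>\<alpha>. \<alpha> \<in> A \<Longrightarrow> set_mset \<alpha> \<subseteq> B"
    and zero: "\<And>y. (\<Sum>\<alpha>\<in>A. k \<alpha> * mon y \<alpha>) = 0" and "\<alpha> \<in> A"
  shows "k \<alpha> = 0"
proof -
  have "(\<Sum>\<alpha>\<in>A. complex_of_real (k \<alpha>) * of_real (mon y \<alpha>)) = of_real (\<Sum>\<alpha>\<in>A. k \<alpha> * mon y \<alpha>)" for y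
    by simp
  then have "(\<Sum>\<alpha>\<in>A. complex_of_real (k \<alpha>) * of_real (mon y \<alpha>)) = 0" for y
    by (simp only: zero of_real_0)
  from mon_independent[OF assms(1,2,3) this assms(5)] show ?thesis by simp
qed

text \<open>Infinitely many arguments suffice; they start at 1 because the exponents in
  \<open>Dop_det_det\<close> do.\<close>

lemma nat_power_independent:
  fixes a :: "nat \<Rightarrow> real"
  assumes "\<And>n. (\<Sum>i\<le>N. a i * real (Suc n) ^ i) = 0" and "i \<le> N"
  shows "a i = 0"
proof -
  define p where "p = (\<Sum>i\<le>N. monom (a i) i)"
  have "p = 0"
  proof (rule ccontr)
    assume "p \<noteq> 0"
    then have "finite {z. poly p z = 0}" by (rule poly_roots_finite)
    moreover have "range (\<lambda>n. real (Suc n)) \<subseteq> {z. poly p z = 0}"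
      using assms(1) by (auto simp: p_def poly_sum poly_monom)
    ultimately have "finite (range (\<lambda>n. real (Suc n)))" using finite_subset by blast
    then have "finite (UNIV :: nat set)" by (rule finite_imageD) (auto simp: inj_on_def)
    then show False by simp
  qed
  then have "coeff p i = 0" by simp
  then show ?thesis using assms(2) by (simp add: p_def coeff_sum)
qed

context simple_real_jordan_algebra
begin

section \<open>The operator on exponentials\<close>

definition pairing :: "'a \<times> 'a \<Rightarrow> 'a \<times> 'a \<Rightarrow> real" where
  "pairing q p = \<tau> (fst q) (fst p) + \<tau> (snd q) (snd p)"

abbreviation expo :: "'a \<times> 'a \<Rightarrow> 'a \<times> 'a \<Rightarrow> complex" where
  "expo q \<equiv> \<lambda>p. of_real (exp (pairing q p))"

abbreviation anti :: "'a \<Rightarrow> 'a \<times> 'a" where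
  "anti \<equiv> \<lambda>v. (v, - v)"

lemma linear_pairing: "linear (pairing q)"
  by (intro linearI) (simp_all add: pairing_def \<tau>_linear algebra_simps)

lemma bounded_linear_pairing: "bounded_linear (pairing q)"
  using linear_pairing linear_conv_bounded_linear by blast

lemma pairing_anti: "pairing q (anti v) = \<tau> v (fst q - snd q)"
  by (simp add: pairing_def \<tau>_linear \<tau>_commute[of v])

text \<open>By nondegeneracy the frequency can be chosen with prescribed values on the basis, so
  identities valid for all frequencies become polynomial identities in free variables.\<close>

lemma pairing_surj: "\<exists>q. \<forall>b\<in>Basis. pairing q b = y b"
proof -
  define l1 where "l1 v = (\<Sum>b\<in>Basis. (v \<bullet> b) * y (b, 0))" for v
  define l2 where "l2 v = (\<Sum>b\<in>Basis. (v \<bullet> b) * y (0, b))" for v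
  have "linear l1" "linear l2"
    unfolding l1_def l2_def
    by (intro linear_compose_sum ballI linearI; simp add: inner_add_left algebra_simps)+
  then obtain z w where zw: "\<forall>v. l1 v = \<tau> z v" "\<forall>v. l2 v = \<tau> w v" using \<tau>_representation by metis
  have l1: "l1 b = y (b, 0)" and l2: "l2 b = y (0, b)" if "b \<in> Basis" for b
  proof -
    have "l1 b = (\<Sum>b'\<in>Basis. if b' = b then y (b, 0) else 0)"
      unfolding l1_def using that by (intro sum.cong refl) (auto simp: inner_Basis)
    then show "l1 b = y (b, 0)" using that by simp
    have "l2 b = (\<Sum>b'\<in>Basis. if b' = b then y (0, b) else 0)"
      unfolding l2_def using that by (intro sum.cong refl) (auto simp: inner_Basis)
    then show "l2 b = y (0, b)" using that by simp
  qed
  have "pairing (z, w) b = y b" if "b \<in> Basis" for b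
    using that l1 l2 linear_0[OF \<open>linear l1\<close>] linear_0[OF \<open>linear l2\<close>] zw
    by (auto simp: Basis_prod_def pairing_def)
  then show ?thesis by blast
qed

lemma exp_pairing_has_derivative:
  "((\<lambda>p. exp (pairing q p)) has_derivative (\<lambda>h. exp (pairing q p) * pairing q h)) (at p)"
  using DERIV_compose_FDERIV[OF DERIV_exp bounded_linear_imp_has_derivative[OF bounded_linear_pairing]]
  by (simp add: mult.commute)

lemma expo_has_derivative:
  "((\<lambda>p. complex_of_real (c * exp (pairing q p))) has_derivative
    (\<lambda>h. of_real (c * (exp (pairing q p) * pairing q h)))) (at p)"
  by (intro bounded_linear.has_derivative[OF bounded_linear_of_real] has_derivative_mult_right
      exp_pairing_has_derivative)

text \<open>Conjugation by the exponential adds the value of its exponent at (v, -v), which is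
  \<tau>(v, x - y) for the frequency q = (x, y). So the variable \<eta> of \<open>dop\<close>
  becomes the difference of the two frequencies.\<close>

lemma iterated_deriv_rpf_exp:
  assumes \<phi>: "real_polynomial_function \<phi>"
  shows "iterated_deriv (map anti vs) (\<lambda>p. of_real (\<phi> p * exp (pairing q p))) =
    (\<lambda>p. of_real (dops anti vs (\<lambda>r. \<phi> (fst r)) (p, fst q - snd q) * exp (pairing q p)))"
proof (induction vs)
  case (Cons v vs)
  define \<Psi> where "\<Psi> = dops anti vs (\<lambda>r. \<phi> (fst r))"
  have \<Psi>: "real_polynomial_function \<Psi>" unfolding \<Psi>_def by (rule rpf_dops[OF rpf_fst[OF \<phi>]])
  let ?\<eta> = "fst q - snd q"
  have "((\<lambda>p. complex_of_real (\<Psi> (p, ?\<eta>) * exp (pairing q p))) has_derivative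
      (\<lambda>h. of_real (\<Psi> (p, ?\<eta>) * (exp (pairing q p) * pairing q h) + frechet_derivative \<Psi> (at (p, ?\<eta>)) (h, 0) * exp (pairing q p)))) (at p)" for p
  proof -
    have "((\<lambda>p. (p, ?\<eta>)) has_derivative (\<lambda>h. (h, 0))) (at p)"
      by (auto intro!: derivative_eq_intros)
    from has_derivative_compose[OF this rpf_has_derivative[OF \<Psi>]]
    have 1: "((\<lambda>p. \<Psi> (p, ?\<eta>)) has_derivative (\<lambda>h. frechet_derivative \<Psi> (at (p, ?\<eta>)) (h, 0))) (at p)" .
    show ?thesis
      by (rule bounded_linear.has_derivative[OF bounded_linear_of_real has_derivative_mult[OF 1 exp_pairing_has_derivative]])
  qed
  from frechet_derivative_eqI[OF this, of _ "anti v"]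
  have "frechet_derivative (\<lambda>p. complex_of_real (\<Psi> (p, ?\<eta>) * exp (pairing q p))) (at p) (anti v) =
      of_real (dop anti v \<Psi> (p, ?\<eta>) * exp (pairing q p))" for p
    by (simp add: dop_def pairing_anti algebra_simps)
  moreover have "iterated_deriv (map anti vs) (\<lambda>p. of_real (\<phi> p * exp (pairing q p))) =
      (\<lambda>p. complex_of_real (\<Psi> (p, ?\<eta>) * exp (pairing q p)))"
    unfolding \<Psi>_def by (rule Cons.IH)
  ultimately show ?case by (simp only: list.map iterated_deriv.simps dops.simps \<Psi>_def[symmetric])
qed simp

lemma iterated_deriv_expo: "iterated_deriv vs (expo q) = (\<lambda>p. of_real ((\<Prod>v\<leftarrow>vs. pairing q v) * exp (pairing q p)))"
proof (induction vs)
  case (Cons v vs)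
  show ?case
    by (simp only: iterated_deriv.simps Cons frechet_derivative_eqI[OF expo_has_derivative])
      (simp add: mult_ac)
qed simp

lemma smooth_expo: "smooth_function_on S (expo q)"
  unfolding smooth_function_on_def iterated_deriv_expo
  using expo_has_derivative differentiable_def by blast

lemma multi_deriv_expo: "multi_deriv \<alpha> (expo q) p = of_real (mon (pairing q) \<alpha> * exp (pairing q p))"
proof -
  obtain vs where vs: "mset vs = \<alpha>" using ex_mset by blast
  have "multi_deriv \<alpha> (expo q) p = iterated_deriv vs (expo q) p"
    by (rule multi_deriv_eq[OF open_UNIV smooth_expo vs]) simp
  moreover have "(\<Prod>v\<leftarrow>vs. pairing q v) = mon (pairing q) \<alpha>"
    unfolding vs[symmetric] by (simp add: prod_mset_prod_list[symmetric])
  ultimately show ?thesis by (simp add: iterated_deriv_expo)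
qed

lemma Dop_expo:
  assumes \<phi>: "real_polynomial_function \<phi>"
  shows "(\<Sum>(c, vs)\<leftarrow>cs. of_real c * iterated_deriv (map anti vs) (\<lambda>p. of_real (\<phi> p * exp (pairing q p))) p) =
    complex_of_real (Dop anti cs (\<lambda>r. \<phi> (fst r)) (p, fst q - snd q) * exp (pairing q p))"
  unfolding iterated_deriv_rpf_exp[OF \<phi>] Dop_def
  by (induction cs) (auto simp: distrib_right)

subsection \<open>Identification of the determinant operator\<close>

text \<open>The Leibniz coefficients for the constant ladder h = 1: they merely rewrite derivatives
  along arbitrary directions in the multi-index form required by \<open>diffop\<close>.\<close>

definition det_coeff :: "'a symbol \<Rightarrow> ('a \<times> 'a) multiset \<Rightarrow> 'a \<times> 'a \<Rightarrow> complex" where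
  "det_coeff cs \<alpha> x = (\<Sum>(c, vs)\<leftarrow>cs. of_real c * lcoeff (\<lambda>_ _ _. 0) (\<lambda>_. 1) (map anti vs) \<alpha> x)"

context
  fixes cs :: "'a symbol" and K :: nat
  assumes K: "\<And>c vs. (c, vs) \<in> set cs \<Longrightarrow> length vs \<le> K"
begin

lemma det_coeff_support:
  assumes "\<alpha> \<notin> multi_indices K"
  shows "det_coeff cs \<alpha> x = 0"
proof -
  have "lcoeff (\<lambda>_ _ _. 0) (\<lambda>_. 1) (map anti vs) \<alpha> x = 0" if "(c, vs) \<in> set cs" for c vs
    using K[OF that] assms by (intro lcoeff_support) (auto simp: multi_indices_def)
  then have "(\<Sum>(c, vs)\<leftarrow>cs. of_real c * lcoeff (\<lambda>_ _ _. 0) (\<lambda>_. 1) (map anti vs) \<alpha> x) = (\<Sum>z\<leftarrow>cs. 0)"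
    by (intro arg_cong[of _ _ sum_list] map_cong) auto
  then show ?thesis by (simp add: det_coeff_def)
qed

lemma det_coeff_const: "det_coeff cs \<alpha> x = det_coeff cs \<alpha> y"
proof -
  obtain k where "\<And>vs. lcoeff (\<lambda>_ _ _. 0) (\<lambda>_. 1) (map anti vs) \<alpha> = (\<lambda>x::'a \<times> 'a. k vs)"
    using lcoeff_const[of "map anti _" \<alpha>] by metis
  then show ?thesis by (simp add: det_coeff_def)
qed

lemma diffop_det_coeff:
  assumes S: "open S" and f: "smooth_function_on S f" and x: "x \<in> S"
  shows "diffop (det_coeff cs) f x = (\<Sum>(c, vs)\<leftarrow>cs. of_real c * iterated_deriv (map anti vs) f x)"
proof -
  have lc: "lcoeff (\<lambda>_ _ _. 0) (\<lambda>_. 1) vs \<alpha> differentiable (at x)" for vs :: "('a \<times> 'a) list" and \<alpha> x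
    using lcoeff_const[of vs \<alpha>] by auto
  have "(\<Sum>(c, vs)\<leftarrow>cs. of_real c * iterated_deriv (map anti vs) (\<lambda>x. 1 * f x) x) =
    1 * (\<Sum>\<alpha>\<in>multi_indices K. (\<Sum>(c, vs)\<leftarrow>cs. of_real c * 1 ^ (K - length vs) *
      lcoeff (\<lambda>_ _ _. 0) (\<lambda>_. 1) (map anti vs) \<alpha> x) * multi_deriv \<alpha> f x)"
    by (rule iterated_deriv_power_mult_list[where h = "\<lambda>_ _. 1", OF S f])
      (use x K lc in \<open>auto simp: frechet_derivative_const\<close>)
  moreover have "diffop (det_coeff cs) f x = (\<Sum>\<alpha>\<in>multi_indices K. det_coeff cs \<alpha> x * multi_deriv \<alpha> f x)"
    by (rule diffop_eq_sum[OF finite_multi_indices]) (rule det_coeff_support)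
  ultimately show ?thesis by (simp add: det_coeff_def)
qed

lemma det_coeff_expo:
  assumes cs: "\<And>x. sym cs x = det x"
  shows "diffop (det_coeff cs) (expo q) p = of_real (det (fst q - snd q)) * expo q p"
proof -
  have "diffop (det_coeff cs) (expo q) p = (\<Sum>(c, vs)\<leftarrow>cs. of_real c * iterated_deriv (map anti vs) (expo q) p)"
    by (rule diffop_det_coeff[OF open_UNIV smooth_expo UNIV_I])
  also have "\<dots> = of_real (sym cs (fst q - snd q)) * expo q p"
    unfolding iterated_deriv_expo sym_def
    by (induction cs) (auto simp: o_def pairing_anti algebra_simps)
  finally show ?thesis by (simp add: cs)
qed

lemma const_coeff_det_coeff: "const_coeff_diffop (det_coeff cs)"
  unfolding const_coeff_diffop_def polynomial_diffop_def
proof (intro conjI allI impI)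
  have "{\<alpha>. \<exists>y. det_coeff cs \<alpha> y \<noteq> 0} \<subseteq> multi_indices K" using det_coeff_support by blast
  then show "finite {\<alpha>. \<exists>y. det_coeff cs \<alpha> y \<noteq> 0}" using finite_multi_indices finite_subset by blast
  show "set_mset \<alpha> \<subseteq> Basis" if "\<exists>y. det_coeff cs \<alpha> y \<noteq> 0" for \<alpha>
    using that det_coeff_support[of \<alpha>] by (auto simp: multi_indices_def)
  show "polynomial_function (det_coeff cs \<alpha>)" for \<alpha>
  proof -
    have "det_coeff cs \<alpha> = (\<lambda>x. det_coeff cs \<alpha> 0)" using det_coeff_const by blast
    then show ?thesis by (subst \<open>det_coeff cs \<alpha> = _\<close>) (rule polynomial_function_const)
  qed
  show "det_coeff cs \<alpha> x = det_coeff cs \<alpha> y" for \<alpha> x y by (rule det_coeff_const)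
qed

end

text \<open>On exponentials at the origin an operator becomes a polynomial in the values of the
  frequency on the basis, with the coefficients of the operator; \<open>mon_independent\<close>
  applies.\<close>

lemma const_coeff_diffop_unique:
  assumes c: "const_coeff_diffop c" "const_coeff_diffop c'"
    and eq: "\<And>q. diffop c (expo q) 0 = diffop c' (expo q) 0"
  shows "c = c'"
proof -
  define A where "A = {\<alpha>. \<exists>y. c \<alpha> y \<noteq> 0} \<union> {\<alpha>. \<exists>y. c' \<alpha> y \<noteq> 0}"
  have A: "finite A" "\<And>\<alpha>. \<alpha> \<in> A \<Longrightarrow> set_mset \<alpha> \<subseteq> Basis"
    using c unfolding A_def const_coeff_diffop_def polynomial_diffop_def by blast+
  have off: "c \<alpha> y = 0" "c' \<alpha> y = 0" if "\<alpha> \<notin> A" for \<alpha> y using that unfolding A_def by blast+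
  have d: "diffop b (expo q) 0 = (\<Sum>\<alpha>\<in>A. b \<alpha> 0 * of_real (mon (pairing q) \<alpha>))"
    if "\<And>\<alpha> y. \<alpha> \<notin> A \<Longrightarrow> b \<alpha> y = 0" for b q
  proof -
    have "diffop b (expo q) 0 = (\<Sum>\<alpha>\<in>A. b \<alpha> 0 * multi_deriv \<alpha> (expo q) 0)"
      by (rule diffop_eq_sum[OF A(1)]) (rule that)
    then show ?thesis by (simp add: multi_deriv_expo linear_0[OF linear_pairing])
  qed
  have zero: "(\<Sum>\<alpha>\<in>A. (c \<alpha> 0 - c' \<alpha> 0) * of_real (mon y \<alpha>)) = 0" for y
  proof -
    obtain q where q: "\<And>b. b \<in> Basis \<Longrightarrow> pairing q b = y b" using pairing_surj by blast
    have "mon y \<alpha> = mon (pairing q) \<alpha>" if "\<alpha> \<in> A" for \<alpha>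
      by (rule arg_cong[of _ _ prod_mset], rule image_mset_cong) (use A(2)[OF that] q in force)
    then have "(\<Sum>\<alpha>\<in>A. (c \<alpha> 0 - c' \<alpha> 0) * of_real (mon y \<alpha>)) = diffop c (expo q) 0 - diffop c' (expo q) 0"
      using d[of c q] d[of c' q] off by (simp add: sum_subtractf[symmetric] algebra_simps)
    then show ?thesis using eq by simp
  qed
  have "c \<alpha> 0 - c' \<alpha> 0 = 0" if "\<alpha> \<in> A" for \<alpha>
    by (rule mon_independent[OF finite_Basis A zero that])
  then have "c \<alpha> 0 = c' \<alpha> 0" for \<alpha> using off by (cases "\<alpha> \<in> A") auto
  then show ?thesis
    using c unfolding const_coeff_diffop_def by (intro ext) metis
qed

lemma det_diffop_eq:
  assumes cs: "\<And>x. sym cs x = det x"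
  shows "det_diffop mul e = det_coeff cs"
  unfolding det_diffop_def
proof (rule the_equality)
  obtain K where K: "\<And>c vs. (c, vs) \<in> set cs \<Longrightarrow> length vs \<le> K"
  proof
    show "length vs \<le> Max (insert 0 ((\<lambda>z. length (snd z)) ` set cs))" if "(c, vs) \<in> set cs" for c vs
      using that by (intro Max_ge) force+
  qed
  have expo_eq: "expo (x, y) = (\<lambda>(\<xi>, \<zeta>). complex_of_real (exp (\<tau> \<xi> x + \<tau> \<zeta> y)))" for x y
    by (auto simp: pairing_def \<tau>_commute)
  show "const_coeff_diffop (det_coeff cs) \<and> (\<forall>x y. let E = (\<lambda>(\<xi>, \<zeta>). complex_of_real (exp (\<tau> \<xi> x + \<tau> \<zeta> y)))
      in \<forall>\<xi> \<zeta>. diffop (det_coeff cs) E (\<xi>, \<zeta>) = complex_of_real (det (x - y)) * E (\<xi>, \<zeta>))"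
    using const_coeff_det_coeff[OF K] det_coeff_expo[OF K cs]
    unfolding Let_def expo_eq[symmetric] by simp
  fix c assume c: "const_coeff_diffop c \<and> (\<forall>x y. let E = (\<lambda>(\<xi>, \<zeta>). complex_of_real (exp (\<tau> \<xi> x + \<tau> \<zeta> y)))
      in \<forall>\<xi> \<zeta>. diffop c E (\<xi>, \<zeta>) = complex_of_real (det (x - y)) * E (\<xi>, \<zeta>))"
  show "c = det_coeff cs"
  proof (rule const_coeff_diffop_unique)
    show "const_coeff_diffop c" using c by blast
    show "const_coeff_diffop (det_coeff cs)" by (rule const_coeff_det_coeff[OF K])
    show "diffop c (expo q) 0 = diffop (det_coeff cs) (expo q) 0" for q
    proof -
      have "diffop c (expo (fst q, snd q)) (0, 0) = of_real (det (fst q - snd q)) * expo (fst q, snd q) (0, 0)"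
        using c unfolding Let_def expo_eq[symmetric] by blast
      then show ?thesis using det_coeff_expo[OF K cs, where q = q and p = 0] by (simp add: zero_prod_def)
    qed
  qed
qed

end

text \<open>The Leibniz formula exhibits every iterated derivative of the product as differentiable.
  Smoothness of the product is what allows the operator in multi-index form to be applied to
  it.\<close>

lemma smooth_power_mult:
  fixes f :: "'b::euclidean_space \<Rightarrow> complex"
  assumes S: "open S" and f: "smooth_function_on S f"
    and h: "\<And>k x. x \<in> S \<Longrightarrow> h k differentiable (at x)"
    and h': "\<And>k x v. x \<in> S \<Longrightarrow> frechet_derivative (h k) (at x) v = a k v x * h (Suc k) x"
    and hm: "\<And>k x. x \<in> S \<Longrightarrow> h k x = m x * h (Suc k) x"
    and lc: "\<And>vs \<alpha> x. x \<in> S \<Longrightarrow> lcoeff a m vs \<alpha> differentiable (at x)"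
  shows "smooth_function_on S (\<lambda>x. h 0 x * f x)"
  unfolding smooth_function_on_def
proof (intro allI ballI)
  fix vs :: "'b list" and x assume x: "x \<in> S"
  have "(\<lambda>x. h (length vs) x * (\<Sum>\<alpha>\<in>multi_indices (length vs). lcoeff a m vs \<alpha> x * multi_deriv \<alpha> f x)) differentiable (at x)"
    by (intro differentiable_mult differentiable_sum ballI finite_multi_indices h[OF x] lc[OF x]
        multi_deriv_differentiable[OF S f x])
  then show "iterated_deriv vs (\<lambda>x. h 0 x * f x) differentiable (at x)"
    by (rule differentiable_cong_open[OF S x, rotated])
      (rule iterated_deriv_power_mult[OF S f h h' hm lc, symmetric])
qed

context simple_real_jordan_algebra
begin

section \<open>Conjugation by complex powers of the determinant\<close>

abbreviation invertible_pairs :: "('a \<times> 'a) set" where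
  "invertible_pairs \<equiv> jordan_invertibles mul e \<times> jordan_invertibles mul e"

lemma invertible_pairs_iff: "p \<in> invertible_pairs \<longleftrightarrow> det (fst p) \<noteq> 0 \<and> det (snd p) \<noteq> 0"
  by (cases p) (simp add: invertibles_eq)

lemma open_invertible_pairs: "open invertible_pairs"
proof -
  have "continuous_on UNIV det"
    using rpf_det_jordan continuous_on_polymonial_function real_polynomial_function_eq by blast
  then have "open (det -` (- {0}))" by (intro open_vimage) auto
  then show ?thesis by (intro open_Times) (simp_all add: invertibles_eq vimage_def Compl_eq)
qed

text \<open>Both exponents drop together, so one factor \<open>det_prod\<close> relates consecutive
  steps; every step flips both signs.\<close>

definition det_pow :: "complex \<Rightarrow> complex \<Rightarrow> parity_sign \<Rightarrow> parity_sign \<Rightarrow> nat \<Rightarrow> 'a \<times> 'a \<Rightarrow> complex" where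
  "det_pow s t \<epsilon> \<eta> k p = signed_powr (det (fst p)) (s - of_nat k) ((opposite ^^ k) \<epsilon>) *
     signed_powr (det (snd p)) (t - of_nat k) ((opposite ^^ k) \<eta>)"

definition det_prod :: "'a \<times> 'a \<Rightarrow> real" where
  "det_prod p = det (fst p) * det (snd p)"

text \<open>The logarithmic derivative of step \<open>k\<close> of \<open>det_pow\<close>, cleared
  of denominators by \<open>det_prod\<close>; hence polynomial in the point and affine in each of
  \<open>s\<close> and \<open>t\<close>.\<close>

definition log_deriv :: "complex \<Rightarrow> complex \<Rightarrow> nat \<Rightarrow> 'a \<times> 'a \<Rightarrow> 'a \<times> 'a \<Rightarrow> complex" where
  "log_deriv s t k v p =
     (s - of_nat k) * of_real (frechet_derivative det (at (fst p)) (fst v) * det (snd p)) +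
     (t - of_nat k) * of_real (det (fst p) * frechet_derivative det (at (snd p)) (snd v))"

lemma rpf_det_prod: "real_polynomial_function det_prod"
  unfolding det_prod_def by (intro rpf_mult rpf_fst rpf_snd rpf_det_jordan)

lemma det_pow_step:
  assumes "p \<in> invertible_pairs"
  shows "det_pow s t \<epsilon> \<eta> k p = of_real (det_prod p) * det_pow s t \<epsilon> \<eta> (Suc k) p"
proof -
  have "s - of_nat k - 1 = s - of_nat (Suc k)" for s :: complex by simp
  then show ?thesis
    using assms signed_powr_step[of "det (fst p)" "s - of_nat k" "(opposite ^^ k) \<epsilon>"]
      signed_powr_step[of "det (snd p)" "t - of_nat k" "(opposite ^^ k) \<eta>"]
    by (simp only: det_pow_def det_prod_def invertible_pairs_iff funpow.simps o_def of_real_mult mult_ac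
        not_False_eq_True simp_thms)
qed

lemma det_pow_add:
  assumes "p \<in> invertible_pairs"
  shows "det_pow s t \<epsilon> \<eta> k p = of_real (det_prod p ^ n) * det_pow s t \<epsilon> \<eta> (k + n) p"
proof (induction n)
  case (Suc n)
  then show ?case using det_pow_step[OF assms, of s t \<epsilon> \<eta> "k + n"] by simp
qed simp

lemma det_pow_has_derivative:
  assumes "p \<in> invertible_pairs"
  shows "(det_pow s t \<epsilon> \<eta> k has_derivative (\<lambda>v. log_deriv s t k v p * det_pow s t \<epsilon> \<eta> (Suc k) p)) (at p)"
proof -
  have factor: "((\<lambda>p. signed_powr (det (\<pi> p)) (s - of_nat k) ((opposite ^^ k) \<epsilon>)) has_derivative
      (\<lambda>v. of_real (frechet_derivative det (at (\<pi> p)) (\<pi> v)) *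
        ((s - of_nat k) * signed_powr (det (\<pi> p)) (s - of_nat (Suc k)) ((opposite ^^ Suc k) \<epsilon>)))) (at p)"
    if \<pi>: "bounded_linear \<pi>" and nz: "det (\<pi> p) \<noteq> 0" for s \<epsilon> and \<pi> :: "'a \<times> 'a \<Rightarrow> 'a"
  proof -
    have "s - of_nat k - 1 = s - of_nat (Suc k)" by simp
    with signed_powr_has_vector_derivative[OF nz, of "s - of_nat k" "(opposite ^^ k) \<epsilon>"]
    have 1: "((\<lambda>d. signed_powr d (s - of_nat k) ((opposite ^^ k) \<epsilon>)) has_derivative
        (\<lambda>h. h *\<^sub>R ((s - of_nat k) * signed_powr (det (\<pi> p)) (s - of_nat (Suc k)) ((opposite ^^ Suc k) \<epsilon>)))) (at (det (\<pi> p)))"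
      by (simp only: has_vector_derivative_def funpow.simps o_def)
    have "((\<lambda>p. det (\<pi> p)) has_derivative (\<lambda>v. frechet_derivative det (at (\<pi> p)) (\<pi> v))) (at p)"
      by (rule has_derivative_compose[OF bounded_linear_imp_has_derivative[OF \<pi>] rpf_has_derivative[OF rpf_det_jordan]])
    from has_derivative_compose[OF this 1] show ?thesis by (simp only: scaleR_conv_of_real)
  qed
  have nz: "det (fst p) \<noteq> 0" "det (snd p) \<noteq> 0" using assms by (simp_all add: invertible_pairs_iff)
  have step: "signed_powr d (s - of_nat k) ((opposite ^^ k) \<epsilon>) = of_real d * signed_powr d (s - of_nat (Suc k)) ((opposite ^^ Suc k) \<epsilon>)"
    if "d \<noteq> 0" for d s \<epsilon>
    using signed_powr_step[OF that, of "s - of_nat k" "(opposite ^^ k) \<epsilon>"] by (simp add: diff_diff_eq add.commute)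
  show ?thesis
    unfolding det_pow_def[abs_def] log_deriv_def
    by (rule has_derivative_eq_rhs[OF has_derivative_mult[OF factor[OF bounded_linear_fst nz(1)] factor[OF bounded_linear_snd nz(2)]]])
      (simp only: step[OF nz(1)] step[OF nz(2)] of_real_mult ring_distribs mult_ac add_ac)
qed

lemma param_poly_log_deriv:
  assumes g: "param_poly g"
  shows "param_poly (\<lambda>s t x. log_deriv s t k v x * g s t x)"
proof -
  let ?r1 = "\<lambda>p. frechet_derivative det (at (fst p)) (fst v) * det (snd p)"
  let ?r2 = "\<lambda>p. det (fst p) * frechet_derivative det (at (snd p)) (snd v)"
  have "real_polynomial_function ?r1" "real_polynomial_function ?r2"
    by (intro rpf_mult rpf_fst[OF rpf_frechet_derivative_const] rpf_snd[OF rpf_frechet_derivative_const] rpf_fst rpf_snd rpf_det_jordan)+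
  note r = this[THEN param_poly_rpf_mult[OF _ g]]
  have "param_poly (\<lambda>s t x. (s * (of_real (?r1 x) * g s t x) + of_real (- real k) * (of_real (?r1 x) * g s t x)) +
      (t * (of_real (?r2 x) * g s t x) + of_real (- real k) * (of_real (?r2 x) * g s t x)))"
    by (intro param_poly_add param_poly_mult_s param_poly_mult_t param_poly_cmult r)
  then show ?thesis by (simp add: log_deriv_def algebra_simps)
qed

lemma param_poly_lcoeff: "param_poly (\<lambda>s t. lcoeff (log_deriv s t) (\<lambda>p. of_real (det_prod p)) vs \<alpha>)"
proof (induction vs arbitrary: \<alpha>)
  case Nil
  show ?case using param_poly_of_rpf[OF rpf_const, of "if \<alpha> = {#} then 1 else 0"] by (simp add: if_distrib cong: if_cong)
next
  case (Cons v vs)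
  have "param_poly (\<lambda>s t x. if b \<in># \<alpha> then of_real (v \<bullet> b) *
      lcoeff (log_deriv s t) (\<lambda>p. of_real (det_prod p)) vs (\<alpha> - {#b#}) x else 0)" for b
    using param_poly_cmult[OF Cons.IH] param_poly_of_rpf[OF rpf_const, of 0] by (cases "b \<in># \<alpha>") simp_all
  then show ?case
    unfolding lcoeff.simps
    by (intro param_poly_add param_poly_log_deriv param_poly_rpf_mult[OF rpf_det_prod] param_poly_sum
        param_poly_derivative(2) Cons.IH finite_Basis)
qed

text \<open>The frequency monomials are separated first, then the powers of the two natural
  parameters one after the other.\<close>

lemma power_mon_independent:
  assumes zero: "\<And>n1 n2 q. (\<Sum>a\<in>multi_indices K \<times> ({..N} \<times> {..N}).
      k a * (real (Suc n1) ^ fst (snd a) * real (Suc n2) ^ snd (snd a) * mon (pairing q) (fst a))) = 0"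
  shows "\<forall>a\<in>multi_indices K \<times> ({..N} \<times> {..N}). k a = 0"
proof -
  have 1: "(\<Sum>i\<le>N. \<Sum>j\<le>N. k (\<alpha>, i, j) * real (Suc n2) ^ j * real (Suc n1) ^ i) = 0"
    if \<alpha>: "\<alpha> \<in> multi_indices K" for n1 n2 \<alpha>
  proof (rule mon_independent_real[OF finite_Basis finite_multi_indices _ _ \<alpha>])
    show "set_mset \<beta> \<subseteq> Basis" if "\<beta> \<in> multi_indices K" for \<beta> :: "('a \<times> 'a) multiset"
      using that by (simp add: multi_indices_def)
    fix y :: "'a \<times> 'a \<Rightarrow> real"
    obtain q where q: "\<And>b. b \<in> Basis \<Longrightarrow> pairing q b = y b" using pairing_surj by blast
    have mon_eq: "mon y \<beta> = mon (pairing q) \<beta>" if "\<beta> \<in> multi_indices K" for \<beta>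
      by (rule arg_cong[of _ _ prod_mset], rule image_mset_cong) (use that q in \<open>auto simp: multi_indices_def\<close>)
    have "(\<Sum>\<beta>\<in>multi_indices K. (\<Sum>i\<le>N. \<Sum>j\<le>N. k (\<beta>, i, j) * real (Suc n2) ^ j * real (Suc n1) ^ i) * mon y \<beta>) =
        (\<Sum>\<beta>\<in>multi_indices K. \<Sum>i\<le>N. \<Sum>j\<le>N. k (\<beta>, i, j) * (real (Suc n1) ^ i * real (Suc n2) ^ j * mon (pairing q) \<beta>))"
      by (intro sum.cong refl) (simp add: mon_eq sum_distrib_left sum_distrib_right mult_ac)
    also have "\<dots> = 0"
      using zero[of n1 n2 q] by (simp add: sum.cartesian_product case_prod_unfold)
    finally show "(\<Sum>\<beta>\<in>multi_indices K. (\<Sum>i\<le>N. \<Sum>j\<le>N. k (\<beta>, i, j) * real (Suc n2) ^ j * real (Suc n1) ^ i) * mon y \<beta>) = 0" .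
  qed
  have 2: "(\<Sum>j\<le>N. k (\<alpha>, i, j) * real (Suc n2) ^ j) = 0"
    if "\<alpha> \<in> multi_indices K" "i \<le> N" for n2 \<alpha> i
    using 1[OF that(1), of n2] that(2)
    by (intro nat_power_independent[of "\<lambda>i. \<Sum>j\<le>N. k (\<alpha>, i, j) * real (Suc n2) ^ j" N]) (simp_all add: sum_distrib_right)
  have "k (\<alpha>, i, j) = 0" if "\<alpha> \<in> multi_indices K" "i \<le> N" "j \<le> N" for \<alpha> i j
    using 2[OF that(1,2)] that(3) by (rule nat_power_independent)
  then show ?thesis by auto
qed

section \<open>Divisibility of the coefficients\<close>

context
  fixes cs :: "'a symbol" and \<kappa> :: nat
  assumes cs: "\<And>x. sym cs x = det x"
    and max_length: "\<forall>z\<in>set cs. length (snd z) \<le> Suc \<kappa>"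
begin

lemma length_cs: "(c, vs) \<in> set cs \<Longrightarrow> length vs \<le> Suc \<kappa>"
  using max_length by force

text \<open>The coefficients of the conjugated operator, brought to step
  \<open>Suc \<kappa>\<close>, a bound for the list lengths. The goal concerns step 1, so
  \<open>det_prod p ^ \<kappa>\<close> must be shown to divide them.\<close>

definition conj_coeff :: "complex \<Rightarrow> complex \<Rightarrow> ('a \<times> 'a) multiset \<Rightarrow> 'a \<times> 'a \<Rightarrow> complex" where
  "conj_coeff s t \<alpha> p = (\<Sum>(c, vs)\<leftarrow>cs. of_real c * of_real (det_prod p) ^ (Suc \<kappa> - length vs) *
     lcoeff (log_deriv s t) (\<lambda>p. of_real (det_prod p)) (map anti vs) \<alpha> p)"

lemma param_poly_conj_coeff: "param_poly (\<lambda>s t. conj_coeff s t \<alpha>)"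
  unfolding conj_coeff_def
proof (induction cs)
  case Nil
  show ?case using param_poly_of_rpf[OF rpf_const, of 0] by simp
next
  case (Cons z zs)
  obtain c vs where z: "z = (c, vs)" by (cases z)
  have "param_poly (\<lambda>s t x. of_real c * (of_real (det_prod x ^ (Suc \<kappa> - length vs)) *
      lcoeff (log_deriv s t) (\<lambda>p. of_real (det_prod p)) (map anti vs) \<alpha> x))"
    by (intro param_poly_cmult param_poly_rpf_mult param_poly_lcoeff real_polynomial_function_power rpf_det_prod)
  from param_poly_add[OF this Cons] show ?case by (simp add: z mult.assoc)
qed

lemma frechet_derivative_det_pow:
  "p \<in> invertible_pairs \<Longrightarrow>
    frechet_derivative (det_pow s t \<epsilon> \<eta> k) (at p) v = log_deriv s t k v p * det_pow s t \<epsilon> \<eta> (Suc k) p"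
  by (rule frechet_derivative_eqI[OF det_pow_has_derivative])

lemma differentiable_det_pow: "p \<in> invertible_pairs \<Longrightarrow> det_pow s t \<epsilon> \<eta> k differentiable (at p)"
  using det_pow_has_derivative differentiable_def by blast

lemma sum_iterated_deriv_det_pow:
  assumes f: "smooth_function_on invertible_pairs f" and p: "p \<in> invertible_pairs"
  shows "(\<Sum>(c, vs)\<leftarrow>cs. of_real c * iterated_deriv (map anti vs) (\<lambda>p. det_pow s t \<epsilon> \<eta> 0 p * f p) p) =
    det_pow s t \<epsilon> \<eta> (Suc \<kappa>) p * (\<Sum>\<alpha>\<in>multi_indices (Suc \<kappa>). conj_coeff s t \<alpha> p * multi_deriv \<alpha> f p)"
  unfolding conj_coeff_def
  by (rule iterated_deriv_power_mult_list[OF open_invertible_pairs f differentiable_det_pow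
      frechet_derivative_det_pow det_pow_step param_poly_derivative(1)[OF param_poly_lcoeff] p length_cs])

lemma diffop_det_pow:
  assumes f: "smooth_function_on invertible_pairs f" and p: "p \<in> invertible_pairs"
  shows "diffop (det_diffop mul e) (\<lambda>p. det_pow s t \<epsilon> \<eta> 0 p * f p) p =
    det_pow s t \<epsilon> \<eta> (Suc \<kappa>) p * (\<Sum>\<alpha>\<in>multi_indices (Suc \<kappa>). conj_coeff s t \<alpha> p * multi_deriv \<alpha> f p)"
proof -
  have "smooth_function_on invertible_pairs (\<lambda>p. det_pow s t \<epsilon> \<eta> 0 p * f p)"
    by (rule smooth_power_mult[OF open_invertible_pairs f differentiable_det_pow
      frechet_derivative_det_pow det_pow_step param_poly_derivative(1)[OF param_poly_lcoeff]])
  from diffop_det_coeff[OF length_cs open_invertible_pairs this p] show ?thesis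
    by (simp only: det_diffop_eq[OF cs] sum_iterated_deriv_det_pow[OF f p])
qed

text \<open>At \<open>(s, t) = (n\<^sub>1 + 1, n\<^sub>2 + 1)\<close> the signed powers are genuine polynomials, so the divisibility
  theorem for polynomials applies.\<close>

lemma conj_coeff_nat:
  "\<exists>R. real_polynomial_function R \<and> (\<forall>p\<in>invertible_pairs.
    (\<Sum>\<alpha>\<in>multi_indices (Suc \<kappa>). conj_coeff (of_nat (Suc n1)) (of_nat (Suc n2)) \<alpha> p * of_real (mon (pairing q) \<alpha>)) =
    of_real (det_prod p ^ \<kappa> * R p))"
proof -
  obtain Q where Q: "real_polynomial_function Q"
    "\<And>\<xi> \<zeta> \<eta>. Dop anti cs (\<lambda>q. det (fst (fst q)) ^ Suc n1 * det (snd (fst q)) ^ Suc n2) ((\<xi>, \<zeta>), \<eta>) =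
      det \<xi> ^ n1 * det \<zeta> ^ n2 * Q ((\<xi>, \<zeta>), \<eta>)"
    using Dop_det_det[OF cs] by blast
  define R where "R p = Q (p, fst q - snd q)" for p
  define \<phi> where "\<phi> p = det (fst p) ^ Suc n1 * det (snd p) ^ Suc n2" for p :: "'a \<times> 'a"
  define h where "h = det_pow (of_nat (Suc n1)) (of_nat (Suc n2))
    (if even (Suc n1) then Plus else Minus) (if even (Suc n2) then Plus else Minus)"
  have R: "real_polynomial_function R"
    unfolding R_def by (intro rpf_compose[OF _ Q(1)] polynomial_function_Pair polynomial_function_id polynomial_function_const)
  have \<phi>: "real_polynomial_function \<phi>"
    unfolding \<phi>_def by (intro rpf_mult rpf_fst[OF rpf_det_power] rpf_snd[OF rpf_det_power])
  have h0: "h 0 p = of_real (\<phi> p)" if "p \<in> invertible_pairs" for p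
    using that signed_powr_nat[of "det (fst p)" "Suc n1"] signed_powr_nat[of "det (snd p)" "Suc n2"]
    unfolding h_def det_pow_def \<phi>_def invertible_pairs_iff
    by (simp only: of_nat_0 diff_zero funpow_0 of_real_mult not_False_eq_True simp_thms)
  have "(\<Sum>\<alpha>\<in>multi_indices (Suc \<kappa>). conj_coeff (of_nat (Suc n1)) (of_nat (Suc n2)) \<alpha> p * of_real (mon (pairing q) \<alpha>)) =
    of_real (det_prod p ^ \<kappa> * R p)" (is "?T = _") if p: "p \<in> invertible_pairs" for p
  proof -
    obtain \<xi> \<zeta> where p_eq: "p = (\<xi>, \<zeta>)" by (cases p)
    have nz: "det \<xi> \<noteq> 0" "det \<zeta> \<noteq> 0" using p by (simp_all add: p_eq invertible_pairs_iff)
    have "iterated_deriv (map anti vs) (\<lambda>p. h 0 p * expo q p) p =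
        iterated_deriv (map anti vs) (\<lambda>p. of_real (\<phi> p * exp (pairing q p))) p" for vs
      by (rule iterated_deriv_cong[OF open_invertible_pairs _ p]) (simp add: h0)
    then have "(\<Sum>(c, vs)\<leftarrow>cs. of_real c * iterated_deriv (map anti vs) (\<lambda>p. h 0 p * expo q p) p) =
        complex_of_real (det \<xi> ^ n1 * det \<zeta> ^ n2 * R p * exp (pairing q p))"
      using Dop_expo[OF \<phi>, where cs = cs and q = q and p = p] by (simp only: \<phi>_def Q(2) R_def p_eq)
    moreover have "(\<Sum>(c, vs)\<leftarrow>cs. of_real c * iterated_deriv (map anti vs) (\<lambda>p. h 0 p * expo q p) p) =
        h (Suc \<kappa>) p * (?T * of_real (exp (pairing q p)))"
      unfolding h_def sum_iterated_deriv_det_pow[OF smooth_expo p] multi_deriv_expo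
      by (simp add: sum_distrib_right mult.assoc)
    ultimately have "h (Suc \<kappa>) p * ?T * of_real (exp (pairing q p)) =
        complex_of_real (det \<xi> ^ n1 * det \<zeta> ^ n2 * R p) * of_real (exp (pairing q p))"
      by (simp add: mult.assoc)
    then have T: "h (Suc \<kappa>) p * ?T = complex_of_real (det \<xi> ^ n1 * det \<zeta> ^ n2 * R p)"
      by (subst (asm) mult_cancel_right) simp
    \<comment> \<open>Multiplication by this factor returns to step 0, where \<open>h\<close> is the
      polynomial \<phi>.\<close>
    have hK: "h 0 p = of_real (det_prod p ^ Suc \<kappa>) * h (Suc \<kappa>) p"
      unfolding h_def using det_pow_add[OF p, where k = 0 and n = "Suc \<kappa>"] by (simp only: add_0)
    have "of_real (det \<xi> ^ Suc n1 * det \<zeta> ^ Suc n2) * ?T = h 0 p * ?T"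
      using h0[OF p] by (simp only: \<phi>_def p_eq fst_conv snd_conv)
    also have "\<dots> = of_real (det_prod p ^ Suc \<kappa>) * (h (Suc \<kappa>) p * ?T)"
      by (simp only: hK mult.assoc)
    also have "\<dots> = of_real (det \<xi> ^ Suc n1 * det \<zeta> ^ Suc n2) * of_real (det_prod p ^ \<kappa> * R p)"
      unfolding T by (simp add: det_prod_def p_eq)
    finally show ?thesis using nz by (subst (asm) mult_cancel_left) simp
  qed
  with R show ?thesis by blast
qed

text \<open>For natural parameters and exponentials \<open>conj_coeff_nat\<close> makes a
  combination of all the \<open>P \<alpha> i j\<close> divisible by det_prod^\<kappa>, and
  \<open>subspace_extraction\<close> passes this on to each of them. The quotients are the
  coefficients of \<open>D\<close>, which is polynomial in \<open>s\<close> and \<open>t\<close> by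
  construction.\<close>

theorem det_diffop_conjugation:
  "\<exists>D. (\<forall>s t. polynomial_diffop (D s t)) \<and>
    (\<forall>s t \<epsilon> \<eta> f. smooth_function_on invertible_pairs f \<longrightarrow>
      (\<forall>p\<in>invertible_pairs. diffop (det_diffop mul e) (\<lambda>p. det_pow s t \<epsilon> \<eta> 0 p * f p) p =
        det_pow s t \<epsilon> \<eta> 1 p * diffop (D s t) f p)) \<and>
    (\<forall>\<alpha>. polynomial_in_parameters (\<lambda>s t. D s t \<alpha>))"
proof -
  let ?M = "multi_indices (Suc \<kappa>) :: ('a \<times> 'a) multiset set"
  obtain N P where NP: "\<And>\<alpha>. \<alpha> \<in> ?M \<Longrightarrow> param_rep N (P \<alpha>) (\<lambda>s t. conj_coeff s t \<alpha>)"
    using param_rep_uniform[OF finite_multi_indices, of "Suc \<kappa>" "\<lambda>\<alpha> s t. conj_coeff s t \<alpha>"] param_poly_conj_coeff by blast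
  have NPe: "conj_coeff s t \<alpha> p = (\<Sum>i\<le>N. \<Sum>j\<le>N. s ^ i * t ^ j * of_real (P \<alpha> i j p))" if "\<alpha> \<in> ?M" for s t \<alpha> p
    using NP[OF that] unfolding param_rep_def by blast
  define U where "U g \<longleftrightarrow> (\<exists>R. real_polynomial_function R \<and> g = (\<lambda>p. det_prod p ^ \<kappa> * R p))" for g
  let ?A = "?M \<times> ({..N} \<times> {..N})"
  have U: "U (P (fst a) (fst (snd a)) (snd (snd a)))" if a: "a \<in> ?A" for a
  proof (rule subspace_extraction[where A = ?A and X = UNIV and U = U and
        \<phi> = "\<lambda>a (n1, n2, q). real (Suc n1) ^ fst (snd a) * real (Suc n2) ^ snd (snd a) * mon (pairing q) (fst a)"])
    show "finite ?A" by (simp add: finite_multi_indices)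
    show "U (\<lambda>_. 0)" unfolding U_def by (intro exI[of _ "\<lambda>_. 0"]) (simp add: rpf_const)
    show "U (\<lambda>p. f p + g p)" if "U f" "U g" for f g
    proof -
      obtain R R' where "real_polynomial_function R" "f = (\<lambda>p. det_prod p ^ \<kappa> * R p)"
        "real_polynomial_function R'" "g = (\<lambda>p. det_prod p ^ \<kappa> * R' p)"
        using \<open>U f\<close> \<open>U g\<close> unfolding U_def by blast
      then show ?thesis unfolding U_def
        by (intro exI[of _ "\<lambda>p. R p + R' p"]) (simp add: rpf_add distrib_left)
    qed
    show "U (\<lambda>p. r * f p)" if "U f" for r f
    proof -
      obtain R where "real_polynomial_function R" "f = (\<lambda>p. det_prod p ^ \<kappa> * R p)"
        using \<open>U f\<close> unfolding U_def by blast
      then show ?thesis unfolding U_def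
        by (intro exI[of _ "\<lambda>p. r * R p"]) (simp add: rpf_mult rpf_const mult.left_commute)
    qed
    show "\<forall>a\<in>?A. k a = 0" if "\<And>x. x \<in> UNIV \<Longrightarrow> (\<Sum>a\<in>?A. k a * (case x of (n1, n2, q) \<Rightarrow>
        real (Suc n1) ^ fst (snd a) * real (Suc n2) ^ snd (snd a) * mon (pairing q) (fst a))) = 0" for k
      by (rule power_mon_independent) (use that[of "(_, _, _)"] in simp)
    fix x :: "nat \<times> nat \<times> 'a \<times> 'a"
    obtain n1 n2 q where x: "x = (n1, n2, q)" by (cases x)
    obtain R where R: "real_polynomial_function R" "\<forall>p\<in>invertible_pairs.
      (\<Sum>\<alpha>\<in>?M. conj_coeff (of_nat (Suc n1)) (of_nat (Suc n2)) \<alpha> p * of_real (mon (pairing q) \<alpha>)) =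
      of_real (det_prod p ^ \<kappa> * R p)"
      using conj_coeff_nat[of n1 n2 q] by (elim exE conjE)
    let ?g = "\<lambda>p. \<Sum>a\<in>?A. (real (Suc n1) ^ fst (snd a) * real (Suc n2) ^ snd (snd a) * mon (pairing q) (fst a)) *
      P (fst a) (fst (snd a)) (snd (snd a)) p"
    have rP: "real_polynomial_function (P \<alpha> i j)" if "\<alpha> \<in> ?M" for \<alpha> i j
      using NP[OF that] unfolding param_rep_def by blast
    \<comment> \<open>Known at invertible pairs; both sides are polynomial, so the identity extends
      to all points, as membership in \<open>U\<close> requires.\<close>
    have "?g p = det_prod p ^ \<kappa> * R p" for p
    proof (rule rpf_eq_on_dense[OF _ _ rpf_det_prod])
      show "real_polynomial_function ?g"
        by (intro real_polynomial_function_sum rpf_mult rpf_const rP) (auto simp: finite_multi_indices)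
      show "real_polynomial_function (\<lambda>p. det_prod p ^ \<kappa> * R p)"
        by (intro rpf_mult real_polynomial_function_power rpf_det_prod R(1))
      show "det_prod (e, e) \<noteq> 0" using e_invertible by (simp add: det_prod_def)
      fix p assume "det_prod p \<noteq> 0"
      then have p: "p \<in> invertible_pairs" by (simp add: invertible_pairs_iff det_prod_def)
      have "complex_of_real (?g p) = (\<Sum>\<alpha>\<in>?M. (\<Sum>i\<le>N. \<Sum>j\<le>N.
          of_nat (Suc n1) ^ i * of_nat (Suc n2) ^ j * of_real (P \<alpha> i j p)) * of_real (mon (pairing q) \<alpha>))"
        by (simp add: sum.cartesian_product' sum_distrib_left sum_distrib_right mult_ac)
      also have "\<dots> = (\<Sum>\<alpha>\<in>?M. conj_coeff (of_nat (Suc n1)) (of_nat (Suc n2)) \<alpha> p * of_real (mon (pairing q) \<alpha>))"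
        using NPe by (intro sum.cong refl) (simp only:)
      also have "\<dots> = of_real (det_prod p ^ \<kappa> * R p)" using R(2) p by (rule bspec)
      finally show "?g p = det_prod p ^ \<kappa> * R p" by (simp only: of_real_eq_iff)
    qed
    then show "U (\<lambda>p. \<Sum>a\<in>?A. (case x of (n1, n2, q) \<Rightarrow>
        real (Suc n1) ^ fst (snd a) * real (Suc n2) ^ snd (snd a) * mon (pairing q) (fst a)) *
        P (fst a) (fst (snd a)) (snd (snd a)) p)"
      unfolding U_def x using R(1) by auto
  qed (rule a)
  have "\<exists>R. real_polynomial_function R \<and> (\<alpha> \<in> ?M \<longrightarrow> i \<le> N \<longrightarrow> j \<le> N \<longrightarrow> P \<alpha> i j = (\<lambda>p. det_prod p ^ \<kappa> * R p))" for \<alpha> i j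
    using U[of "(\<alpha>, i, j)"] rpf_const unfolding U_def by fastforce
  then obtain R where R: "\<And>\<alpha> i j. real_polynomial_function (R \<alpha> i j)"
    "\<And>\<alpha> i j. \<alpha> \<in> ?M \<Longrightarrow> i \<le> N \<Longrightarrow> j \<le> N \<Longrightarrow> P \<alpha> i j = (\<lambda>p. det_prod p ^ \<kappa> * R \<alpha> i j p)"
    by metis
  \<comment> \<open>Beyond the relevant multi-indices the quotient is set to 0, which gives
    \<open>D\<close> finite support.\<close>
  define r where "r \<alpha> i j = (if \<alpha> \<in> ?M then R \<alpha> i j else (\<lambda>_. 0))" for \<alpha> i j
  define D where "D s t \<alpha> p = (\<Sum>i\<le>N. \<Sum>j\<le>N. s ^ i * t ^ j * complex_of_real (r \<alpha> i j p))" for s t \<alpha> p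
  have poly_r: "polynomial_function (\<lambda>p. complex_of_real (r \<alpha> i j p))" for \<alpha> i j
  proof -
    have "real_polynomial_function (r \<alpha> i j)" by (simp add: r_def R(1) rpf_const)
    then show ?thesis
      by (intro polynomial_function_compose'[OF _ polynomial_function_bounded_linear[OF bounded_linear_of_real]])
        (simp add: real_polynomial_function_eq)
  qed
  have D0: "D s t \<alpha> p = 0" if "\<alpha> \<notin> ?M" for s t \<alpha> p using that by (simp add: D_def r_def)
  show ?thesis
  proof (intro exI[of _ D] conjI allI impI ballI)
    fix s t
    show "polynomial_diffop (D s t)"
      unfolding polynomial_diffop_def
    proof (intro conjI allI impI)
      have "{\<alpha>. \<exists>y. D s t \<alpha> y \<noteq> 0} \<subseteq> ?M" using D0 by blast
      then show "finite {\<alpha>. \<exists>y. D s t \<alpha> y \<noteq> 0}" using finite_multi_indices finite_subset by blast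
      show "set_mset \<alpha> \<subseteq> Basis" if "\<exists>y. D s t \<alpha> y \<noteq> 0" for \<alpha>
        using that D0[of \<alpha>] unfolding multi_indices_def by blast
      show "polynomial_function (D s t \<alpha>)" for \<alpha>
        unfolding D_def
        by (intro polynomial_function_sum finite_atMost
            polynomial_function_compose'[OF poly_r polynomial_function_bounded_linear[OF bounded_linear_mult_right]])
    qed
    fix \<epsilon> \<eta> f p assume f: "smooth_function_on invertible_pairs f" and p: "p \<in> invertible_pairs"
    have "conj_coeff s t \<alpha> p = of_real (det_prod p ^ \<kappa>) * D s t \<alpha> p" if "\<alpha> \<in> ?M" for \<alpha>
    proof -
      have "conj_coeff s t \<alpha> p = (\<Sum>i\<le>N. \<Sum>j\<le>N. s ^ i * t ^ j * of_real (P \<alpha> i j p))"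
        by (rule NPe[OF that])
      also have "\<dots> = (\<Sum>i\<le>N. \<Sum>j\<le>N. of_real (det_prod p ^ \<kappa>) * (s ^ i * t ^ j * of_real (r \<alpha> i j p)))"
        using that by (intro sum.cong refl) (simp add: R(2) r_def)
      finally show ?thesis by (simp add: D_def sum_distrib_left)
    qed
    then have "(\<Sum>\<alpha>\<in>?M. conj_coeff s t \<alpha> p * multi_deriv \<alpha> f p) = of_real (det_prod p ^ \<kappa>) * diffop (D s t) f p"
      by (simp add: diffop_eq_sum[OF finite_multi_indices D0] sum_distrib_left mult.assoc)
    then show "diffop (det_diffop mul e) (\<lambda>p. det_pow s t \<epsilon> \<eta> 0 p * f p) p =
        det_pow s t \<epsilon> \<eta> 1 p * diffop (D s t) f p"
      using diffop_det_pow[OF f p, of s t \<epsilon> \<eta>] det_pow_add[OF p, of s t \<epsilon> \<eta> 1 \<kappa>] by (simp add: mult_ac)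
  next
    fix \<alpha>
    show "polynomial_in_parameters (\<lambda>s t. D s t \<alpha>)"
      unfolding polynomial_in_parameters_def D_def using poly_r[of \<alpha>]
      by (intro exI[of _ N] exI[of _ "\<lambda>i j p. complex_of_real (r \<alpha> i j p)"]) auto
  qed
qed

end

end

theorem theorem4p2:
  fixes mul :: "'a::euclidean_space \<Rightarrow> 'a \<Rightarrow> 'a" and e :: 'a
  assumes "simple_real_jordan_algebra mul e"
  shows "\<exists>D :: complex \<Rightarrow> complex \<Rightarrow> ('a \<times> 'a) multiset \<Rightarrow> 'a \<times> 'a \<Rightarrow> complex.
    (\<forall>s t. polynomial_diffop (D s t)) \<and>
    (\<forall>s t \<epsilon> \<eta> f.
       smooth_function_on (jordan_invertibles mul e \<times> jordan_invertibles mul e) f \<longrightarrow>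
       (\<forall>\<xi>\<in>jordan_invertibles mul e. \<forall>\<zeta>\<in>jordan_invertibles mul e.
          diffop (det_diffop mul e)
            (\<lambda>(\<xi>, \<zeta>). signed_powr (jordan_det mul e \<xi>) s \<epsilon> *
                      signed_powr (jordan_det mul e \<zeta>) t \<eta> * f (\<xi>, \<zeta>)) (\<xi>, \<zeta>) =
          signed_powr (jordan_det mul e \<xi>) (s - 1) (opposite \<epsilon>) *
          signed_powr (jordan_det mul e \<zeta>) (t - 1) (opposite \<eta>) *
          diffop (D s t) f (\<xi>, \<zeta>))) \<and>
    (\<forall>\<alpha>. polynomial_in_parameters (\<lambda>s t. D s t \<alpha>))"
proof -
  interpret simple_real_jordan_algebra mul e by fact
  obtain cs where cs: "\<And>x. sym cs x = jordan_det mul e x"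
    using sym_exists[OF rpf_det_jordan] by blast
  \<comment> \<open>Any bound on the list lengths serves, since the final quotient by
    det_prod^\<kappa> compensates for its size.\<close>
  have "\<forall>z\<in>set cs. length (snd z) \<le> Suc (Max ((\<lambda>z. length (snd z)) ` set cs))"
    by (intro ballI le_SucI Max_ge) auto
  from det_diffop_conjugation[OF cs this] obtain D where D: "\<And>s t. polynomial_diffop (D s t)"
    "\<And>s t \<epsilon> \<eta> f p. smooth_function_on invertible_pairs f \<Longrightarrow> p \<in> invertible_pairs \<Longrightarrow>
      diffop (det_diffop mul e) (\<lambda>p. det_pow s t \<epsilon> \<eta> 0 p * f p) p = det_pow s t \<epsilon> \<eta> 1 p * diffop (D s t) f p"
    "\<And>\<alpha>. polynomial_in_parameters (\<lambda>s t. D s t \<alpha>)"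
    by blast
  have pow: "(\<lambda>(\<xi>, \<zeta>). signed_powr (jordan_det mul e \<xi>) s \<epsilon> * signed_powr (jordan_det mul e \<zeta>) t \<eta> * f (\<xi>, \<zeta>)) =
      (\<lambda>p. det_pow s t \<epsilon> \<eta> 0 p * f p)" for s t \<epsilon> \<eta> f
    by (auto simp: det_pow_def)
  show ?thesis
    unfolding pow
  proof (intro exI[of _ D] conjI allI impI ballI D(1,3))
    fix s t \<epsilon> \<eta> f \<xi> \<zeta>
    assume "smooth_function_on invertible_pairs f" "\<xi> \<in> jordan_invertibles mul e" "\<zeta> \<in> jordan_invertibles mul e"
    then show "diffop (det_diffop mul e) (\<lambda>p. det_pow s t \<epsilon> \<eta> 0 p * f p) (\<xi>, \<zeta>) =
        signed_powr (jordan_det mul e \<xi>) (s - 1) (opposite \<epsilon>) *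
        signed_powr (jordan_det mul e \<zeta>) (t - 1) (opposite \<eta>) * diffop (D s t) f (\<xi>, \<zeta>)"
      using D(2)[of f "(\<xi>, \<zeta>)" s t \<epsilon> \<eta>] by (simp add: det_pow_def)
  qed
qed

end
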